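(* Let $f\in L^2(J;L^2(\Omega))$, $b\in L^\infty(J;L^\infty(\Omega))^d$ and $c\in L^\infty(J;L^\infty(\Omega))$, and let $w\in V(\Omega,J)\cap L^2(J;X(\Omega))$ be a solution of $$\frac{\partial w}{\partial t}-\nu\Delta w+b\cdot\nabla w+cw=f\ \text{ in }\Omega\times J,\qquad w=0\ \text{ on }\partial\Omega\times J,\qquad w(0)=0\ \text{ in }\Omega .$$ With the discretization and constants defined in the context, assume $\kappa(h,k):=\tau(h,k)\,\mathcal{E}<1$. Then \begin{align*} \|w\|_{L^2(J;H^1_0(\Omega))}&\le \mathcal{M}_1\|f\|_{L^2(J;L^2(\Omega))}, & \mathcal{M}_1&:=M_1C_{Q_h^k}+\tilde C_1(h,k)C_\Delta,\\ \|w\|_{L^2(J;L^2(\Omega))}&\le \mathcal{M}_0\|f\|_{L^2(J;L^2(\Omega))}, & \mathcal{M}_0&:=M_0C_{Q_h^k}+\tilde C_0(h,k)C_\Delta,\\ \|w(T)\|_{L^2(\Omega)}&\le \mathcal{M}_T\|f\|_{L^2(J;L^2(\Omega))}, & \mathcal{M}_T&:=M_TC_{Q_h^k}+\tilde c_0(h,k)C_\Delta . \end{align*}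
   Context: **Spaces.** $\nu>0$ is a constant, $\Omega\subset\mathbb{R}^d$ ($d\in\{1,2,3\}$) a bounded polygonal or polyhedral domain (an interval if $d=1$), $J=(0,T)$ a bounded open interval. $H^1_0(\Omega)$ carries the inner product $\langle\nabla u,\nabla v\rangle_{L^2(\Omega)^d}$ and the corresponding norm. $X(\Omega):=\{u\in L^2(\Omega):\Delta u\in L^2(\Omega)\}$. $V^1(J):=\{u\in H^1(J):u(0)=0\}$ with inner product $\langle u',v'\rangle_{L^2(J)}$. For a Hilbert space $Y$, $V^1(J;Y):=\{u\in L^2(J;Y):\partial_t u\in L^2(J;Y),\ u(0)=0 \text{ in }Y\}$ with norm $\|u\|_{V^1(J;Y)}=\|\partial_t u\|_{L^2(J;Y)}$. $V(\Omega,J):=V^1(J;L^2(\Omega))\cap L^2(J;H^1_0(\Omega))$. **Discretization.** $S_h(\Omega)\subset H^1_0(\Omega)$ is a finite-dimensional subspace of dimension $n$ (parameter $h$). $V_k^1(J)\subset V^1(J)$ is the space of continuous piecewise linear functions (P1 finite elements) vanishing at $0$ for nodes $0=t_0<t_1<\dots<t_m=T$ (parameter $k$). $S_h^k(\Omega,J):=V_k^1(J)\otimes S_h(\Omega)$, with a basis $\{\varphi_i\}_{i=1}^{mn}$. $P_h^1:H_0^1(\Omega)\to S_h(\Omega)$ is the $H^1_0$-orthogonal projection. $\Pi_k:V^1(J)\to V^1_k(J)$ is nodal interpolation, $(\Pi_ku)(t_i)=u(t_i)$ for $0\le i\le m$. Positive constants $C_\Omega(h),C_J(k),C_{\mathrm{inv}}(h)$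 are fixed such that $\|u-P_h^1u\|_{H^1_0(\Omega)}\le C_\Omega(h)\|\Delta u\|_{L^2(\Omega)}$ for all $u\in H_0^1(\Omega)\cap X(\Omega)$; $\|u-\Pi_ku\|_{L^2(J)}\le C_J(k)\|u\|_{V^1(J)}$ for all $u\in V^1(J)$; $\|u_h\|_{H^1_0(\Omega)}\le C_{\mathrm{inv}}(h)\|u_h\|_{L^2(\Omega)}$ for all $u_h\in S_h(\Omega)$. **Bilinear forms and matrices.** For $\phi\in V(\Omega,J)$, $\psi\in V^1(J;H^1_0(\Omega))$ let $a_0(\phi,\psi):=\langle\partial_t\phi,\partial_t\psi\rangle_{L^2(J;L^2(\Omega))}+\nu\langle\nabla\phi,\partial_t\nabla\psi\rangle_{L^2(J;L^2(\Omega))^d}$ and $a(\phi,\psi):=a_0(\phi,\psi)+\langle b\cdot\nabla\phi+c\phi,\partial_t\psi\rangle_{L^2(J;L^2(\Omega))}$. Define $mn\times mn$ matrices (all inner products over $\Omega\times J$ except for $\mathbf Y$): $\mathbf A_{ij}=\langle\partial_t\varphi_j,\partial_t\varphi_i\rangle$, $\mathbf M_{ij}=\langle\nabla\varphi_j,\nabla\varphi_i\rangle$, $\mathbf B_{ij}=\langle\nabla\varphi_j,\partial_t\nabla\varphi_i\rangle$, $\mathbf U_{ij}=\langle\varphi_j,\varphi_i\rangle$, $\mathbf W_{ij}=\langle\partial_t\nabla\varphi_j,\partial_t\nabla\varphi_i\rangle$, $\mathbf Y_{ij}=\langle\varphi_j(\cdot,T),\varphi_i(\cdot,T)\rangle_{L^2(\Omega)}$,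 $\mathbf G_{ij}=a(\varphi_j,\varphi_i)$. $\mathbf G$ is assumed invertible. For each symmetric positive (semi)definite matrix $\mathbf Z\in\{\mathbf A,\mathbf M,\mathbf U,\mathbf W,\mathbf Y\}$ fix a (Cholesky-type) factorization $\mathbf Z=\mathbf Z^{1/2}\mathbf Z^{T/2}$, where $\mathbf Z^{T/2}:=(\mathbf Z^{1/2})^{T}$. $\|\cdot\|_E$ is the matrix norm induced by the Euclidean norm. **Constants.** $\gamma_1:=\nu\|\mathbf M^{T/2}(\mathbf A+\nu\mathbf B)^{-1}\mathbf W^{1/2}\|_E$, $\gamma_0:=\nu\|\mathbf U^{T/2}(\mathbf A+\nu\mathbf B)^{-1}\mathbf W^{1/2}\|_E$, $\gamma_T:=\nu\|\mathbf Y^{T/2}(\mathbf A+\nu\mathbf B)^{-1}\mathbf W^{1/2}\|_E$; $\tilde C_1(h,k):=\frac2\nu C_\Omega(h)+C_{\mathrm{inv}}(h)C_J(k)+C_J(k)C_{\mathrm{inv}}(h)\gamma_1$; $\tilde C_0(h,k):=\frac8\nu C_\Omega(h)^2+C_J(k)+C_J(k)C_{\mathrm{inv}}(h)\gamma_0$; $\tilde c_0(h,k):=\sqrt{8/\nu}\,C_\Omega(h)+C_J(k)C_{\mathrm{inv}}(h)\gamma_T$; $C_b:=\big(\sum_{i=1}^d\|b_i\|_{L^\infty(J;L^\infty(\Omega))}^2\big)^{1/2}$, $C_c:=\|c\|_{L^\infty(J;L^\infty(\Omega))}$; $M_1:=\|\mathbf M^{T/2}\mathbf G^{-1}\mathbf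 A^{1/2}\|_E$, $M_0:=\|\mathbf U^{T/2}\mathbf G^{-1}\mathbf A^{1/2}\|_E$, $M_T:=\|\mathbf Y^{T/2}\mathbf G^{-1}\mathbf A^{1/2}\|_E$; $\tau(h,k):=\tilde C_1(h,k)C_b+\tilde C_0(h,k)C_c$; $\mathcal E:=M_1C_b+M_0C_c+1$; $C_\Delta:=\mathcal E/(1-\kappa(h,k))$ with $\kappa(h,k)=\tau(h,k)\mathcal E$; $C_{Q_h^k}:=\tau(h,k)C_\Delta+1$. *)

theory Defs
  imports "HOL-Analysis.Analysis" "HOL-Probability.Essential_Supremum"
begin

text \<open>
  Elements of Lebesgue and Sobolev spaces are represented by functions, not by equivalence
  classes; every membership predicate, norm and inner product below is invariant under
  changes on null sets of \<open>\<Omega>\<close>. Weak derivatives are only determined up to null sets, so the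
  operators returning them pick an arbitrary representative.
\<close>

section \<open>The spatial domain\<close>

text \<open>
  Only the boundary is required to be made of finitely many flat pieces; no one-sidedness or
  Lipschitz condition is imposed. In dimension 1 the pieces are points, so that the
  domain is a bounded open interval.
\<close>

definition polyhedral_domain :: "'a::euclidean_space set \<Rightarrow> bool" where
  "polyhedral_domain \<Omega> \<longleftrightarrow> open \<Omega> \<and> connected \<Omega> \<and> bounded \<Omega> \<and> \<Omega> \<noteq> {} \<and>
     (\<exists>F. finite F \<and> (\<forall>P\<in>F. polytope P \<and> aff_dim P = int DIM('a) - 1) \<and> frontier \<Omega> = \<Union>F)"


section \<open>Lebesgue spaces\<close>

definition L2 :: "'a::euclidean_space set \<Rightarrow> ('a \<Rightarrow> 'b::euclidean_space) set" where
  "L2 \<Omega> = {u \<in> borel_measurable (lebesgue_on \<Omega>).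
            integrable (lebesgue_on \<Omega>) (\<lambda>x. (norm (u x))\<^sup>2)}"

definition L2_inner ::
  "'a::euclidean_space set \<Rightarrow> ('a \<Rightarrow> 'b::euclidean_space) \<Rightarrow> ('a \<Rightarrow> 'b) \<Rightarrow> real" where
  "L2_inner \<Omega> u v = (LINT x|lebesgue_on \<Omega>. u x \<bullet> v x)"

definition L2_norm :: "'a::euclidean_space set \<Rightarrow> ('a \<Rightarrow> 'b::euclidean_space) \<Rightarrow> real" where
  "L2_norm \<Omega> u = sqrt (L2_inner \<Omega> u u)"

definition Linf :: "'a::euclidean_space set \<Rightarrow> ('a \<Rightarrow> real) set" where
  "Linf \<Omega> = {u \<in> borel_measurable (lebesgue_on \<Omega>).
              esssup (lebesgue_on \<Omega>) (\<lambda>x. ereal \<bar>u x\<bar>) < \<infinity>}"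

definition Linf_norm :: "'a::euclidean_space set \<Rightarrow> ('a \<Rightarrow> real) \<Rightarrow> real" where
  "Linf_norm \<Omega> u = real_of_ereal (esssup (lebesgue_on \<Omega>) (\<lambda>x. ereal \<bar>u x\<bar>))"


section \<open>Test functions\<close>

definition partial_deriv :: "'a \<Rightarrow> ('a::euclidean_space \<Rightarrow> real) \<Rightarrow> 'a \<Rightarrow> real" where
  "partial_deriv i \<phi> x = frechet_derivative \<phi> (at x) i"

primrec Ck :: "nat \<Rightarrow> ('a::euclidean_space \<Rightarrow> real) \<Rightarrow> bool" where
  "Ck 0 \<phi> \<longleftrightarrow> continuous_on UNIV \<phi>"
| "Ck (Suc k) \<phi> \<longleftrightarrow> (\<forall>x. \<phi> differentiable (at x)) \<and> (\<forall>i\<in>Basis. Ck k (partial_deriv i \<phi>))"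

text \<open>\<open>C\<^sub>c\<^sup>\<infinity>(\<Omega>)\<close>, with each function extended by zero to the whole space.\<close>

definition test_fun :: "'a::euclidean_space set \<Rightarrow> ('a \<Rightarrow> real) set" where
  "test_fun \<Omega> = {\<phi>. (\<forall>k. Ck k \<phi>) \<and> compact (closure {x. \<phi> x \<noteq> 0}) \<and>
                    closure {x. \<phi> x \<noteq> 0} \<subseteq> \<Omega>}"


section \<open>Sobolev spaces\<close>

definition has_weak_grad ::
  "'a::euclidean_space set \<Rightarrow> ('a \<Rightarrow> real) \<Rightarrow> ('a \<Rightarrow> 'a) \<Rightarrow> bool" where
  "has_weak_grad \<Omega> u g \<longleftrightarrow> (\<forall>\<phi>\<in>test_fun \<Omega>. \<forall>i\<in>Basis.
     (LINT x|lebesgue_on \<Omega>. u x * partial_deriv i \<phi> x) = - (LINT x|lebesgue_on \<Omega>. (g x \<bullet> i) * \<phi> x))"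

definition H1 :: "'a::euclidean_space set \<Rightarrow> ('a \<Rightarrow> real) set" where
  "H1 \<Omega> = {u \<in> L2 \<Omega>. \<exists>g \<in> L2 \<Omega>. has_weak_grad \<Omega> u g}"

definition weak_grad :: "'a::euclidean_space set \<Rightarrow> ('a \<Rightarrow> real) \<Rightarrow> 'a \<Rightarrow> 'a" where
  "weak_grad \<Omega> u = (SOME g. g \<in> L2 \<Omega> \<and> has_weak_grad \<Omega> u g)"

text \<open>The closure of \<open>C\<^sub>c\<^sup>\<infinity>(\<Omega>)\<close> in \<open>H\<^sup>1(\<Omega>)\<close>.\<close>

definition H10 :: "'a::euclidean_space set \<Rightarrow> ('a \<Rightarrow> real) set" where
  "H10 \<Omega> = {u \<in> H1 \<Omega>. \<exists>\<phi>::nat \<Rightarrow> 'a \<Rightarrow> real. (\<forall>k. \<phi> k \<in> test_fun \<Omega>) \<and>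
     (\<lambda>k. L2_norm \<Omega> (\<lambda>x. \<phi> k x - u x)) \<longlonglongrightarrow> 0 \<and>
     (\<lambda>k. L2_norm \<Omega> (\<lambda>x. weak_grad \<Omega> (\<phi> k) x - weak_grad \<Omega> u x)) \<longlonglongrightarrow> 0}"

definition H10_inner ::
  "'a::euclidean_space set \<Rightarrow> ('a \<Rightarrow> real) \<Rightarrow> ('a \<Rightarrow> real) \<Rightarrow> real" where
  "H10_inner \<Omega> u v = L2_inner \<Omega> (weak_grad \<Omega> u) (weak_grad \<Omega> v)"

definition H10_norm :: "'a::euclidean_space set \<Rightarrow> ('a \<Rightarrow> real) \<Rightarrow> real" where
  "H10_norm \<Omega> u = sqrt (H10_inner \<Omega> u u)"

definition has_weak_laplacian ::
  "'a::euclidean_space set \<Rightarrow> ('a \<Rightarrow> real) \<Rightarrow> ('a \<Rightarrow> real) \<Rightarrow> bool" where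
  "has_weak_laplacian \<Omega> u g \<longleftrightarrow> (\<forall>\<phi>\<in>test_fun \<Omega>.
     (LINT x|lebesgue_on \<Omega>. u x * (\<Sum>i\<in>Basis. partial_deriv i (partial_deriv i \<phi>) x)) =
     (LINT x|lebesgue_on \<Omega>. g x * \<phi> x))"

definition Xspace :: "'a::euclidean_space set \<Rightarrow> ('a \<Rightarrow> real) set" where
  "Xspace \<Omega> = {u \<in> L2 \<Omega>. \<exists>g \<in> L2 \<Omega>. has_weak_laplacian \<Omega> u g}"

definition laplacian :: "'a::euclidean_space set \<Rightarrow> ('a \<Rightarrow> real) \<Rightarrow> 'a \<Rightarrow> real" where
  "laplacian \<Omega> u = (SOME g. g \<in> L2 \<Omega> \<and> has_weak_laplacian \<Omega> u g)"

text \<open>The Laplacian is the distributional one, so \<open>Xspace \<Omega>\<close> is normed by the graph norm.\<close>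

definition X_norm :: "'a::euclidean_space set \<Rightarrow> ('a \<Rightarrow> real) \<Rightarrow> real" where
  "X_norm \<Omega> u = sqrt ((L2_norm \<Omega> u)\<^sup>2 + (L2_norm \<Omega> (laplacian \<Omega> u))\<^sup>2)"


section \<open>Bochner spaces\<close>

text \<open>
  A space \<open>Y\<close> of functions on \<open>\<Omega>\<close> is given by its carrier \<open>Y\<close> and its norm \<open>N\<close> or inner
  product \<open>ip\<close>. Measurability is strong (Bochner) measurability: almost everywhere \<open>u\<close> is the
  \<open>N\<close>-limit of simple \<open>Y\<close>-valued functions.
\<close>

definition strongly_measurable ::
  "real set \<Rightarrow> ('a \<Rightarrow> 'b::euclidean_space) set \<Rightarrow> (('a \<Rightarrow> 'b) \<Rightarrow> real) \<Rightarrow>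
   (real \<Rightarrow> 'a \<Rightarrow> 'b) \<Rightarrow> bool" where
  "strongly_measurable J Y N u \<longleftrightarrow> (AE t in lebesgue_on J. u t \<in> Y) \<and>
     (\<exists>s::nat \<Rightarrow> real \<Rightarrow> 'a \<Rightarrow> 'b.
        (\<forall>k. simple_function (lebesgue_on J) (s k) \<and> (\<forall>t\<in>J. s k t \<in> Y)) \<and>
        (AE t in lebesgue_on J. (\<lambda>k. N (\<lambda>x. s k t x - u t x)) \<longlonglongrightarrow> 0))"

definition bochner_L2 ::
  "real set \<Rightarrow> ('a \<Rightarrow> 'b::euclidean_space) set \<Rightarrow> (('a \<Rightarrow> 'b) \<Rightarrow> real) \<Rightarrow>
   (real \<Rightarrow> 'a \<Rightarrow> 'b) set" where
  "bochner_L2 J Y N = {u. strongly_measurable J Y N u \<and>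
                          integrable (lebesgue_on J) (\<lambda>t. (N (u t))\<^sup>2)}"

definition bochner_L2_norm ::
  "real set \<Rightarrow> (('a \<Rightarrow> 'b) \<Rightarrow> real) \<Rightarrow> (real \<Rightarrow> 'a \<Rightarrow> 'b) \<Rightarrow> real" where
  "bochner_L2_norm J N u = sqrt (LINT t|lebesgue_on J. (N (u t))\<^sup>2)"

definition bochner_Linf ::
  "real set \<Rightarrow> ('a \<Rightarrow> 'b::euclidean_space) set \<Rightarrow> (('a \<Rightarrow> 'b) \<Rightarrow> real) \<Rightarrow>
   (real \<Rightarrow> 'a \<Rightarrow> 'b) set" where
  "bochner_Linf J Y N = {u. strongly_measurable J Y N u \<and>
                            esssup (lebesgue_on J) (\<lambda>t. ereal (N (u t))) < \<infinity>}"

definition bochner_Linf_norm ::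
  "real set \<Rightarrow> (('a \<Rightarrow> 'b) \<Rightarrow> real) \<Rightarrow> (real \<Rightarrow> 'a \<Rightarrow> 'b) \<Rightarrow> real" where
  "bochner_Linf_norm J N u = real_of_ereal (esssup (lebesgue_on J) (\<lambda>t. ereal (N (u t))))"

text \<open>
  The identity \<open>\<integral> \<phi>' u dt = - \<integral> \<phi> v dt\<close> between Bochner integrals in the Hilbert space \<open>Y\<close>,
  written out by pairing both sides with every \<open>y \<in> Y\<close>.
\<close>

definition has_time_deriv ::
  "real set \<Rightarrow> ('a \<Rightarrow> 'b) set \<Rightarrow> (('a \<Rightarrow> 'b) \<Rightarrow> ('a \<Rightarrow> 'b) \<Rightarrow> real) \<Rightarrow>
   (real \<Rightarrow> 'a \<Rightarrow> 'b) \<Rightarrow> (real \<Rightarrow> 'a \<Rightarrow> 'b) \<Rightarrow> bool" where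
  "has_time_deriv J Y ip u v \<longleftrightarrow> (\<forall>\<phi>\<in>test_fun J. \<forall>y\<in>Y.
     (LINT t|lebesgue_on J. partial_deriv 1 \<phi> t * ip (u t) y) =
     - (LINT t|lebesgue_on J. \<phi> t * ip (v t) y))"

text \<open>
  \<open>V\<^sup>1(J;Y)\<close> for \<open>J = (0,T)\<close>. Its elements are represented by their continuous versions
  \<open>[0,T] \<rightarrow> Y\<close>, so that the values \<open>u 0\<close> and \<open>u T\<close> are meaningful.
\<close>

definition bochner_V1 ::
  "real \<Rightarrow> ('a \<Rightarrow> 'b::euclidean_space) set \<Rightarrow> (('a \<Rightarrow> 'b) \<Rightarrow> ('a \<Rightarrow> 'b) \<Rightarrow> real) \<Rightarrow>
   (real \<Rightarrow> 'a \<Rightarrow> 'b) set" where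
  "bochner_V1 T Y ip =
     (let J = {0<..<T}; N = (\<lambda>u. sqrt (ip u u)) in
      {u \<in> bochner_L2 J Y N.
         (\<exists>v \<in> bochner_L2 J Y N. has_time_deriv J Y ip u v) \<and>
         (\<forall>t\<in>{0..T}. u t \<in> Y \<and>
            ((\<lambda>s. N (\<lambda>x. u s x - u t x)) \<longlongrightarrow> 0) (at t within {0..T})) \<and>
         N (u 0) = 0})"

definition Vspace :: "real \<Rightarrow> 'a::euclidean_space set \<Rightarrow> (real \<Rightarrow> 'a \<Rightarrow> real) set" where
  "Vspace T \<Omega> = bochner_V1 T (L2 \<Omega>) (L2_inner \<Omega>) \<inter> bochner_L2 {0<..<T} (H10 \<Omega>) (H10_norm \<Omega>)"

text \<open>
  The time derivative and the inner product over \<open>\<Omega> \<times> J\<close> are polymorphic in the value type \<open>'b\<close>: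
  they apply to scalar functions (\<open>'b = real\<close>) and to spatial gradients (\<open>'b = 'a\<close>).
\<close>

definition dt :: "real \<Rightarrow> 'a::euclidean_space set \<Rightarrow> (real \<Rightarrow> 'a \<Rightarrow> 'b::euclidean_space) \<Rightarrow>
   real \<Rightarrow> 'a \<Rightarrow> 'b" where
  "dt T \<Omega> u = (SOME v. v \<in> bochner_L2 {0<..<T} (L2 \<Omega>) (L2_norm \<Omega>) \<and>
                       has_time_deriv {0<..<T} (L2 \<Omega>) (L2_inner \<Omega>) u v)"

definition st_inner :: "real \<Rightarrow> 'a::euclidean_space set \<Rightarrow> (real \<Rightarrow> 'a \<Rightarrow> 'b::euclidean_space) \<Rightarrow>
   (real \<Rightarrow> 'a \<Rightarrow> 'b) \<Rightarrow> real" where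
  "st_inner T \<Omega> u v = (LINT t|lebesgue_on {0<..<T}. L2_inner \<Omega> (u t) (v t))"

definition nabla :: "'a::euclidean_space set \<Rightarrow> (real \<Rightarrow> 'a \<Rightarrow> real) \<Rightarrow> real \<Rightarrow> 'a \<Rightarrow> 'a" where
  "nabla \<Omega> u t = weak_grad \<Omega> (u t)"


section \<open>Discrete spaces\<close>

text \<open>
  Linear independence is understood in \<open>L\<^sup>2(\<Omega>)\<close>, that is, up to null sets, and \<open>S\<close> is closed
  under modification on null sets.
\<close>

definition findim_subspace_H10 ::
  "'a::euclidean_space set \<Rightarrow> nat \<Rightarrow> ('a \<Rightarrow> real) set \<Rightarrow> bool" where
  "findim_subspace_H10 \<Omega> n S \<longleftrightarrow> (\<exists>e::nat \<Rightarrow> 'a \<Rightarrow> real.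
     (\<forall>i<n. e i \<in> H10 \<Omega>) \<and>
     (\<forall>a. (AE x in lebesgue_on \<Omega>. (\<Sum>i<n. a i * e i x) = 0) \<longrightarrow> (\<forall>i<n. a i = 0)) \<and>
     S = {v \<in> H10 \<Omega>. \<exists>a. AE x in lebesgue_on \<Omega>. v x = (\<Sum>i<n. a i * e i x)})"

definition H10_proj ::
  "'a::euclidean_space set \<Rightarrow> ('a \<Rightarrow> real) set \<Rightarrow> ('a \<Rightarrow> real) \<Rightarrow> 'a \<Rightarrow> real" where
  "H10_proj \<Omega> S u = (SOME p. p \<in> S \<and> (\<forall>v\<in>S. H10_inner \<Omega> (\<lambda>x. u x - p x) v = 0))"

text \<open>\<open>V\<^sup>1(J)\<close> for scalar functions; again the continuous representative is taken.\<close>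

definition V1 :: "real \<Rightarrow> (real \<Rightarrow> real) set" where
  "V1 T = {u \<in> H1 {0<..<T}. continuous_on {0..T} u \<and> u 0 = 0}"

definition V1_norm :: "real \<Rightarrow> (real \<Rightarrow> real) \<Rightarrow> real" where
  "V1_norm T u = L2_norm {0<..<T} (weak_grad {0<..<T} u)"

definition nodes :: "real \<Rightarrow> nat \<Rightarrow> (nat \<Rightarrow> real) \<Rightarrow> bool" where
  "nodes T m tn \<longleftrightarrow> tn 0 = 0 \<and> tn m = T \<and> (\<forall>i<m. tn i < tn (Suc i))"

definition P1_space :: "real \<Rightarrow> nat \<Rightarrow> (nat \<Rightarrow> real) \<Rightarrow> (real \<Rightarrow> real) set" where
  "P1_space T m tn = {v. continuous_on {0..T} v \<and> v 0 = 0 \<and>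
     (\<forall>i<m. \<exists>\<alpha> \<beta>. \<forall>t\<in>{tn i..tn (Suc i)}. v t = \<alpha> + \<beta> * t)}"

definition nodal_interp ::
  "real \<Rightarrow> nat \<Rightarrow> (nat \<Rightarrow> real) \<Rightarrow> (real \<Rightarrow> real) \<Rightarrow> real \<Rightarrow> real" where
  "nodal_interp T m tn u = (SOME p. p \<in> P1_space T m tn \<and> (\<forall>i\<le>m. p (tn i) = u (tn i)))"

text \<open>The algebraic tensor product \<open>V \<otimes> S\<close>, as functions of time and space.\<close>

definition tensor_space :: "real \<Rightarrow> 'a::euclidean_space set \<Rightarrow> (real \<Rightarrow> real) set \<Rightarrow>
   ('a \<Rightarrow> real) set \<Rightarrow> (real \<Rightarrow> 'a \<Rightarrow> real) set" where
  "tensor_space T \<Omega> V S = {u. \<exists>(N::nat) v s. (\<forall>j<N. v j \<in> V \<and> s j \<in> S) \<and>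
     (\<forall>t\<in>{0..T}. AE x in lebesgue_on \<Omega>. u t x = (\<Sum>j<N. v j t * s j x))}"

definition is_basis :: "real \<Rightarrow> 'a::euclidean_space set \<Rightarrow> (real \<Rightarrow> 'a \<Rightarrow> real) set \<Rightarrow>
   ('n::finite \<Rightarrow> real \<Rightarrow> 'a \<Rightarrow> real) \<Rightarrow> bool" where
  "is_basis T \<Omega> S \<phi> \<longleftrightarrow> (\<forall>i. \<phi> i \<in> S) \<and>
     (\<forall>a. (\<forall>t\<in>{0..T}. AE x in lebesgue_on \<Omega>. (\<Sum>i\<in>UNIV. a i * \<phi> i t x) = 0) \<longrightarrow> (\<forall>i. a i = 0)) \<and>
     (\<forall>u\<in>S. \<exists>a. \<forall>t\<in>{0..T}. AE x in lebesgue_on \<Omega>. u t x = (\<Sum>i\<in>UNIV. a i * \<phi> i t x))"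


section \<open>Bilinear forms and matrix norm\<close>

definition form_a0 :: "real \<Rightarrow> 'a::euclidean_space set \<Rightarrow> real \<Rightarrow> (real \<Rightarrow> 'a \<Rightarrow> real) \<Rightarrow>
   (real \<Rightarrow> 'a \<Rightarrow> real) \<Rightarrow> real" where
  "form_a0 T \<Omega> \<nu> \<phi> \<psi> = st_inner T \<Omega> (dt T \<Omega> \<phi>) (dt T \<Omega> \<psi>)
     + \<nu> * st_inner T \<Omega> (nabla \<Omega> \<phi>) (dt T \<Omega> (nabla \<Omega> \<psi>))"

definition form_a :: "real \<Rightarrow> 'a::euclidean_space set \<Rightarrow> real \<Rightarrow> (real \<Rightarrow> 'a \<Rightarrow> 'a) \<Rightarrow>
   (real \<Rightarrow> 'a \<Rightarrow> real) \<Rightarrow> (real \<Rightarrow> 'a \<Rightarrow> real) \<Rightarrow> (real \<Rightarrow> 'a \<Rightarrow> real) \<Rightarrow> real" where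
  "form_a T \<Omega> \<nu> b c \<phi> \<psi> = form_a0 T \<Omega> \<nu> \<phi> \<psi>
     + st_inner T \<Omega> (\<lambda>t x. b t x \<bullet> nabla \<Omega> \<phi> t x + c t x * \<phi> t x) (dt T \<Omega> \<psi>)"

definition mat_norm :: "real^'n^'m \<Rightarrow> real" where
  "mat_norm Z = onorm ((*v) Z)"

end

theory Submission
  imports Defs
begin

text \<open>
  Put \<open>g = \<partial>\<^sub>t w - \<nu> \<Delta> w = f - b \<bullet> \<nabla>w - c w\<close> and let \<open>Q\<close> be the space-time Galerkin approximation of the solution
  \<open>w\<close> of the heat equation with right-hand side \<open>g\<close>. The error \<open>w - Q\<close> is bounded by multiples of \<open>\<parallel>g\<parallel>\<close> alone:
  the semidiscrete Galerkin error is controlled by \<open>\<nu> \<parallel>\<Delta>w\<parallel> \<le> \<parallel>g\<parallel>\<close>, the energy identity and Aubin--Nitsche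
  duality; and since nodal interpolation is the \<open>V\<^sup>1\<close>-orthogonal projection, the difference between \<open>Q\<close>
  and the interpolant of the semidiscrete solution solves the discrete heat equation with the interpolation
  error as data, which produces the constants \<open>\<gamma>\<close>.

  On the other hand \<open>Q\<close> solves the full discrete problem with right-hand side
  \<open>h = g + b \<bullet> \<nabla>Q + c Q = f - b \<bullet> \<nabla>(w - Q) - c (w - Q)\<close>, so that \<open>Q\<close> is bounded by multiples \<open>M\<close> of \<open>\<parallel>h\<parallel>\<close>
  and \<open>\<parallel>h\<parallel> \<le> \<parallel>f\<parallel> + \<tau> \<parallel>g\<parallel>\<close>. Inserting \<open>w = Q + (w - Q)\<close> in the definition of \<open>g\<close> gives
  \<open>\<parallel>g\<parallel> \<le> E \<parallel>f\<parallel> + \<kappa> \<parallel>g\<parallel>\<close>, and the last term is absorbed.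

  The analysis takes place in Hilbert spaces of classes of square integrable functions: time-dependent
  functions are curves in such a space, and \<open>H\<^sub>0\<^sup>1(\<Omega>)\<close> is the closed graph of the gradient.
\<close>

section \<open>Strongly measurable square integrable functions\<close>

text \<open>Both bilinear forms carry a time derivative on the test side, and this decides which
  matrices enter the constants. A load paired with time derivatives of basis functions is bounded
  through the norm that \<open>A\<close> measures, a load paired with gradients of those derivatives
  through the norm that \<open>W\<close> measures, while \<open>M\<close>, \<open>U\<close> and
  \<open>Y\<close> measure the solution in the three norms of the claim. The inverse inequality
  enters at one place only: the interpolation error in time is controlled in L2, but acts through
  its gradient. The obstacle is regularity. Only the error is split, never its time derivative. For
  the same reason the Laplacian is bounded with the help of resolvents. Integrals with values in the
  infinite-dimensional spaces are avoided: curves are paired with fixed vectors, and all identities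
  are between real integrals.\<close>

definition smeas :: "'c measure \<Rightarrow> ('c \<Rightarrow> 'h::real_normed_vector) \<Rightarrow> bool" where
  "smeas M u \<longleftrightarrow> (\<exists>s::nat \<Rightarrow> 'c \<Rightarrow> 'h. (\<forall>k. simple_function M (s k)) \<and>
     (AE t in M. (\<lambda>k. s k t) \<longlonglongrightarrow> u t))"

lemma smeas_comp:
  assumes "continuous_on UNIV f" "smeas M u"
  shows "smeas M (\<lambda>t. f (u t))"
proof -
  obtain s where s: "\<And>k. simple_function M (s k)" "AE t in M. (\<lambda>k. s k t) \<longlonglongrightarrow> u t"
    using assms(2) unfolding smeas_def by blast
  have "AE t in M. (\<lambda>k. f (s k t)) \<longlonglongrightarrow> f (u t)"
    using s(2) by eventually_elim (rule continuous_on_tendsto_compose[OF assms(1)], auto)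
  moreover have "\<And>k. simple_function M (\<lambda>t. f (s k t))"
    using simple_function_compose1[OF s(1), of f] .
  ultimately show ?thesis unfolding smeas_def
    by (intro exI[of _ "\<lambda>k t. f (s k t)"]) auto
qed

text \<open>Pairing reduces the algebra of measurable curves to composition with a continuous map.
  Limits of simple functions are stable under it in any normed space, whereas pairs and sums of
  Borel maps need not be Borel when the value space is not separable.\<close>

lemma smeas_Pair:
  assumes "smeas M u" "smeas M v"
  shows "smeas M (\<lambda>t. (u t, v t))"
proof -
  obtain s where s: "\<And>k. simple_function M (s k)" "AE t in M. (\<lambda>k. s k t) \<longlonglongrightarrow> u t"
    using assms(1) unfolding smeas_def by blast
  obtain r where r: "\<And>k. simple_function M (r k)" "AE t in M. (\<lambda>k. r k t) \<longlonglongrightarrow> v t"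
    using assms(2) unfolding smeas_def by blast
  have "AE t in M. (\<lambda>k. (s k t, r k t)) \<longlonglongrightarrow> (u t, v t)"
    using s(2) r(2) by eventually_elim (rule tendsto_Pair)
  moreover have "\<And>k. simple_function M (\<lambda>t. (s k t, r k t))"
    using simple_function_Pair[OF s(1) r(1)] .
  ultimately show ?thesis unfolding smeas_def
    by (intro exI[of _ "\<lambda>k t. (s k t, r k t)"]) auto
qed

lemma smeas_comp2:
  assumes "continuous_on UNIV (\<lambda>p. f (fst p) (snd p))" "smeas M u" "smeas M v"
  shows "smeas M (\<lambda>t. f (u t) (v t))"
  using smeas_comp[OF assms(1) smeas_Pair[OF assms(2,3)]] by simp

lemma smeas_add: "smeas M u \<Longrightarrow> smeas M v \<Longrightarrow> smeas M (\<lambda>t. u t + v t)"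
  by (rule smeas_comp2) (intro continuous_intros)

lemma smeas_diff: "smeas M u \<Longrightarrow> smeas M v \<Longrightarrow> smeas M (\<lambda>t. u t - v t)"
  by (rule smeas_comp2) (intro continuous_intros)

lemma smeas_scaleR: "smeas M a \<Longrightarrow> smeas M v \<Longrightarrow> smeas M (\<lambda>t. a t *\<^sub>R v t)"
  by (rule smeas_comp2) (intro continuous_intros)

lemma smeas_inner: "smeas M u \<Longrightarrow> smeas M v \<Longrightarrow> smeas M (\<lambda>t. u t \<bullet> (v t :: 'h::real_inner))"
  by (rule smeas_comp2) (intro continuous_intros)

lemma smeas_norm: "smeas M u \<Longrightarrow> smeas M (\<lambda>t. norm (u t))"
  by (rule smeas_comp) (intro continuous_intros)

lemma smeas_const: "smeas M (\<lambda>t. c)"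
  unfolding smeas_def by (rule exI[of _ "\<lambda>k t. c"]) auto

lemma smeas_linear: "bounded_linear L \<Longrightarrow> smeas M u \<Longrightarrow> smeas M (\<lambda>t. L (u t))"
  by (rule smeas_comp) (rule linear_continuous_on)

lemma smeas_cong_AE:
  assumes "AE t in M. u t = v t" "smeas M u"
  shows "smeas M v"
proof -
  obtain s where s: "\<And>k. simple_function M (s k)" "AE t in M. (\<lambda>k. s k t) \<longlonglongrightarrow> u t"
    using assms(2) unfolding smeas_def by blast
  have "AE t in M. (\<lambda>k. s k t) \<longlonglongrightarrow> v t"
    using s(2) assms(1) by eventually_elim auto
  with s(1) show ?thesis unfolding smeas_def by blast
qed

lemma borel_smeas:
  fixes u :: "'c \<Rightarrow> 'b::{second_countable_topology,real_normed_vector}"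
  assumes "u \<in> borel_measurable M" shows "smeas M u"
proof -
  obtain F where "\<forall>i. simple_function M (F i)" "\<forall>x\<in>space M. (\<lambda>i. F i x) \<longlonglongrightarrow> u x"
    using borel_measurable_implies_sequence_metric[OF assms, of 0] by blast
  then show ?thesis unfolding smeas_def by (intro exI[of _ F]) auto
qed

lemma borel_measurable_complete_AE:
  assumes "complete_measure M" "f \<in> borel_measurable M" "AE x in M. f x = g x"
  shows "g \<in> borel_measurable M"
proof (rule measurableI)
  fix A :: "'b set" assume A: "A \<in> sets borel"
  obtain N where N: "{x\<in>space M. \<not> f x = g x} \<subseteq> N" "emeasure M N = 0" "N \<in> sets M"
    by (rule AE_E[OF assms(3)])
  have 1: "f -` A \<inter> space M \<in> sets M" using assms(2) A by (rule measurable_sets)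
  have "N \<in> null_sets M" using N(2,3) by (rule null_setsI)
  then have 2: "g -` A \<inter> space M \<inter> N \<in> sets M"
    by (rule complete_measure.complete[OF assms(1) Int_lower2])
  have eq: "g -` A \<inter> space M = ((f -` A \<inter> space M) - N) \<union> (g -` A \<inter> space M \<inter> N)"
    using N(1) by auto
  show "g -` A \<inter> space M \<in> sets M" by (subst eq) (intro sets.Un sets.Diff 1 2 N(3))
qed simp

text \<open>On the exceptional null set the function is arbitrary; completeness of the measure makes
  it measurable nevertheless.\<close>

lemma smeas_borel_measurable:
  fixes u :: "'c \<Rightarrow> 'b::euclidean_space"
  assumes "complete_measure M" "smeas M u" shows "u \<in> borel_measurable M"
proof -
  obtain s where s: "\<And>k. simple_function M (s k)" "AE t in M. (\<lambda>k. s k t) \<longlonglongrightarrow> u t"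
    using assms(2) unfolding smeas_def by blast
  obtain N where N: "{x\<in>space M. \<not> (\<lambda>k. s k x) \<longlonglongrightarrow> u x} \<subseteq> N" "emeasure M N = 0" "N \<in> sets M"
    by (rule AE_E[OF s(2)])
  have "(\<lambda>x. if x \<in> N then 0 else u x) \<in> borel_measurable M"
  proof (rule borel_measurable_LIMSEQ_metric)
    show "(\<lambda>x. if x \<in> N then 0 else s k x) \<in> borel_measurable M" for k
      using N(3) borel_measurable_simple_function[OF s(1)[of k]] by (intro measurable_If_set) auto
    show "(\<lambda>i. if x \<in> N then 0 else s i x) \<longlonglongrightarrow> (if x \<in> N then 0 else u x)" if "x \<in> space M" for x
      using N(1) that by (cases "x \<in> N") (simp, simp, blast)
  qed
  moreover have "AE x in M. (if x \<in> N then 0 else u x) = u x"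
    by (rule AE_I[OF _ N(2,3)]) auto
  ultimately show ?thesis by (rule borel_measurable_complete_AE[OF assms(1)])
qed

section \<open>Square integrable curves and the Cauchy--Schwarz inequality\<close>

definition l2c :: "'c measure \<Rightarrow> ('c \<Rightarrow> 'h::real_normed_vector) \<Rightarrow> bool" where
  "l2c M u \<longleftrightarrow> smeas M u \<and> integrable M (\<lambda>t. (norm (u t))\<^sup>2)"

definition l2n :: "'c measure \<Rightarrow> ('c \<Rightarrow> 'h::real_normed_vector) \<Rightarrow> real" where
  "l2n M u = sqrt (LINT t|M. (norm (u t))\<^sup>2)"

lemma l2n_nonneg [simp]: "0 \<le> l2n M u"
  by (simp add: l2n_def)

lemma l2n_sq: "(l2n M u)\<^sup>2 = (LINT t|M. (norm (u t))\<^sup>2)"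
  by (simp add: l2n_def)

lemma l2c_smeas: "l2c M u \<Longrightarrow> smeas M u" by (simp add: l2c_def)

lemma l2c_integrable: "l2c M u \<Longrightarrow> integrable M (\<lambda>t. (norm (u t))\<^sup>2)" by (simp add: l2c_def)

lemma l2c_cong_AE:
  assumes "AE t in M. u t = v t" "l2c M u" "complete_measure M"
  shows "l2c M v"
proof -
  have "smeas M v" using assms smeas_cong_AE l2c_smeas by blast
  moreover have "integrable M (\<lambda>t. (norm (v t))\<^sup>2)"
  proof (rule integrable_cong_AE_imp[OF l2c_integrable[OF assms(2)]])
    show "(\<lambda>t. (norm (v t))\<^sup>2) \<in> borel_measurable M"
      using smeas_borel_measurable[OF assms(3) smeas_norm[OF \<open>smeas M v\<close>]] by measurable
    show "AE t in M. (norm (u t))\<^sup>2 = (norm (v t))\<^sup>2" using assms(1) by eventually_elim auto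
  qed
  ultimately show ?thesis by (simp add: l2c_def)
qed

context complete_measure
begin

lemma l2c_bound:
  assumes "smeas M u" "l2c M v" "AE t in M. norm (u t) \<le> C * norm (v t)"
  shows "l2c M u"
proof -
  have "integrable M (\<lambda>t. (norm (u t))\<^sup>2)"
  proof (rule Bochner_Integration.integrable_bound)
    show "integrable M (\<lambda>t. C\<^sup>2 * (norm (v t))\<^sup>2)" using l2c_integrable[OF assms(2)] by simp
    show "(\<lambda>t. (norm (u t))\<^sup>2) \<in> borel_measurable M"
      using smeas_borel_measurable[OF complete_measure_axioms smeas_norm[OF assms(1)]] by measurable
    show "AE t in M. norm ((norm (u t))\<^sup>2) \<le> norm (C\<^sup>2 * (norm (v t))\<^sup>2)"
      using assms(3)
    proof eventually_elim
      case (elim t)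
      then have "(norm (u t))\<^sup>2 \<le> (C * norm (v t))\<^sup>2" by (intro power_mono) auto
      then show ?case by (simp add: power_mult_distrib)
    qed
  qed
  then show ?thesis using assms(1) by (simp add: l2c_def)
qed

lemma l2c_add:
  assumes "l2c M u" "l2c M v" shows "l2c M (\<lambda>t. u t + v t)"
proof -
  have s: "smeas M (\<lambda>t. u t + v t)" using assms by (auto intro: smeas_add l2c_smeas)
  have "integrable M (\<lambda>t. (norm (u t + v t))\<^sup>2)"
  proof (rule Bochner_Integration.integrable_bound)
    show "integrable M (\<lambda>t. 2 * (norm (u t))\<^sup>2 + 2 * (norm (v t))\<^sup>2)"
      using assms by (intro Bochner_Integration.integrable_add integrable_mult_right l2c_integrable)
    show "(\<lambda>t. (norm (u t + v t))\<^sup>2) \<in> borel_measurable M"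
      using smeas_borel_measurable[OF complete_measure_axioms smeas_norm[OF s]] by measurable
    show "AE t in M. norm ((norm (u t + v t))\<^sup>2) \<le> norm (2 * (norm (u t))\<^sup>2 + 2 * (norm (v t))\<^sup>2)"
    proof (rule AE_I2)
      fix t
      have "(norm (u t + v t))\<^sup>2 \<le> (norm (u t) + norm (v t))\<^sup>2"
        by (intro power_mono norm_triangle_ineq) auto
      also have "\<dots> \<le> 2 * (norm (u t))\<^sup>2 + 2 * (norm (v t))\<^sup>2"
        using sum_squares_bound[of "norm (u t)" "norm (v t)"] by (simp add: power2_sum)
      finally show "norm ((norm (u t + v t))\<^sup>2) \<le> norm (2 * (norm (u t))\<^sup>2 + 2 * (norm (v t))\<^sup>2)"
        by simp
    qed
  qed
  with s show ?thesis by (simp add: l2c_def)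
qed

lemma l2c_linear:
  assumes "bounded_linear L" "l2c M u" shows "l2c M (\<lambda>t. L (u t))"
proof -
  obtain K where K: "\<forall>x. norm (L x) \<le> norm x * K" using bounded_linear.bounded[OF assms(1)] by blast
  have s: "smeas M (\<lambda>t. L (u t))" by (rule smeas_linear[OF assms(1) l2c_smeas[OF assms(2)]])
  show ?thesis
  proof (rule l2c_bound[OF s assms(2)])
    show "AE t in M. norm (L (u t)) \<le> K * norm (u t)" using K by (simp add: mult.commute)
  qed
qed

lemma l2c_scaleR: "l2c M u \<Longrightarrow> l2c M (\<lambda>t. c *\<^sub>R u t)"
  by (rule l2c_linear[OF bounded_linear_scaleR_right])

lemma l2c_zero: "l2c M (\<lambda>t. 0)"
  by (simp add: l2c_def smeas_const)

lemma l2c_diff: "l2c M u \<Longrightarrow> l2c M v \<Longrightarrow> l2c M (\<lambda>t. u t - v t)"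
  using l2c_add[of u "\<lambda>t. (-1) *\<^sub>R v t"] l2c_scaleR[of v "-1"] by simp

lemma l2c_sum: "(\<And>i. i \<in> I \<Longrightarrow> l2c M (u i)) \<Longrightarrow> l2c M (\<lambda>t. \<Sum>i\<in>I. u i t)"
  by (induction I rule: infinite_finite_induct) (auto intro: l2c_zero l2c_add)

lemma l2c_norm: "l2c M u \<Longrightarrow> l2c M (\<lambda>t. norm (u t))"
  by (auto simp: l2c_def intro: smeas_norm)

lemma integrable_inner:
  fixes u v :: "'a \<Rightarrow> 'h::real_inner"
  assumes "l2c M u" "l2c M v" shows "integrable M (\<lambda>t. u t \<bullet> v t)"
proof (rule Bochner_Integration.integrable_bound)
  show "integrable M (\<lambda>t. (norm (u t))\<^sup>2 + (norm (v t))\<^sup>2)"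
    using assms by (intro Bochner_Integration.integrable_add l2c_integrable)
  show "(\<lambda>t. u t \<bullet> v t) \<in> borel_measurable M"
    using smeas_borel_measurable[OF complete_measure_axioms smeas_inner] assms l2c_smeas by blast
  show "AE t in M. norm (u t \<bullet> v t) \<le> norm ((norm (u t))\<^sup>2 + (norm (v t))\<^sup>2)"
  proof (rule AE_I2)
    fix t
    have "\<bar>u t \<bullet> v t\<bar> \<le> norm (u t) * norm (v t)" by (rule Cauchy_Schwarz_ineq2)
    also have "\<dots> \<le> (norm (u t))\<^sup>2 + (norm (v t))\<^sup>2"
      using sum_squares_bound[of "norm (u t)" "norm (v t)"]
        mult_nonneg_nonneg[OF norm_ge_zero[of "u t"] norm_ge_zero[of "v t"]] by linarith
    finally show "norm (u t \<bullet> v t) \<le> norm ((norm (u t))\<^sup>2 + (norm (v t))\<^sup>2)" by simp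
  qed
qed

lemma integrable_norm_mult:
  assumes "l2c M u" "l2c M v" shows "integrable M (\<lambda>t. norm (u t) * norm (v t))"
  using integrable_inner[OF l2c_norm[OF assms(1)] l2c_norm[OF assms(2)]] by simp

text \<open>Discriminant argument: the integral of
  \<open>(x * norm (u t) - norm (v t))\<^sup>2\<close> is a nonnegative quadratic in
  \<open>x\<close>. The version for norms holds in every normed space, and the triangle inequality
  for \<open>l2n\<close> rests on it.\<close>

lemma l2n_CS_norm:
  assumes "l2c M u" "l2c M v"
  shows "(LINT t|M. norm (u t) * norm (v t)) \<le> l2n M u * l2n M v"
proof -
  define a where "a = (LINT t|M. (norm (u t))\<^sup>2)"
  define b where "b = (LINT t|M. (norm (v t))\<^sup>2)"
  define c where "c = (LINT t|M. norm (u t) * norm (v t))"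
  note i = integrable_norm_mult[OF assms] l2c_integrable[OF assms(1)] l2c_integrable[OF assms(2)]
  have q: "0 \<le> x\<^sup>2 * a - 2 * x * c + b" for x
  proof -
    have "0 \<le> (LINT t|M. (x * norm (u t) - norm (v t))\<^sup>2)" by simp
    also have "\<dots> = (LINT t|M. x\<^sup>2 * (norm (u t))\<^sup>2 - 2 * x * (norm (u t) * norm (v t)) + (norm (v t))\<^sup>2)"
      by (intro Bochner_Integration.integral_cong) (auto simp: power2_diff power_mult_distrib)
    also have "\<dots> = x\<^sup>2 * a - 2 * x * c + b"
      using i by (simp add: a_def b_def c_def)
    finally show ?thesis .
  qed
  have ab: "a \<ge> 0" "b \<ge> 0" "c \<ge> 0" by (auto simp: a_def b_def c_def)
  have "c\<^sup>2 \<le> a * b"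
  proof (cases "a = 0")
    case True
    have "c = 0"
    proof (rule ccontr)
      assume "c \<noteq> 0"
      \<comment> \<open>With this value of \<open>x\<close> and \<open>a = 0\<close> the quadratic
        takes the value -1.\<close>
      then have "2 * ((b + 1) / (2 * c)) * c = b + 1" by simp
      then show False using q[of "(b + 1) / (2 * c)"] True ab by simp
    qed
    then show ?thesis using True by simp
  next
    case False
    then have "(c / a)\<^sup>2 * a - 2 * (c / a) * c + b = (a * b - c\<^sup>2) / a"
      by (simp add: field_simps power2_eq_square)
    then have "0 \<le> (a * b - c\<^sup>2) / a" using q[of "c / a"] by simp
    moreover have "a > 0" using False ab by simp
    ultimately show ?thesis by (simp add: zero_le_divide_iff)
  qed
  then have "c \<le> sqrt (a * b)" by (rule real_le_rsqrt)
  then show ?thesis by (simp add: l2n_def a_def b_def c_def real_sqrt_mult)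
qed

lemma l2n_CS:
  fixes u v :: "'a \<Rightarrow> 'h::real_inner"
  assumes "l2c M u" "l2c M v"
  shows "\<bar>LINT t|M. u t \<bullet> v t\<bar> \<le> l2n M u * l2n M v"
proof -
  have "\<bar>LINT t|M. u t \<bullet> v t\<bar> \<le> (LINT t|M. \<bar>u t \<bullet> v t\<bar>)" by (rule integral_abs_bound)
  also have "\<dots> \<le> (LINT t|M. norm (u t) * norm (v t))"
    using integrable_inner[OF assms] integrable_norm_mult[OF assms]
    by (intro integral_mono integrable_abs) (simp_all add: Cauchy_Schwarz_ineq2)
  also have "\<dots> \<le> l2n M u * l2n M v" by (rule l2n_CS_norm[OF assms])
  finally show ?thesis .
qed

lemma l2n_mono:
  assumes "l2c M u" "l2c M v" "C \<ge> 0" "AE t in M. norm (u t) \<le> C * norm (v t)"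
  shows "l2n M u \<le> C * l2n M v"
proof (rule power2_le_imp_le)
  have "(l2n M u)\<^sup>2 \<le> (LINT t|M. C\<^sup>2 * (norm (v t))\<^sup>2)"
    unfolding l2n_sq
  proof (rule integral_mono_AE)
    show "AE t in M. (norm (u t))\<^sup>2 \<le> C\<^sup>2 * (norm (v t))\<^sup>2"
      using assms(4)
    proof eventually_elim
      case (elim t)
      then have "(norm (u t))\<^sup>2 \<le> (C * norm (v t))\<^sup>2" by (intro power_mono) auto
      then show ?case by (simp add: power_mult_distrib)
    qed
  qed (use assms in \<open>auto dest: l2c_integrable\<close>)
  then show "(l2n M u)\<^sup>2 \<le> (C * l2n M v)\<^sup>2" by (simp add: power_mult_distrib l2n_sq)
qed (use assms in auto)

lemma l2n_triangle:
  assumes "l2c M u" "l2c M v"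
  shows "l2n M (\<lambda>t. u t + v t) \<le> l2n M u + l2n M v"
proof (rule power2_le_imp_le)
  note i = integrable_norm_mult[OF assms] l2c_integrable[OF assms(1)] l2c_integrable[OF assms(2)]
  have "(l2n M (\<lambda>t. u t + v t))\<^sup>2 \<le> (LINT t|M. (norm (u t))\<^sup>2 + (norm (v t))\<^sup>2 + 2 * (norm (u t) * norm (v t)))"
    unfolding l2n_sq
  proof (rule integral_mono)
    show "(norm (u t + v t))\<^sup>2 \<le> (norm (u t))\<^sup>2 + (norm (v t))\<^sup>2 + 2 * (norm (u t) * norm (v t))" for t
      using power_mono[OF norm_triangle_ineq[of "u t" "v t"], of 2] by (simp add: power2_sum)
  qed (use i l2c_integrable[OF l2c_add[OF assms]] in auto)
  also have "\<dots> = (l2n M u)\<^sup>2 + (l2n M v)\<^sup>2 + 2 * (LINT t|M. norm (u t) * norm (v t))"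
    using i by (simp add: l2n_sq)
  also have "\<dots> \<le> (l2n M u + l2n M v)\<^sup>2"
    using l2n_CS_norm[OF assms] by (simp add: power2_sum)
  finally show "(l2n M (\<lambda>t. u t + v t))\<^sup>2 \<le> (l2n M u + l2n M v)\<^sup>2" .
qed simp

lemma l2n_scaleR: "l2n M (\<lambda>t. c *\<^sub>R u t) = \<bar>c\<bar> * l2n M u"
  by (simp add: l2n_def power_mult_distrib real_sqrt_mult)

lemma l2n_triangle_diff:
  assumes "l2c M u" "l2c M v"
  shows "l2n M (\<lambda>t. u t - v t) \<le> l2n M u + l2n M v"
  using l2n_triangle[OF assms(1) l2c_scaleR[OF assms(2), of "-1"]] l2n_scaleR[of "-1" v] by simp

end

lemma l2n_cong_AE:
  assumes "AE t in M. u t = v t" "smeas M u" "complete_measure M"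
  shows "l2n M u = l2n M v"
proof -
  have "smeas M v" using assms smeas_cong_AE by blast
  have "(LINT t|M. (norm (u t))\<^sup>2) = (LINT t|M. (norm (v t))\<^sup>2)"
  proof (rule integral_cong_AE)
    show "(\<lambda>t. (norm (v t))\<^sup>2) \<in> borel_measurable M" "(\<lambda>t. (norm (u t))\<^sup>2) \<in> borel_measurable M"
      using smeas_borel_measurable[OF assms(3) smeas_norm[OF \<open>smeas M v\<close>]] smeas_borel_measurable[OF assms(3) smeas_norm[OF \<open>smeas M u\<close>]]
      by measurable
    show "AE t in M. (norm (u t))\<^sup>2 = (norm (v t))\<^sup>2" using assms(1) by eventually_elim auto
  qed
  then show ?thesis by (simp add: l2n_def)
qed

lemma complete_measure_lebesgue_on:
  assumes "S \<in> sets lebesgue" shows "complete_measure (lebesgue_on S)"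
proof
  fix A B assume "B \<subseteq> A" "A \<in> null_sets (lebesgue_on S)"
  then have "A \<in> null_sets lebesgue" "A \<subseteq> S" using assms
    by (auto simp: null_sets_restrict_space)
  then have "B \<in> null_sets lebesgue"
    using completion.complete2[OF \<open>B \<subseteq> A\<close>] by blast
  then show "B \<in> sets (lebesgue_on S)" using \<open>B \<subseteq> A\<close> \<open>A \<subseteq> S\<close> assms
    by (auto simp: sets_restrict_space image_iff)
qed

section \<open>Hilbert spaces\<close>

text \<open>A minimizing sequence for the distance is Cauchy by the parallelogram law. At its limit
  the distance is minimal along every line in \<open>H\<close>, which is orthogonality.\<close>

lemma closed_subspace_projection:
  fixes H :: "'h::{real_inner,complete_space} set"
  assumes "subspace H" "closed H"
  shows "\<exists>p\<in>H. \<forall>h\<in>H. (x - p) \<bullet> h = 0"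
proof -
  define d where "d = infdist x H"
  have ne: "H \<noteq> {}" using subspace_0[OF assms(1)] by blast
  have d0: "d \<ge> 0" by (simp add: d_def infdist_nonneg)
  have dle: "d \<le> norm (x - h)" if "h \<in> H" for h
    using infdist_le[OF that, of x] by (simp add: d_def dist_norm)
  have "\<exists>h\<in>H. norm (x - h) < d + 1 / real (Suc n)" for n
  proof -
    have "infdist x H < d + 1 / real (Suc n)" by (simp add: d_def)
    then obtain h where "h \<in> H" "dist x h < d + 1 / real (Suc n)"
      unfolding infdist_notempty[OF ne] by (subst (asm) cINF_less_iff) (use ne in auto)
    then show ?thesis by (auto simp: dist_norm)
  qed
  then obtain h where hH: "\<And>n. h n \<in> H" and hd: "\<And>n. norm (x - h n) < d + 1 / real (Suc n)"
    by metis
  have par: "(norm (a - b))\<^sup>2 \<le> 2 * (norm (x - a))\<^sup>2 + 2 * (norm (x - b))\<^sup>2 - 4 * d\<^sup>2"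
    if "a \<in> H" "b \<in> H" for a b
  proof -
    have "(1/2) *\<^sub>R (a + b) \<in> H" using that assms(1) by (simp add: subspace_add subspace_scale)
    then have "d\<^sup>2 \<le> (norm (x - (1/2) *\<^sub>R (a + b)))\<^sup>2" by (intro power_mono dle d0)
    moreover have "(norm (a - b))\<^sup>2 = 2 * (norm (x - a))\<^sup>2 + 2 * (norm (x - b))\<^sup>2
        - 4 * (norm (x - (1/2) *\<^sub>R (a + b)))\<^sup>2"
      by (simp add: power2_norm_eq_inner inner_diff inner_add algebra_simps inner_commute)
    ultimately show ?thesis by simp
  qed
  have "Cauchy h"
  proof (rule metric_CauchyI)
    fix e :: real assume e: "e > 0"
    have "(\<lambda>n. 4 * (d + 1 / real (Suc n))\<^sup>2 - 4 * d\<^sup>2) \<longlonglongrightarrow> 4 * (d + 0)\<^sup>2 - 4 * d\<^sup>2"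
      by (intro tendsto_intros LIMSEQ_Suc lim_1_over_n)
    then have "eventually (\<lambda>n. 4 * (d + 1 / real (Suc n))\<^sup>2 - 4 * d\<^sup>2 < e\<^sup>2) sequentially"
      using e by (intro order_tendstoD) auto
    then obtain N where N: "4 * (d + 1 / real (Suc N))\<^sup>2 - 4 * d\<^sup>2 < e\<^sup>2"
      unfolding eventually_sequentially by blast
    have sm: "(norm (x - h n))\<^sup>2 \<le> (d + 1 / real (Suc N))\<^sup>2" if "n \<ge> N" for n
    proof (rule power_mono)
      have "1 / real (Suc n) \<le> 1 / real (Suc N)" using that by (simp add: frac_le)
      then show "norm (x - h n) \<le> d + 1 / real (Suc N)" using hd[of n] by linarith
    qed simp
    show "\<exists>M. \<forall>m\<ge>M. \<forall>n\<ge>M. dist (h m) (h n) < e"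
    proof (intro exI[of _ N] allI impI)
      fix m n assume mn: "N \<le> m" "N \<le> n"
      have "(norm (h m - h n))\<^sup>2 < e\<^sup>2"
        using par[OF hH[of m] hH[of n]] sm[OF mn(1)] sm[OF mn(2)] N by linarith
      then show "dist (h m) (h n) < e" using e by (simp add: dist_norm power2_less_imp_less)
    qed
  qed
  then obtain p where p: "h \<longlonglongrightarrow> p" using Cauchy_convergent convergent_def by blast
  have pH: "p \<in> H" using closed_sequentially[OF assms(2) _ p] hH by blast
  have "(\<lambda>n. d + 1 / real (Suc n)) \<longlonglongrightarrow> d + 0"
    by (intro tendsto_intros LIMSEQ_Suc lim_1_over_n)
  moreover have "(\<lambda>n. norm (x - h n)) \<longlonglongrightarrow> norm (x - p)" by (intro tendsto_intros p)
  ultimately have np: "norm (x - p) \<le> d"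
    using hd by (intro LIMSEQ_le[of "\<lambda>n. norm (x - h n)" _ "\<lambda>n. d + 1 / real (Suc n)" d])
      (auto intro: less_imp_le)
  show ?thesis
  proof (intro bexI[OF _ pH] ballI)
    fix k assume k: "k \<in> H"
    show "(x - p) \<bullet> k = 0"
    proof (cases "k = 0")
      case False
      \<comment> \<open>The minimizer of the squared distance from \<open>x\<close> to
        \<open>p + t *\<^sub>R k\<close>; since 0 is minimal as well, the numerator must
        vanish.\<close>
      define t where "t = (x - p) \<bullet> k / (k \<bullet> k)"
      have kk: "k \<bullet> k > 0" using False by simp
      have "p + t *\<^sub>R k \<in> H" using pH k assms(1) by (simp add: subspace_add subspace_scale)
      then have "norm (x - p) \<le> norm (x - (p + t *\<^sub>R k))" using dle np by force
      then have "(norm (x - p))\<^sup>2 \<le> (norm (x - (p + t *\<^sub>R k)))\<^sup>2" by (intro power_mono) auto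
      also have "\<dots> = (norm (x - p))\<^sup>2 - 2 * t * ((x - p) \<bullet> k) + t * t * (k \<bullet> k)"
        by (simp add: power2_norm_eq_inner inner_diff inner_add algebra_simps inner_commute)
      finally have "0 \<le> - 2 * t * ((x - p) \<bullet> k) + t * t * (k \<bullet> k)" by simp
      also have "\<dots> = - (((x - p) \<bullet> k)\<^sup>2 / (k \<bullet> k))"
        using kk by (simp add: t_def power2_eq_square)
      finally have "((x - p) \<bullet> k)\<^sup>2 / (k \<bullet> k) \<le> 0" by simp
      then have "((x - p) \<bullet> k)\<^sup>2 \<le> 0" using kk by (simp add: divide_le_0_iff)
      then show ?thesis by simp
    qed simp
  qed
qed

text \<open>A special case of Lax--Milgram, by a damped fixed-point iteration.\<close>

lemma monotone_perturbation_surj: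
  fixes K :: "'h::{real_inner,complete_space} \<Rightarrow> 'h"
  assumes K: "bounded_linear K" and pos: "\<And>x. 0 \<le> x \<bullet> K x"
  shows "\<exists>x. x + K x = y"
proof -
  interpret K: bounded_linear K by fact
  obtain C where C: "C > 0" "\<And>x. norm (K x) \<le> norm x * C" using K.pos_bounded by blast
  \<comment> \<open>Once the cross term is dropped by positivity, the squared contraction factor is
    \<open>(1 - \<delta>)\<^sup>2 + \<delta>\<^sup>2 * C\<^sup>2\<close>. This step size minimizes
    it, and the minimum is \<open>q\<close>.\<close>
  define \<delta> where "\<delta> = 1 / (1 + C\<^sup>2)"
  define q where "q = C\<^sup>2 / (1 + C\<^sup>2)"
  have den: "1 + C\<^sup>2 > 0" by (simp add: add_pos_nonneg)
  have \<delta>: "\<delta> > 0" "1 - \<delta> = q" "q \<ge> 0" "q < 1"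
    using den by (auto simp: \<delta>_def q_def field_simps)
  have qd: "q\<^sup>2 + \<delta>\<^sup>2 * C\<^sup>2 = q"
  proof -
    have "\<delta> * C\<^sup>2 = q" by (simp add: \<delta>_def q_def)
    then have "\<delta>\<^sup>2 * C\<^sup>2 = \<delta> * q" by (simp add: power2_eq_square)
    then have "q\<^sup>2 + \<delta>\<^sup>2 * C\<^sup>2 = q * (q + \<delta>)" by (simp add: algebra_simps power2_eq_square)
    moreover have "q + \<delta> = 1" using \<delta>(2) by linarith
    ultimately show ?thesis by simp
  qed
  define f where "f x = x - \<delta> *\<^sub>R (x + K x - y)" for x
  have "\<exists>!x. f x = x"
  proof (rule banach_fix_type[of "sqrt q"])
    show "0 \<le> sqrt q" "sqrt q < 1" using \<delta> by auto
    show "\<forall>x z. dist (f x) (f z) \<le> sqrt q * dist x z"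
    proof (intro allI)
      fix x z :: 'h
      define u where "u = x - z"
      have fu: "f x - f z = q *\<^sub>R u - \<delta> *\<^sub>R K u"
        by (simp add: f_def u_def K.diff algebra_simps flip: \<delta>(2))
      have "(norm (f x - f z))\<^sup>2 = q\<^sup>2 * (norm u)\<^sup>2 - 2 * q * \<delta> * (u \<bullet> K u) + \<delta>\<^sup>2 * (norm (K u))\<^sup>2"
        unfolding fu power2_norm_eq_inner
        by (simp add: inner_diff algebra_simps inner_commute power2_eq_square)
      also have "\<dots> \<le> q\<^sup>2 * (norm u)\<^sup>2 + \<delta>\<^sup>2 * (norm u * C)\<^sup>2"
        using pos[of u] \<delta> C(2)[of u] by (intro add_mono mult_left_mono power_mono) auto
      also have "\<dots> = (q\<^sup>2 + \<delta>\<^sup>2 * C\<^sup>2) * (norm u)\<^sup>2" by (simp add: algebra_simps power_mult_distrib)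
      also have "\<dots> = (sqrt q * norm u)\<^sup>2" using \<delta> by (simp add: qd power_mult_distrib)
      finally have *: "(norm (f x - f z))\<^sup>2 \<le> (sqrt q * norm u)\<^sup>2" .
      have "norm (f x - f z) \<le> sqrt q * norm u" by (rule power2_le_imp_le[OF *]) (simp add: \<delta>(3))
      then show "dist (f x) (f z) \<le> sqrt q * dist x z" by (simp add: dist_norm u_def)
    qed
  qed
  then obtain x where "f x = x" by blast
  then have "\<delta> *\<^sub>R (x + K x - y) = 0" by (simp add: f_def)
  then show ?thesis using \<delta>(1) by (intro exI[of _ x]) simp
qed

text \<open>When \<open>H\<close> consists of functions paired with their gradients, this is the
  weak solution \<open>u\<close> of u - \<alpha> \<Delta>u = z, returned together with its
  gradient.\<close>

definition resolvent ::
  "('h::{real_inner,complete_space} \<times> 'g::{real_inner,complete_space}) set \<Rightarrow> real \<Rightarrow> 'h \<Rightarrow> 'h \<times> 'g" where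
  "resolvent H \<alpha> z = (SOME p. p \<in> H \<and> (\<forall>h\<in>H. (fst p - z) \<bullet> fst h + \<alpha> * (snd p \<bullet> snd h) = 0))"

text \<open>The abstract form domain: the pairs in \<open>H\<close> stand for functions of the
  energy space and their gradients, so closedness of the subspace expresses closedness of the
  Dirichlet form.\<close>

locale form_domain =
  fixes H :: "('h::{real_inner,complete_space} \<times> 'g::{real_inner,complete_space}) set"
  assumes subspace_H: "subspace H" and closed_H: "closed H"
begin

text \<open>After scaling the second component by the square root of \<alpha>, the equation says
  that the solution is the orthogonal projection of \<open>(z, 0)\<close> onto the scaled subspace,
  which is again closed.\<close>

lemma resolvent_exists:
  assumes "\<alpha> > 0"
  shows "\<exists>p. p \<in> H \<and> (\<forall>h\<in>H. (fst p - z) \<bullet> fst h + \<alpha> * (snd p \<bullet> snd h) = 0)"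
proof -
  define s where "s = sqrt \<alpha>"
  have s: "s > 0" "s * s = \<alpha>" using assms by (auto simp: s_def)
  define S where "S p = (fst p, s *\<^sub>R snd p)" for p :: "'h \<times> 'g"
  define S' where "S' p = (fst p, (1 / s) *\<^sub>R snd p)" for p :: "'h \<times> 'g"
  have SS: "S (S' p) = p" "S' (S p) = p" for p using s by (auto simp: S_def S'_def)
  have im: "S ` H = S' -` H" using SS by (auto simp: image_iff) (metis SS(1))
  have "linear S" by (auto simp: S_def linear_iff scaleR_add_right)
  then have "subspace (S ` H)" using subspace_H by (rule linear_subspace_image)
  moreover have "closed (S ` H)" unfolding im S'_def
    by (intro closed_vimage closed_H continuous_intros)
  ultimately obtain q where q: "q \<in> S ` H" "\<forall>h\<in>S ` H. ((z, 0) - q) \<bullet> h = 0"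
    using closed_subspace_projection by blast
  then obtain p where p: "p \<in> H" "q = S p" by blast
  have "(fst p - z) \<bullet> fst h + \<alpha> * (snd p \<bullet> snd h) = 0" if "h \<in> H" for h
  proof -
    have "((z, 0) - S p) \<bullet> S h = 0" using q(2) p(2) that by blast
    then show ?thesis by (simp add: S_def inner_diff inner_prod_def s(2)[symmetric])
  qed
  with p(1) show ?thesis by blast
qed

lemma resolvent_props:
  assumes "\<alpha> > 0"
  shows "resolvent H \<alpha> z \<in> H"
    and "h \<in> H \<Longrightarrow> (fst (resolvent H \<alpha> z) - z) \<bullet> fst h + \<alpha> * (snd (resolvent H \<alpha> z) \<bullet> snd h) = 0"
  using someI_ex[OF resolvent_exists[OF assms, of z]] unfolding resolvent_def by blast+

lemma resolvent_unique:
  assumes "\<alpha> > 0" "p \<in> H" "\<And>h. h \<in> H \<Longrightarrow> (fst p - z) \<bullet> fst h + \<alpha> * (snd p \<bullet> snd h) = 0"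
  shows "resolvent H \<alpha> z = p"
proof -
  define r where "r = resolvent H \<alpha> z"
  note r = resolvent_props[OF assms(1), where z=z, folded r_def]
  have d: "r - p \<in> H" using r(1) assms(2) subspace_H by (simp add: subspace_diff)
  have "(fst (r - p)) \<bullet> fst (r - p) + \<alpha> * (snd (r - p) \<bullet> snd (r - p)) = 0"
    using r(2)[OF d] assms(3)[OF d] by (simp add: inner_diff algebra_simps)
  moreover have "\<alpha> * (snd (r - p) \<bullet> snd (r - p)) \<ge> 0" using assms(1) by simp
  ultimately have "fst (r - p) \<bullet> fst (r - p) = 0" "\<alpha> * (snd (r - p) \<bullet> snd (r - p)) = 0"
    using inner_ge_zero[of "fst (r - p)"] by linarith+
  then have "fst (r - p) = 0" "snd (r - p) = 0" using assms(1) by auto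
  then show ?thesis by (simp add: r_def prod_eq_iff)
qed

text \<open>Testing the resolvent equation with its own solution leaves a nonnegative gradient
  term.\<close>

lemma norm_resolvent_le:
  assumes "\<alpha> > 0" shows "norm (fst (resolvent H \<alpha> z)) \<le> norm z"
proof -
  let ?r = "resolvent H \<alpha> z"
  have "(norm (fst ?r))\<^sup>2 = z \<bullet> fst ?r - \<alpha> * (snd ?r \<bullet> snd ?r)"
    using resolvent_props(2)[OF assms resolvent_props(1)[OF assms, where z=z], where z=z]
    by (simp add: power2_norm_eq_inner inner_diff)
  also have "\<dots> \<le> z \<bullet> fst ?r" using assms by simp
  also have "\<dots> \<le> norm z * norm (fst ?r)" by (rule norm_cauchy_schwarz)
  finally have "norm (fst ?r) * norm (fst ?r) \<le> norm z * norm (fst ?r)" by (simp add: power2_eq_square)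
  then show ?thesis by (cases "norm (fst ?r) = 0") (auto simp: mult_le_cancel_right)
qed

lemma bounded_linear_resolvent:
  assumes "\<alpha> > 0" shows "bounded_linear (\<lambda>z. fst (resolvent H \<alpha> z))"
proof (rule bounded_linear_intro[of _ 1])
  note r = resolvent_props[OF assms]
  fix x y and c :: real
  have "resolvent H \<alpha> (x + y) = resolvent H \<alpha> x + resolvent H \<alpha> y"
  proof (rule resolvent_unique[OF assms])
    show "resolvent H \<alpha> x + resolvent H \<alpha> y \<in> H" using r(1) subspace_H by (simp add: subspace_add)
    fix h assume "h \<in> H"
    then show "(fst (resolvent H \<alpha> x + resolvent H \<alpha> y) - (x + y)) \<bullet> fst h
        + \<alpha> * (snd (resolvent H \<alpha> x + resolvent H \<alpha> y) \<bullet> snd h) = 0"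
      using r(2)[of h, where z=x] r(2)[of h, where z=y] by (simp add: inner_diff inner_add algebra_simps)
  qed
  then show "fst (resolvent H \<alpha> (x + y)) = fst (resolvent H \<alpha> x) + fst (resolvent H \<alpha> y)" by simp
  have "resolvent H \<alpha> (c *\<^sub>R x) = c *\<^sub>R resolvent H \<alpha> x"
  proof (rule resolvent_unique[OF assms])
    show "c *\<^sub>R resolvent H \<alpha> x \<in> H" using r(1) subspace_H by (simp add: subspace_scale)
    fix h assume "h \<in> H"
    then have "c * ((fst (resolvent H \<alpha> x) - x) \<bullet> fst h + \<alpha> * (snd (resolvent H \<alpha> x) \<bullet> snd h)) = 0"
      using r(2)[of h, where z=x] by simp
    then show "(fst (c *\<^sub>R resolvent H \<alpha> x) - c *\<^sub>R x) \<bullet> fst h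
        + \<alpha> * (snd (c *\<^sub>R resolvent H \<alpha> x) \<bullet> snd h) = 0"
      by (simp add: inner_diff algebra_simps)
  qed
  then show "fst (resolvent H \<alpha> (c *\<^sub>R x)) = c *\<^sub>R fst (resolvent H \<alpha> x)" by simp
  show "norm (fst (resolvent H \<alpha> x)) \<le> norm x * 1" using norm_resolvent_le[OF assms] by simp
qed

text \<open>Each of the two resolvent equations is tested with the solution of the other.\<close>

lemma resolvent_symmetric:
  assumes "\<alpha> > 0" shows "fst (resolvent H \<alpha> x) \<bullet> y = x \<bullet> fst (resolvent H \<alpha> y)"
  using resolvent_props(2)[OF assms resolvent_props(1)[OF assms, where z=x], where z=y]
    resolvent_props(2)[OF assms resolvent_props(1)[OF assms, where z=y], where z=x]
  by (simp add: inner_diff inner_commute)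

text \<open>The variational Laplacian: \<open>z\<close> is the Laplacian of the first component of
  \<open>p\<close>. Membership in the closure of the first components determines \<open>z\<close>
  uniquely, and it is the condition under which resolvents of \<open>z\<close> converge to
  \<open>z\<close>.\<close>

definition weak_lap :: "'h \<times> 'g \<Rightarrow> 'h \<Rightarrow> bool" where
  "weak_lap p z \<longleftrightarrow> p \<in> H \<and> z \<in> closure (fst ` H) \<and> (\<forall>h\<in>H. z \<bullet> fst h = - (snd p \<bullet> snd h))"

text \<open>\<open>p\<close> itself solves the resolvent equation with data
  \<open>fst p - \<alpha> *\<^sub>R z\<close>; the identity then follows by linearity. Its role is
  to express the Yosida approximation through the resolvent of the Laplacian.\<close>

lemma resolvent_weak_lap:
  assumes "\<alpha> > 0" "weak_lap p z"
  shows "fst (resolvent H \<alpha> (fst p)) = fst p + \<alpha> *\<^sub>R fst (resolvent H \<alpha> z)"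
proof -
  interpret bounded_linear "\<lambda>z. fst (resolvent H \<alpha> z)" by (rule bounded_linear_resolvent[OF assms(1)])
  have "resolvent H \<alpha> (fst p - \<alpha> *\<^sub>R z) = p"
    using assms by (intro resolvent_unique) (auto simp: weak_lap_def)
  then show ?thesis using diff[of "fst p" "\<alpha> *\<^sub>R z"] scaleR[of \<alpha> z] by (simp add: algebra_simps)
qed

text \<open>For data \<open>fst p\<close> with \<open>p\<close> in \<open>H\<close>, testing with
  the difference bounds the squared error by \<alpha> times the squared norm of
  \<open>snd p\<close>. General data are approximated by such ones, and contractivity makes the
  approximation uniform in \<alpha>.\<close>

lemma resolvent_tendsto:
  assumes "z \<in> closure (fst ` H)"
  shows "(\<lambda>n. fst (resolvent H (1 / real (Suc n)) z)) \<longlonglongrightarrow> z"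
proof (rule LIMSEQ_I)
  fix e :: real assume e: "e > 0"
  obtain p where p: "p \<in> H" "dist (fst p) z < e / 4"
    using assms e unfolding closure_approachable by (metis divide_pos_pos imageE zero_less_numeral)
  have "(\<lambda>n. 1 / real (Suc n) * (norm (snd p))\<^sup>2) \<longlonglongrightarrow> 0 * (norm (snd p))\<^sup>2"
    by (intro tendsto_intros LIMSEQ_Suc lim_1_over_n)
  then have "eventually (\<lambda>n. 1 / real (Suc n) * (norm (snd p))\<^sup>2 < (e / 2)\<^sup>2) sequentially"
    using e by (intro order_tendstoD) auto
  then obtain N where N: "\<And>n. n \<ge> N \<Longrightarrow> 1 / real (Suc n) * (norm (snd p))\<^sup>2 < (e / 2)\<^sup>2"
    unfolding eventually_sequentially by blast
  show "\<exists>no. \<forall>n\<ge>no. norm (fst (resolvent H (1 / real (Suc n)) z) - z) < e"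
  proof (intro exI[of _ N] allI impI)
    fix n assume n: "N \<le> n"
    define \<alpha> where "\<alpha> = 1 / real (Suc n)"
    have l: "\<alpha> > 0" by (simp add: \<alpha>_def)
    interpret bounded_linear "\<lambda>z. fst (resolvent H \<alpha> z)" by (rule bounded_linear_resolvent[OF l])
    define r where "r = resolvent H \<alpha> (fst p)"
    note r = resolvent_props[OF l, where z="fst p", folded r_def]
    have "r - p \<in> H" using r(1) p(1) subspace_H by (simp add: subspace_diff)
    from r(2)[OF this] have "(norm (fst r - fst p))\<^sup>2 = \<alpha> * (snd r \<bullet> snd p - (norm (snd r))\<^sup>2)"
      by (simp add: power2_norm_eq_inner inner_diff_right algebra_simps)
    also have "\<dots> \<le> \<alpha> * (norm (snd p))\<^sup>2"
    proof (rule mult_left_mono)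
      have "snd r \<bullet> snd p \<le> norm (snd r) * norm (snd p)" by (rule norm_cauchy_schwarz)
      then show "snd r \<bullet> snd p - (norm (snd r))\<^sup>2 \<le> (norm (snd p))\<^sup>2"
        using sum_squares_bound[of "norm (snd r)" "norm (snd p)"]
          mult_nonneg_nonneg[OF norm_ge_zero[of "snd r"] norm_ge_zero[of "snd p"]] by linarith
    qed (use l in simp)
    also have "\<dots> < (e / 2)\<^sup>2" using N[OF n] by (simp add: \<alpha>_def)
    finally have *: "(norm (fst r - fst p))\<^sup>2 < (e / 2)\<^sup>2" .
    have 1: "norm (fst r - fst p) < e / 2" by (rule power2_less_imp_less[OF *]) (use e in simp)
    have "norm (fst (resolvent H \<alpha> z) - fst r) \<le> norm (z - fst p)"
      unfolding r_def diff[symmetric] by (rule norm_resolvent_le[OF l])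
    then have "norm (fst (resolvent H \<alpha> z) - fst r) < e / 4"
      using p(2) by (simp add: dist_norm norm_minus_commute)
    moreover have "norm (fst p - z) < e / 4" using p(2) by (simp add: dist_norm)
    moreover have "norm (fst (resolvent H \<alpha> z) - z)
        = norm ((fst (resolvent H \<alpha> z) - fst r) + (fst r - fst p) + (fst p - z))" by simp
    ultimately have "norm (fst (resolvent H \<alpha> z) - z) < e"
      using 1 norm_triangle_ineq[of "fst (resolvent H \<alpha> z) - fst r + (fst r - fst p)" "fst p - z"]
        norm_triangle_ineq[of "fst (resolvent H \<alpha> z) - fst r" "fst r - fst p"] by linarith
    then show "norm (fst (resolvent H (1 / real (Suc n)) z) - z) < e" by (simp add: \<alpha>_def)
  qed
qed

text \<open>
  The Aubin--Nitsche trick. The dual problem \<open>-\<Delta>u = \<rho>\<close> is replaced by \<open>u/\<mu> - \<Delta>u = \<rho>\<close>, which the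
  projection theorem solves, and \<open>\<mu> \<rightarrow> \<infinity>\<close>.
\<close>

lemma aubin_nitsche:
  assumes poincare: "\<And>h. h \<in> H \<Longrightarrow> norm (fst h) \<le> CP * norm (snd h)"
    and approx: "\<And>p z. weak_lap p z \<Longrightarrow> \<exists>s. snd \<rho> \<bullet> s = 0 \<and> norm (snd p - s) \<le> C * norm z"
    and \<rho>: "\<rho> \<in> H" and C: "C \<ge> 0"
  shows "norm (fst \<rho>) \<le> C * norm (snd \<rho>)"
proof (cases "norm (fst \<rho>) = 0")
  case False
  define a where "a = norm (fst \<rho>)"
  have a: "a > 0" using False by (simp add: a_def)
  have key: "a \<le> CP\<^sup>2 * a / \<mu> + C * norm (snd \<rho>)" if \<mu>: "\<mu> > 0" for \<mu> :: real
  proof -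
    \<comment> \<open>With data scaled by \<mu> the resolvent equation reads u/\<mu> - \<Delta>u =
      \<rho>, so the \<open>z\<close> defined below is the Laplacian of \<open>u\<close>.\<close>
    define u where "u = resolvent H \<mu> (\<mu> *\<^sub>R fst \<rho>)"
    note u = resolvent_props[OF \<mu>, where z="\<mu> *\<^sub>R fst \<rho>", folded u_def]
    define z where "z = (1 / \<mu>) *\<^sub>R fst u - fst \<rho>"
    have zv: "z \<bullet> fst h = - (snd u \<bullet> snd h)" if "h \<in> H" for h
      using u(2)[OF that] \<mu> by (simp add: z_def inner_diff field_simps)
    have "z = fst ((1 / \<mu>) *\<^sub>R u - \<rho>)" "(1 / \<mu>) *\<^sub>R u - \<rho> \<in> H"
      using u(1) \<rho> subspace_H by (auto simp: z_def subspace_diff subspace_scale)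
    then have "z \<in> closure (fst ` H)" using closure_subset by (metis image_eqI subsetD)
    then have wl: "weak_lap u z" using zv u(1) by (simp add: weak_lap_def)
    obtain s where s: "snd \<rho> \<bullet> s = 0" "norm (snd u - s) \<le> C * norm z" using approx[OF wl] by blast
    have "(norm z)\<^sup>2 = - ((norm (snd u))\<^sup>2 / \<mu>) - z \<bullet> fst \<rho>"
      using zv[OF u(1)] by (simp add: power2_norm_eq_inner z_def inner_diff_right)
    also have "\<dots> \<le> norm z * a"
      using divide_nonneg_pos[OF zero_le_power2[of "norm (snd u)"] \<mu>] Cauchy_Schwarz_ineq2[of z "fst \<rho>"]
      unfolding a_def by linarith
    finally have nz: "norm z \<le> a" using a by (cases "norm z = 0") (auto simp: power2_eq_square)
    have "z \<bullet> fst u = - (norm (snd u))\<^sup>2" using zv[OF u(1)] by (simp add: power2_norm_eq_inner)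
    then have "(norm (fst u))\<^sup>2 / \<mu> + (norm (snd u))\<^sup>2 = fst \<rho> \<bullet> fst u"
      by (simp add: z_def inner_diff power2_norm_eq_inner)
    moreover have "(norm (fst u))\<^sup>2 / \<mu> \<ge> 0" using \<mu> by simp
    ultimately have "(norm (snd u))\<^sup>2 \<le> a * norm (fst u)"
      using norm_cauchy_schwarz[of "fst \<rho>" "fst u"] by (simp add: a_def)
    \<comment> \<open>The Poincare inequality bounds \<open>u\<close> independently of \<mu>; this
      is what lets the zeroth-order term disappear as \<mu> grows.\<close>
    moreover have "(norm (fst u))\<^sup>2 \<le> CP\<^sup>2 * (norm (snd u))\<^sup>2"
      using power_mono[OF poincare[OF u(1)] norm_ge_zero, of 2] by (simp add: power_mult_distrib)
    moreover have "CP\<^sup>2 * (norm (snd u))\<^sup>2 \<le> CP\<^sup>2 * (a * norm (fst u))"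
      using calculation(1) by (intro mult_left_mono) auto
    ultimately have "(norm (fst u))\<^sup>2 \<le> (CP\<^sup>2 * a) * norm (fst u)"
      by (simp add: mult.assoc)
    then have "norm (fst u) * norm (fst u) \<le> (CP\<^sup>2 * a) * norm (fst u)"
      unfolding power2_eq_square[of "norm (fst u)"] .
    then have nu: "norm (fst u) \<le> CP\<^sup>2 * a" using a by (cases "norm (fst u) = 0") auto
    have "a\<^sup>2 = fst \<rho> \<bullet> fst \<rho>" by (simp add: a_def power2_norm_eq_inner)
    also have "\<dots> = (fst u \<bullet> fst \<rho>) / \<mu> - z \<bullet> fst \<rho>" by (simp add: z_def inner_diff)
    \<comment> \<open>The gradient of the error is orthogonal to \<open>s\<close>, so the dual
      gradient may be replaced by its approximation error.\<close>
    also have "\<dots> = (fst u \<bullet> fst \<rho>) / \<mu> + (snd u - s) \<bullet> snd \<rho>"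
      using zv[OF \<rho>] s(1) by (simp add: inner_diff inner_commute)
    also have "\<dots> \<le> (CP\<^sup>2 * a * a) / \<mu> + (C * a) * norm (snd \<rho>)"
    proof (rule add_mono)
      have "fst u \<bullet> fst \<rho> \<le> norm (fst u) * a" unfolding a_def by (rule norm_cauchy_schwarz)
      also have "\<dots> \<le> CP\<^sup>2 * a * a" using nu a by (intro mult_right_mono) auto
      finally show "fst u \<bullet> fst \<rho> / \<mu> \<le> CP\<^sup>2 * a * a / \<mu>" using \<mu> by (simp add: divide_right_mono)
      have "(snd u - s) \<bullet> snd \<rho> \<le> norm (snd u - s) * norm (snd \<rho>)" by (rule norm_cauchy_schwarz)
      also have "\<dots> \<le> (C * a) * norm (snd \<rho>)"
        using s(2) mult_left_mono[OF nz C] by (intro mult_right_mono) auto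
      finally show "(snd u - s) \<bullet> snd \<rho> \<le> C * a * norm (snd \<rho>)" .
    qed
    finally have "a * a \<le> (CP\<^sup>2 * a / \<mu> + C * norm (snd \<rho>)) * a"
      by (simp add: algebra_simps power2_eq_square)
    then show ?thesis using a by simp
  qed
  have "a \<le> C * norm (snd \<rho>) + \<epsilon>" if "\<epsilon> > 0" for \<epsilon>
  proof -
    \<comment> \<open>Large enough that the zeroth-order term is at most \<epsilon>; the added 1
      keeps \<mu> positive.\<close>
    define \<mu> where "\<mu> = (CP\<^sup>2 * a + 1) / \<epsilon>"
    have "CP\<^sup>2 * a \<ge> 0" using a by simp
    then have \<mu>: "\<mu> > 0" "CP\<^sup>2 * a / \<mu> \<le> \<epsilon>"
      using that by (auto simp: \<mu>_def divide_simps mult_left_mono)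
    show ?thesis using key[OF \<mu>(1)] \<mu>(2) by linarith
  qed
  then show ?thesis unfolding a_def by (rule field_le_epsilon)
qed (use C in simp)

end

text \<open>The component of \<open>r\<close> orthogonal to the range of
  \<open>R ** transpose R\<close> lies in the kernel of \<open>transpose R\<close>, where the bound
  makes the functional vanish; hence \<open>r\<close> is in that range. This handles singular
  factors, and it turns a bound on a load vector into a Euclidean vector to which a matrix norm can
  be applied.\<close>

lemma factor_bounded_functional:
  fixes R :: "real^'n^'n" and r :: "real^'n"
  assumes bound: "\<And>y. \<bar>r \<bullet> y\<bar> \<le> C * norm (transpose R *v y)" and C: "C \<ge> 0"
  shows "\<exists>z. r = R *v z \<and> norm z \<le> C"
proof -
  have adj: "(R *v x) \<bullet> y = x \<bullet> (transpose R *v y)" for x y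
    using dot_lmul_matrix[of y R x] by (simp add: inner_commute transpose_matrix_vector)
  define S where "S = range (\<lambda>y. R *v (transpose R *v y))"
  have sS: "subspace S" unfolding S_def
    by (rule linear_subspace_image[OF linear_compose[OF matrix_vector_mul_linear
          matrix_vector_mul_linear, unfolded o_def] subspace_UNIV])
  obtain a b where ab: "a \<in> span S" "\<And>w. w \<in> span S \<Longrightarrow> orthogonal b w" "r = a + b"
    using orthogonal_subspace_decomp_exists by metis
  have "R *v (transpose R *v b) \<in> span S" by (rule span_base) (auto simp: S_def)
  then have "b \<bullet> (R *v (transpose R *v b)) = 0" using ab(2) by (simp add: orthogonal_def)
  then have "transpose R *v b = 0" using adj[of "transpose R *v b" b] by (simp add: inner_commute)
  then have "r \<bullet> b = 0" using bound[of b] by simp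
  moreover have "a \<bullet> b = 0" using ab(2)[OF ab(1)] by (simp add: orthogonal_def inner_commute)
  ultimately have "b = 0" using ab(3) by (simp add: inner_add)
  then have "r \<in> S" using ab sS by (simp add: span_eq_iff[THEN iffD2])
  then obtain y where y: "r = R *v (transpose R *v y)" by (auto simp: S_def)
  define z where "z = transpose R *v y"
  have "norm z * norm z = r \<bullet> y" unfolding y z_def adj by (simp add: power2_norm_eq_inner flip: power2_eq_square)
  also have "\<dots> \<le> C * norm z" using bound[of y] by (simp add: z_def)
  finally have "norm z \<le> C" using C by (cases "norm z = 0") auto
  then show ?thesis using y z_def by blast
qed

section \<open>Absolutely continuous curves in a Hilbert space\<close>

text \<open>The change on a null set buys convergence at every point, which is needed where
  measurability on a product space has to be proved.\<close>

lemma smeas_everywhere: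
  assumes "smeas M u"
  obtains u0 s where "AE t in M. u t = u0 t" "\<And>k. simple_function M (s k)"
    "\<And>t. t \<in> space M \<Longrightarrow> (\<lambda>k. s k t) \<longlonglongrightarrow> u0 t"
proof -
  obtain s where s: "\<And>k. simple_function M (s k)" "AE t in M. (\<lambda>k. s k t) \<longlonglongrightarrow> u t"
    using assms unfolding smeas_def by blast
  obtain N where N: "{x\<in>space M. \<not> (\<lambda>k. s k x) \<longlonglongrightarrow> u x} \<subseteq> N" "emeasure M N = 0" "N \<in> sets M"
    by (rule AE_E[OF s(2)])
  show thesis
  proof (rule that[of "\<lambda>t. if t \<in> N then 0 else u t" "\<lambda>k t. if t \<in> N then 0 else s k t"])
    show "AE t in M. u t = (if t \<in> N then 0 else u t)"
      by (rule AE_I[OF _ N(2,3)]) auto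
    show "simple_function M (\<lambda>t. if t \<in> N then 0 else s k t)" for k
    proof -
      have "N \<inter> space M \<in> sets M" using N(3) by simp
      then show ?thesis by (intro simple_function_If_set simple_function_const s(1))
    qed
    show "(\<lambda>k. if t \<in> N then 0 else s k t) \<longlonglongrightarrow> (if t \<in> N then 0 else u t)" if "t \<in> space M" for t
      using N(1) that by (cases "t \<in> N") (simp, simp, blast)
  qed
qed

locale time_interval =
  fixes T :: real
  assumes T_pos: "0 < T"
begin

abbreviation J :: "real measure" where "J \<equiv> lebesgue_on {0<..<T}"

sublocale J: complete_measure J
  by (rule complete_measure_lebesgue_on) auto

sublocale J: finite_measure J
  by (rule finite_measure_lebesgue_on) simp

lemma measure_J: "measure J {0<..<T} = T"
  using T_pos by (simp add: measure_restrict_space)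

lemma indicator_measurable_J [measurable]: "indicator {..<t::real} \<in> borel_measurable J"
  by (intro measurable_restrict_space1 borel_measurable_indicator) auto

lemma ident_measurable_J: "(\<lambda>x::real. x) \<in> borel_measurable J"
  by (intro measurable_restrict_space1 measurable_completion) simp

lemma AE_J_interval: "AE t in J. t \<in> {0<..<T}"
  by (rule AE_I2) simp

lemma smeas_borel: "smeas J u \<Longrightarrow> (u :: real \<Rightarrow> 'b::euclidean_space) \<in> borel_measurable J"
  by (rule smeas_borel_measurable[OF J.complete_measure_axioms])

lemma l2c_bounded:
  assumes "smeas J u" "AE t in J. norm (u t) \<le> C"
  shows "l2c J u"
  by (rule J.l2c_bound[OF assms(1), of "\<lambda>t. 1::real" C]) (use assms(2) in \<open>auto simp: l2c_def smeas_const\<close>)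

lemma l2c_const: "l2c J (\<lambda>t. c)"
  by (rule l2c_bounded[OF smeas_const, where C="norm c"]) simp

lemma integrable_l2c: 
  assumes "l2c J u" shows "integrable J (\<lambda>t. norm (u t))"
  using J.integrable_norm_mult[OF assms l2c_const[of "1::real"]] by simp

lemma integrable_l2c_inner:
  assumes "l2c J u" shows "integrable J (\<lambda>t. u t \<bullet> y)"
  by (rule J.integrable_inner[OF assms l2c_const])

text \<open>\<open>u\<close> is the integral of \<open>v\<close> from 0, tested against every
  vector. The relation replaces weak time derivatives: it contains the initial value 0 and fixes the
  continuous representative on the closed interval.\<close>

definition antideriv :: "(real \<Rightarrow> 'h::real_inner) \<Rightarrow> (real \<Rightarrow> 'h) \<Rightarrow> bool" where
  "antideriv u v \<longleftrightarrow> l2c J v \<and>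
     (\<forall>t\<in>{0..T}. \<forall>y. u t \<bullet> y = (LINT s|J. indicator {..<t} s * (v s \<bullet> y)))"

lemma antideriv_l2c: "antideriv u v \<Longrightarrow> l2c J v"
  by (simp add: antideriv_def)

lemma antideriv_inner:
  "antideriv u v \<Longrightarrow> t \<in> {0..T} \<Longrightarrow> u t \<bullet> y = (LINT s|J. indicator {..<t} s * (v s \<bullet> y))"
  by (simp add: antideriv_def)

lemma integrable_indicator_inner:
  assumes "l2c J v" shows "integrable J (\<lambda>s. indicator {..<t} s * (v s \<bullet> y))"
proof (rule Bochner_Integration.integrable_bound[OF integrable_l2c_inner[OF assms, of y]])
  have [measurable]: "(\<lambda>s. v s \<bullet> y) \<in> borel_measurable J"
    using integrable_l2c_inner[OF assms, of y] by simp
  show "(\<lambda>s. indicator {..<t} s * (v s \<bullet> y)) \<in> borel_measurable J" by measurable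
qed (auto simp: indicator_def)

lemma antideriv_end: "antideriv u v \<Longrightarrow> u T \<bullet> y = (LINT s|J. v s \<bullet> y)"
  using T_pos by (auto simp: antideriv_def intro!: Bochner_Integration.integral_cong)

lemma antideriv_zero: "antideriv u v \<Longrightarrow> u 0 = 0"
proof -
  assume a: "antideriv u v"
  have "u 0 \<bullet> u 0 = (LINT s|J. indicator {..<0} s * (v s \<bullet> u 0))"
    using antideriv_inner[OF a, of 0] T_pos by simp
  also have "\<dots> = (LINT s|J. 0)" by (intro Bochner_Integration.integral_cong) auto
  finally show ?thesis by simp
qed

lemma antideriv_cong:
  assumes "antideriv u v" "\<And>t. t \<in> {0..T} \<Longrightarrow> u t = u' t"
  shows "antideriv u' v"
  using assms by (simp add: antideriv_def)

lemma antideriv_cong_AE: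
  assumes "antideriv u v" "AE t in J. v t = v' t"
  shows "antideriv u v'"
proof -
  have v': "l2c J v'" using l2c_cong_AE[OF assms(2) antideriv_l2c[OF assms(1)] J.complete_measure_axioms] .
  have "u t \<bullet> y = (LINT s|J. indicator {..<t} s * (v' s \<bullet> y))" if t: "t \<in> {0..T}" for t y
    unfolding antideriv_inner[OF assms(1) t]
  proof (rule integral_cong_AE)
    show "AE s in J. indicator {..<t} s * (v s \<bullet> y) = indicator {..<t} s * (v' s \<bullet> y)"
      using assms(2) by eventually_elim auto
  qed (use integrable_indicator_inner v' antideriv_l2c[OF assms(1)] in blast)+
  with v' show ?thesis by (simp add: antideriv_def)
qed

lemma antideriv_add:
  assumes "antideriv u v" "antideriv u' v'"
  shows "antideriv (\<lambda>t. u t + u' t) (\<lambda>t. v t + v' t)"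
  unfolding antideriv_def
proof (intro conjI ballI allI)
  show "l2c J (\<lambda>t. v t + v' t)" using assms antideriv_l2c J.l2c_add by blast
  fix t y assume t: "t \<in> {0..T}"
  show "(u t + u' t) \<bullet> y = (LINT s|J. indicator {..<t} s * ((v s + v' s) \<bullet> y))"
    using integrable_indicator_inner[OF antideriv_l2c[OF assms(1)], of t y]
      integrable_indicator_inner[OF antideriv_l2c[OF assms(2)], of t y]
    by (simp add: inner_add antideriv_inner[OF assms(1) t] antideriv_inner[OF assms(2) t] algebra_simps)
qed

lemma antideriv_linear:
  assumes "antideriv u v" "bounded_linear L" "\<And>x y. L x \<bullet> y = x \<bullet> L' y"
  shows "antideriv (\<lambda>t. L (u t)) (\<lambda>t. L (v t))"
  using assms(1) J.l2c_linear[OF assms(2)] by (simp add: antideriv_def assms(3))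

lemma antideriv_scaleR: "antideriv u v \<Longrightarrow> antideriv (\<lambda>t. c *\<^sub>R u t) (\<lambda>t. c *\<^sub>R v t)"
  by (rule antideriv_linear[OF _ bounded_linear_scaleR_right, where L'="\<lambda>y. c *\<^sub>R y"]) simp_all

lemma antideriv_diff:
  "antideriv u v \<Longrightarrow> antideriv u' v' \<Longrightarrow> antideriv (\<lambda>t. u t - u' t) (\<lambda>t. v t - v' t)"
  using antideriv_add[of u v "\<lambda>t. (-1) *\<^sub>R u' t" "\<lambda>t. (-1) *\<^sub>R v' t"] antideriv_scaleR[of u' v' "-1"] by simp

lemma antideriv_const_zero: "antideriv (\<lambda>t. 0) (\<lambda>t. 0)"
  by (simp add: antideriv_def J.l2c_zero)

lemma antideriv_sum:
  "(\<And>i. i \<in> I \<Longrightarrow> antideriv (u i) (v i)) \<Longrightarrow> antideriv (\<lambda>t. \<Sum>i\<in>I. u i t) (\<lambda>t. \<Sum>i\<in>I. v i t)"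
  by (induction I rule: infinite_finite_induct) (simp_all add: antideriv_const_zero antideriv_add)

lemma antideriv_scaleR_left:
  fixes a a' :: "real \<Rightarrow> real" and e :: "'h::real_inner"
  assumes "antideriv a a'" shows "antideriv (\<lambda>t. a t *\<^sub>R e) (\<lambda>t. a' t *\<^sub>R e)"
  unfolding antideriv_def
proof (intro conjI ballI allI)
  show "l2c J (\<lambda>t. a' t *\<^sub>R e)"
    by (rule J.l2c_linear[OF bounded_linear_scaleR_left antideriv_l2c[OF assms]])
  fix t y assume t: "t \<in> {0..T}"
  show "(a t *\<^sub>R e) \<bullet> y = (LINT s|J. indicator {..<t} s * ((a' s *\<^sub>R e) \<bullet> y))"
    using antideriv_inner[OF assms t, of "e \<bullet> y"] by simp
qed

lemma antideriv_comp_inner: "antideriv u v \<Longrightarrow> antideriv (\<lambda>t. u t \<bullet> y) (\<lambda>t. v t \<bullet> y)"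
  unfolding antideriv_def
proof (intro conjI ballI allI; elim conjE)
  assume "l2c J v"
  then show "l2c J (\<lambda>t. v t \<bullet> y)" by (rule J.l2c_linear[OF bounded_linear_inner_left])
next
  fix t r assume t: "t \<in> {0..T}" and "\<forall>t\<in>{0..T}. \<forall>y. u t \<bullet> y = (LINT s|J. indicator {..<t} s * (v s \<bullet> y))"
  then have "u t \<bullet> (r *\<^sub>R y) = (LINT s|J. indicator {..<t} s * (v s \<bullet> (r *\<^sub>R y)))" by blast
  then show "(u t \<bullet> y) \<bullet> r = (LINT s|J. indicator {..<t} s * ((v s \<bullet> y) \<bullet> r))"
    by (simp add: mult.commute)
qed

definition prim :: "(real \<Rightarrow> 'b::euclidean_space) \<Rightarrow> real \<Rightarrow> 'b" where
  "prim v t = (LINT s|J. indicator {..<t} s *\<^sub>R v s)"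

lemma antideriv_prim:
  fixes v :: "real \<Rightarrow> 'b::euclidean_space"
  assumes "l2c J v" shows "antideriv (prim v) v"
  unfolding antideriv_def
proof (intro conjI ballI allI)
  fix t y
  have "integrable J v" using integrable_l2c[OF assms] smeas_borel[OF l2c_smeas[OF assms]]
    by (simp add: integrable_norm_iff)
  then have "integrable J (\<lambda>s. indicator {..<t} s *\<^sub>R v s)"
    by (rule Bochner_Integration.integrable_bound)
      (use borel_measurable_scaleR[OF indicator_measurable_J smeas_borel[OF l2c_smeas[OF assms]]]
        in \<open>auto simp: indicator_def\<close>)
  then show "prim v t \<bullet> y = (LINT s|J. indicator {..<t} s * (v s \<bullet> y))"
    by (simp add: prim_def flip: integral_inner_left)
qed (rule assms)

text \<open>Testing with the increment itself and applying Cauchy--Schwarz on the subinterval gives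
  Hoelder continuity with exponent 1/2. Boundedness, continuity and strong measurability of
  antiderivatives all follow from it.\<close>

lemma antideriv_norm_diff:
  assumes "antideriv u v" "0 \<le> s" "s \<le> t" "t \<le> T"
  shows "norm (u t - u s) \<le> sqrt (t - s) * l2n J v"
proof -
  define y where "y = u t - u s"
  note l = antideriv_l2c[OF assms(1)]
  define h where "h r = indicator {s..<t} r *\<^sub>R y" for r :: real
  have hm: "(indicator {s..<t} :: real \<Rightarrow> real) \<in> borel_measurable J"
    by (intro measurable_restrict_space1 borel_measurable_indicator) auto
  have "smeas J h" unfolding h_def by (intro smeas_scaleR borel_smeas hm smeas_const)
  then have h: "l2c J h" by (rule l2c_bounded[where C="norm y"]) (auto simp: h_def indicator_def)
  have "y \<bullet> y = u t \<bullet> y - u s \<bullet> y" by (simp add: y_def inner_diff)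
  also have "\<dots> = (LINT r|J. indicator {..<t} r * (v r \<bullet> y)) - (LINT r|J. indicator {..<s} r * (v r \<bullet> y))"
    using assms by (simp add: antideriv_inner)
  also have "\<dots> = (LINT r|J. indicator {..<t} r * (v r \<bullet> y) - indicator {..<s} r * (v r \<bullet> y))"
    using integrable_indicator_inner[OF l] by simp
  also have "\<dots> = (LINT r|J. v r \<bullet> h r)"
    using assms(3) by (intro Bochner_Integration.integral_cong) (auto simp: h_def indicator_def)
  also have "\<dots> \<le> l2n J v * l2n J h" using J.l2n_CS[OF l h] by linarith
  also have "l2n J h = sqrt (t - s) * norm y"
  proof -
    have "(LINT r|J. (norm (h r))\<^sup>2) = (LINT r|J. (norm y)\<^sup>2 * indicator {s..<t} r)"
      by (intro Bochner_Integration.integral_cong) (auto simp: h_def indicator_def)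
    also have "\<dots> = (norm y)\<^sup>2 * measure J ({s..<t} \<inter> {0<..<T})" by simp
    also have "measure J ({s..<t} \<inter> {0<..<T}) = measure lebesgue ({s..<t} \<inter> {0<..<T})"
      by (simp add: measure_restrict_space)
    also have "\<dots> = t - s"
    proof -
      have "{s<..<t} \<subseteq> {s..<t} \<inter> {0<..<T}" "{s..<t} \<inter> {0<..<T} \<subseteq> {s..<t}" using assms by auto
      moreover have "{s..<t} \<in> lmeasurable" "{s..<t} \<inter> {0<..<T} \<in> lmeasurable"
        by (rule bounded_set_imp_lmeasurable[OF bounded_subset[of "{s..t}"]]; auto)+
      ultimately have "measure lebesgue {s<..<t} \<le> measure lebesgue ({s..<t} \<inter> {0<..<T})"
        "measure lebesgue ({s..<t} \<inter> {0<..<T}) \<le> measure lebesgue {s..<t}"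
        by (metis measure_mono_fmeasurable lmeasurable_interval(2) box_real(1) fmeasurableD, metis measure_mono_fmeasurable fmeasurableD)
      then show ?thesis using assms(3) by simp
    qed
    finally show ?thesis by (simp add: l2n_def real_sqrt_mult mult.commute)
  qed
  finally have "norm y * norm y \<le> (sqrt (t - s) * l2n J v) * norm y"
    by (simp add: power2_norm_eq_inner[symmetric] power2_eq_square mult_ac)
  then have "norm y \<le> sqrt (t - s) * l2n J v"
    using assms(3) by (cases "norm y = 0") auto
  then show ?thesis by (simp add: y_def)
qed

lemma antideriv_norm_le:
  assumes "antideriv u v" "t \<in> {0..T}"
  shows "norm (u t) \<le> sqrt T * l2n J v"
proof -
  have "norm (u t) \<le> sqrt t * l2n J v"
    using antideriv_norm_diff[OF assms(1), of 0 t] assms(2) by (simp add: antideriv_zero[OF assms(1)])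
  also have "\<dots> \<le> sqrt T * l2n J v" using assms(2) by (intro mult_right_mono) auto
  finally show ?thesis .
qed

lemma antideriv_tendsto:
  assumes "antideriv u v" "t \<in> {0..T}"
  shows "(u \<longlongrightarrow> u t) (at t within {0..T})"
proof -
  have "((\<lambda>s. norm (u s - u t)) \<longlongrightarrow> 0) (at t within {0..T})"
  proof (rule tendsto_sandwich[OF _ _ tendsto_const])
    show "\<forall>\<^sub>F s in at t within {0..T}. norm (u s - u t) \<le> sqrt \<bar>s - t\<bar> * l2n J v"
      unfolding eventually_at_topological
    proof (intro exI[of _ UNIV] conjI ballI impI)
      fix s assume "s \<in> {0..T}"
      then show "norm (u s - u t) \<le> sqrt \<bar>s - t\<bar> * l2n J v"
        using antideriv_norm_diff[OF assms(1), of s t] antideriv_norm_diff[OF assms(1), of t s] assms(2)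
        by (cases "s \<le> t") (auto simp: norm_minus_commute)
    qed auto
    have "((\<lambda>s. sqrt \<bar>s - t\<bar> * l2n J v) \<longlongrightarrow> sqrt \<bar>t - t\<bar> * l2n J v) (at t within {0..T})"
      by (intro tendsto_intros)
    then show "((\<lambda>s. sqrt \<bar>s - t\<bar> * l2n J v) \<longlongrightarrow> 0) (at t within {0..T})" by simp
  qed auto
  then show ?thesis by (simp add: LIM_zero_iff tendsto_norm_zero_iff)
qed

text \<open>Sampling \<open>u\<close> at the grid point of mesh \<open>1 / real (Suc k)\<close> to
  the left of \<open>t\<close> takes finitely many values, and Hoelder continuity makes the samples
  converge.\<close>

lemma antideriv_smeas:
  assumes "antideriv u v" shows "smeas J u"
  unfolding smeas_def
proof (intro exI conjI allI)
  define s where "s k t = u (max 0 (min T (of_int \<lfloor>real (Suc k) * t\<rfloor> / real (Suc k))))" for k :: nat and t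
  show "simple_function J (s k)" for k
  proof -
    define g where "g t = \<lfloor>real (Suc k) * t\<rfloor>" for t :: real
    have gm: "g \<in> measurable J (count_space UNIV)"
    proof -
      have "(\<lambda>x::real. x) \<in> borel_measurable J" by (rule ident_measurable_J)
      then have "(\<lambda>t. real (Suc k) * t) \<in> borel_measurable J" by (intro borel_measurable_times) simp_all
      then show ?thesis unfolding g_def by (rule measurable_compose[OF _ measurable_real_floor])
    qed
    have "g ` {0<..<T} \<subseteq> {0..\<lfloor>real (Suc k) * T\<rfloor>}"
      by (auto simp: g_def intro!: floor_mono mult_left_mono)
    from finite_subset[OF this finite_atLeastAtMost_int] have "finite (g ` space J)" by simp
    then have "simple_function J g"
      unfolding simple_function_def using measurable_sets[OF gm] by auto
    from simple_function_compose1[OF this, of "\<lambda>i. u (max 0 (min T (of_int i / real (Suc k))))"]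
    show ?thesis by (simp add: s_def[abs_def] g_def)
  qed
  show "AE t in J. (\<lambda>k. s k t) \<longlonglongrightarrow> u t"
  proof (rule AE_I2)
    fix t assume "t \<in> space J"
    then have t: "0 < t" "t < T" by auto
    define r where "r k = of_int \<lfloor>real (Suc k) * t\<rfloor> / real (Suc k)" for k :: nat
    have r: "0 \<le> r k" "r k \<le> t" "t - r k \<le> 1 / real (Suc k)" for k
    proof -
      show "0 \<le> r k" using t by (simp add: r_def)
      have "of_int \<lfloor>real (Suc k) * t\<rfloor> \<le> real (Suc k) * t" by (rule of_int_floor_le)
      then show "r k \<le> t" by (simp add: r_def field_simps)
      have "real (Suc k) * t \<le> of_int \<lfloor>real (Suc k) * t\<rfloor> + 1" by linarith
      then have "t \<le> (of_int \<lfloor>real (Suc k) * t\<rfloor> + 1) / real (Suc k)"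
        by (subst pos_le_divide_eq) (simp_all add: mult.commute)
      then show "t - r k \<le> 1 / real (Suc k)" by (simp add: r_def add_divide_distrib)
    qed
    have sr: "s k t = u (r k)" for k
      using r[of k] t unfolding s_def r_def[symmetric] by (simp add: max_def min_def)
    have "(\<lambda>k. norm (u t - u (r k))) \<longlonglongrightarrow> 0"
    proof (rule tendsto_sandwich[OF _ _ tendsto_const])
      show "\<forall>\<^sub>F k in sequentially. norm (u t - u (r k)) \<le> sqrt (1 / real (Suc k)) * l2n J v"
      proof (rule always_eventually, rule allI)
        fix k
        have "norm (u t - u (r k)) \<le> sqrt (t - r k) * l2n J v"
          by (rule antideriv_norm_diff[OF assms]) (use r[of k] t in auto)
        also have "\<dots> \<le> sqrt (1 / real (Suc k)) * l2n J v"
          by (intro mult_right_mono real_sqrt_le_mono r(3)) simp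
        finally show "norm (u t - u (r k)) \<le> sqrt (1 / real (Suc k)) * l2n J v" .
      qed
      have "(\<lambda>k. sqrt (1 / real (Suc k)) * l2n J v) \<longlonglongrightarrow> sqrt 0 * l2n J v"
        by (intro tendsto_intros LIMSEQ_Suc lim_1_over_n)
      then show "(\<lambda>k. sqrt (1 / real (Suc k)) * l2n J v) \<longlonglongrightarrow> 0" by simp
    qed auto
    then have "(\<lambda>k. u t - u (r k)) \<longlonglongrightarrow> 0" by (simp add: tendsto_norm_zero_iff)
    from tendsto_diff[OF tendsto_const[of "u t"] this] show "(\<lambda>k. s k t) \<longlonglongrightarrow> u t" by (simp add: sr)
  qed
qed

lemma antideriv_l2c_fun:
  assumes "antideriv u v" shows "l2c J u"
  by (rule l2c_bounded[OF antideriv_smeas[OF assms], where C="sqrt T * l2n J v"])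
    (auto intro!: AE_I2 antideriv_norm_le[OF assms])

text \<open>Fubini on the square: the regions \<open>y < x\<close> and \<open>x < y\<close> cover it
  up to the diagonal. It is the product rule for antiderivatives before the inner integrals are
  evaluated.\<close>

lemma antideriv_product_aux:
  fixes f g :: "real \<Rightarrow> 'h::real_inner"
  assumes "l2c J f" "l2c J g"
  shows "(LINT x|J. LINT y|J. indicator {..<x} y * (f x \<bullet> g y))
       + (LINT y|J. LINT x|J. indicator {..<y} x * (f x \<bullet> g y)) = (LINT x|J. LINT y|J. f x \<bullet> g y)"
proof -
  interpret P: pair_sigma_finite J J ..
  obtain f0 sf where f0: "AE t in J. f t = f0 t" "\<And>k. simple_function J (sf k)"
    "\<And>t. t \<in> space J \<Longrightarrow> (\<lambda>k. sf k t) \<longlonglongrightarrow> f0 t" using smeas_everywhere[OF l2c_smeas[OF assms(1)]] by blast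
  obtain g0 sg where g0: "AE t in J. g t = g0 t" "\<And>k. simple_function J (sg k)"
    "\<And>t. t \<in> space J \<Longrightarrow> (\<lambda>k. sg k t) \<longlonglongrightarrow> g0 t" using smeas_everywhere[OF l2c_smeas[OF assms(2)]] by blast
  have lf: "l2c J f0" by (rule l2c_cong_AE[OF f0(1) assms(1) J.complete_measure_axioms])
  have lg: "l2c J g0" by (rule l2c_cong_AE[OF g0(1) assms(2) J.complete_measure_axioms])
  \<comment> \<open>Fubini asks for joint measurability. It follows from simple functions that
    converge everywhere, which is why \<open>f\<close> and \<open>g\<close> were modified on null
    sets.\<close>
  have km: "(\<lambda>(x,y). f0 x \<bullet> g0 y) \<in> borel_measurable (J \<Otimes>\<^sub>M J)"
  proof (rule borel_measurable_LIMSEQ_real)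
    show "(\<lambda>k. (\<lambda>(x,y). sf k x \<bullet> sg k y) p) \<longlonglongrightarrow> (\<lambda>(x,y). f0 x \<bullet> g0 y) p" if "p \<in> space (J \<Otimes>\<^sub>M J)" for p
      using that by (auto simp: space_pair_measure intro!: tendsto_inner f0(3) g0(3))
    show "(\<lambda>(x,y). sf k x \<bullet> sg k y) \<in> borel_measurable (J \<Otimes>\<^sub>M J)" for k
    proof -
      have "simple_function (J \<Otimes>\<^sub>M J) (\<lambda>p. sf k (fst p))" "simple_function (J \<Otimes>\<^sub>M J) (\<lambda>p. sg k (snd p))"
        by (rule simple_function_comp[OF measurable_fst f0(2)], rule simple_function_comp[OF measurable_snd g0(2)])
      from simple_function_compose2[OF this, of "(\<bullet>)"] show ?thesis
        unfolding case_prod_beta by (rule borel_measurable_simple_function)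
    qed
  qed
  have nm: "(\<lambda>x. norm (f0 x)) \<in> borel_measurable J" "(\<lambda>x. norm (g0 x)) \<in> borel_measurable J"
    using smeas_borel smeas_norm lf lg l2c_smeas by blast+
  have nP: "integrable (J \<Otimes>\<^sub>M J) (\<lambda>(x,y). norm (f0 x) * norm (g0 y))"
  proof (rule P.Fubini_integrable)
    show "(\<lambda>(x,y). norm (f0 x) * norm (g0 y)) \<in> borel_measurable (J \<Otimes>\<^sub>M J)"
      using nm by measurable
    show "integrable J (\<lambda>x. LINT y|J. norm (case (x,y) of (x,y) \<Rightarrow> norm (f0 x) * norm (g0 y)))"
      using integrable_l2c[OF lf] by simp
    show "AE x in J. integrable J (\<lambda>y. case (x,y) of (x,y) \<Rightarrow> norm (f0 x) * norm (g0 y))"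
      using integrable_l2c[OF lg] by simp
  qed
  have kP: "integrable (J \<Otimes>\<^sub>M J) (\<lambda>(x,y). h x y * (f0 x \<bullet> g0 y))"
    if "(\<lambda>(x,y). h x y) \<in> borel_measurable (J \<Otimes>\<^sub>M J)" "\<And>x y. \<bar>h x y\<bar> \<le> 1" for h :: "real \<Rightarrow> real \<Rightarrow> real"
  proof (rule Bochner_Integration.integrable_bound[OF nP])
    have "(\<lambda>p. (\<lambda>(x,y). h x y) p * (\<lambda>(x,y). f0 x \<bullet> g0 y) p) \<in> borel_measurable (J \<Otimes>\<^sub>M J)"
      using that(1) km by (rule borel_measurable_times)
    then show "(\<lambda>(x,y). h x y * (f0 x \<bullet> g0 y)) \<in> borel_measurable (J \<Otimes>\<^sub>M J)"
      by (simp add: case_prod_beta)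
    have "\<bar>h x y * (f0 x \<bullet> g0 y)\<bar> \<le> 1 * (norm (f0 x) * norm (g0 y))" for x y
      unfolding abs_mult by (intro mult_mono that(2) Cauchy_Schwarz_ineq2) auto
    then show "AE p in J \<Otimes>\<^sub>M J. norm (case p of (x,y) \<Rightarrow> h x y * (f0 x \<bullet> g0 y))
        \<le> norm (case p of (x,y) \<Rightarrow> norm (f0 x) * norm (g0 y))" by auto
  qed
  have idm: "(\<lambda>x::real. x) \<in> borel_measurable J" by (rule ident_measurable_J)
  then have [measurable]: "(\<lambda>p. fst p) \<in> borel_measurable (J \<Otimes>\<^sub>M J)" "(\<lambda>p. snd p) \<in> borel_measurable (J \<Otimes>\<^sub>M J)"
    using measurable_compose[OF measurable_fst idm] measurable_compose[OF measurable_snd idm] by auto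
  have m1: "(\<lambda>(x,y). indicator {..<x} y :: real) \<in> borel_measurable (J \<Otimes>\<^sub>M J)"
  proof -
    have "(\<lambda>p. if snd p < fst p then 1 else 0 :: real) \<in> borel_measurable (J \<Otimes>\<^sub>M J)" by measurable
    then show ?thesis by (simp add: case_prod_beta indicator_def of_bool_def)
  qed
  have m2: "(\<lambda>(x,y). indicator {..<y} x :: real) \<in> borel_measurable (J \<Otimes>\<^sub>M J)"
  proof -
    have "(\<lambda>p. if fst p < snd p then 1 else 0 :: real) \<in> borel_measurable (J \<Otimes>\<^sub>M J)" by measurable
    then show ?thesis by (simp add: case_prod_beta indicator_def of_bool_def)
  qed
  have i1: "integrable (J \<Otimes>\<^sub>M J) (\<lambda>(x,y). indicator {..<x} y * (f0 x \<bullet> g0 y))"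
    by (rule kP[OF m1]) (auto simp: indicator_def)
  have i2: "integrable (J \<Otimes>\<^sub>M J) (\<lambda>(x,y). indicator {..<y} x * (f0 x \<bullet> g0 y))"
    by (rule kP[OF m2]) (auto simp: indicator_def)
  have inner_cong: "(LINT x|J. LINT y|J. h x y * (f x \<bullet> g y)) = (LINT x|J. LINT y|J. h x y * (f0 x \<bullet> g0 y))"
    if m: "\<And>x. x \<in> space J \<Longrightarrow> (\<lambda>y. h x y) \<in> borel_measurable J"
      and mm: "(\<lambda>x. LINT y|J. h x y * (f0 x \<bullet> g0 y)) \<in> borel_measurable J" for h :: "real \<Rightarrow> real \<Rightarrow> real"
  proof -
    have e: "AE x in J. (LINT y|J. h x y * (f x \<bullet> g y)) = (LINT y|J. h x y * (f0 x \<bullet> g0 y))"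
      using f0(1) AE_space
    proof eventually_elim
      case (elim x)
      have "(\<lambda>y. h x y * (f x \<bullet> g y)) \<in> borel_measurable J" "(\<lambda>y. h x y * (f0 x \<bullet> g0 y)) \<in> borel_measurable J"
        using m[OF elim(2)] smeas_borel[OF smeas_inner[OF smeas_const[of J "f x"] l2c_smeas[OF assms(2)]]]
          smeas_borel[OF smeas_inner[OF smeas_const[of J "f0 x"] l2c_smeas[OF lg]]]
        by (auto intro!: borel_measurable_times)
      moreover have "AE y in J. h x y * (f x \<bullet> g y) = h x y * (f0 x \<bullet> g0 y)"
        using g0(1) by eventually_elim (simp add: elim(1))
      ultimately show ?case by (intro integral_cong_AE)
    qed
    have "(\<lambda>x. LINT y|J. h x y * (f x \<bullet> g y)) \<in> borel_measurable J"
      by (rule borel_measurable_complete_AE[OF J.complete_measure_axioms mm]) (use e in eventually_elim, auto)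
    then show ?thesis by (intro integral_cong_AE mm e)
  qed
  have ind: "(\<lambda>y::real. indicator {..<x} y :: real) \<in> borel_measurable J" "(\<lambda>y::real. indicator {..<y} x :: real) \<in> borel_measurable J" for x
  proof -
    show "(\<lambda>y::real. indicator {..<x} y :: real) \<in> borel_measurable J" by measurable
    have "(\<lambda>y::real. if x < y then 1 else 0 :: real) \<in> borel_measurable J" using idm by measurable
    then show "(\<lambda>y::real. indicator {..<y} x :: real) \<in> borel_measurable J" by (simp add: indicator_def of_bool_def)
  qed
  have f1: "integrable J (\<lambda>x. LINT y|J. indicator {..<x} y * (f0 x \<bullet> g0 y))" using P.integrable_fst[OF i1] .
  have f2: "integrable J (\<lambda>x. LINT y|J. indicator {..<y} x * (f0 x \<bullet> g0 y))" using P.integrable_fst[OF i2] .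
  have A: "(LINT x|J. LINT y|J. indicator {..<x} y * (f x \<bullet> g y)) = (LINT x|J. LINT y|J. indicator {..<x} y * (f0 x \<bullet> g0 y))"
    by (rule inner_cong[OF ind(1) borel_measurable_integrable[OF f1]])
  have i2': "integrable (J \<Otimes>\<^sub>M J) (\<lambda>(y,x). indicator {..<y} x * (f0 x \<bullet> g0 y))"
    using P.integrable_product_swap[OF i2] by (simp add: case_prod_beta)
  have f2': "integrable J (\<lambda>y. LINT x|J. indicator {..<y} x * (f0 x \<bullet> g0 y))" using P.integrable_fst[OF i2'] .
  have B1: "(LINT y|J. LINT x|J. indicator {..<y} x * (f x \<bullet> g y)) = (LINT y|J. LINT x|J. indicator {..<y} x * (f0 x \<bullet> g0 y))"
  proof -
    have e: "AE y in J. (LINT x|J. indicator {..<y} x * (f x \<bullet> g y)) = (LINT x|J. indicator {..<y} x * (f0 x \<bullet> g0 y))"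
      using g0(1)
    proof eventually_elim
      case (elim y)
      have "(\<lambda>x. indicator {..<y} x * (f x \<bullet> g y)) \<in> borel_measurable J"
        "(\<lambda>x. indicator {..<y} x * (f0 x \<bullet> g0 y)) \<in> borel_measurable J"
        using borel_measurable_integrable[OF integrable_indicator_inner[OF assms(1)]]
          borel_measurable_integrable[OF integrable_indicator_inner[OF lf]] by blast+
      moreover have "AE x in J. indicator {..<y} x * (f x \<bullet> g y) = indicator {..<y} x * (f0 x \<bullet> g0 y)"
        using f0(1) by eventually_elim (simp add: elim)
      ultimately show ?case by (intro integral_cong_AE)
    qed
    have "(\<lambda>y. LINT x|J. indicator {..<y} x * (f x \<bullet> g y)) \<in> borel_measurable J"
      by (rule borel_measurable_complete_AE[OF J.complete_measure_axioms borel_measurable_integrable[OF f2']])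
        (use e in eventually_elim, auto)
    then show ?thesis by (intro integral_cong_AE borel_measurable_integrable[OF f2'] e)
  qed
  have B2: "(LINT y|J. LINT x|J. indicator {..<y} x * (f0 x \<bullet> g0 y)) = (LINT x|J. LINT y|J. indicator {..<y} x * (f0 x \<bullet> g0 y))"
    by (rule P.Fubini_integral[OF i2])
  have C: "(LINT x|J. LINT y|J. f x \<bullet> g y) = (LINT x|J. LINT y|J. 1 * (f0 x \<bullet> g0 y))"
    using inner_cong[of "\<lambda>x y. 1"] P.integrable_fst[OF kP[of "\<lambda>x y. 1"]] by simp
  have "(LINT x|J. LINT y|J. indicator {..<x} y * (f0 x \<bullet> g0 y)) + (LINT x|J. LINT y|J. indicator {..<y} x * (f0 x \<bullet> g0 y))
    = (LINT x|J. (LINT y|J. indicator {..<x} y * (f0 x \<bullet> g0 y)) + (LINT y|J. indicator {..<y} x * (f0 x \<bullet> g0 y)))"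
    using f1 f2 by simp
  also have "\<dots> = (LINT x|J. LINT y|J. 1 * (f0 x \<bullet> g0 y))"
  proof (rule Bochner_Integration.integral_cong[OF refl])
    fix x
    have g: "integrable J (\<lambda>y. f0 x \<bullet> g0 y)" using integrable_l2c_inner[OF lg, of "f0 x"] by (simp add: inner_commute)
    have ii: "integrable J (\<lambda>y. h y * (f0 x \<bullet> g0 y))" if "h \<in> borel_measurable J" "\<And>y. \<bar>h y\<bar> \<le> 1" for h :: "real \<Rightarrow> real"
    proof (rule Bochner_Integration.integrable_bound[OF g])
      show "(\<lambda>y. h y * (f0 x \<bullet> g0 y)) \<in> borel_measurable J" using that(1) g by (auto intro!: borel_measurable_times)
      show "AE y in J. norm (h y * (f0 x \<bullet> g0 y)) \<le> norm (f0 x \<bullet> g0 y)"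
        using that(2) by (auto simp: abs_mult intro!: mult_left_le_one_le)
    qed
    have i1: "integrable J (\<lambda>y. indicator {..<x} y * (f0 x \<bullet> g0 y))" by (rule ii[OF ind(1)]) (auto simp: indicator_def)
    have i2: "integrable J (\<lambda>y. indicator {..<y} x * (f0 x \<bullet> g0 y))" by (rule ii[OF ind(2)]) (auto simp: indicator_def)
    have ae: "AE y in J. y \<noteq> x"
    proof (rule AE_I'[of "{x} \<inter> {0<..<T}"])
      have "{x} \<in> null_sets lebesgue" using negligible_iff_null_sets negligible_sing by blast
      then have "{x} \<inter> {0<..<T} \<in> null_sets lebesgue" by (rule completion.complete2[OF Int_lower1])
      then show "{x} \<inter> {0<..<T} \<in> null_sets J" by (simp add: null_sets_restrict_space)
    qed auto
    have "(LINT y|J. indicator {..<x} y * (f0 x \<bullet> g0 y)) + (LINT y|J. indicator {..<y} x * (f0 x \<bullet> g0 y))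
      = (LINT y|J. indicator {..<x} y * (f0 x \<bullet> g0 y) + indicator {..<y} x * (f0 x \<bullet> g0 y))"
      using i1 i2 by simp
    also have "\<dots> = (LINT y|J. 1 * (f0 x \<bullet> g0 y))"
    proof (rule integral_cong_AE)
      show "AE y in J. indicator {..<x} y * (f0 x \<bullet> g0 y) + indicator {..<y} x * (f0 x \<bullet> g0 y) = 1 * (f0 x \<bullet> g0 y)"
        using ae by eventually_elim (auto simp: indicator_def)
    qed (use i1 i2 g in auto)
    finally show "(LINT y|J. indicator {..<x} y * (f0 x \<bullet> g0 y)) + (LINT y|J. indicator {..<y} x * (f0 x \<bullet> g0 y))
      = (LINT y|J. 1 * (f0 x \<bullet> g0 y))" .
  qed
  finally show ?thesis using A B1 B2 C by simp
qed

lemma antideriv_product: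
  assumes "antideriv u u'" "antideriv v v'"
  shows "(LINT t|J. u' t \<bullet> v t + u t \<bullet> v' t) = u T \<bullet> v T"
proof -
  have 1: "(LINT x|J. u' x \<bullet> v x) = (LINT x|J. LINT y|J. indicator {..<x} y * (u' x \<bullet> v' y))"
    by (intro Bochner_Integration.integral_cong refl)
      (simp add: inner_commute[of "u' _"] antideriv_inner[OF assms(2)])
  have 2: "(LINT y|J. u y \<bullet> v' y) = (LINT y|J. LINT x|J. indicator {..<y} x * (u' x \<bullet> v' y))"
    by (intro Bochner_Integration.integral_cong refl) (simp add: antideriv_inner[OF assms(1)])
  have 3: "(LINT x|J. LINT y|J. u' x \<bullet> v' y) = (LINT x|J. u' x \<bullet> v T)"
    by (intro Bochner_Integration.integral_cong refl)
      (simp add: inner_commute[of "u' _"] antideriv_end[OF assms(2)])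
  have "(LINT t|J. u' t \<bullet> v t + u t \<bullet> v' t) = (LINT t|J. u' t \<bullet> v t) + (LINT t|J. u t \<bullet> v' t)"
    using J.integrable_inner[OF antideriv_l2c[OF assms(1)] antideriv_l2c_fun[OF assms(2)]]
      J.integrable_inner[OF antideriv_l2c_fun[OF assms(1)] antideriv_l2c[OF assms(2)]] by simp
  also have "\<dots> = (LINT x|J. u' x \<bullet> v T)"
    using antideriv_product_aux[OF antideriv_l2c[OF assms(1)] antideriv_l2c[OF assms(2)]]
    by (simp add: 1 2 3)
  also have "\<dots> = u T \<bullet> v T" by (simp add: antideriv_end[OF assms(1)])
  finally show ?thesis .
qed

text \<open>The product rule for a symmetric operator; the lower boundary term is absent because
  antiderivatives vanish at 0. It serves for Gram matrices, for the identity and for Yosida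
  approximations alike.\<close>

lemma antideriv_energy:
  assumes "antideriv u u'" "bounded_linear L" "\<And>x y. L x \<bullet> y = x \<bullet> L y"
  shows "2 * (LINT t|J. u' t \<bullet> L (u t)) = u T \<bullet> L (u T)"
proof -
  have "(LINT t|J. u' t \<bullet> L (u t) + u t \<bullet> L (u' t)) = u T \<bullet> L (u T)"
    by (rule antideriv_product[OF assms(1) antideriv_linear[OF assms(1,2,3)]])
  moreover have "u t \<bullet> L (u' t) = u' t \<bullet> L (u t)" for t
    using assms(3)[of "u t" "u' t"] by (simp add: inner_commute)
  ultimately show ?thesis by simp
qed

end

section \<open>The Hilbert space of square integrable functions\<close>

lemma complete_measure_lebesgue: "complete_measure lebesgue"
  by (rule completion.complete_measure_axioms)

lemma l2c_borel_iff:
  fixes u :: "'c \<Rightarrow> 'b::euclidean_space"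
  assumes "complete_measure M"
  shows "l2c M u \<longleftrightarrow> u \<in> borel_measurable M \<and> integrable M (\<lambda>x. (norm (u x))\<^sup>2)"
  using smeas_borel_measurable[OF assms] borel_smeas unfolding l2c_def by blast

text \<open>Fatou's lemma applied to the squared norms.\<close>

lemma l2c_limit:
  fixes f :: "nat \<Rightarrow> 'c \<Rightarrow> 'b::euclidean_space"
  assumes M: "complete_measure M" and f: "\<And>n. l2c M (f n)" and C: "\<And>n. l2n M (f n) \<le> C"
    and lim: "AE x in M. (\<lambda>n. f n x) \<longlonglongrightarrow> g x"
  shows "l2c M g \<and> l2n M g \<le> C"
proof -
  have fm: "f n \<in> borel_measurable M" for n using f l2c_borel_iff[OF M] by blast
  have C0: "C \<ge> 0" using C[of 0] l2n_nonneg[of M "f 0"] by linarith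
  have gm: "g \<in> borel_measurable M"
  proof (rule borel_measurable_complete_AE[OF M])
    show "(\<lambda>x. lim (\<lambda>n. f n x)) \<in> borel_measurable M" using fm by (rule borel_measurable_lim_metric)
    show "AE x in M. lim (\<lambda>n. f n x) = g x" using lim by eventually_elim (rule limI)
  qed
  have "(\<integral>\<^sup>+x. ennreal ((norm (g x))\<^sup>2) \<partial>M) = (\<integral>\<^sup>+x. liminf (\<lambda>n. ennreal ((norm (f n x))\<^sup>2)) \<partial>M)"
  proof (rule nn_integral_cong_AE)
    show "AE x in M. ennreal ((norm (g x))\<^sup>2) = liminf (\<lambda>n. ennreal ((norm (f n x))\<^sup>2))"
      using lim
    proof eventually_elim
      case (elim x)
      have "(\<lambda>n. ennreal ((norm (f n x))\<^sup>2)) \<longlonglongrightarrow> ennreal ((norm (g x))\<^sup>2)"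
        by (intro tendsto_ennrealI tendsto_intros elim)
      then show ?case by (rule lim_imp_Liminf[OF trivial_limit_sequentially, symmetric])
    qed
  qed
  also have "\<dots> \<le> liminf (\<lambda>n. \<integral>\<^sup>+x. ennreal ((norm (f n x))\<^sup>2) \<partial>M)"
    using fm by (intro nn_integral_liminf) measurable
  also have "\<dots> \<le> liminf (\<lambda>n::nat. ennreal (C\<^sup>2))"
  proof (rule Liminf_mono, rule always_eventually, rule allI)
    fix n
    have "(\<integral>\<^sup>+x. ennreal ((norm (f n x))\<^sup>2) \<partial>M) = ennreal ((l2n M (f n))\<^sup>2)"
      unfolding l2n_sq by (rule nn_integral_eq_integral[OF l2c_integrable[OF f]]) simp
    also have "\<dots> \<le> ennreal (C\<^sup>2)" by (intro ennreal_leI power_mono C) simp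
    finally show "(\<integral>\<^sup>+x. ennreal ((norm (f n x))\<^sup>2) \<partial>M) \<le> ennreal (C\<^sup>2)" .
  qed
  also have "\<dots> = ennreal (C\<^sup>2)" by (simp add: Liminf_const)
  finally have bd: "(\<integral>\<^sup>+x. ennreal ((norm (g x))\<^sup>2) \<partial>M) \<le> ennreal (C\<^sup>2)" .
  have int: "integrable M (\<lambda>x. (norm (g x))\<^sup>2)"
  proof (rule integrableI_nonneg)
    show "(\<lambda>x. (norm (g x))\<^sup>2) \<in> borel_measurable M" using gm by measurable
    show "(\<integral>\<^sup>+x. ennreal ((norm (g x))\<^sup>2) \<partial>M) < \<infinity>" using bd by (rule le_less_trans) simp
  qed simp
  then have l: "l2c M g" using gm l2c_borel_iff[OF M] by blast
  have "ennreal ((l2n M g)\<^sup>2) \<le> ennreal (C\<^sup>2)"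
    unfolding l2n_sq nn_integral_eq_integral[OF int, symmetric, simplified] by (rule bd)
  then have "(l2n M g)\<^sup>2 \<le> C\<^sup>2" by simp
  then have "l2n M g \<le> C" by (rule power2_le_imp_le[OF _ C0])
  with l show ?thesis by blast
qed

\<comment> \<open>A type cannot depend on the domain, so the classes live on the whole space and
  functions on \<Omega> are extended by zero. The relation is partial since only square integrable
  functions have a class.\<close>
quotient_type (overloaded) ('a, 'b) ltwo = "'a::euclidean_space \<Rightarrow> 'b::euclidean_space" /
  partial: "\<lambda>f g. l2c lebesgue f \<and> l2c lebesgue g \<and> (AE x in lebesgue. f x = g x)"
proof (rule part_equivpI)
  show "\<exists>f::'a \<Rightarrow> 'b. l2c lebesgue f \<and> l2c lebesgue f \<and> (AE x in lebesgue. f x = f x)"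
    by (rule exI[of _ "\<lambda>x. 0"]) (simp add: completion.l2c_zero)
  show "symp (\<lambda>f g::'a \<Rightarrow> 'b. l2c lebesgue f \<and> l2c lebesgue g \<and> (AE x in lebesgue. f x = g x))"
    by (auto simp: symp_def)
  show "transp (\<lambda>f g::'a \<Rightarrow> 'b. l2c lebesgue f \<and> l2c lebesgue g \<and> (AE x in lebesgue. f x = g x))"
  proof (rule transpI, elim conjE, intro conjI)
    fix f g h :: "'a \<Rightarrow> 'b"
    assume "AE x in lebesgue. f x = g x" "AE x in lebesgue. g x = h x"
    then show "AE x in lebesgue. f x = h x" by eventually_elim simp
  qed
qed

lemma ltwo_integral_cong:
  assumes "l2c lebesgue f \<and> l2c lebesgue f' \<and> (AE x in lebesgue. f x = f' x)"
    and "l2c lebesgue g \<and> l2c lebesgue g' \<and> (AE x in lebesgue. g x = g' x)"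
  shows "(LINT x|lebesgue. f x \<bullet> g x) = (LINT x|lebesgue. f' x \<bullet> (g' x :: 'b::euclidean_space))"
proof (rule integral_cong_AE)
  have "AE x in lebesgue. f x = f' x" "AE x in lebesgue. g x = g' x" using assms by blast+
  then show "AE x in lebesgue. f x \<bullet> g x = f' x \<bullet> g' x" by eventually_elim simp
qed (use assms in \<open>blast intro: borel_measurable_integrable completion.integrable_inner\<close>)+

instantiation ltwo :: (euclidean_space, euclidean_space) real_inner
begin

lift_definition zero_ltwo :: "('a, 'b) ltwo" is "\<lambda>x. 0"
  by (simp add: completion.l2c_zero)

lift_definition plus_ltwo :: "('a, 'b) ltwo \<Rightarrow> ('a, 'b) ltwo \<Rightarrow> ('a, 'b) ltwo" is "\<lambda>f g x. f x + g x"
  by (auto intro: completion.l2c_add)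

lift_definition minus_ltwo :: "('a, 'b) ltwo \<Rightarrow> ('a, 'b) ltwo \<Rightarrow> ('a, 'b) ltwo" is "\<lambda>f g x. f x - g x"
  by (auto intro: completion.l2c_diff)

lift_definition scaleR_ltwo :: "real \<Rightarrow> ('a, 'b) ltwo \<Rightarrow> ('a, 'b) ltwo" is "\<lambda>c f x. c *\<^sub>R f x"
  by (auto intro: completion.l2c_scaleR)

lift_definition inner_ltwo :: "('a, 'b) ltwo \<Rightarrow> ('a, 'b) ltwo \<Rightarrow> real" is
  "\<lambda>f g. LINT x|lebesgue. f x \<bullet> g x"
  by (rule ltwo_integral_cong)

definition "uminus_ltwo (f :: ('a, 'b) ltwo) = (-1) *\<^sub>R f"
definition "norm_ltwo (f :: ('a, 'b) ltwo) = sqrt (f \<bullet> f)"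
definition "dist_ltwo (f :: ('a, 'b) ltwo) g = norm (f - g)"
definition "sgn_ltwo (f :: ('a, 'b) ltwo) = inverse (norm f) *\<^sub>R f"
definition "uniformity_ltwo = (INF e\<in>{0<..}. principal {(x::('a, 'b) ltwo, y). dist x y < e})"
definition "open_ltwo (S :: ('a, 'b) ltwo set) \<longleftrightarrow> (\<forall>x\<in>S. \<forall>\<^sub>F (x', y) in uniformity. x' = x \<longrightarrow> y \<in> S)"

instance
proof
  fix f g h :: "('a, 'b) ltwo" and a b :: real
  show "f + g + h = f + (g + h)" by transfer (auto simp: add.assoc intro!: completion.l2c_add)
  show "f + g = g + f" by transfer (auto simp: add.commute intro!: completion.l2c_add)
  show "0 + f = f" by transfer auto
  show "- f + f = 0" unfolding uminus_ltwo_def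
    by transfer (auto intro!: completion.l2c_add completion.l2c_scaleR completion.l2c_zero)
  show "f - g = f + - g" unfolding uminus_ltwo_def
    by transfer (auto intro!: completion.l2c_add completion.l2c_diff completion.l2c_scaleR)
  show "a *\<^sub>R (f + g) = a *\<^sub>R f + a *\<^sub>R g"
    by transfer (auto simp: scaleR_add_right intro!: completion.l2c_add completion.l2c_scaleR)
  show "(a + b) *\<^sub>R f = a *\<^sub>R f + b *\<^sub>R f"
    by transfer (auto simp: scaleR_add_left intro!: completion.l2c_add completion.l2c_scaleR)
  show "a *\<^sub>R b *\<^sub>R f = (a * b) *\<^sub>R f" by transfer (auto intro!: completion.l2c_scaleR)
  show "1 *\<^sub>R f = f" by transfer auto
  show "f \<bullet> g = g \<bullet> f" by transfer (simp add: inner_commute)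
  show "(f + g) \<bullet> h = f \<bullet> h + g \<bullet> h"
    by transfer (simp add: inner_add_left completion.integrable_inner)
  show "(a *\<^sub>R f) \<bullet> g = a * (f \<bullet> g)" by transfer simp
  show "0 \<le> f \<bullet> f" by transfer simp
  show "(f \<bullet> f = 0) = (f = 0)"
  proof transfer
    fix f :: "'a \<Rightarrow> 'b" assume f: "l2c lebesgue f \<and> l2c lebesgue f \<and> (AE x in lebesgue. f x = f x)"
    then have "integrable lebesgue (\<lambda>x. f x \<bullet> f x)" by (intro completion.integrable_inner) auto
    then have "((LINT x|lebesgue. f x \<bullet> f x) = 0) = (AE x in lebesgue. f x \<bullet> f x = 0)"
      by (rule integral_nonneg_eq_0_iff_AE) simp
    also have "\<dots> = (AE x in lebesgue. f x = 0)" by simp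
    finally show "((LINT x|lebesgue. f x \<bullet> f x) = 0) =
      (l2c lebesgue f \<and> l2c lebesgue (\<lambda>x::'a. 0::'b) \<and> (AE x in lebesgue. f x = 0))"
      using f by (simp add: completion.l2c_zero)
  qed
qed (simp_all only: norm_ltwo_def dist_ltwo_def sgn_ltwo_def uniformity_ltwo_def open_ltwo_def)


end

lemma abs_ltwo_eq_iff:
  assumes "l2c lebesgue f" "l2c lebesgue g"
  shows "abs_ltwo f = abs_ltwo g \<longleftrightarrow> (AE x in lebesgue. f x = g x)"
  using Quotient3_rel[OF Quotient3_ltwo, of f g] assms by auto

lemma rep_ltwo_l2c: "l2c lebesgue (rep_ltwo h)"
  using Quotient3_rep_reflp[OF Quotient3_ltwo, of h] by blast

lemma abs_rep_ltwo: "abs_ltwo (rep_ltwo h) = h"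
  by (rule Quotient3_abs_rep[OF Quotient3_ltwo])

lemma inner_abs_ltwo:
  assumes "l2c lebesgue f" "l2c lebesgue g"
  shows "abs_ltwo f \<bullet> abs_ltwo g = (LINT x|lebesgue. f x \<bullet> g x)"
  using assms by (simp add: inner_ltwo.abs_eq)

lemma norm_abs_ltwo:
  assumes "l2c lebesgue f" shows "norm (abs_ltwo f) = l2n lebesgue f"
  unfolding norm_eq_sqrt_inner[of "abs_ltwo f"] inner_abs_ltwo[OF assms assms] l2n_def power2_norm_eq_inner ..

text \<open>Riesz--Fischer: along a subsequence whose increments are below \<open>(1/2)^k\<close>,
  representatives converge almost everywhere, and Fatou's lemma in the form \<open>l2c_limit\<close>
  turns this into convergence in norm.\<close>

instance ltwo :: (euclidean_space, euclidean_space) complete_space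
proof
  fix X :: "nat \<Rightarrow> ('a, 'b) ltwo" assume X: "Cauchy X"
  have "\<exists>N. \<forall>m\<ge>N. \<forall>n\<ge>N. dist (X m) (X n) < (1/2)^k" for k :: nat
    using X unfolding Cauchy_def by simp
  then obtain N where N: "\<And>k m n. m \<ge> N k \<Longrightarrow> n \<ge> N k \<Longrightarrow> dist (X m) (X n) < (1/2)^k" by metis
  define r where "r k = (\<Sum>j\<le>k. N j) + k" for k :: nat
  have rN: "r k \<ge> N k" for k
    using member_le_sum[of k "{..k}" N] by (simp add: r_def)
  have rs: "strict_mono r" by (rule strict_monoI_Suc) (simp add: r_def)
  define f where "f k = rep_ltwo (X (r k))" for k
  have fl: "l2c lebesgue (f k)" for k by (simp add: f_def rep_ltwo_l2c)
  have dl: "l2n lebesgue (\<lambda>x. f m x - f k x) \<le> (1/2)^k" if "m \<ge> k" for m k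
  proof -
    have "l2n lebesgue (\<lambda>x. f m x - f k x) = norm (abs_ltwo (\<lambda>x. f m x - f k x))"
      by (rule norm_abs_ltwo[OF completion.l2c_diff[OF fl fl], symmetric])
    also have "abs_ltwo (\<lambda>x. f m x - f k x) = X (r m) - X (r k)"
      using minus_ltwo.abs_eq[of "f m" "f k"] fl by (simp add: f_def abs_rep_ltwo)
    also have "norm (X (r m) - X (r k)) < (1/2)^k"
      unfolding dist_norm[symmetric]
      using that rN[of k] strict_mono_leD[OF rs that] by (intro N) linarith+
    finally show ?thesis by simp
  qed
  \<comment> \<open>The weight \<open>2^k\<close> still leaves a convergent series of integrals,
    because \<open>2^k * ((1/2)^k)\<^sup>2 = (1/2)^k\<close>, and it yields a geometric bound for
    the increments at almost every point.\<close>
  define d where "d k x = 2^k * (norm (f (Suc k) x - f k x))\<^sup>2" for k x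
  have di: "integrable lebesgue (d k)" for k
    unfolding d_def using l2c_integrable[OF completion.l2c_diff[OF fl fl]] by simp
  have ds: "(\<integral>\<^sup>+x. ennreal (d k x) \<partial>lebesgue) \<le> ennreal ((1/2)^k)" for k
  proof -
    have "(\<integral>\<^sup>+x. ennreal (d k x) \<partial>lebesgue) = ennreal (LINT x|lebesgue. d k x)"
      by (rule nn_integral_eq_integral[OF di]) (simp add: d_def)
    also have "(LINT x|lebesgue. d k x) = 2^k * (l2n lebesgue (\<lambda>x. f (Suc k) x - f k x))\<^sup>2"
      by (simp add: d_def l2n_sq)
    also have "\<dots> \<le> 2^k * ((1/2)^k)\<^sup>2" by (intro mult_left_mono power_mono dl) auto
    also have "\<dots> = (1/2)^k" by (simp add: power2_eq_square power_one_over)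
    finally show ?thesis by (auto intro: ennreal_leI)
  qed
  have "(\<integral>\<^sup>+x. (\<Sum>k. ennreal (d k x)) \<partial>lebesgue) = (\<Sum>k. \<integral>\<^sup>+x. ennreal (d k x) \<partial>lebesgue)"
    using di by (intro nn_integral_suminf) auto
  also have "\<dots> \<le> (\<Sum>k. ennreal ((1/2)^k))" by (intro suminf_le ds) auto
  also have "\<dots> = ennreal (\<Sum>k. (1/2)^k)" by (intro suminf_ennreal_eq) (auto intro: summable_sums)
  also have "\<dots> < \<infinity>" by simp
  finally have "AE x in lebesgue. (\<Sum>k. ennreal (d k x)) \<noteq> \<infinity>"
    using di by (intro nn_integral_PInf_AE) auto
  then have conv: "AE x in lebesgue. (\<lambda>k. f k x) \<longlonglongrightarrow> lim (\<lambda>k. f k x)"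
  proof eventually_elim
    case (elim x)
    have d0: "d k x \<ge> 0" for k by (simp add: d_def)
    have sd: "summable (\<lambda>k. d k x)" using summable_suminf_not_top[OF d0] elim by simp
    define C where "C = (\<Sum>k. d k x)"
    have dC: "d k x \<le> C" for k
      unfolding C_def using sum_le_suminf[OF sd, of "{k}"] d0 by simp
    have C0: "C \<ge> 0" using d0[of 0] dC[of 0] by linarith
    have nb: "norm (f (Suc k) x - f k x) \<le> sqrt C * (sqrt (1/2))^k" for k
    proof (rule power2_le_imp_le)
      have "(norm (f (Suc k) x - f k x))\<^sup>2 \<le> C / 2^k" using dC[of k] by (simp add: d_def field_simps)
      also have "\<dots> = (sqrt C * (sqrt (1/2))^k)\<^sup>2"
        using C0 by (simp add: power_mult_distrib power_mult[symmetric] mult.commute[of k] power_mult[of _ 2]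
            power_one_over del: real_sqrt_divide)
      finally show "(norm (f (Suc k) x - f k x))\<^sup>2 \<le> (sqrt C * (sqrt (1/2))^k)\<^sup>2" .
    qed (use C0 in auto)
    have "summable (\<lambda>k. sqrt C * (sqrt (1/2))^k)"
      by (intro summable_mult summable_geometric) (simp add: real_sqrt_lt_1_iff del: real_sqrt_divide)
    then have "summable (\<lambda>k. f (Suc k) x - f k x)"
      by (rule summable_comparison_test'[where N=0]) (use nb in auto)
    then have "convergent (\<lambda>n. \<Sum>k<n. f (Suc k) x - f k x)" by (simp add: summable_iff_convergent)
    then have "convergent (\<lambda>n. f n x - f 0 x)" using sum_lessThan_telescope[of "\<lambda>n. f n x"] by simp
    then have "convergent (\<lambda>n. f n x)"
      using convergent_add[OF _ convergent_const[of "f 0 x"], of "\<lambda>n. f n x - f 0 x"] by simp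
    then show ?case by (simp add: convergent_LIMSEQ_iff)
  qed
  define g where "g x = lim (\<lambda>k. f k x)" for x
  have key: "l2c lebesgue (\<lambda>x. g x - f k x) \<and> l2n lebesgue (\<lambda>x. g x - f k x) \<le> (1/2)^k" for k
  proof (rule l2c_limit[OF complete_measure_lebesgue, of "\<lambda>m x. f (m + k) x - f k x"])
    show "l2c lebesgue (\<lambda>x. f (m + k) x - f k x)" for m by (intro completion.l2c_diff fl)
    show "l2n lebesgue (\<lambda>x. f (m + k) x - f k x) \<le> (1/2)^k" for m by (rule dl) simp
    show "AE x in lebesgue. (\<lambda>m. f (m + k) x - f k x) \<longlonglongrightarrow> g x - f k x"
      using conv unfolding g_def
      by eventually_elim (intro tendsto_diff tendsto_const LIMSEQ_ignore_initial_segment)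
  qed
  have gl: "l2c lebesgue g" using completion.l2c_add[OF conjunct1[OF key[of 0]] fl[of 0]] by simp
  have "(\<lambda>k. X (r k)) \<longlonglongrightarrow> abs_ltwo g"
  proof (rule LIM_zero_cancel, rule tendsto_norm_zero_cancel, rule tendsto_sandwich[OF _ _ tendsto_const])
    show "\<forall>\<^sub>F k in sequentially. norm (X (r k) - abs_ltwo g) \<le> (1/2)^k"
    proof (rule always_eventually, rule allI)
      fix k
      have "norm (X (r k) - abs_ltwo g) = norm (abs_ltwo g - X (r k))" by (rule norm_minus_commute)
      also have "abs_ltwo g - X (r k) = abs_ltwo (\<lambda>x. g x - f k x)"
        using minus_ltwo.abs_eq[of g "f k"] gl fl by (simp add: f_def abs_rep_ltwo)
      also have "norm \<dots> = l2n lebesgue (\<lambda>x. g x - f k x)" by (rule norm_abs_ltwo[OF conjunct1[OF key]])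
      also have "\<dots> \<le> (1/2)^k" using key by blast
      finally show "norm (X (r k) - abs_ltwo g) \<le> (1/2)^k" .
    qed
    show "(\<lambda>k. (1/2)^k :: real) \<longlonglongrightarrow> 0" by (rule LIMSEQ_power_zero) simp
  qed auto
  then have "X \<longlonglongrightarrow> abs_ltwo g"
    by (intro Cauchy_converges_subseq[OF X rs]) (simp add: o_def)
  then show "convergent X" by (auto simp: convergent_def)
qed


section \<open>Functions on a domain as elements of the Hilbert space\<close>

text \<open>\<open>cls \<Omega> u\<close> is the class of \<open>u\<close>, extended by zero; it is meaningless unless \<open>u \<in> L2 \<Omega>\<close>.\<close>

definition cls :: "'a::euclidean_space set \<Rightarrow> ('a \<Rightarrow> 'b::euclidean_space) \<Rightarrow> ('a, 'b) ltwo" where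
  "cls \<Omega> u = abs_ltwo (\<lambda>x. if x \<in> \<Omega> then u x else 0)"

locale domain =
  fixes \<Omega> :: "'a::euclidean_space set"
  assumes sets_dom: "\<Omega> \<in> sets lebesgue"
begin

sublocale D: complete_measure "lebesgue_on \<Omega>"
  by (rule complete_measure_lebesgue_on[OF sets_dom])

lemma L2_iff: "(u :: 'a \<Rightarrow> 'b::euclidean_space) \<in> L2 \<Omega> \<longleftrightarrow> l2c (lebesgue_on \<Omega>) u"
  by (simp add: L2_def l2c_borel_iff[OF D.complete_measure_axioms])

lemma L2_norm_eq: "L2_norm \<Omega> u = l2n (lebesgue_on \<Omega>) u"
  by (simp add: L2_norm_def L2_inner_def l2n_def dot_square_norm)

lemma L2_ext:
  fixes u :: "'a \<Rightarrow> 'b::euclidean_space"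
  shows "u \<in> L2 \<Omega> \<longleftrightarrow> l2c lebesgue (\<lambda>x. if x \<in> \<Omega> then u x else 0)"
proof -
  have "(\<lambda>x. (norm (if x \<in> \<Omega> then u x else 0))\<^sup>2) = (\<lambda>x. if x \<in> \<Omega> then (norm (u x))\<^sup>2 else 0)" by auto
  then show ?thesis
    unfolding L2_def l2c_borel_iff[OF complete_measure_lebesgue]
    using borel_measurable_if[OF sets_dom, of u] Lebesgue_Measure.integrable_restrict_UNIV[OF sets_dom, of "\<lambda>x. (norm (u x))\<^sup>2"]
    by simp
qed

lemma inner_cls:
  fixes u v :: "'a \<Rightarrow> 'b::euclidean_space"
  assumes "u \<in> L2 \<Omega>" "v \<in> L2 \<Omega>"
  shows "cls \<Omega> u \<bullet> cls \<Omega> v = L2_inner \<Omega> u v"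
proof -
  have "cls \<Omega> u \<bullet> cls \<Omega> v = (LINT x|lebesgue. (if x \<in> \<Omega> then u x \<bullet> v x else 0))"
    using assms unfolding cls_def L2_ext
    by (simp add: inner_abs_ltwo) (intro Bochner_Integration.integral_cong, auto)
  then show ?thesis by (simp add: Lebesgue_Measure.integral_restrict_UNIV[OF sets_dom] L2_inner_def)
qed

lemma norm_cls: "(u :: 'a \<Rightarrow> 'b::euclidean_space) \<in> L2 \<Omega> \<Longrightarrow> norm (cls \<Omega> u) = L2_norm \<Omega> u"
  by (simp add: norm_eq_sqrt_inner inner_cls L2_norm_def)

lemma L2_add: "u \<in> L2 \<Omega> \<Longrightarrow> v \<in> L2 \<Omega> \<Longrightarrow> (\<lambda>x. u x + v x :: 'b::euclidean_space) \<in> L2 \<Omega>"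
  unfolding L2_iff by (rule D.l2c_add)

lemma L2_diff: "u \<in> L2 \<Omega> \<Longrightarrow> v \<in> L2 \<Omega> \<Longrightarrow> (\<lambda>x. u x - v x :: 'b::euclidean_space) \<in> L2 \<Omega>"
  unfolding L2_iff by (rule D.l2c_diff)

lemma L2_scaleR: "u \<in> L2 \<Omega> \<Longrightarrow> (\<lambda>x. c *\<^sub>R u x :: 'b::euclidean_space) \<in> L2 \<Omega>"
  unfolding L2_iff by (rule D.l2c_scaleR)

lemma L2_zero: "(\<lambda>x. 0 :: 'b::euclidean_space) \<in> L2 \<Omega>"
  unfolding L2_iff by (rule D.l2c_zero)

lemma L2_sum: "(\<And>i. i \<in> I \<Longrightarrow> u i \<in> L2 \<Omega>) \<Longrightarrow> (\<lambda>x. \<Sum>i\<in>I. u i x :: 'b::euclidean_space) \<in> L2 \<Omega>"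
  unfolding L2_iff by (rule D.l2c_sum)

lemma cls_add:
  fixes u v :: "'a \<Rightarrow> 'b::euclidean_space"
  assumes "u \<in> L2 \<Omega>" "v \<in> L2 \<Omega>"
  shows "cls \<Omega> (\<lambda>x. u x + v x) = cls \<Omega> u + cls \<Omega> v"
proof -
  have "(\<lambda>x. if x \<in> \<Omega> then u x + v x else 0) = (\<lambda>x. (if x \<in> \<Omega> then u x else 0) + (if x \<in> \<Omega> then v x else 0))"
    by auto
  then show ?thesis using assms unfolding cls_def L2_ext by (simp add: plus_ltwo.abs_eq)
qed

lemma cls_diff:
  fixes u v :: "'a \<Rightarrow> 'b::euclidean_space"
  assumes "u \<in> L2 \<Omega>" "v \<in> L2 \<Omega>"
  shows "cls \<Omega> (\<lambda>x. u x - v x) = cls \<Omega> u - cls \<Omega> v"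
proof -
  have "(\<lambda>x. if x \<in> \<Omega> then u x - v x else 0) = (\<lambda>x. (if x \<in> \<Omega> then u x else 0) - (if x \<in> \<Omega> then v x else 0))"
    by auto
  then show ?thesis using assms unfolding cls_def L2_ext by (simp add: minus_ltwo.abs_eq)
qed

lemma cls_scaleR:
  fixes u :: "'a \<Rightarrow> 'b::euclidean_space"
  assumes "u \<in> L2 \<Omega>"
  shows "cls \<Omega> (\<lambda>x. c *\<^sub>R u x) = c *\<^sub>R cls \<Omega> u"
proof -
  have "(\<lambda>x. if x \<in> \<Omega> then c *\<^sub>R u x else 0) = (\<lambda>x. c *\<^sub>R (if x \<in> \<Omega> then u x else 0))"
    by auto
  then show ?thesis using assms unfolding cls_def L2_ext by (simp add: scaleR_ltwo.abs_eq)
qed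

lemma cls_mult: "u \<in> L2 \<Omega> \<Longrightarrow> cls \<Omega> (\<lambda>x. c * u x :: real) = c *\<^sub>R cls \<Omega> u"
  using cls_scaleR[of u c] by simp

lemma cls_zero: "cls \<Omega> (\<lambda>x. 0 :: 'b::euclidean_space) = 0"
  by (simp add: cls_def zero_ltwo.abs_eq)

lemma cls_sum:
  fixes u :: "'i \<Rightarrow> 'a \<Rightarrow> 'b::euclidean_space"
  assumes "\<And>i. i \<in> I \<Longrightarrow> u i \<in> L2 \<Omega>"
  shows "cls \<Omega> (\<lambda>x. \<Sum>i\<in>I. u i x) = (\<Sum>i\<in>I. cls \<Omega> (u i))"
  using assms
proof (induction I rule: infinite_finite_induct)
  case (insert i I)
  then show ?case using cls_add[OF _ L2_sum, of "u i" I u] by simp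
qed (simp_all add: cls_zero)

lemma cls_eq_iff:
  fixes u v :: "'a \<Rightarrow> 'b::euclidean_space"
  assumes "u \<in> L2 \<Omega>" "v \<in> L2 \<Omega>"
  shows "cls \<Omega> u = cls \<Omega> v \<longleftrightarrow> (AE x in lebesgue_on \<Omega>. u x = v x)"
proof -
  have "cls \<Omega> u = cls \<Omega> v \<longleftrightarrow>
      (AE x in lebesgue. (if x \<in> \<Omega> then u x else 0) = (if x \<in> \<Omega> then v x else 0))"
    unfolding cls_def using assms unfolding L2_ext by (rule abs_ltwo_eq_iff)
  also have "\<dots> \<longleftrightarrow> (AE x in lebesgue. x \<in> \<Omega> \<longrightarrow> u x = v x)"
    by (intro AE_cong) auto
  also have "\<dots> \<longleftrightarrow> (AE x in lebesgue_on \<Omega>. u x = v x)"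
    using sets_dom by (simp add: AE_restrict_space_iff)
  finally show ?thesis .
qed

lemma rep_L2: "rep_ltwo (h :: ('a, 'b::euclidean_space) ltwo) \<in> L2 \<Omega>"
  unfolding L2_ext
proof (rule completion.l2c_bound[OF _ rep_ltwo_l2c[of h]])
  have "rep_ltwo h \<in> borel_measurable lebesgue"
    using rep_ltwo_l2c[of h] l2c_borel_iff[OF complete_measure_lebesgue] by blast
  then show "smeas lebesgue (\<lambda>x. if x \<in> \<Omega> then rep_ltwo h x else 0)"
    using sets_dom by (intro borel_smeas measurable_If_set) auto
  show "AE x in lebesgue. norm (if x \<in> \<Omega> then rep_ltwo h x else 0) \<le> 1 * norm (rep_ltwo h x)" by auto
qed

text \<open>A class \<open>h\<close> need not vanish outside \<Omega>. Restricting a representative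
  to \<Omega> is the orthogonal projection onto the classes that do, so pairings with those are
  unchanged.\<close>

lemma inner_cls_rep:
  fixes h :: "('a, 'b::euclidean_space) ltwo"
  assumes "v \<in> L2 \<Omega>"
  shows "cls \<Omega> (rep_ltwo h) \<bullet> cls \<Omega> v = h \<bullet> cls \<Omega> v"
proof -
  have "h \<bullet> cls \<Omega> v = abs_ltwo (rep_ltwo h) \<bullet> cls \<Omega> v" by (simp add: abs_rep_ltwo)
  also have "\<dots> = (LINT x|lebesgue. rep_ltwo h x \<bullet> (if x \<in> \<Omega> then v x else 0))"
    using assms unfolding cls_def L2_ext by (intro inner_abs_ltwo rep_ltwo_l2c)
  also have "\<dots> = (LINT x|lebesgue. (if x \<in> \<Omega> then rep_ltwo h x \<bullet> v x else 0))"
    by (intro Bochner_Integration.integral_cong) auto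
  also have "\<dots> = cls \<Omega> (rep_ltwo h) \<bullet> cls \<Omega> v"
    by (simp add: Lebesgue_Measure.integral_restrict_UNIV[OF sets_dom] inner_cls[OF rep_L2 assms] L2_inner_def)
  finally show ?thesis ..
qed

lemma cls_rep_diff_le:
  fixes h :: "('a, 'b::euclidean_space) ltwo"
  assumes "v \<in> L2 \<Omega>"
  shows "norm (cls \<Omega> (rep_ltwo h) - cls \<Omega> v) \<le> norm (h - cls \<Omega> v)"
proof -
  define d where "d = cls \<Omega> (rep_ltwo h) - cls \<Omega> v"
  have d: "d = cls \<Omega> (\<lambda>x. rep_ltwo h x - v x)" by (simp add: d_def cls_diff[OF rep_L2 assms])
  have "(\<lambda>x. rep_ltwo h x - v x) \<in> L2 \<Omega>" by (rule L2_diff[OF rep_L2 assms])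
  from inner_cls_rep[OF this, of h] have "d \<bullet> d = (h - cls \<Omega> v) \<bullet> d"
    unfolding d[symmetric] by (simp add: d_def inner_diff_left)
  also have "\<dots> \<le> norm (h - cls \<Omega> v) * norm d" by (rule norm_cauchy_schwarz)
  finally have "norm d * norm d \<le> norm (h - cls \<Omega> v) * norm d"
    by (simp add: power2_norm_eq_inner[symmetric] power2_eq_square)
  then show ?thesis by (cases "norm d = 0") (auto simp: d_def[symmetric])
qed

text \<open>Classes of functions on \<Omega> form the range of a projection, hence limits of such
  classes are again fixed by it.\<close>

lemma cls_rep_eqI:
  fixes h :: "('a, 'b::euclidean_space) ltwo"
  assumes "(\<lambda>k. cls \<Omega> (u k)) \<longlonglongrightarrow> h" "\<And>k. u k \<in> L2 \<Omega>"
  shows "cls \<Omega> (rep_ltwo h) = h"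
proof (rule LIMSEQ_unique[OF _ assms(1)])
  have "(\<lambda>k. norm (h - cls \<Omega> (u k))) \<longlonglongrightarrow> 0"
    using tendsto_norm_zero[OF LIM_zero[OF assms(1)]] by (simp add: norm_minus_commute)
  from tendsto_sandwich[OF _ _ tendsto_const this, of "\<lambda>k. norm (cls \<Omega> (rep_ltwo h) - cls \<Omega> (u k))"]
  have "(\<lambda>k. norm (cls \<Omega> (rep_ltwo h) - cls \<Omega> (u k))) \<longlonglongrightarrow> 0"
    by (simp add: cls_rep_diff_le assms(2))
  then have "(\<lambda>k. cls \<Omega> (u k) - cls \<Omega> (rep_ltwo h)) \<longlonglongrightarrow> 0"
    by (simp add: tendsto_norm_zero_iff norm_minus_commute[of "cls \<Omega> (rep_ltwo h)"])
  then show "(\<lambda>k. cls \<Omega> (u k)) \<longlonglongrightarrow> cls \<Omega> (rep_ltwo h)" by (rule LIM_zero_cancel)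
qed

end

section \<open>Test functions\<close>

lemma partial_derivI: "(f has_derivative D) (at x) \<Longrightarrow> partial_deriv i f x = D i"
  unfolding partial_deriv_def using frechet_derivative_at by metis

lemma has_derivative_partial:
  fixes f :: "'a::euclidean_space \<Rightarrow> real"
  assumes "f differentiable (at x)"
  shows "(f has_derivative (\<lambda>h. \<Sum>i\<in>Basis. (h \<bullet> i) * partial_deriv i f x)) (at x)"
proof -
  define D where "D = frechet_derivative f (at x)"
  have D: "(f has_derivative D) (at x)" unfolding D_def using assms by (simp add: frechet_derivative_works)
  interpret linear D using D by (rule has_derivative_linear)
  have "D = (\<lambda>h. \<Sum>i\<in>Basis. (h \<bullet> i) * partial_deriv i f x)"
  proof
    fix h
    have "D h = D (\<Sum>i\<in>Basis. (h \<bullet> i) *\<^sub>R i)" by (simp add: euclidean_representation)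
    then show "D h = (\<Sum>i\<in>Basis. (h \<bullet> i) * partial_deriv i f x)"
      by (simp add: sum scale partial_deriv_def D_def[symmetric])
  qed
  then show ?thesis using D by simp
qed

lemma Ck_diff: "Ck (Suc k) f \<Longrightarrow> f differentiable (at x)" by simp

lemma Ck_pred: "Ck (Suc k) f \<Longrightarrow> Ck k f"
proof (induction k arbitrary: f)
  case 0
  then have "\<And>x. f differentiable (at x)" by simp
  then show ?case by (simp add: continuous_at_imp_continuous_on differentiable_imp_continuous_within)
next
  case (Suc k)
  have "f differentiable (at x)" for x using Suc.prems by (rule Ck_diff)
  moreover have "Ck k (partial_deriv i f)" if "i \<in> Basis" for i
    using Suc.prems that by (intro Suc.IH) (subst (asm) Ck.simps(2), blast)
  ultimately show ?case by simp
qed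

lemma Ck_continuous: "Ck k f \<Longrightarrow> continuous_on UNIV f"
  by (induction k) (auto dest: Ck_pred simp del: Ck.simps(2))

lemma Ck_const: "Ck k (\<lambda>x. c)"
proof (induction k arbitrary: c)
  case (Suc k)
  have "partial_deriv i (\<lambda>x::'a. c) = (\<lambda>x. 0)" for i
    by (rule ext, subst partial_derivI[OF has_derivative_const]) simp
  then show ?case using Suc by simp
qed simp

lemma Ck_add: "Ck k f \<Longrightarrow> Ck k g \<Longrightarrow> Ck k (\<lambda>x. f x + g x)"
proof (induction k arbitrary: f g)
  case (Suc k)
  have d: "f differentiable (at x)" "g differentiable (at x)" for x using Suc.prems by auto
  have "partial_deriv i (\<lambda>x. f x + g x) = (\<lambda>x. partial_deriv i f x + partial_deriv i g x)" for i
    by (rule ext, subst partial_derivI[OF has_derivative_add[OF d[unfolded frechet_derivative_works]]])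
      (simp add: partial_deriv_def)
  then show ?case using Suc d by simp
qed (simp add: continuous_on_add)

lemma partial_deriv_mult:
  fixes f g :: "'a::euclidean_space \<Rightarrow> real"
  assumes "f differentiable (at x)" "g differentiable (at x)"
  shows "partial_deriv i (\<lambda>x. f x * g x) x = f x * partial_deriv i g x + partial_deriv i f x * g x"
  by (subst partial_derivI[OF has_derivative_mult[OF assms[unfolded frechet_derivative_works]]])
    (simp add: partial_deriv_def)

lemma Ck_mult: "Ck k f \<Longrightarrow> Ck k g \<Longrightarrow> Ck k (\<lambda>x. f x * g x)"
proof (induction k arbitrary: f g)
  case (Suc k)
  have d: "f differentiable (at x)" "g differentiable (at x)" for x using Suc.prems by auto
  have e: "partial_deriv i (\<lambda>x. f x * g x) = (\<lambda>x. f x * partial_deriv i g x + partial_deriv i f x * g x)" for i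
    using partial_deriv_mult[OF d] by auto
  have "Ck k f" "Ck k g" using Suc.prems Ck_pred by blast+
  then have "Ck k (\<lambda>x. f x * partial_deriv i g x + partial_deriv i f x * g x)" if "i \<in> Basis" for i
    using Suc.prems that by (intro Ck_add Suc.IH) auto
  then show ?case using d by (simp add: e)
qed (simp add: continuous_on_mult)

lemma Ck_cmult: "Ck k f \<Longrightarrow> Ck k (\<lambda>x. c * f x)"
  by (intro Ck_mult Ck_const)

lemma Ck_prod: "(\<And>i. i \<in> I \<Longrightarrow> Ck k (f i)) \<Longrightarrow> Ck k (\<lambda>x. \<Prod>i\<in>I. f i x)"
  by (induction I rule: infinite_finite_induct) (simp_all add: Ck_const Ck_mult)

lemma Ck_inner: "Ck k (\<lambda>x. x \<bullet> b)"
proof (cases k)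
  case 0 then show ?thesis by (simp add: continuous_on_inner)
next
  case (Suc j)
  have d: "((\<lambda>x. x \<bullet> b) has_derivative (\<lambda>x. x \<bullet> b)) (at x)" for x :: 'a
    by (auto intro!: derivative_eq_intros)
  have "partial_deriv i (\<lambda>x. x \<bullet> b) = (\<lambda>x. i \<bullet> b)" for i :: 'a
    by (rule ext) (rule partial_derivI[OF d])
  moreover have "(\<lambda>x. x \<bullet> b) differentiable (at x)" for x :: 'a
    using d unfolding differentiable_def by blast
  ultimately show ?thesis using Suc by (simp add: Ck_const)
qed

lemma Ck_compose:
  fixes f :: "real \<Rightarrow> real" and g :: "'a::euclidean_space \<Rightarrow> real"
  shows "Ck k f \<Longrightarrow> Ck k g \<Longrightarrow> Ck k (\<lambda>x. f (g x))"
proof (induction k arbitrary: f)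
  case 0 then show ?case by (auto intro: continuous_on_compose2)
next
  case (Suc k)
  have d: "f differentiable (at y)" "g differentiable (at x)" for y x using Suc.prems by auto
  have df: "(f has_derivative (\<lambda>h. h * partial_deriv 1 f y)) (at y)" for y
    using has_derivative_partial[OF d(1)] by simp
  have dg: "(g has_derivative frechet_derivative g (at x)) (at x)" for x
    using d(2) by (simp add: frechet_derivative_works)
  have c: "((\<lambda>x. f (g x)) has_derivative (\<lambda>h. frechet_derivative g (at x) h * partial_deriv 1 f (g x))) (at x)" for x
    using has_derivative_compose[OF dg df] by simp
  have e: "partial_deriv i (\<lambda>x. f (g x)) = (\<lambda>x. partial_deriv i g x * partial_deriv 1 f (g x))" for i
    by (rule ext, subst partial_derivI[OF c]) (simp add: partial_deriv_def)
  have "Ck k (\<lambda>x. partial_deriv i g x * partial_deriv 1 f (g x))" if "i \<in> Basis" for i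
  proof (rule Ck_mult)
    show "Ck k (partial_deriv i g)" using Suc.prems(2) that by simp
    have "Ck k (partial_deriv 1 f)" using Suc.prems(1) by simp
    then show "Ck k (\<lambda>x. partial_deriv 1 f (g x))" using Ck_pred[OF Suc.prems(2)] by (rule Suc.IH)
  qed
  moreover have "(\<lambda>x. f (g x)) differentiable (at x)" for x
    using c by (rule differentiableI)
  ultimately show ?case by (simp add: e)
qed

text \<open>The derivatives of the flat function \<open>exp(-1/t)\<close> are combinations of the functions below.\<close>

definition flat :: "nat \<Rightarrow> real \<Rightarrow> real" where
  "flat n t = (if t > 0 then (1 / t)^n * exp (- (1 / t)) else 0)"

lemma flat_tendsto: "(flat n \<longlongrightarrow> 0) (at 0)"
proof -
  have "((\<lambda>t::real. (inverse t)^n / exp (inverse t)) \<longlongrightarrow> 0) (at_right 0)"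
    by (rule filterlim_compose[OF tendsto_power_div_exp_0 filterlim_inverse_at_top_right])
  moreover have "\<forall>\<^sub>F t in at_right 0. (inverse t)^n / exp (inverse t) = flat n t"
    unfolding eventually_at_right_field
    by (rule exI[of _ 1]) (auto simp: flat_def exp_minus field_simps)
  ultimately have "(flat n \<longlongrightarrow> 0) (at_right 0)" using tendsto_cong by fast
  moreover have "(flat n \<longlongrightarrow> 0) (at_left 0)"
  proof -
    have "\<forall>\<^sub>F t in at_left 0. flat n t = 0"
      unfolding eventually_at_left_field by (rule exI[of _ "-1"]) (auto simp: flat_def)
    then show ?thesis by (simp add: tendsto_eventually)
  qed
  ultimately show ?thesis by (simp add: filterlim_split_at)
qed

lemma flat_deriv: "(flat n has_real_derivative (flat (n + 2) t - real n * flat (n + 1) t)) (at t)"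
proof -
  consider "t > 0" | "t < 0" | "t = 0" by linarith
  then show ?thesis
  proof cases
    case 1
    have "((\<lambda>t. (1 / t)^n * exp (- (1 / t))) has_real_derivative (flat (n + 2) t - real n * flat (n + 1) t)) (at t)"
    proof (cases n)
      case 0
      then show ?thesis using 1
        by (auto intro!: derivative_eq_intros simp: flat_def power2_eq_square)
    next
      case (Suc j)
      show ?thesis unfolding Suc using 1
        by (auto intro!: derivative_eq_intros simp: flat_def divide_simps) (simp add: algebra_simps, cases j, auto)
    qed
    then show ?thesis
      by (rule has_field_derivative_transform_within_open[of _ _ _ "{0<..}"]) (use 1 in \<open>auto simp: flat_def\<close>)
  next
    case 2
    have "((\<lambda>t. 0) has_real_derivative (flat (n + 2) t - real n * flat (n + 1) t)) (at t)"
      using 2 by (simp add: flat_def)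
    then show ?thesis
      by (rule has_field_derivative_transform_within_open[of _ _ _ "{..<0}"]) (use 2 in \<open>auto simp: flat_def\<close>)
  next
    case 3
    \<comment> \<open>At 0 the difference quotient of \<open>flat n\<close> is
      \<open>flat (Suc n)\<close>, which is already known to tend to 0.\<close>
    have "((\<lambda>h. (flat n (0 + h) - flat n 0) / h) \<longlongrightarrow> 0) (at 0)"
    proof (rule Lim_transform_eventually[OF flat_tendsto[of "Suc n"]])
      have "flat (Suc n) h = (flat n (0 + h) - flat n 0) / h" if "h \<noteq> 0" for h
        using that by (auto simp: flat_def)
      then show "\<forall>\<^sub>F h in at 0. flat (Suc n) h = (flat n (0 + h) - flat n 0) / h"
        by (auto simp: eventually_at_filter)
    qed
    then have "(flat n has_real_derivative 0) (at 0)" by (simp add: DERIV_def)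
    then show ?thesis using 3 by (simp add: flat_def)
  qed
qed

lemma Ck_flat: "Ck k (flat n)"
proof (induction k arbitrary: n)
  case 0
  have "isCont (flat n) t" for t using flat_deriv[of n t] by (rule DERIV_isCont)
  then show ?case by (simp add: continuous_at_imp_continuous_on)
next
  case (Suc k)
  have d: "(flat n has_derivative (\<lambda>h. h * (flat (n + 2) t - real n * flat (n + 1) t))) (at t)" for t
    using flat_deriv[of n t] unfolding has_field_derivative_def
    by (rule has_derivative_eq_rhs) (auto simp: mult.commute)
  have e: "partial_deriv 1 (flat n) = (\<lambda>t. flat (n + 2) t + (- real n) * flat (n + 1) t)"
    by (rule ext, subst partial_derivI[OF d]) simp
  have "Ck k (\<lambda>t. flat (n + 2) t + (- real n) * flat (n + 1) t)" by (intro Ck_add Ck_cmult Suc.IH)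
  moreover have "flat n differentiable (at t)" for t using d unfolding differentiable_def by blast
  ultimately show ?case using e by simp
qed

text \<open>Positive exactly on the open box and bounded by 1. The factor \<open>Suc m\<close> makes
  the sequence converge to the indicator of the box, so that dominated convergence carries
  statements about test functions over to boxes.\<close>

definition bump :: "nat \<Rightarrow> 'a \<Rightarrow> 'a \<Rightarrow> 'a::euclidean_space \<Rightarrow> real" where
  "bump m a b x = (\<Prod>i\<in>Basis. flat 0 (real (Suc m) * (x \<bullet> i - a \<bullet> i)) * flat 0 (real (Suc m) * (b \<bullet> i - x \<bullet> i)))"

lemma Ck_bump: "Ck k (bump m a b)"
proof -
  have "Ck k (\<lambda>x. flat 0 (real (Suc m) * (x \<bullet> i + - (a \<bullet> i))) * flat 0 (real (Suc m) * (b \<bullet> i + (-1) * (x \<bullet> i))))" for i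
    by (intro Ck_mult Ck_compose[OF Ck_flat] Ck_cmult Ck_add Ck_const Ck_inner)
  then have "Ck k (\<lambda>x. \<Prod>i\<in>Basis. flat 0 (real (Suc m) * (x \<bullet> i + - (a \<bullet> i))) * flat 0 (real (Suc m) * (b \<bullet> i + (-1) * (x \<bullet> i))))"
    by (intro Ck_prod)
  then show ?thesis by (simp add: bump_def[abs_def])
qed

lemma flat0_bounds: "0 \<le> flat 0 t" "flat 0 t \<le> 1" by (auto simp: flat_def)

lemma bump_bounds: "0 \<le> bump m a b x" "bump m a b x \<le> 1"
  unfolding bump_def by (auto intro!: prod_nonneg prod_le_1 mult_le_one simp: flat0_bounds)

lemma bump_support: "bump m a b x \<noteq> 0 \<longleftrightarrow> x \<in> box a b"
  by (auto simp: bump_def box_def flat_def zero_less_mult_iff)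

lemma bump_tendsto: "(\<lambda>m. bump m a b x) \<longlonglongrightarrow> indicator (box a b) x"
proof (cases "x \<in> box a b")
  case True
  have f: "(\<lambda>m. flat 0 (real (Suc m) * s)) \<longlonglongrightarrow> 1" if "s > 0" for s
  proof -
    have "(\<lambda>m. exp (- (1 / real (Suc m) * (1 / s)))) \<longlonglongrightarrow> exp (- (0 * (1 / s)))"
      by (intro tendsto_intros LIMSEQ_Suc lim_1_over_n)
    then show ?thesis using that by (simp add: flat_def)
  qed
  have "(\<lambda>m. bump m a b x) \<longlonglongrightarrow> (\<Prod>i\<in>(Basis::'a set). 1 * 1)"
    unfolding bump_def using True by (intro tendsto_prod tendsto_mult f) (auto simp: box_def)
  then show ?thesis using True by simp
next
  case False
  then have "bump m a b x = 0" for m using bump_support[of m a b x] by blast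
  then show ?thesis using False by simp
qed

section \<open>Test functions, integration of derivatives and the fundamental lemma\<close>

lemma test_funI:
  assumes "\<And>k. Ck k \<phi>" "compact K" "K \<subseteq> \<Omega>" "\<And>x. x \<notin> K \<Longrightarrow> \<phi> x = 0"
  shows "\<phi> \<in> test_fun \<Omega>"
proof -
  have s: "closure {x. \<phi> x \<noteq> 0} \<subseteq> K"
    by (rule closure_minimal) (use assms compact_imp_closed in auto)
  then have "compact (closure {x. \<phi> x \<noteq> 0})"
    using compact_Int_closed[OF assms(2) closed_closure, of "{x. \<phi> x \<noteq> 0}"] by (simp add: Int_absorb1)
  then show ?thesis using s assms by (auto simp: test_fun_def)
qed

lemma test_funD:
  assumes "\<phi> \<in> test_fun \<Omega>"
  obtains K where "\<And>k. Ck k \<phi>" "compact K" "K \<subseteq> \<Omega>" "\<And>x. x \<notin> K \<Longrightarrow> \<phi> x = 0"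
  using assms closure_subset[of "{x. \<phi> x \<noteq> 0}"] unfolding test_fun_def by blast

lemma test_fun_Ck: "\<phi> \<in> test_fun \<Omega> \<Longrightarrow> Ck k \<phi>"
  by (simp add: test_fun_def)

lemma test_fun_differentiable: "\<phi> \<in> test_fun \<Omega> \<Longrightarrow> \<phi> differentiable (at x)"
  using test_fun_Ck Ck_diff by blast

lemma test_fun_bump:
  assumes "cbox a b \<subseteq> \<Omega>" shows "bump m a b \<in> test_fun \<Omega>"
proof (rule test_funI[of _ "cbox a b"])
  show "bump m a b x = 0" if "x \<notin> cbox a b" for x
    using bump_support[of m a b x] that box_subset_cbox by blast
qed (use assms Ck_bump in auto)

lemma test_fun_add:
  assumes "\<phi> \<in> test_fun \<Omega>" "\<psi> \<in> test_fun \<Omega>" shows "(\<lambda>x. \<phi> x + \<psi> x) \<in> test_fun \<Omega>"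
proof -
  obtain K where K: "\<And>k. Ck k \<phi>" "compact K" "K \<subseteq> \<Omega>" "\<And>x. x \<notin> K \<Longrightarrow> \<phi> x = 0" by (rule test_funD[OF assms(1)]) blast
  obtain L where L: "\<And>k. Ck k \<psi>" "compact L" "L \<subseteq> \<Omega>" "\<And>x. x \<notin> L \<Longrightarrow> \<psi> x = 0" by (rule test_funD[OF assms(2)]) blast
  show ?thesis by (rule test_funI[of _ "K \<union> L"]) (use K L in \<open>auto intro: Ck_add\<close>)
qed

lemma test_fun_cmult:
  assumes "\<phi> \<in> test_fun \<Omega>" shows "(\<lambda>x. c * \<phi> x) \<in> test_fun \<Omega>"
proof -
  obtain K where K: "\<And>k. Ck k \<phi>" "compact K" "K \<subseteq> \<Omega>" "\<And>x. x \<notin> K \<Longrightarrow> \<phi> x = 0" by (rule test_funD[OF assms(1)]) blast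
  show ?thesis by (rule test_funI[of _ K]) (use K in \<open>auto intro: Ck_cmult\<close>)
qed

lemma partial_deriv_zero_outside:
  assumes "closed K" "\<And>x. x \<notin> K \<Longrightarrow> \<phi> x = 0" "x \<notin> K" shows "partial_deriv i \<phi> x = 0"
proof -
  have "((\<lambda>x. 0::real) has_derivative (\<lambda>h. 0)) (at x)" by simp
  then have "(\<phi> has_derivative (\<lambda>h. 0)) (at x)"
    by (rule has_derivative_transform_within_open[of _ _ _ _ "- K"]) (use assms in auto)
  then show ?thesis by (rule partial_derivI)
qed

lemma test_fun_partial:
  assumes "\<phi> \<in> test_fun \<Omega>" "i \<in> Basis" shows "partial_deriv i \<phi> \<in> test_fun \<Omega>"
proof -
  obtain K where K: "\<And>k. Ck k \<phi>" "compact K" "K \<subseteq> \<Omega>" "\<And>x. x \<notin> K \<Longrightarrow> \<phi> x = 0" by (rule test_funD[OF assms(1)]) blast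
  have "Ck k (partial_deriv i \<phi>)" for k using K(1)[of "Suc k"] assms(2) by simp
  then show ?thesis
    by (rule test_funI[of _ K]) (use K partial_deriv_zero_outside[OF compact_imp_closed[OF K(2)] K(4)] in auto)
qed

lemma compact_support_integrable:
  fixes f :: "'a::euclidean_space \<Rightarrow> real"
  assumes "continuous_on UNIV f" "compact K" "\<And>x. x \<notin> K \<Longrightarrow> f x = 0"
  shows "integrable lborel f" and "\<exists>M. \<forall>x. \<bar>f x\<bar> \<le> M"
proof -
  have "compact (f ` K)" by (intro compact_continuous_image assms continuous_on_subset[OF assms(1)]) auto
  then obtain M where M: "\<And>y. y \<in> f ` K \<Longrightarrow> norm y \<le> M" using compact_imp_bounded bounded_iff by metis
  have M': "\<bar>f x\<bar> \<le> max M 0" for x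
  proof (cases "x \<in> K")
    case True
    then have "\<bar>f x\<bar> \<le> M" using M[of "f x"] by simp
    then show ?thesis by simp
  qed (simp add: assms(3))
  then show "\<exists>M. \<forall>x. \<bar>f x\<bar> \<le> M" by blast
  show "integrable lborel f"
  proof (rule Bochner_Integration.integrable_bound)
    have "emeasure lborel K < \<infinity>" using assms(2) by (rule emeasure_compact_finite)
    then show "integrable lborel (\<lambda>x. max M 0 * indicator K x)"
      using borel_closed[OF compact_imp_closed[OF assms(2)]] by (intro integrable_mult_right integrable_real_indicator) auto
    show "f \<in> borel_measurable lborel" using borel_measurable_continuous_onI[OF assms(1)] by simp
    show "AE x in lborel. norm (f x) \<le> norm (max M 0 * indicator K x)"
      using M' assms(3) by (auto simp: indicator_def)
  qed
qed

text \<open>Difference quotients in a coordinate direction have integral zero by translation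
  invariance of Lebesgue measure, and they converge to the derivative with an integrable
  bound.\<close>

lemma integral_partial_deriv_zero:
  fixes F :: "'a::euclidean_space \<Rightarrow> real"
  assumes "\<And>x. F differentiable (at x)" "continuous_on UNIV (partial_deriv i F)"
    and K: "compact K" "\<And>x. x \<notin> K \<Longrightarrow> F x = 0" and i: "i \<in> Basis"
  shows "(LINT x|lborel. partial_deriv i F x) = 0"
proof -
  have cF: "continuous_on UNIV F"
    using assms(1) by (simp add: continuous_at_imp_continuous_on differentiable_imp_continuous_within)
  note F_int = compact_support_integrable(1)[OF cF K]
  have pz: "partial_deriv i F x = 0" if "x \<notin> K" for x
    by (rule partial_deriv_zero_outside[OF compact_imp_closed[OF K(1)] K(2) that])
  obtain M where M: "\<And>x. \<bar>partial_deriv i F x\<bar> \<le> M"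
    using compact_support_integrable(2)[OF assms(2) K(1) pz] by blast
  obtain R where R: "\<And>x. x \<in> K \<Longrightarrow> norm x \<le> R" using compact_imp_bounded[OF K(1)] bounded_iff by metis
  have D: "((\<lambda>t. F (x + t *\<^sub>R i)) has_real_derivative partial_deriv i F (x + t *\<^sub>R i)) (at t)" for x t
  proof -
    have "((\<lambda>t. x + t *\<^sub>R i) has_derivative (\<lambda>h. h *\<^sub>R i)) (at t)" by (auto intro!: derivative_eq_intros)
    moreover have dF: "(F has_derivative frechet_derivative F (at y)) (at y)" for y
      using assms(1) by (simp add: frechet_derivative_works)
    ultimately have "((\<lambda>t. F (x + t *\<^sub>R i)) has_derivative (\<lambda>h. frechet_derivative F (at (x + t *\<^sub>R i)) (h *\<^sub>R i))) (at t)"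
      by (rule has_derivative_compose)
    then show ?thesis unfolding has_field_derivative_def partial_deriv_def
      by (rule has_derivative_eq_rhs)
        (simp add: linear_cmul[OF has_derivative_linear[OF dF]] mult.commute fun_eq_iff)
  qed
  define s where "s n x = (F (x + (1 / real (Suc n)) *\<^sub>R i) - F x) * real (Suc n)" for n x
  have lim: "(\<lambda>n. s n x) \<longlonglongrightarrow> partial_deriv i F x" for x
  proof -
    have "((\<lambda>h. (F (x + (0 + h) *\<^sub>R i) - F (x + 0 *\<^sub>R i)) / h) \<longlongrightarrow> partial_deriv i F (x + 0 *\<^sub>R i)) (at 0)"
      using D[of x 0] unfolding DERIV_def .
    moreover have "filterlim (\<lambda>n. 1 / real (Suc n)) (at 0) sequentially"
      unfolding filterlim_at by (intro conjI LIMSEQ_Suc lim_1_over_n) auto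
    ultimately have "(\<lambda>n. (F (x + (0 + 1 / real (Suc n)) *\<^sub>R i) - F (x + 0 *\<^sub>R i)) / (1 / real (Suc n))) \<longlonglongrightarrow> partial_deriv i F (x + 0 *\<^sub>R i)"
      by (rule filterlim_compose)
    then show ?thesis by (simp add: s_def mult.commute)
  qed
  \<comment> \<open>The mean value theorem supplies \<open>M\<close>. Steps have length at most 1,
    so all supports lie in the ball whose radius is enlarged by 1.\<close>
  have sb: "\<bar>s n x\<bar> \<le> M * indicator (cball 0 (R + 1)) x" for n x
  proof -
    define t where "t = 1 / real (Suc n)"
    have t: "t > 0" "t \<le> 1" by (auto simp: t_def)
    obtain z where z: "F (x + t *\<^sub>R i) - F (x + 0 *\<^sub>R i) = (t - 0) * partial_deriv i F (x + z *\<^sub>R i)"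
      using MVT2[OF t(1), of "\<lambda>t. F (x + t *\<^sub>R i)" "\<lambda>t. partial_deriv i F (x + t *\<^sub>R i)"] D by blast
    have "s n x = (F (x + t *\<^sub>R i) - F (x + 0 *\<^sub>R i)) / t" by (simp add: s_def t_def mult.commute)
    then have "s n x = partial_deriv i F (x + z *\<^sub>R i)" using z t by simp
    then have 1: "\<bar>s n x\<bar> \<le> M" using M by simp
    show ?thesis
    proof (cases "x \<in> cball 0 (R + 1)")
      case False
      then have nx: "norm x > R + 1" by simp
      have "norm (x + t *\<^sub>R i) \<ge> norm x - norm (t *\<^sub>R i)"
        using norm_triangle_ineq2[of x "- (t *\<^sub>R i)"] by simp
      then have "norm (x + t *\<^sub>R i) > R" using nx t i by simp
      then have "x \<notin> K" "x + t *\<^sub>R i \<notin> K" using R nx by force+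
      then have "F x = 0" "F (x + t *\<^sub>R i) = 0" by (simp_all add: K(2))
      moreover have "s n x = (F (x + t *\<^sub>R i) - F x) * real (Suc n)" by (simp only: s_def t_def)
      ultimately show ?thesis using False by simp
    qed (use 1 in simp)
  qed
  have si: "(LINT x|lborel. s n x) = 0" for n
  proof -
    define v where "v = (1 / real (Suc n)) *\<^sub>R i"
    have m: "F \<in> borel_measurable borel" by (rule borel_measurable_continuous_onI[OF cF])
    have "(LINT x|lborel. F x) = (LINT x|distr lborel borel ((+) v). F x)" by (simp add: lborel_distr_plus)
    also have "\<dots> = (LINT x|lborel. F (v + x))" by (rule integral_distr) (use m in simp_all)
    finally have e: "(LINT x|lborel. F (x + v)) = (LINT x|lborel. F x)" by (simp add: add.commute)
    have "integrable (distr lborel borel ((+) v)) F" using F_int by (simp add: lborel_distr_plus)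
    then have "integrable lborel (\<lambda>x. F (v + x))" by (subst (asm) integrable_distr_eq) (use m in simp_all)
    then have "integrable lborel (\<lambda>x. F (x + v))" by (simp add: add.commute)
    moreover have "s n x = (F (x + v) - F x) * real (Suc n)" for x by (simp only: s_def v_def)
    ultimately show ?thesis using F_int e by simp
  qed
  have "(\<lambda>n. LINT x|lborel. s n x) \<longlonglongrightarrow> (LINT x|lborel. partial_deriv i F x)"
  proof (rule integral_dominated_convergence[where w="\<lambda>x. M * indicator (cball 0 (R + 1)) x"])
    show "partial_deriv i F \<in> borel_measurable lborel" using borel_measurable_continuous_onI[OF assms(2)] by simp
    show "s n \<in> borel_measurable lborel" for n
    proof -
      have "continuous_on UNIV (s n)" unfolding s_def
        by (intro continuous_intros continuous_on_compose2[OF cF]) auto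
      then show ?thesis using borel_measurable_continuous_onI by auto
    qed
    show "integrable lborel (\<lambda>x. M * indicator (cball 0 (R + 1)) x)"
      by (intro integrable_mult_right integrable_real_indicator emeasure_compact_finite[THEN less_le_trans]) auto
  qed (use lim sb in auto)
  then show ?thesis using si by (simp add: LIMSEQ_const_iff)
qed

text \<open>Dynkin's argument: boxes are stable under intersection and generate the Borel sets, so
  all integrals of \<open>f\<close> over Borel sets vanish, among them those over the sets where
  \<open>f\<close> is positive or negative.\<close>

lemma integral_zero_boxes_imp_AE_zero:
  fixes f :: "'a::euclidean_space \<Rightarrow> real"
  assumes f: "integrable lborel f" and out: "\<And>x. x \<notin> box a b \<Longrightarrow> f x = 0"
    and z: "\<And>c d. (LINT x|lborel. indicator (box c d) x * f x) = 0"
  shows "AE x in lborel. f x = 0"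
proof -
  have fm [measurable]: "f \<in> borel_measurable borel" using f by auto
  have int: "integrable lborel (\<lambda>x. indicator A x * f x)" if "A \<in> sets borel" for A
    using integrable_mult_indicator[of A lborel f] f that by simp
  \<comment> \<open>Passing to complements requires the total integral; it is the integral over a
    box because \<open>f\<close> vanishes outside one.\<close>
  have tot: "(LINT x|lborel. f x) = 0"
  proof -
    have "(\<lambda>x. indicator (box a b) x * f x) = f" using out by (auto simp: indicator_def fun_eq_iff)
    then show ?thesis using z[of a b] by simp
  qed
  have zero: "(LINT x|lborel. indicator A x * f x) = 0" if "A \<in> sets borel" for A
  proof -
    have "Int_stable (range (\<lambda>(a, b). box a b :: 'a set))" by (auto simp: Int_stable_def box_Int_box)
    moreover have "range (\<lambda>(a, b). box a b :: 'a set) \<subseteq> Pow UNIV" by auto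
    moreover have "A \<in> sigma_sets UNIV (range (\<lambda>(a, b). box a b))" using that unfolding borel_eq_box by simp
    ultimately show ?thesis
    proof (induction rule: sigma_sets_induct_disjoint)
      case (basic A) then show ?case using z by auto
    next
      case empty then show ?case by simp
    next
      case (compl A)
      then have A: "A \<in> sets borel" by (simp add: borel_eq_box)
      have "(LINT x|lborel. indicator (UNIV - A) x * f x) = (LINT x|lborel. f x - indicator A x * f x)"
        by (intro Bochner_Integration.integral_cong) (auto simp: indicator_def)
      then show ?case using f int[OF A] compl tot by simp
    next
      case (union F)
      then have F: "\<And>i. F i \<in> sets borel" by (simp add: borel_eq_box subset_eq)
      have "(LINT x:(\<Union>i. F i)|lborel. f x) = (\<Sum>i. (LINT x:(F i)|lborel. f x))"
      proof (rule lebesgue_integral_countable_add)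
        show "set_integrable lborel (\<Union> (range F)) f"
          unfolding set_integrable_def using int[of "\<Union> (range F)"] F by auto
        show "i \<noteq> j \<Longrightarrow> F i \<inter> F j = {}" for i j using union(1) by (auto simp: disjoint_family_on_def)
      qed (use F in auto)
      then show ?case using union by (simp add: set_lebesgue_integral_def)
    qed
  qed
  have "(LINT x|lborel. \<bar>f x\<bar>) = (LINT x|lborel. indicator {x. f x > 0} x * f x - indicator {x. f x < 0} x * f x)"
    by (intro Bochner_Integration.integral_cong) (auto simp: indicator_def)
  also have "\<dots> = 0"
    using zero[of "{x. f x > 0}"] zero[of "{x. f x < 0}"] int[of "{x. f x > 0}"] int[of "{x. f x < 0}"] by simp
  finally show ?thesis using f by (simp add: integral_nonneg_eq_0_iff_AE)
qed

locale open_domain = domain \<Omega> for \<Omega> :: "'a::euclidean_space set" +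
  assumes open_dom: "open \<Omega>"
begin

lemma integral_dom_lborel:
  assumes "f \<in> borel_measurable borel" "\<And>x. x \<notin> \<Omega> \<Longrightarrow> f x = (0::real)"
  shows "(LINT x|lebesgue_on \<Omega>. f x) = (LINT x|lborel. f x)"
proof -
  have "(LINT x|lebesgue_on \<Omega>. f x) = (LINT x|lebesgue. (if x \<in> \<Omega> then f x else 0))"
    by (rule Lebesgue_Measure.integral_restrict_UNIV[OF sets_dom, symmetric])
  also have "(\<lambda>x. if x \<in> \<Omega> then f x else 0) = f" using assms(2) by auto
  also have "(LINT x|lebesgue. f x) = (LINT x|lborel. f x)" by (rule integral_completion) (use assms(1) in simp)
  finally show ?thesis .
qed

text \<open>The statement is proved on open boxes whose closure lies in \<Omega>, where bump
  functions approximate indicators of smaller boxes, and is then spread over a countable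
  cover.\<close>

lemma fundamental_lemma:
  assumes g: "g \<in> L2 \<Omega>" and z: "\<And>\<phi>. \<phi> \<in> test_fun \<Omega> \<Longrightarrow> (LINT x|lebesgue_on \<Omega>. g x * \<phi> x) = (0::real)"
  shows "AE x in lebesgue_on \<Omega>. g x = 0"
proof -
  define g0 where "g0 x = (if x \<in> \<Omega> then g x else 0)" for x
  have g0: "l2c lebesgue g0" using g unfolding L2_ext g0_def .
  then have "g0 \<in> borel_measurable lebesgue" using l2c_borel_iff[OF complete_measure_lebesgue] by blast
  \<comment> \<open>A Borel version of the extension by zero: the argument with boxes takes place in
    the Borel measure space.\<close>
  then obtain g1 where g1: "g1 \<in> borel_measurable lborel" "AE x in lborel. g0 x = g1 x"
    using completion_ex_borel_measurable_real by blast
  have g1b [measurable]: "g1 \<in> borel_measurable borel" using g1(1) by simp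
  have ae: "AE x in lebesgue. g0 x = g1 x" using g1(2) by (rule AE_completion)
  have l1: "l2c lebesgue g1" by (rule l2c_cong_AE[OF ae g0 complete_measure_lebesgue])
  have box0: "AE x in lborel. x \<in> box a b \<longrightarrow> g1 x = 0" if ab: "cbox a b \<subseteq> \<Omega>" for a b
  proof -
    define f where "f x = indicator (box a b) x * g1 x" for x
    have ind: "l2c lebesgue (indicator (box c d) :: 'a \<Rightarrow> real)" for c d
      unfolding l2c_borel_iff[OF complete_measure_lebesgue]
    proof
      show "(indicator (box c d) :: 'a \<Rightarrow> real) \<in> borel_measurable lebesgue" by (intro borel_measurable_indicator) auto
      have "(\<lambda>x. (norm (indicator (box c d) x :: real))\<^sup>2) = indicator (box c d)" by (auto simp: indicator_def)
      moreover have "integrable lebesgue (indicator (box c d) :: 'a \<Rightarrow> real)"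
        by (rule integrable_real_indicator) (auto simp: emeasure_lborel_box_finite[unfolded infinity_ennreal_def])
      ultimately show "integrable lebesgue (\<lambda>x. (norm (indicator (box c d) x :: real))\<^sup>2)" by simp
    qed
    have fi: "integrable lborel f"
    proof -
      have "integrable lebesgue f"
        using completion.integrable_inner[OF ind[of a b] l1] by (simp add: f_def[abs_def])
      then show ?thesis unfolding f_def[abs_def] by (subst (asm) integrable_completion) measurable
    qed
    have "AE x in lborel. f x = 0"
    proof (rule integral_zero_boxes_imp_AE_zero[OF fi, of a b])
      show "f x = 0" if "x \<notin> box a b" for x using that by (simp add: f_def)
      fix c d
      \<comment> \<open>The intersection of two boxes is a box, and its bump functions are supported
        inside \<Omega>.\<close>
      obtain e h where eh: "box c d \<inter> box a b = box e h" using box_Int_box[of c d a b] by blast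
      show "(LINT x|lborel. indicator (box c d) x * f x) = 0"
      proof (cases "box e h = {}")
        case True
        then have "(\<lambda>x. indicator (box c d) x * f x) = (\<lambda>x. 0)"
          using eh by (auto simp: f_def indicator_def fun_eq_iff)
        then show ?thesis by simp
      next
        case False
        then have "cbox e h \<subseteq> cbox a b" using eh subset_box(2,4) by (metis inf_le2 box_subset_cbox closure_box closure_minimal closed_cbox order_trans)
        then have t: "bump m e h \<in> test_fun \<Omega>" for m using ab by (intro test_fun_bump) auto
        have "(\<lambda>m. LINT x|lborel. bump m e h x * f x) \<longlonglongrightarrow> (LINT x|lborel. indicator (box e h) x * f x)"
        proof (rule integral_dominated_convergence[where w="\<lambda>x. \<bar>f x\<bar>"])
          show "(\<lambda>x. bump m e h x * f x) \<in> borel_measurable lborel" for m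
            using fi borel_measurable_continuous_onI[OF Ck_continuous[OF Ck_bump[of 0 m e h]]] by auto
          show "AE x in lborel. norm (bump m e h x * f x) \<le> \<bar>f x\<bar>" for m
            using bump_bounds[of m e h] by (auto simp: abs_mult intro!: mult_left_le_one_le AE_I2)
          show "AE x in lborel. (\<lambda>m. bump m e h x * f x) \<longlonglongrightarrow> indicator (box e h) x * f x"
            by (intro AE_I2 tendsto_mult tendsto_const bump_tendsto)
        qed (use fi in auto)
        moreover have "(LINT x|lborel. bump m e h x * f x) = 0" for m
        proof -
          have bo: "bump m e h x = 0" if "x \<notin> box a b" for x using bump_support[of m e h x] eh that by blast
          have bm [measurable]: "bump m e h \<in> borel_measurable borel"
            by (rule borel_measurable_continuous_onI[OF Ck_continuous[OF Ck_bump[of 0 m e h]]])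
          have "(LINT x|lborel. bump m e h x * f x) = (LINT x|lborel. bump m e h x * g1 x)"
            using bo by (intro Bochner_Integration.integral_cong) (auto simp: f_def indicator_def)
          also have "\<dots> = (LINT x|lebesgue. bump m e h x * g1 x)" by (rule integral_completion[symmetric]) measurable
          also have "\<dots> = (LINT x|lebesgue. (if x \<in> \<Omega> then g x * bump m e h x else 0))"
          proof (rule integral_cong_AE)
            show "AE x in lebesgue. bump m e h x * g1 x = (if x \<in> \<Omega> then g x * bump m e h x else 0)"
              using ae
            proof eventually_elim
              case (elim x)
              show ?case
              proof (cases "x \<in> \<Omega>")
                case False
                then have "x \<notin> box a b" using ab box_subset_cbox[of a b] by blast
                then show ?thesis using False bo by simp
              qed (use elim in \<open>simp add: g0_def\<close>)
            qed
            have "(\<lambda>x. g0 x * bump m e h x) \<in> borel_measurable lebesgue"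
            proof (rule borel_measurable_times[OF \<open>g0 \<in> borel_measurable lebesgue\<close>])
              show "bump m e h \<in> borel_measurable lebesgue" by (intro measurable_completion) (use bm in simp)
            qed
            moreover have "(\<lambda>x. g0 x * bump m e h x) = (\<lambda>x. if x \<in> \<Omega> then g x * bump m e h x else 0)"
              by (auto simp: g0_def)
            ultimately show "(\<lambda>x. if x \<in> \<Omega> then g x * bump m e h x else 0) \<in> borel_measurable lebesgue" by simp
            show "(\<lambda>x. bump m e h x * g1 x) \<in> borel_measurable lebesgue" by (intro measurable_completion) measurable
          qed
          also have "\<dots> = (LINT x|lebesgue_on \<Omega>. g x * bump m e h x)"
            by (rule Lebesgue_Measure.integral_restrict_UNIV[OF sets_dom])
          also have "\<dots> = 0" by (rule z[OF t])
          finally show ?thesis .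
        qed
        ultimately have "(LINT x|lborel. indicator (box e h) x * f x) = 0" by (simp add: LIMSEQ_const_iff)
        moreover have "(\<lambda>x. indicator (box c d) x * f x) = (\<lambda>x. indicator (box e h) x * f x)"
          using eh by (auto simp: f_def indicator_def fun_eq_iff)
        ultimately show ?thesis by (simp only:)
      qed
    qed
    then show ?thesis by eventually_elim (auto simp: f_def indicator_def)
  qed
  obtain \<D> where D: "countable \<D>" "\<Union>\<D> = \<Omega>" "\<And>X. X \<in> \<D> \<Longrightarrow> \<exists>a b. X = box a b \<and> cbox a b \<subseteq> \<Omega>"
  proof -
    define \<D> where "\<D> = {X. \<exists>a b. X = box a b \<and> cbox a b \<subseteq> \<Omega>}"
    have op: "\<And>X. X \<in> \<D> \<Longrightarrow> open X" unfolding \<D>_def by auto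
    \<comment> \<open>The Lindeloef property leaves countably many boxes, hence a countable union of
      null sets.\<close>
    obtain \<D>' where D': "\<D>' \<subseteq> \<D>" "countable \<D>'" "\<Union>\<D>' = \<Union>\<D>" using Lindelof[OF op] by metis
    have "\<Union>\<D> = \<Omega>"
    proof
      show "\<Union>\<D> \<subseteq> \<Omega>" unfolding \<D>_def using box_subset_cbox by blast
      show "\<Omega> \<subseteq> \<Union>\<D>"
      proof
        fix x assume x: "x \<in> \<Omega>"
        then obtain a b where "cbox a b \<subseteq> \<Omega>" "x \<in> box a b"
          using open_contains_cbox[OF open_dom x] by metis
        then show "x \<in> \<Union>\<D>" unfolding \<D>_def by blast
      qed
    qed
    with D' show thesis by (intro that[of \<D>']) (auto simp: \<D>_def)
  qed
  have "AE x in lborel. \<forall>X\<in>\<D>. x \<in> X \<longrightarrow> g1 x = 0"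
  proof (rule AE_ball_countable[THEN iffD2, OF D(1)], rule ballI)
    fix X assume "X \<in> \<D>"
    then show "AE x in lborel. x \<in> X \<longrightarrow> g1 x = 0" using D(3) box0 by blast
  qed
  then have "AE x in lebesgue. \<forall>X\<in>\<D>. x \<in> X \<longrightarrow> g1 x = 0" by (rule AE_completion)
  then have "AE x in lebesgue. x \<in> \<Omega> \<longrightarrow> g x = 0"
    using ae
  proof eventually_elim
    case (elim x)
    show ?case
    proof
      assume x: "x \<in> \<Omega>"
      then have "g1 x = 0" using elim(1) D(2) by blast
      then show "g x = 0" using elim(2) x by (simp add: g0_def)
    qed
  qed
  then show ?thesis using sets_dom by (simp add: AE_restrict_space_iff)
qed

end

section \<open>Linear systems of ordinary differential equations\<close>

context time_interval
begin

sublocale JD: domain "{0<..<T}"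
  by standard auto

lemma l2n_le_T:
  assumes "antideriv u v" shows "l2n J u \<le> T * l2n J v"
proof -
  have "l2n J u \<le> (sqrt T * l2n J v) * l2n J (\<lambda>t. 1::real)"
    using antideriv_norm_le[OF assms]
    by (intro J.l2n_mono antideriv_l2c_fun[OF assms] l2c_const AE_I2) (use T_pos in auto)
  also have "l2n J (\<lambda>t. 1::real) = sqrt T" using T_pos by (simp add: l2n_def measure_J)
  also have "sqrt T * l2n J v * sqrt T = (sqrt T * sqrt T) * l2n J v" by (simp only: mult_ac)
  also have "sqrt T * sqrt T = T" using T_pos by simp
  finally show ?thesis .
qed

lemma prim_cong_AE:
  fixes v :: "real \<Rightarrow> 'b::euclidean_space"
  assumes "AE t in J. v t = v' t" "l2c J v" "t \<in> {0..T}"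
  shows "prim v t = prim v' t"
proof (rule euclidean_eqI)
  fix i :: 'b
  have v': "l2c J v'" by (rule l2c_cong_AE[OF assms(1,2) J.complete_measure_axioms])
  show "prim v t \<bullet> i = prim v' t \<bullet> i"
    using antideriv_inner[OF antideriv_cong_AE[OF antideriv_prim[OF assms(2)] assms(1)] assms(3)]
      antideriv_inner[OF antideriv_prim[OF v'] assms(3)] by simp
qed

lemma prim_linear:
  fixes v w :: "real \<Rightarrow> 'b::euclidean_space"
  assumes "l2c J v" "l2c J w" "t \<in> {0..T}"
  shows "prim (\<lambda>t. v t + w t) t = prim v t + prim w t" "prim (\<lambda>t. c *\<^sub>R v t) t = c *\<^sub>R prim v t"
proof -
  note v = antideriv_prim[OF assms(1)] and w = antideriv_prim[OF assms(2)]
  show "prim (\<lambda>t. v t + w t) t = prim v t + prim w t"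
    by (rule euclidean_eqI) (simp only: antideriv_inner[OF antideriv_add[OF v w] assms(3)]
      antideriv_inner[OF antideriv_prim[OF J.l2c_add[OF assms(1,2)]] assms(3)])
  show "prim (\<lambda>t. c *\<^sub>R v t) t = c *\<^sub>R prim v t"
    by (rule euclidean_eqI) (simp only: antideriv_inner[OF antideriv_scaleR[OF v, of c] assms(3)]
      antideriv_inner[OF antideriv_prim[OF J.l2c_scaleR[OF assms(1), of c]] assms(3)])
qed

lemma AE_lebesgue_J: "AE x in lebesgue. P x \<Longrightarrow> AE t in J. P t"
  by (subst AE_restrict_space_iff) (auto elim: eventually_mono)

text \<open>The derivative is taken as the unknown. In the Hilbert space of square integrable
  functions on the interval the system reads \<open>x + Kop x = F\<close>, where \<open>Kop\<close>
  integrates from 0 and then applies \<open>K\<close>; such an equation is solved by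
  \<open>monotone_perturbation_surj\<close>.\<close>

lemma linear_ode:
  fixes K :: "real^'n^'n" and F :: "real \<Rightarrow> real^'n"
  assumes sym: "transpose K = K" and pos: "\<And>y. 0 \<le> y \<bullet> (K *v y)" and F: "l2c J F"
  obtains q q' where "antideriv q q'" "AE t in J. q' t + K *v q t = F t"
proof -
  have KL: "bounded_linear ((*v) K)" by (rule matrix_vector_mul_bounded_linear)
  have Ks: "(K *v x) \<bullet> y = x \<bullet> (K *v y)" for x y
    using sym by (metis dot_lmul_matrix inner_commute transpose_matrix_vector)
  have rl: "l2c J (rep_ltwo h)" for h :: "(real, real^'n) ltwo" using JD.rep_L2 JD.L2_iff by blast
  define V where "V h t = K *v prim (rep_ltwo h) t" for h :: "(real, real^'n) ltwo" and t
  have aV: "antideriv (V h) (\<lambda>t. K *v rep_ltwo h t)" for h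
    unfolding V_def by (rule antideriv_linear[OF antideriv_prim[OF rl] KL Ks])
  have VL: "V h \<in> L2 {0<..<T}" for h using antideriv_l2c_fun[OF aV] JD.L2_iff by blast
  define Kop where "Kop h = cls {0<..<T} (V h)" for h
  have eqJ: "cls {0<..<T} f = cls {0<..<T} g"
    if "\<And>t. t \<in> {0<..<T} \<Longrightarrow> f t = g t" "f \<in> L2 {0<..<T}" "g \<in> L2 {0<..<T}" for f g :: "real \<Rightarrow> real^'n"
    using JD.cls_eq_iff[OF that(2,3)] that(1) by (auto intro: AE_I2)
  have bl: "bounded_linear Kop"
  proof -
    obtain C where C: "C > 0" "\<And>x. norm (K *v x) \<le> norm x * C"
      using bounded_linear.pos_bounded[OF KL] by blast
    show ?thesis
    proof (rule bounded_linear_intro[of _ "C * T"])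
      fix h h' :: "(real, real^'n) ltwo" and c :: real
      have "AE x in lebesgue. rep_ltwo (h + h') x = rep_ltwo h x + rep_ltwo h' x"
        using abs_ltwo_eq_iff[OF rep_ltwo_l2c[of "h + h'"] completion.l2c_add[OF rep_ltwo_l2c[of h] rep_ltwo_l2c[of h']]]
          plus_ltwo.abs_eq[of "rep_ltwo h" "rep_ltwo h'"] rep_ltwo_l2c[of h] rep_ltwo_l2c[of h']
        by (simp add: abs_rep_ltwo)
      then have "prim (rep_ltwo (h + h')) t = prim (rep_ltwo h) t + prim (rep_ltwo h') t" if "t \<in> {0..T}" for t
        using prim_cong_AE[OF AE_lebesgue_J rl that] prim_linear(1)[OF rl rl that] by metis
      then have "Kop (h + h') = cls {0<..<T} (\<lambda>t. V h t + V h' t)"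
        unfolding Kop_def by (intro eqJ VL JD.L2_add) (simp add: V_def matrix_vector_right_distrib)
      then show "Kop (h + h') = Kop h + Kop h'" by (simp add: Kop_def JD.cls_add[OF VL VL])
      have "AE x in lebesgue. rep_ltwo (c *\<^sub>R h) x = c *\<^sub>R rep_ltwo h x"
        using abs_ltwo_eq_iff[OF rep_ltwo_l2c[of "c *\<^sub>R h"] completion.l2c_scaleR[OF rep_ltwo_l2c[of h]]]
          scaleR_ltwo.abs_eq[of "rep_ltwo h" c] rep_ltwo_l2c[of h]
        by (simp add: abs_rep_ltwo)
      then have "prim (rep_ltwo (c *\<^sub>R h)) t = c *\<^sub>R prim (rep_ltwo h) t" if "t \<in> {0..T}" for t
        using prim_cong_AE[OF AE_lebesgue_J rl that] prim_linear(2)[OF rl rl that] by metis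
      then have "Kop (c *\<^sub>R h) = cls {0<..<T} (\<lambda>t. c *\<^sub>R V h t)"
        unfolding Kop_def
        by (intro eqJ VL JD.L2_scaleR) (simp add: V_def scaleR_matrix_vector_assoc[symmetric] matrix_vector_mult_scaleR)
      then show "Kop (c *\<^sub>R h) = c *\<^sub>R Kop h" by (simp add: Kop_def JD.cls_scaleR[OF VL])
      have "norm (Kop h) = l2n J (V h)" by (simp add: Kop_def JD.norm_cls[OF VL] JD.L2_norm_eq)
      also have "\<dots> \<le> T * l2n J (\<lambda>t. K *v rep_ltwo h t)" by (rule l2n_le_T[OF aV])
      also have "\<dots> \<le> T * (C * l2n J (rep_ltwo h))"
        using T_pos C by (intro mult_left_mono J.l2n_mono J.l2c_linear[OF KL] rl AE_I2) (auto simp: mult.commute)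
      also have "l2n J (rep_ltwo h) \<le> norm h"
        using JD.cls_rep_diff_le[OF JD.L2_zero, of h] by (simp add: JD.cls_zero JD.norm_cls[OF JD.rep_L2] JD.L2_norm_eq)
      finally show "norm (Kop h) \<le> norm h * (C * T)" using T_pos C by (simp add: mult_ac)
    qed
  qed
  \<comment> \<open>By the energy identity the quadratic form of \<open>Kop\<close> is half the
    value of the form of \<open>K\<close> at the final time of the primitive.\<close>
  have pos': "0 \<le> h \<bullet> Kop h" for h
  proof -
    have "h \<bullet> Kop h = cls {0<..<T} (rep_ltwo h) \<bullet> cls {0<..<T} (V h)"
      by (simp only: Kop_def JD.inner_cls_rep[OF VL])
    also have "\<dots> = (LINT t|J. rep_ltwo h t \<bullet> V h t)"
      by (simp only: JD.inner_cls[OF JD.rep_L2 VL] L2_inner_def)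
    also have "2 * \<dots> = prim (rep_ltwo h) T \<bullet> (K *v prim (rep_ltwo h) T)"
      unfolding V_def by (rule antideriv_energy[OF antideriv_prim[OF rl] KL Ks])
    finally show ?thesis using pos[of "prim (rep_ltwo h) T"] by linarith
  qed
  obtain x where x: "x + Kop x = cls {0<..<T} F" using monotone_perturbation_surj[OF bl pos'] by blast
  have FL: "F \<in> L2 {0<..<T}" using F JD.L2_iff by blast
  have xc: "x = cls {0<..<T} (\<lambda>t. F t - V x t)" using x by (simp add: JD.cls_diff[OF FL VL] Kop_def algebra_simps)
  have gL: "(\<lambda>t. F t - V x t) \<in> L2 {0<..<T}" by (rule JD.L2_diff[OF FL VL])
  \<comment> \<open>\<open>x\<close> is the class of a function on the interval, so restricting its
    representative changes nothing and the equation between classes becomes one almost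
    everywhere.\<close>
  have "cls {0<..<T} (rep_ltwo x) = x"
    by (rule JD.cls_rep_eqI[of "\<lambda>k t. F t - V x t"]) (use xc gL in auto)
  then have "AE t in J. rep_ltwo x t = F t - V x t"
    using JD.cls_eq_iff[OF JD.rep_L2 gL, of x] xc by simp
  then have "AE t in J. rep_ltwo x t + K *v prim (rep_ltwo x) t = F t"
    by eventually_elim (simp add: V_def)
  with antideriv_prim[OF rl] that show thesis by blast
qed

end

section \<open>Sobolev functions\<close>

lemma subspace_closure:
  fixes S :: "'a::real_normed_vector set"
  assumes "subspace S" shows "subspace (closure S)"
proof (rule subspaceI)
  show "0 \<in> closure S" using subspace_0[OF assms] closure_subset by blast
next
  fix x y assume "x \<in> closure S" "y \<in> closure S"
  then obtain f g where fg: "\<forall>n::nat. f n \<in> S" "f \<longlonglongrightarrow> x" "\<forall>n::nat. g n \<in> S" "g \<longlonglongrightarrow> y"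
    unfolding closure_sequential by blast
  have "\<forall>n. f n + g n \<in> S" using fg(1,3) subspace_add[OF assms] by blast
  then show "x + y \<in> closure S" unfolding closure_sequential using tendsto_add[OF fg(2,4)]
    by (intro exI[of _ "\<lambda>n. f n + g n"] conjI)
next
  fix c x assume "x \<in> closure S"
  then obtain f where f: "\<forall>n::nat. f n \<in> S" "f \<longlonglongrightarrow> x" unfolding closure_sequential by blast
  have "\<forall>n. c *\<^sub>R f n \<in> S" using f(1) subspace_scale[OF assms] by blast
  then show "c *\<^sub>R x \<in> closure S" unfolding closure_sequential using tendsto_scaleR[OF tendsto_const f(2)]
    by (intro exI[of _ "\<lambda>n. c *\<^sub>R f n"] conjI)
qed

definition grad :: "('a::euclidean_space \<Rightarrow> real) \<Rightarrow> 'a \<Rightarrow> 'a" where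
  "grad \<phi> x = (\<Sum>i\<in>Basis. partial_deriv i \<phi> x *\<^sub>R i)"

lemma grad_inner: "i \<in> Basis \<Longrightarrow> grad \<phi> x \<bullet> i = partial_deriv i \<phi> x"
  by (simp add: grad_def)

context open_domain
begin

lemma compact_support_L2:
  fixes f :: "'a \<Rightarrow> 'b::euclidean_space"
  assumes "continuous_on UNIV f" "compact K" "K \<subseteq> \<Omega>" "\<And>x. x \<notin> K \<Longrightarrow> f x = 0"
  shows "f \<in> L2 \<Omega>"
proof -
  have "integrable lborel (\<lambda>x. (norm (f x))\<^sup>2)"
    by (rule compact_support_integrable(1)[OF _ assms(2)]) (use assms in \<open>auto intro!: continuous_intros\<close>)
  moreover have fb: "f \<in> borel_measurable borel" by (rule borel_measurable_continuous_onI[OF assms(1)])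
  ultimately have "integrable lebesgue (\<lambda>x. (norm (f x))\<^sup>2)"
    by (subst integrable_completion) measurable
  moreover have "f \<in> borel_measurable lebesgue" by (intro measurable_completion) (use fb in simp)
  ultimately have "l2c lebesgue f" using l2c_borel_iff[OF complete_measure_lebesgue] by blast
  moreover have "(\<lambda>x. if x \<in> \<Omega> then f x else 0) = f" using assms by (auto simp: fun_eq_iff)
  ultimately show ?thesis unfolding L2_ext by simp
qed

lemma test_continuous: "\<phi> \<in> test_fun \<Omega> \<Longrightarrow> continuous_on UNIV \<phi>"
  using test_fun_Ck[of \<phi> \<Omega> 0] by simp

lemma test_L2: "\<phi> \<in> test_fun \<Omega> \<Longrightarrow> \<phi> \<in> L2 \<Omega>"
  by (erule test_funD) (rule compact_support_L2, auto dest: Ck_continuous)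

lemma grad_L2:
  assumes "\<phi> \<in> test_fun \<Omega>" shows "grad \<phi> \<in> L2 \<Omega>"
proof -
  obtain K where K: "\<And>k. Ck k \<phi>" "compact K" "K \<subseteq> \<Omega>" "\<And>x. x \<notin> K \<Longrightarrow> \<phi> x = 0"
    by (rule test_funD[OF assms]) blast
  show ?thesis
  proof (rule compact_support_L2[OF _ K(2,3)])
    show "continuous_on UNIV (grad \<phi>)" unfolding grad_def
      by (intro continuous_intros test_continuous test_fun_partial assms)
    show "grad \<phi> x = 0" if "x \<notin> K" for x
      unfolding grad_def using partial_deriv_zero_outside[OF compact_imp_closed[OF K(2)] K(4) that] by simp
  qed
qed

lemma test_scaleR_L2: "\<psi> \<in> test_fun \<Omega> \<Longrightarrow> (\<lambda>x. \<psi> x *\<^sub>R (i :: 'b::euclidean_space)) \<in> L2 \<Omega>"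
  unfolding L2_iff using D.l2c_linear[OF bounded_linear_scaleR_left] test_L2 L2_iff by blast

lemma grad_add:
  assumes "\<phi> \<in> test_fun \<Omega>" "\<psi> \<in> test_fun \<Omega>"
  shows "grad (\<lambda>x. \<phi> x + \<psi> x) = (\<lambda>x. grad \<phi> x + grad \<psi> x)"
proof
  fix x
  have "partial_deriv i (\<lambda>x. \<phi> x + \<psi> x) x = partial_deriv i \<phi> x + partial_deriv i \<psi> x" for i
    using test_fun_differentiable[OF assms(1), of x] test_fun_differentiable[OF assms(2), of x]
    by (subst partial_derivI[OF has_derivative_add]) (auto simp: frechet_derivative_works partial_deriv_def)
  then show "grad (\<lambda>x. \<phi> x + \<psi> x) x = grad \<phi> x + grad \<psi> x"
    by (simp add: grad_def scaleR_add_left sum.distrib)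
qed

lemma grad_cmult:
  assumes "\<phi> \<in> test_fun \<Omega>"
  shows "grad (\<lambda>x. c * \<phi> x) = (\<lambda>x. c *\<^sub>R grad \<phi> x)"
proof
  fix x
  have "partial_deriv i (\<lambda>x. c * \<phi> x) x = c * partial_deriv i \<phi> x" for i
    using test_fun_differentiable[OF assms, of x]
    by (subst partial_derivI[OF has_derivative_mult_right]) (auto simp: frechet_derivative_works partial_deriv_def)
  then show "grad (\<lambda>x. c * \<phi> x) x = c *\<^sub>R grad \<phi> x"
    by (simp add: grad_def scaleR_sum_right)
qed

lemma integral_dom_partial_zero:
  assumes "\<And>k. Ck k F" "compact K" "K \<subseteq> \<Omega>" "\<And>x. x \<notin> K \<Longrightarrow> F x = 0" "i \<in> Basis"
  shows "(LINT x|lebesgue_on \<Omega>. partial_deriv i F x) = 0"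
proof -
  have c: "continuous_on UNIV (partial_deriv i F)"
    using assms(1)[of "Suc 0"] assms(5) by simp
  have "(LINT x|lebesgue_on \<Omega>. partial_deriv i F x) = (LINT x|lborel. partial_deriv i F x)"
  proof (rule integral_dom_lborel)
    show "partial_deriv i F \<in> borel_measurable borel" by (rule borel_measurable_continuous_onI[OF c])
    show "partial_deriv i F x = 0" if "x \<notin> \<Omega>" for x
      by (rule partial_deriv_zero_outside[OF compact_imp_closed[OF assms(2)] assms(4)]) (use that assms(3) in auto)
  qed
  also have "\<dots> = 0"
    by (rule integral_partial_deriv_zero[OF _ c assms(2,4,5)]) (use assms(1)[of "Suc 0"] in simp)
  finally show ?thesis .
qed

lemma integrable_mult_L2:
  assumes "u \<in> L2 \<Omega>" "v \<in> L2 \<Omega>" shows "integrable (lebesgue_on \<Omega>) (\<lambda>x. u x * v x :: real)"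
  using D.integrable_inner assms unfolding L2_iff by force

text \<open>The product of two test functions has compact support, so its partial derivatives
  integrate to zero.\<close>

lemma has_weak_grad_test:
  assumes "\<phi> \<in> test_fun \<Omega>" shows "has_weak_grad \<Omega> \<phi> (grad \<phi>)"
  unfolding has_weak_grad_def
proof (intro ballI)
  fix \<psi> i assume \<psi>: "\<psi> \<in> test_fun \<Omega>" and i: "i \<in> (Basis :: 'a set)"
  obtain K where K: "\<And>k. Ck k \<phi>" "compact K" "K \<subseteq> \<Omega>" "\<And>x. x \<notin> K \<Longrightarrow> \<phi> x = 0"
    by (rule test_funD[OF assms]) blast
  have "(LINT x|lebesgue_on \<Omega>. partial_deriv i (\<lambda>x. \<phi> x * \<psi> x) x) = 0"
  proof (rule integral_dom_partial_zero[OF _ K(2,3) _ i])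
    show "Ck k (\<lambda>x. \<phi> x * \<psi> x)" for k by (intro Ck_mult K(1) test_fun_Ck[OF \<psi>])
    show "\<phi> x * \<psi> x = 0" if "x \<notin> K" for x by (simp add: K(4)[OF that])
  qed
  moreover have "partial_deriv i (\<lambda>x. \<phi> x * \<psi> x) x = \<phi> x * partial_deriv i \<psi> x + partial_deriv i \<phi> x * \<psi> x" for x
    by (intro partial_deriv_mult test_fun_differentiable[OF assms] test_fun_differentiable[OF \<psi>])
  moreover have "integrable (lebesgue_on \<Omega>) (\<lambda>x. \<phi> x * partial_deriv i \<psi> x)"
    "integrable (lebesgue_on \<Omega>) (\<lambda>x. partial_deriv i \<phi> x * \<psi> x)"
    by (intro integrable_mult_L2 test_L2 test_fun_partial assms \<psi> i)+
  ultimately show "(LINT x|lebesgue_on \<Omega>. \<phi> x * partial_deriv i \<psi> x) = - (LINT x|lebesgue_on \<Omega>. (grad \<phi> x \<bullet> i) * \<psi> x)"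
    using i by (simp add: grad_inner)
qed

lemma has_weak_grad_cls:
  assumes "u \<in> L2 \<Omega>" "g \<in> L2 \<Omega>"
  shows "has_weak_grad \<Omega> u g \<longleftrightarrow> (\<forall>\<psi>\<in>test_fun \<Omega>. \<forall>i\<in>Basis.
    cls \<Omega> u \<bullet> cls \<Omega> (partial_deriv i \<psi>) = - (cls \<Omega> g \<bullet> cls \<Omega> (\<lambda>x. \<psi> x *\<^sub>R i)))"
  unfolding has_weak_grad_def
  by (intro ball_cong refl)
    (simp add: inner_cls assms test_L2 test_fun_partial test_scaleR_L2 L2_inner_def mult.commute)

text \<open>Componentwise the fundamental lemma. As a result the arbitrary choice made by
  \<open>weak_grad\<close> is harmless at the level of classes.\<close>

lemma weak_grad_unique:
  assumes "g \<in> L2 \<Omega>" "h \<in> L2 \<Omega>" "has_weak_grad \<Omega> u g" "has_weak_grad \<Omega> u h"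
  shows "cls \<Omega> g = cls \<Omega> h"
proof -
  have "AE x in lebesgue_on \<Omega>. (g x - h x) \<bullet> i = 0" if i: "i \<in> Basis" for i
  proof (rule fundamental_lemma)
    show L: "(\<lambda>x. (g x - h x) \<bullet> i) \<in> L2 \<Omega>"
      using D.l2c_linear[OF bounded_linear_inner_left] L2_diff[OF assms(1,2)] unfolding L2_iff by blast
    fix \<phi> assume \<phi>: "\<phi> \<in> test_fun \<Omega>"
    have "integrable (lebesgue_on \<Omega>) (\<lambda>x. (g x \<bullet> i) * \<phi> x)" "integrable (lebesgue_on \<Omega>) (\<lambda>x. (h x \<bullet> i) * \<phi> x)"
      using D.l2c_linear[OF bounded_linear_inner_left] assms(1,2) unfolding L2_iff
      by (auto intro!: integrable_mult_L2 test_L2[OF \<phi>] simp: L2_iff)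
    then have "(LINT x|lebesgue_on \<Omega>. (g x - h x) \<bullet> i * \<phi> x)
        = (LINT x|lebesgue_on \<Omega>. (g x \<bullet> i) * \<phi> x) - (LINT x|lebesgue_on \<Omega>. (h x \<bullet> i) * \<phi> x)"
      by (simp add: inner_diff_left left_diff_distrib)
    moreover have "(LINT x|lebesgue_on \<Omega>. (g x \<bullet> i) * \<phi> x) = (LINT x|lebesgue_on \<Omega>. (h x \<bullet> i) * \<phi> x)"
    proof -
      have "- (LINT x|lebesgue_on \<Omega>. (g x \<bullet> i) * \<phi> x) = - (LINT x|lebesgue_on \<Omega>. (h x \<bullet> i) * \<phi> x)"
        using assms(3,4) \<phi> i unfolding has_weak_grad_def by metis
      then show ?thesis by simp
    qed
    ultimately show "(LINT x|lebesgue_on \<Omega>. (g x - h x) \<bullet> i * \<phi> x) = 0" by simp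
  qed
  then have "AE x in lebesgue_on \<Omega>. \<forall>i\<in>Basis. (g x - h x) \<bullet> i = 0"
    by (intro AE_finite_allI) auto
  then have "AE x in lebesgue_on \<Omega>. g x = h x"
  proof eventually_elim
    case (elim x)
    then show ?case by (intro euclidean_eqI[of "g x" "h x"]) (simp add: inner_diff_left)
  qed
  then show ?thesis using cls_eq_iff[OF assms(1,2)] by blast
qed

definition Gr :: "('a \<Rightarrow> real) \<Rightarrow> ('a, 'a) ltwo" where
  "Gr u = cls \<Omega> (weak_grad \<Omega> u)"

lemma H1_weak_grad:
  assumes "u \<in> H1 \<Omega>"
  shows "weak_grad \<Omega> u \<in> L2 \<Omega>" "has_weak_grad \<Omega> u (weak_grad \<Omega> u)"
proof -
  have "\<exists>g. g \<in> L2 \<Omega> \<and> has_weak_grad \<Omega> u g" using assms by (auto simp: H1_def)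
  from someI_ex[OF this] show "weak_grad \<Omega> u \<in> L2 \<Omega>" "has_weak_grad \<Omega> u (weak_grad \<Omega> u)"
    unfolding weak_grad_def by auto
qed

lemma H1_L2: "u \<in> H1 \<Omega> \<Longrightarrow> u \<in> L2 \<Omega>" by (simp add: H1_def)

lemma H1I:
  assumes "u \<in> L2 \<Omega>" "g \<in> L2 \<Omega>" "has_weak_grad \<Omega> u g"
  shows "u \<in> H1 \<Omega>" "Gr u = cls \<Omega> g"
proof -
  show "u \<in> H1 \<Omega>" using assms by (auto simp: H1_def)
  from weak_grad_unique[OF H1_weak_grad(1)[OF this] assms(2) H1_weak_grad(2)[OF this] assms(3)]
  show "Gr u = cls \<Omega> g" by (simp add: Gr_def)
qed

lemma H1_test:
  assumes "\<phi> \<in> test_fun \<Omega>" shows "\<phi> \<in> H1 \<Omega>" "Gr \<phi> = cls \<Omega> (grad \<phi>)"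
  using H1I[OF test_L2 grad_L2 has_weak_grad_test] assms by auto

lemma Gr_test_pairing:
  assumes "u \<in> H1 \<Omega>" "\<psi> \<in> test_fun \<Omega>" "i \<in> Basis"
  shows "cls \<Omega> u \<bullet> cls \<Omega> (partial_deriv i \<psi>) = - (Gr u \<bullet> cls \<Omega> (\<lambda>x. \<psi> x *\<^sub>R i))"
  using has_weak_grad_cls[OF H1_L2[OF assms(1)] H1_weak_grad(1)[OF assms(1)]] H1_weak_grad(2)[OF assms(1)] assms(2,3)
  by (simp add: Gr_def)

lemma H1_add:
  assumes "u \<in> H1 \<Omega>" "v \<in> H1 \<Omega>"
  shows "(\<lambda>x. u x + v x) \<in> H1 \<Omega>" "Gr (\<lambda>x. u x + v x) = Gr u + Gr v"
proof -
  note L = H1_L2[OF assms(1)] H1_L2[OF assms(2)] H1_weak_grad(1)[OF assms(1)] H1_weak_grad(1)[OF assms(2)]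
  have "has_weak_grad \<Omega> (\<lambda>x. u x + v x) (\<lambda>x. weak_grad \<Omega> u x + weak_grad \<Omega> v x)"
    unfolding has_weak_grad_cls[OF L2_add[OF L(1,2)] L2_add[OF L(3,4)]]
    using Gr_test_pairing[OF assms(1)] Gr_test_pairing[OF assms(2)]
    by (simp add: cls_add L inner_add_left Gr_def)
  from H1I[OF L2_add[OF L(1,2)] L2_add[OF L(3,4)] this]
  show "(\<lambda>x. u x + v x) \<in> H1 \<Omega>" "Gr (\<lambda>x. u x + v x) = Gr u + Gr v"
    by (simp_all add: cls_add L Gr_def)
qed

lemma H1_cmult:
  assumes "u \<in> H1 \<Omega>"
  shows "(\<lambda>x. c * u x) \<in> H1 \<Omega>" "Gr (\<lambda>x. c * u x) = c *\<^sub>R Gr u"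
proof -
  note L = H1_L2[OF assms(1)] H1_weak_grad(1)[OF assms(1)]
  have L': "(\<lambda>x. c * u x) \<in> L2 \<Omega>" using L2_scaleR[OF L(1), of c] by simp
  have "has_weak_grad \<Omega> (\<lambda>x. c * u x) (\<lambda>x. c *\<^sub>R weak_grad \<Omega> u x)"
    unfolding has_weak_grad_cls[OF L' L2_scaleR[OF L(2)]]
    using Gr_test_pairing[OF assms(1)]
    by (simp add: cls_mult cls_scaleR L Gr_def)
  from H1I[OF L' L2_scaleR[OF L(2)] this]
  show "(\<lambda>x. c * u x) \<in> H1 \<Omega>" "Gr (\<lambda>x. c * u x) = c *\<^sub>R Gr u"
    by (simp_all add: cls_scaleR L Gr_def)
qed

lemma H1_cong_AE:
  assumes "u \<in> H1 \<Omega>" "v \<in> L2 \<Omega>" "cls \<Omega> u = cls \<Omega> v"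
  shows "v \<in> H1 \<Omega>" "Gr v = Gr u"
proof -
  note L = H1_L2[OF assms(1)] H1_weak_grad(1)[OF assms(1)]
  have "has_weak_grad \<Omega> v (weak_grad \<Omega> u)"
    unfolding has_weak_grad_cls[OF assms(2) L(2)]
    using Gr_test_pairing[OF assms(1)] by (simp add: Gr_def assms(3))
  from H1I[OF assms(2) L(2) this] show "v \<in> H1 \<Omega>" "Gr v = Gr u" by (simp_all add: Gr_def)
qed

section \<open>The energy space as a closed graph of the gradient\<close>

definition test_graph :: "(('a, real) ltwo \<times> ('a, 'a) ltwo) set" where
  "test_graph = (\<lambda>\<phi>. (cls \<Omega> \<phi>, cls \<Omega> (grad \<phi>))) ` test_fun \<Omega>"

text \<open>The energy space with zero boundary values, each element recorded together with its
  gradient. Being a closure, it is the closed form domain to which the abstract results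
  apply.\<close>

definition HD :: "(('a, real) ltwo \<times> ('a, 'a) ltwo) set" where
  "HD = closure test_graph"

lemma subspace_test_graph: "subspace test_graph"
proof (rule subspaceI)
  have "(\<lambda>x. 0) \<in> test_fun \<Omega>" by (rule test_funI[of _ "{}"]) (auto simp: Ck_const)
  moreover have "grad (\<lambda>x. 0) = (\<lambda>x. 0 :: 'a)"
    by (rule ext) (simp add: grad_def partial_derivI[OF has_derivative_const])
  ultimately show "0 \<in> test_graph" unfolding test_graph_def
    by (intro image_eqI[of _ _ "\<lambda>x. 0"]) (simp_all add: cls_zero zero_prod_def)
next
  fix p q assume "p \<in> test_graph" "q \<in> test_graph"
  then obtain \<phi> \<psi> where "\<phi> \<in> test_fun \<Omega>" "\<psi> \<in> test_fun \<Omega>"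
    "p = (cls \<Omega> \<phi>, cls \<Omega> (grad \<phi>))" "q = (cls \<Omega> \<psi>, cls \<Omega> (grad \<psi>))" by (auto simp: test_graph_def)
  then show "p + q \<in> test_graph" unfolding test_graph_def
    by (intro image_eqI[of _ _ "\<lambda>x. \<phi> x + \<psi> x"]) (simp_all add: grad_add cls_add test_L2 grad_L2 test_fun_add)
next
  fix c p assume "p \<in> test_graph"
  then obtain \<phi> where "\<phi> \<in> test_fun \<Omega>" "p = (cls \<Omega> \<phi>, cls \<Omega> (grad \<phi>))" by (auto simp: test_graph_def)
  then show "c *\<^sub>R p \<in> test_graph" unfolding test_graph_def
    by (intro image_eqI[of _ _ "\<lambda>x. c * \<phi> x"]) (simp_all add: grad_cmult cls_mult cls_scaleR test_L2 grad_L2 test_fun_cmult)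
qed

sublocale HD: form_domain HD
  by unfold_locales (simp_all add: HD_def subspace_closure subspace_test_graph)

lemma HD_sequence:
  assumes "p \<in> HD"
  obtains \<phi> where "\<And>k::nat. \<phi> k \<in> test_fun \<Omega>" "(\<lambda>k. cls \<Omega> (\<phi> k)) \<longlonglongrightarrow> fst p" "(\<lambda>k. cls \<Omega> (grad (\<phi> k))) \<longlonglongrightarrow> snd p"
proof -
  obtain x where x: "\<And>k. x k \<in> test_graph" "x \<longlonglongrightarrow> p"
    using assms unfolding HD_def closure_sequential by blast
  obtain \<phi> where \<phi>: "\<And>k. \<phi> k \<in> test_fun \<Omega>" "\<And>k. x k = (cls \<Omega> (\<phi> k), cls \<Omega> (grad (\<phi> k)))"
    using x(1) unfolding test_graph_def image_iff by metis
  show thesis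
    using that[OF \<phi>(1)] tendsto_fst[OF x(2)] tendsto_snd[OF x(2)] by (simp add: \<phi>(2))
qed

text \<open>The density principle: a closed condition needs to be checked on test functions
  only.\<close>

lemma HD_test_ball:
  assumes "\<And>\<phi>. \<phi> \<in> test_fun \<Omega> \<Longrightarrow> P (cls \<Omega> \<phi>, cls \<Omega> (grad \<phi>))" "closed {p. P p}" "p \<in> HD"
  shows "P p"
proof -
  have "HD \<subseteq> {p. P p}" unfolding HD_def
    by (rule closure_minimal[OF _ assms(2)]) (auto simp: test_graph_def assms(1))
  then show ?thesis using assms(3) by blast
qed

lemma HD_pairing:
  assumes "p \<in> HD" "\<psi> \<in> test_fun \<Omega>" "i \<in> Basis"
  shows "fst p \<bullet> cls \<Omega> (partial_deriv i \<psi>) = - (snd p \<bullet> cls \<Omega> (\<lambda>x. \<psi> x *\<^sub>R i))"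
proof (rule HD_test_ball[OF _ _ assms(1)])
  show "fst (cls \<Omega> \<phi>, cls \<Omega> (grad \<phi>)) \<bullet> cls \<Omega> (partial_deriv i \<psi>) =
    - (snd (cls \<Omega> \<phi>, cls \<Omega> (grad \<phi>)) \<bullet> cls \<Omega> (\<lambda>x. \<psi> x *\<^sub>R i))" if "\<phi> \<in> test_fun \<Omega>" for \<phi>
    using Gr_test_pairing[OF H1_test(1)[OF that] assms(2,3)] H1_test(2)[OF that] by simp
  show "closed {p. fst p \<bullet> cls \<Omega> (partial_deriv i \<psi>) = - (snd p \<bullet> cls \<Omega> (\<lambda>x. \<psi> x *\<^sub>R i))}"
    by (intro closed_Collect_eq continuous_intros)
qed

lemma HD_cls_rep:
  assumes "p \<in> HD"
  shows "cls \<Omega> (rep_ltwo (fst p)) = fst p" "cls \<Omega> (rep_ltwo (snd p)) = snd p"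
proof -
  obtain \<phi> where \<phi>: "\<And>k::nat. \<phi> k \<in> test_fun \<Omega>" "(\<lambda>k. cls \<Omega> (\<phi> k)) \<longlonglongrightarrow> fst p"
    "(\<lambda>k. cls \<Omega> (grad (\<phi> k))) \<longlonglongrightarrow> snd p" using HD_sequence[OF assms] by blast
  show "cls \<Omega> (rep_ltwo (fst p)) = fst p" by (rule cls_rep_eqI[OF \<phi>(2) test_L2[OF \<phi>(1)]])
  show "cls \<Omega> (rep_ltwo (snd p)) = snd p" by (rule cls_rep_eqI[OF \<phi>(3) grad_L2[OF \<phi>(1)]])
qed

lemma H10_H1: "u \<in> H10 \<Omega> \<Longrightarrow> u \<in> H1 \<Omega>" by (simp add: H10_def)

lemma H10_L2: "u \<in> H10 \<Omega> \<Longrightarrow> u \<in> L2 \<Omega>" using H10_H1 H1_L2 by blast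

text \<open>The two L2 norms in the definition of \<open>H10\<close> are distances between classes,
  so the approximating sequences are exactly the sequences of test pairs that converge in the
  product space.\<close>

lemma H10_iff: "u \<in> H10 \<Omega> \<longleftrightarrow> u \<in> H1 \<Omega> \<and> (cls \<Omega> u, Gr u) \<in> HD"
proof -
  have key: "(\<lambda>k. L2_norm \<Omega> (\<lambda>x. \<phi> k x - u x)) \<longlonglongrightarrow> 0 \<longleftrightarrow> (\<lambda>k. cls \<Omega> (\<phi> k)) \<longlonglongrightarrow> cls \<Omega> u"
    "(\<lambda>k. L2_norm \<Omega> (\<lambda>x. weak_grad \<Omega> (\<phi> k) x - weak_grad \<Omega> u x)) \<longlonglongrightarrow> 0 \<longleftrightarrow> (\<lambda>k. cls \<Omega> (grad (\<phi> k))) \<longlonglongrightarrow> Gr u"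
    if u: "u \<in> H1 \<Omega>" and \<phi>: "\<And>k::nat. \<phi> k \<in> test_fun \<Omega>" for \<phi>
  proof -
    note L = H1_L2[OF u] H1_weak_grad(1)[OF u] test_L2[OF \<phi>] H1_weak_grad(1)[OF H1_test(1)[OF \<phi>]]
    have "L2_norm \<Omega> (\<lambda>x. \<phi> k x - u x) = norm (cls \<Omega> (\<phi> k) - cls \<Omega> u)" for k
      unfolding cls_diff[OF L(3) L(1), symmetric] by (rule norm_cls[OF L2_diff[OF L(3) L(1)], symmetric])
    then show "(\<lambda>k. L2_norm \<Omega> (\<lambda>x. \<phi> k x - u x)) \<longlonglongrightarrow> 0 \<longleftrightarrow> (\<lambda>k. cls \<Omega> (\<phi> k)) \<longlonglongrightarrow> cls \<Omega> u"
      by (simp add: tendsto_norm_zero_iff LIM_zero_iff)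
    have "L2_norm \<Omega> (\<lambda>x. weak_grad \<Omega> (\<phi> k) x - weak_grad \<Omega> u x) = norm (cls \<Omega> (grad (\<phi> k)) - Gr u)" for k
      unfolding H1_test(2)[OF \<phi>, symmetric] Gr_def cls_diff[OF L(4) L(2), symmetric]
      by (rule norm_cls[OF L2_diff[OF L(4) L(2)], symmetric])
    then show "(\<lambda>k. L2_norm \<Omega> (\<lambda>x. weak_grad \<Omega> (\<phi> k) x - weak_grad \<Omega> u x)) \<longlonglongrightarrow> 0 \<longleftrightarrow> (\<lambda>k. cls \<Omega> (grad (\<phi> k))) \<longlonglongrightarrow> Gr u"
      by (simp add: tendsto_norm_zero_iff LIM_zero_iff)
  qed
  show ?thesis
  proof
    assume "u \<in> H10 \<Omega>"
    then obtain \<phi> where u: "u \<in> H1 \<Omega>" and \<phi>: "\<And>k::nat. \<phi> k \<in> test_fun \<Omega>"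
      "(\<lambda>k. L2_norm \<Omega> (\<lambda>x. \<phi> k x - u x)) \<longlonglongrightarrow> 0"
      "(\<lambda>k. L2_norm \<Omega> (\<lambda>x. weak_grad \<Omega> (\<phi> k) x - weak_grad \<Omega> u x)) \<longlonglongrightarrow> 0" by (auto simp: H10_def)
    have "(\<lambda>k. (cls \<Omega> (\<phi> k), cls \<Omega> (grad (\<phi> k)))) \<longlonglongrightarrow> (cls \<Omega> u, Gr u)"
      using \<phi> key[OF u \<phi>(1)] by (intro tendsto_Pair) auto
    moreover have "\<forall>k. (cls \<Omega> (\<phi> k), cls \<Omega> (grad (\<phi> k))) \<in> test_graph" using \<phi>(1) by (auto simp: test_graph_def)
    ultimately have "(cls \<Omega> u, Gr u) \<in> HD" unfolding HD_def closure_sequential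
      by (intro exI[of _ "\<lambda>k. (cls \<Omega> (\<phi> k), cls \<Omega> (grad (\<phi> k)))"] conjI)
    with u show "u \<in> H1 \<Omega> \<and> (cls \<Omega> u, Gr u) \<in> HD" by blast
  next
    assume a: "u \<in> H1 \<Omega> \<and> (cls \<Omega> u, Gr u) \<in> HD"
    then obtain \<phi> where \<phi>: "\<And>k::nat. \<phi> k \<in> test_fun \<Omega>" "(\<lambda>k. cls \<Omega> (\<phi> k)) \<longlonglongrightarrow> cls \<Omega> u"
      "(\<lambda>k. cls \<Omega> (grad (\<phi> k))) \<longlonglongrightarrow> Gr u" using HD_sequence[of "(cls \<Omega> u, Gr u)"] by auto
    then show "u \<in> H10 \<Omega>" unfolding H10_def using a key[of \<phi>] by auto
  qed
qed

lemma H10_HD: "u \<in> H10 \<Omega> \<Longrightarrow> (cls \<Omega> u, Gr u) \<in> HD" by (simp add: H10_iff)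

text \<open>The components of a pair in \<open>HD\<close> are limits of classes of functions on
  \<Omega>, hence have representatives there, and the defining identity of weak gradients passes to
  the limit.\<close>

lemma HD_H10:
  assumes "p \<in> HD"
  obtains u where "u \<in> H10 \<Omega>" "p = (cls \<Omega> u, Gr u)"
proof -
  define u where "u = rep_ltwo (fst p)"
  define g where "g = rep_ltwo (snd p)"
  note e = HD_cls_rep[OF assms, folded u_def g_def]
  have L: "u \<in> L2 \<Omega>" "g \<in> L2 \<Omega>" by (simp_all add: u_def g_def rep_L2)
  have "has_weak_grad \<Omega> u g" unfolding has_weak_grad_cls[OF L] e using HD_pairing[OF assms] by blast
  from H1I[OF L this] have "u \<in> H1 \<Omega>" "p = (cls \<Omega> u, Gr u)" by (simp_all add: e)
  then show thesis using that[of u] assms by (simp add: H10_iff)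
qed

lemma H10_add: "u \<in> H10 \<Omega> \<Longrightarrow> v \<in> H10 \<Omega> \<Longrightarrow> (\<lambda>x. u x + v x) \<in> H10 \<Omega>"
  using subspace_add[OF HD.subspace_H, of "(cls \<Omega> u, Gr u)" "(cls \<Omega> v, Gr v)"]
  by (auto simp: H10_iff H1_add cls_add H1_L2)

lemma H10_cmult: "u \<in> H10 \<Omega> \<Longrightarrow> (\<lambda>x. c * u x) \<in> H10 \<Omega>"
  using subspace_scale[OF HD.subspace_H, of "(cls \<Omega> u, Gr u)" c]
  by (auto simp: H10_iff H1_cmult cls_mult H1_L2)

lemma H10_zero: "(\<lambda>x. 0) \<in> H10 \<Omega>"
proof -
  obtain u where "u \<in> H10 \<Omega>" using HD_H10[OF subspace_0[OF HD.subspace_H]] by blast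
  from H10_cmult[OF this, of 0] show ?thesis by simp
qed

lemma Gr_zero: "Gr (\<lambda>x. 0) = 0"
  using H1_cmult(2)[OF H10_H1[OF H10_zero], of 0] by simp

lemma H10_diff:
  assumes "u \<in> H10 \<Omega>" "v \<in> H10 \<Omega>"
  shows "(\<lambda>x. u x - v x) \<in> H10 \<Omega>" "Gr (\<lambda>x. u x - v x) = Gr u - Gr v"
  using H10_add[OF assms(1) H10_cmult[OF assms(2), of "-1"]]
    H1_add(2)[OF H10_H1[OF assms(1)] H1_cmult(1)[OF H10_H1[OF assms(2)], of "-1"]]
    H1_cmult(2)[OF H10_H1[OF assms(2)], of "-1"] by simp_all

lemma H10_sum:
  assumes "\<And>i. i \<in> I \<Longrightarrow> u i \<in> H10 \<Omega>"
  shows "(\<lambda>x. \<Sum>i\<in>I. c i * u i x) \<in> H10 \<Omega>" "Gr (\<lambda>x. \<Sum>i\<in>I. c i * u i x) = (\<Sum>i\<in>I. c i *\<^sub>R Gr (u i))"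
  using assms
proof (induction I rule: infinite_finite_induct)
  case (insert i I)
  {
    case 1
    then show ?case using insert.IH(1) insert.hyps H10_add[OF H10_cmult[of "u i" "c i"]] by simp
  next
    case 2
    then show ?case
      using insert.IH insert.hyps H1_add(2)[OF H1_cmult(1)[OF H10_H1[of "u i"]] H10_H1, of "\<lambda>x. \<Sum>i\<in>I. c i * u i x" "c i"]
        H1_cmult(2)[OF H10_H1[of "u i"], of "c i"] by simp
  }
qed (simp_all add: H10_zero Gr_zero)

lemma H10_cong_AE:
  assumes "u \<in> H10 \<Omega>" "v \<in> L2 \<Omega>" "cls \<Omega> u = cls \<Omega> v"
  shows "v \<in> H10 \<Omega>" "Gr v = Gr u"
  using H1_cong_AE[OF H10_H1[OF assms(1)] assms(2,3)] assms by (auto simp: H10_iff)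

lemma H10_norm_eq: "u \<in> H1 \<Omega> \<Longrightarrow> H10_norm \<Omega> u = norm (Gr u)"
  by (simp add: H10_norm_def H10_inner_def Gr_def norm_cls H1_weak_grad L2_norm_def)

lemma H10_inner_eq: "u \<in> H1 \<Omega> \<Longrightarrow> v \<in> H1 \<Omega> \<Longrightarrow> H10_inner \<Omega> u v = Gr u \<bullet> Gr v"
  by (simp add: H10_inner_def Gr_def inner_cls H1_weak_grad)

text \<open>For a test function the integral of the \<open>i\<close>-th partial derivative of
  \<open>(x \<bullet> i) * (\<phi> x * \<phi> x)\<close> is zero. The product rule and
  Cauchy--Schwarz give the constant \<open>2 * R\<close> with \<open>R\<close> a bound for \<Omega>;
  density does the rest.\<close>

lemma poincare:
  assumes "bounded \<Omega>"
  obtains CP where "\<And>h. h \<in> HD \<Longrightarrow> norm (fst h) \<le> CP * norm (snd h)"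
proof -
  obtain R where R: "R > 0" "\<And>x. x \<in> \<Omega> \<Longrightarrow> norm x \<le> R" using assms bounded_pos by metis
  obtain i :: 'a where i: "i \<in> Basis" using nonempty_Basis by blast
  have test: "norm (cls \<Omega> \<phi>) \<le> 2 * R * norm (cls \<Omega> (grad \<phi>))" if \<phi>: "\<phi> \<in> test_fun \<Omega>" for \<phi>
  proof -
    obtain K where K: "\<And>k. Ck k \<phi>" "compact K" "K \<subseteq> \<Omega>" "\<And>x. x \<notin> K \<Longrightarrow> \<phi> x = 0"
      by (rule test_funD[OF \<phi>]) blast
    have d: "\<phi> differentiable (at x)" for x by (rule test_fun_differentiable[OF \<phi>])
    have dp: "(\<lambda>x. \<phi> x * \<phi> x) differentiable (at x)" for x
      using d by (intro differentiable_mult)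
    have di: "((\<lambda>x. x \<bullet> i) has_derivative (\<lambda>x. x \<bullet> i)) (at x)" for x by (auto intro!: derivative_eq_intros)
    have pi: "partial_deriv i (\<lambda>x. x \<bullet> i) x = 1" for x
      using partial_derivI[OF di, of i] i by simp
    have "(LINT x|lebesgue_on \<Omega>. partial_deriv i (\<lambda>x. (x \<bullet> i) * (\<phi> x * \<phi> x)) x) = 0"
    proof (rule integral_dom_partial_zero[OF _ K(2,3) _ i])
      show "Ck k (\<lambda>x. (x \<bullet> i) * (\<phi> x * \<phi> x))" for k by (intro Ck_mult K(1) Ck_inner)
      show "(x \<bullet> i) * (\<phi> x * \<phi> x) = 0" if "x \<notin> K" for x by (simp add: K(4)[OF that])
    qed
    moreover have "partial_deriv i (\<lambda>x. (x \<bullet> i) * (\<phi> x * \<phi> x)) x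
        = \<phi> x * (2 * ((x \<bullet> i) * partial_deriv i \<phi> x)) + \<phi> x * \<phi> x" for x
      using partial_deriv_mult[OF differentiableI[OF di] dp, where i=i] partial_deriv_mult[OF d d, where i=i] pi
      by (simp add: algebra_simps)
    moreover have XL: "(\<lambda>x. 2 * ((x \<bullet> i) * partial_deriv i \<phi> x)) \<in> L2 \<Omega>"
    proof (rule compact_support_L2[OF _ K(2,3)])
      show "continuous_on UNIV (\<lambda>x. 2 * ((x \<bullet> i) * partial_deriv i \<phi> x))"
        by (intro continuous_intros test_continuous test_fun_partial \<phi> i)
      show "2 * ((x \<bullet> i) * partial_deriv i \<phi> x) = 0" if "x \<notin> K" for x
        using partial_deriv_zero_outside[OF compact_imp_closed[OF K(2)] K(4) that, where i=i] by simp
    qed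
    moreover have "integrable (lebesgue_on \<Omega>) (\<lambda>x. \<phi> x * (2 * ((x \<bullet> i) * partial_deriv i \<phi> x)))"
      "integrable (lebesgue_on \<Omega>) (\<lambda>x. \<phi> x * \<phi> x)"
      by (intro integrable_mult_L2 test_L2 \<phi> XL)+
    ultimately have "L2_inner \<Omega> \<phi> \<phi> = - L2_inner \<Omega> \<phi> (\<lambda>x. 2 * ((x \<bullet> i) * partial_deriv i \<phi> x))"
      by (simp add: L2_inner_def)
    then have "cls \<Omega> \<phi> \<bullet> cls \<Omega> \<phi> = - (cls \<Omega> \<phi> \<bullet> cls \<Omega> (\<lambda>x. 2 * ((x \<bullet> i) * partial_deriv i \<phi> x)))"
      by (simp add: inner_cls test_L2[OF \<phi>] XL)
    also have "\<dots> \<le> norm (cls \<Omega> \<phi>) * norm (cls \<Omega> (\<lambda>x. 2 * ((x \<bullet> i) * partial_deriv i \<phi> x)))"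
      using Cauchy_Schwarz_ineq2[of "cls \<Omega> \<phi>" "cls \<Omega> (\<lambda>x. 2 * ((x \<bullet> i) * partial_deriv i \<phi> x))"] by linarith
    finally have n1: "norm (cls \<Omega> \<phi>) \<le> norm (cls \<Omega> (\<lambda>x. 2 * ((x \<bullet> i) * partial_deriv i \<phi> x)))"
      by (cases "norm (cls \<Omega> \<phi>) = 0") (auto simp: power2_norm_eq_inner[symmetric] power2_eq_square)
    also have "\<dots> = l2n (lebesgue_on \<Omega>) (\<lambda>x. 2 * ((x \<bullet> i) * partial_deriv i \<phi> x))"
      by (simp add: norm_cls[OF XL] L2_norm_eq)
    also have "\<dots> \<le> (2 * R) * l2n (lebesgue_on \<Omega>) (grad \<phi>)"
    proof (rule D.l2n_mono)
      show "l2c (lebesgue_on \<Omega>) (\<lambda>x. 2 * ((x \<bullet> i) * partial_deriv i \<phi> x))" using XL L2_iff by blast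
      show "l2c (lebesgue_on \<Omega>) (grad \<phi>)" using grad_L2[OF \<phi>] L2_iff by blast
      show "AE x in lebesgue_on \<Omega>. norm (2 * ((x \<bullet> i) * partial_deriv i \<phi> x)) \<le> 2 * R * norm (grad \<phi> x)"
      proof (rule AE_I2)
        fix x assume "x \<in> space (lebesgue_on \<Omega>)"
        then have "\<bar>x \<bullet> i\<bar> \<le> R" using R(2)[of x] Basis_le_norm[OF i, of x] by simp
        moreover have "\<bar>partial_deriv i \<phi> x\<bar> \<le> norm (grad \<phi> x)"
          using Basis_le_norm[OF i, of "grad \<phi> x"] grad_inner[OF i] by simp
        ultimately have "\<bar>x \<bullet> i\<bar> * \<bar>partial_deriv i \<phi> x\<bar> \<le> R * norm (grad \<phi> x)" by (intro mult_mono) auto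
        then show "norm (2 * ((x \<bullet> i) * partial_deriv i \<phi> x)) \<le> 2 * R * norm (grad \<phi> x)" by (simp add: abs_mult)
      qed
    qed (use R in auto)
    also have "l2n (lebesgue_on \<Omega>) (grad \<phi>) = norm (cls \<Omega> (grad \<phi>))"
      by (simp add: norm_cls[OF grad_L2[OF \<phi>]] L2_norm_eq)
    finally show ?thesis .
  qed
  show thesis
  proof (rule that[of "2 * R"])
    fix h assume "h \<in> HD"
    then show "norm (fst h) \<le> 2 * R * norm (snd h)"
      by (rule HD_test_ball[rotated 2]) (auto simp: test intro!: closed_Collect_le continuous_intros)
  qed
qed

text \<open>The part of \<open>z\<close> orthogonal to the closure is orthogonal to all test
  functions, and so vanishes by the fundamental lemma.\<close>

lemma cls_in_closure:
  assumes "z \<in> L2 \<Omega>" shows "cls \<Omega> z \<in> closure (fst ` HD)"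
proof -
  have s: "subspace (closure (fst ` HD))"
    by (intro subspace_closure linear_subspace_image[OF _ HD.subspace_H] linear_fst)
  obtain p where p: "p \<in> closure (fst ` HD)" "\<And>h. h \<in> closure (fst ` HD) \<Longrightarrow> (cls \<Omega> z - p) \<bullet> h = 0"
    using closed_subspace_projection[OF s closed_closure, of "cls \<Omega> z"] by blast
  obtain x where x: "\<And>k. x k \<in> fst ` HD" "x \<longlonglongrightarrow> p" using p(1) unfolding closure_sequential by blast
  have xr: "cls \<Omega> (rep_ltwo (x k)) = x k" for k using x(1)[of k] HD_cls_rep(1) by auto
  have pr: "cls \<Omega> (rep_ltwo p) = p"
    by (rule cls_rep_eqI[of "\<lambda>k. rep_ltwo (x k)"]) (use x(2) xr rep_L2 in auto)
  define y where "y x = z x - rep_ltwo p x" for x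
  have yL: "y \<in> L2 \<Omega>" unfolding y_def by (rule L2_diff[OF assms rep_L2])
  have yc: "cls \<Omega> y = cls \<Omega> z - p" unfolding y_def cls_diff[OF assms rep_L2] pr ..
  have "AE x in lebesgue_on \<Omega>. y x = 0"
  proof (rule fundamental_lemma[OF yL])
    fix \<phi> assume \<phi>: "\<phi> \<in> test_fun \<Omega>"
    have "(cls \<Omega> \<phi>, cls \<Omega> (grad \<phi>)) \<in> HD" unfolding HD_def using closure_subset \<phi> by (force simp: test_graph_def)
    then have "cls \<Omega> \<phi> \<in> closure (fst ` HD)" using closure_subset by force
    then have "cls \<Omega> y \<bullet> cls \<Omega> \<phi> = 0" using p(2) yc by simp
    then show "(LINT x|lebesgue_on \<Omega>. y x * \<phi> x) = 0" by (simp add: inner_cls yL test_L2[OF \<phi>] L2_inner_def)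
  qed
  then have "cls \<Omega> y = cls \<Omega> (\<lambda>x. 0)" using cls_eq_iff[OF yL L2_zero] by blast
  then have "cls \<Omega> z = p" using yc by (simp add: cls_zero)
  then show ?thesis using p(1) by simp
qed

text \<open>One of the two derivatives on the test function is moved to \<open>u\<close> by the
  definition of the weak gradient; the resulting identity for test functions extends to
  \<open>HD\<close> by density.\<close>

lemma weak_laplacian_iff:
  assumes u: "u \<in> H10 \<Omega>" and z: "z \<in> L2 \<Omega>"
  shows "has_weak_laplacian \<Omega> u z \<longleftrightarrow> HD.weak_lap (cls \<Omega> u, Gr u) (cls \<Omega> z)"
proof -
  have lap: "(LINT x|lebesgue_on \<Omega>. u x * (\<Sum>i\<in>Basis. partial_deriv i (partial_deriv i \<phi>) x)) = - (Gr u \<bullet> cls \<Omega> (grad \<phi>))"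
    if \<phi>: "\<phi> \<in> test_fun \<Omega>" for \<phi>
  proof -
    have "(LINT x|lebesgue_on \<Omega>. u x * (\<Sum>i\<in>Basis. partial_deriv i (partial_deriv i \<phi>) x))
        = (\<Sum>i\<in>Basis. LINT x|lebesgue_on \<Omega>. u x * partial_deriv i (partial_deriv i \<phi>) x)"
      unfolding sum_distrib_left
      by (intro Bochner_Integration.integral_sum integrable_mult_L2 H10_L2[OF u] test_L2 test_fun_partial \<phi>)
    also have "\<dots> = (\<Sum>i\<in>Basis. - (Gr u \<bullet> cls \<Omega> (\<lambda>x. partial_deriv i \<phi> x *\<^sub>R i)))"
    proof (rule sum.cong[OF refl])
      fix i :: 'a assume i: "i \<in> Basis"
      show "(LINT x|lebesgue_on \<Omega>. u x * partial_deriv i (partial_deriv i \<phi>) x) = - (Gr u \<bullet> cls \<Omega> (\<lambda>x. partial_deriv i \<phi> x *\<^sub>R i))"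
        using Gr_test_pairing[OF H10_H1[OF u] test_fun_partial[OF \<phi> i] i]
        by (simp add: inner_cls H10_L2[OF u] test_L2 test_fun_partial \<phi> i L2_inner_def)
    qed
    also have "\<dots> = - (Gr u \<bullet> (\<Sum>i\<in>Basis. cls \<Omega> (\<lambda>x. partial_deriv i \<phi> x *\<^sub>R i)))"
      by (simp add: sum_negf inner_sum_right)
    also have "(\<Sum>i\<in>Basis. cls \<Omega> (\<lambda>x. partial_deriv i \<phi> x *\<^sub>R i)) = cls \<Omega> (grad \<phi>)"
      unfolding grad_def by (rule cls_sum[symmetric]) (intro test_scaleR_L2 test_fun_partial \<phi>)
    finally show ?thesis .
  qed
  have "has_weak_laplacian \<Omega> u z \<longleftrightarrow> (\<forall>\<phi>\<in>test_fun \<Omega>. cls \<Omega> z \<bullet> cls \<Omega> \<phi> = - (Gr u \<bullet> cls \<Omega> (grad \<phi>)))"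
    unfolding has_weak_laplacian_def
    by (rule ball_cong[OF refl]) (auto simp: lap inner_cls z test_L2 L2_inner_def)
  also have "\<dots> \<longleftrightarrow> (\<forall>h\<in>HD. cls \<Omega> z \<bullet> fst h = - (Gr u \<bullet> snd h))"
  proof
    assume a: "\<forall>\<phi>\<in>test_fun \<Omega>. cls \<Omega> z \<bullet> cls \<Omega> \<phi> = - (Gr u \<bullet> cls \<Omega> (grad \<phi>))"
    show "\<forall>h\<in>HD. cls \<Omega> z \<bullet> fst h = - (Gr u \<bullet> snd h)"
    proof
      fix h assume "h \<in> HD"
      then show "cls \<Omega> z \<bullet> fst h = - (Gr u \<bullet> snd h)"
        by (rule HD_test_ball[rotated 2]) (use a in \<open>auto intro!: closed_Collect_eq continuous_intros\<close>)
    qed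
  next
    assume a: "\<forall>h\<in>HD. cls \<Omega> z \<bullet> fst h = - (Gr u \<bullet> snd h)"
    show "\<forall>\<phi>\<in>test_fun \<Omega>. cls \<Omega> z \<bullet> cls \<Omega> \<phi> = - (Gr u \<bullet> cls \<Omega> (grad \<phi>))"
    proof
      fix \<phi> assume "\<phi> \<in> test_fun \<Omega>"
      then have "(cls \<Omega> \<phi>, cls \<Omega> (grad \<phi>)) \<in> HD" unfolding HD_def using closure_subset by (force simp: test_graph_def)
      then show "cls \<Omega> z \<bullet> cls \<Omega> \<phi> = - (Gr u \<bullet> cls \<Omega> (grad \<phi>))" using a by force
    qed
  qed
  finally show ?thesis unfolding HD.weak_lap_def using H10_HD[OF u] cls_in_closure[OF z] by simp
qed

lemma X_laplacian:
  assumes "u \<in> Xspace \<Omega>"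
  shows "laplacian \<Omega> u \<in> L2 \<Omega>" "has_weak_laplacian \<Omega> u (laplacian \<Omega> u)"
proof -
  have "\<exists>g. g \<in> L2 \<Omega> \<and> has_weak_laplacian \<Omega> u g" using assms by (auto simp: Xspace_def)
  from someI_ex[OF this] show "laplacian \<Omega> u \<in> L2 \<Omega>" "has_weak_laplacian \<Omega> u (laplacian \<Omega> u)"
    unfolding laplacian_def by auto
qed

lemma weak_laplacian_pairing:
  assumes "z \<in> L2 \<Omega>" "has_weak_laplacian \<Omega> u z" "\<phi> \<in> test_fun \<Omega>"
  shows "cls \<Omega> z \<bullet> cls \<Omega> \<phi> = (LINT x|lebesgue_on \<Omega>. u x * (\<Sum>i\<in>Basis. partial_deriv i (partial_deriv i \<phi>) x))"
  using assms by (simp add: has_weak_laplacian_def inner_cls test_L2 L2_inner_def)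

lemma laplacian_unique:
  assumes "z \<in> L2 \<Omega>" "y \<in> L2 \<Omega>" "\<And>\<phi>. \<phi> \<in> test_fun \<Omega> \<Longrightarrow> cls \<Omega> z \<bullet> cls \<Omega> \<phi> = cls \<Omega> y \<bullet> cls \<Omega> \<phi>"
  shows "cls \<Omega> z = cls \<Omega> y"
proof -
  have L: "(\<lambda>x. z x - y x) \<in> L2 \<Omega>" by (rule L2_diff[OF assms(1,2)])
  have "AE x in lebesgue_on \<Omega>. z x - y x = 0"
  proof (rule fundamental_lemma[OF L])
    fix \<phi> assume \<phi>: "\<phi> \<in> test_fun \<Omega>"
    have "cls \<Omega> (\<lambda>x. z x - y x) \<bullet> cls \<Omega> \<phi> = 0" using assms(3)[OF \<phi>] by (simp add: cls_diff assms inner_diff_left)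
    then show "(LINT x|lebesgue_on \<Omega>. (z x - y x) * \<phi> x) = 0" by (simp add: inner_cls L test_L2[OF \<phi>] L2_inner_def)
  qed
  then show ?thesis using cls_eq_iff[OF assms(1,2)] by simp
qed

end

section \<open>Weak time derivatives\<close>

text \<open>By completeness the two functions are both measurable or both not. In the second case
  neither is integrable and both integrals are 0 by convention, so that integrands can be exchanged
  without a measurability condition.\<close>

lemma integral_cong_AE_complete:
  fixes f g :: "'c \<Rightarrow> real"
  assumes "complete_measure M" "AE x in M. f x = g x"
  shows "integral\<^sup>L M f = integral\<^sup>L M g"
proof (cases "f \<in> borel_measurable M")
  case True
  then show ?thesis
    by (intro integral_cong_AE True borel_measurable_complete_AE[OF assms(1) True assms(2)] assms(2))
next
  case False
  have "AE x in M. g x = f x" using assms(2) by eventually_elim simp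
  then have "g \<notin> borel_measurable M" using False borel_measurable_complete_AE[OF assms(1)] by blast
  then have "\<not> integrable M f" "\<not> integrable M g" using False by auto
  then show ?thesis by (simp add: not_integrable_integral_eq)
qed

text \<open>The exceptional null set may depend on the test vector. The countably many values of
  approximating simple functions suffice as test vectors, and their null sets can be united.\<close>

lemma smeas_weakly_zero:
  fixes \<delta> :: "'c \<Rightarrow> 'h::real_inner"
  assumes "smeas M \<delta>" "\<And>y. AE t in M. \<delta> t \<bullet> y = 0"
  shows "AE t in M. \<delta> t = 0"
proof -
  obtain s where s: "\<And>k. simple_function M (s k)" "AE t in M. (\<lambda>k. s k t) \<longlonglongrightarrow> \<delta> t"
    using assms(1) unfolding smeas_def by blast
  define Y where "Y = (\<Union>k. s k ` space M)"
  have "countable Y" unfolding Y_def using s(1) by (intro countable_UN) (auto simp: simple_function_def countable_finite)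
  then have "AE t in M. \<forall>y\<in>Y. \<delta> t \<bullet> y = 0" using assms(2) by (simp add: AE_ball_countable)
  then show ?thesis using s(2) AE_space
  proof eventually_elim
    case (elim t)
    have "(\<lambda>k. \<delta> t \<bullet> s k t) \<longlonglongrightarrow> \<delta> t \<bullet> \<delta> t" by (intro tendsto_intros elim(2))
    moreover have "\<delta> t \<bullet> s k t = 0" for k using elim(1,3) by (auto simp: Y_def)
    ultimately have "\<delta> t \<bullet> \<delta> t = 0" by (simp add: LIMSEQ_const_iff)
    then show ?case by simp
  qed
qed

text \<open>A map that does not increase distances carries simple approximations to simple
  approximations. It is used with \<open>\<Phi>\<close> the class of a function, of its gradient and
  of its Laplacian.\<close>

lemma strongly_measurable_smeas:
  assumes u: "strongly_measurable {0<..<T} Y N u"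
    and N: "\<And>a b. a \<in> Y \<Longrightarrow> b \<in> Y \<Longrightarrow> norm (\<Phi> a - \<Phi> b) \<le> N (\<lambda>x. a x - b x)"
  shows "smeas (lebesgue_on {0<..<T}) (\<lambda>t. \<Phi> (u t) :: 'h::real_normed_vector)"
proof -
  let ?J = "lebesgue_on {0<..<T}"
  obtain s where s: "\<And>k::nat. simple_function ?J (s k)" "\<And>k t. t \<in> {0<..<T} \<Longrightarrow> s k t \<in> Y"
    "AE t in ?J. (\<lambda>k. N (\<lambda>x. s k t x - u t x)) \<longlonglongrightarrow> 0" and Y: "AE t in ?J. u t \<in> Y"
    using u unfolding strongly_measurable_def by blast
  have "simple_function ?J (\<lambda>t. \<Phi> (s k t))" for k using simple_function_compose1[OF s(1), of \<Phi>] .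
  moreover have "AE t in ?J. (\<lambda>k. \<Phi> (s k t)) \<longlonglongrightarrow> \<Phi> (u t)"
    using s(3) Y AE_space
  proof eventually_elim
    case (elim t)
    have t: "t \<in> {0<..<T}" using elim(3) by simp
    have "(\<lambda>k. norm (\<Phi> (s k t) - \<Phi> (u t))) \<longlonglongrightarrow> 0"
      by (rule tendsto_sandwich[OF _ _ tendsto_const elim(1)]) (simp_all add: N s(2)[OF t] elim(2))
    then show ?case by (simp add: tendsto_norm_zero_iff LIM_zero_iff)
  qed
  ultimately show ?thesis unfolding smeas_def by (intro exI[of _ "\<lambda>k t. \<Phi> (s k t)"] conjI allI)
qed

context time_interval
begin

sublocale JO: open_domain "{0<..<T}"
  by unfold_locales auto

lemma integral_indicator_J:
  fixes f :: "real \<Rightarrow> real"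
  assumes "continuous_on UNIV f" "t \<in> {0..T}"
  shows "(LINT s|J. indicator {..<t} s * f s) = integral {0..t} f"
proof -
  have ci: "integrable (lebesgue_on {0..t}) f"
    by (rule continuous_imp_integrable_real[OF continuous_on_subset[OF assms(1)]]) simp
  have "(LINT s|J. indicator {..<t} s * f s) = (LINT s|lebesgue. (if s \<in> {0<..<T} then indicator {..<t} s * f s else 0))"
    by (rule Lebesgue_Measure.integral_restrict_UNIV[symmetric]) auto
  also have "\<dots> = (LINT s|lebesgue. (if s \<in> {0..t} then f s else 0))"
  proof (rule integral_cong_AE_complete[OF complete_measure_lebesgue])
    have "{0, t} \<in> null_sets lebesgue" using negligible_iff_null_sets negligible_finite by blast
    from AE_not_in[OF this] show "AE s in lebesgue. (if s \<in> {0<..<T} then indicator {..<t} s * f s else 0) = (if s \<in> {0..t} then f s else 0)"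
    proof eventually_elim
      case (elim s)
      then show ?case using assms(2) by (auto simp: indicator_def)
    qed
  qed
  also have "\<dots> = (LINT s|lebesgue_on {0..t}. f s)"
    by (rule Lebesgue_Measure.integral_restrict_UNIV) auto
  also have "\<dots> = integral {0..t} f" by (rule lebesgue_integral_eq_integral[OF ci]) auto
  finally show ?thesis .
qed

section \<open>Weak derivatives of real functions of time\<close>

lemma test_real_derivative:
  assumes "\<phi> \<in> test_fun S"
  shows "(\<phi> has_real_derivative partial_deriv 1 \<phi> t) (at t)"
  unfolding has_field_derivative_def
  using has_derivative_partial[OF test_fun_differentiable[OF assms], of t]
  by (rule has_derivative_eq_rhs) (auto simp: mult.commute)

lemma test_zero:
  assumes "\<phi> \<in> test_fun {0<..<T}" "t \<notin> {0<..<T}"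
  shows "\<phi> t = 0"
  using assms by (elim test_funD) blast

lemma test_antideriv:
  assumes \<phi>: "\<phi> \<in> test_fun {0<..<T}"
  shows "antideriv \<phi> (partial_deriv 1 \<phi>)"
  unfolding antideriv_def
proof (intro conjI ballI allI)
  have p: "partial_deriv 1 \<phi> \<in> test_fun {0<..<T}" by (rule test_fun_partial[OF \<phi>]) simp
  show l: "l2c J (partial_deriv 1 \<phi>)" using JO.test_L2[OF p] JD.L2_iff by blast
  fix t y assume t: "t \<in> {0..T}"
  have "(LINT s|J. indicator {..<t} s * (partial_deriv 1 \<phi> s * y)) = (LINT s|J. indicator {..<t} s * partial_deriv 1 \<phi> s) * y"
    by (simp add: mult.assoc[symmetric])
  also have "(LINT s|J. indicator {..<t} s * partial_deriv 1 \<phi> s) = integral {0..t} (partial_deriv 1 \<phi>)"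
    by (rule integral_indicator_J[OF JO.test_continuous[OF p] t])
  also have "\<dots> = \<phi> t - \<phi> 0"
  proof (rule integral_unique, rule fundamental_theorem_of_calculus)
    fix x assume "x \<in> {0..t}"
    show "(\<phi> has_vector_derivative partial_deriv 1 \<phi> x) (at x within {0..t})"
      using has_field_derivative_at_within[OF test_real_derivative[OF \<phi>, of x]]
      by (simp add: has_real_derivative_iff_has_vector_derivative)
  qed (use t in simp)
  also have "\<phi> 0 = 0" by (rule test_zero[OF \<phi>]) simp
  finally show "\<phi> t \<bullet> y = (LINT s|J. indicator {..<t} s * (partial_deriv 1 \<phi> s \<bullet> y))" by simp
qed

lemma integration_by_parts_test:
  assumes "antideriv u v" "\<phi> \<in> test_fun {0<..<T}"
  shows "(LINT t|J. partial_deriv 1 \<phi> t * (u t \<bullet> y)) = - (LINT t|J. \<phi> t * (v t \<bullet> y))"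
proof -
  note a = test_antideriv[OF assms(2)] and b = antideriv_comp_inner[OF assms(1), of y]
  have "(LINT t|J. partial_deriv 1 \<phi> t \<bullet> (u t \<bullet> y) + \<phi> t \<bullet> (v t \<bullet> y)) = \<phi> T \<bullet> (u T \<bullet> y)"
    by (rule antideriv_product[OF a b])
  moreover have "\<phi> T = 0" by (rule test_zero[OF assms(2)]) simp
  ultimately show ?thesis
    using J.integrable_inner[OF antideriv_l2c[OF a] antideriv_l2c_fun[OF b]]
      J.integrable_inner[OF antideriv_l2c_fun[OF a] antideriv_l2c[OF b]] by simp
qed

text \<open>Vanishing mean makes the primitive zero to the right of the support as well. The
  interval \<open>{c..d}\<close> leaves a margin around the support, so that the primitive is
  locally zero and smooth near the end points too.\<close>

lemma prim_test:
  assumes \<psi>: "\<psi> \<in> test_fun {0<..<T}" and z: "(LINT t|J. \<psi> t) = 0"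
  shows "prim \<psi> \<in> test_fun {0<..<T}" "partial_deriv 1 (prim \<psi>) = \<psi>"
proof -
  obtain K where K: "\<And>k. Ck k \<psi>" "compact K" "K \<subseteq> {0<..<T}" "\<And>x. x \<notin> K \<Longrightarrow> \<psi> x = 0"
    by (rule test_funD[OF \<psi>]) blast
  obtain c d where cd: "0 < c" "c < d" "d < T" "K \<subseteq> {c<..<d}"
  proof (cases "K = {}")
    case True
    then show thesis using that[of "T / 3" "2 * T / 3"] T_pos by auto
  next
    case False
    obtain c where c: "c \<in> K" "\<And>x. x \<in> K \<Longrightarrow> c \<le> x" using compact_attains_inf[OF K(2) False] by blast
    obtain d where d: "d \<in> K" "\<And>x. x \<in> K \<Longrightarrow> x \<le> d" using compact_attains_sup[OF K(2) False] by blast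
    have "0 < c" "d < T" "c \<le> d" using c d K(3) by auto
    moreover have "K \<subseteq> {c / 2<..<(d + T) / 2}" using c(2) d(2) \<open>0 < c\<close> \<open>d < T\<close> by force
    ultimately show thesis using that[of "c / 2" "(d + T) / 2"] by auto
  qed
  have out: "prim \<psi> t = 0" if "t \<le> c \<or> d \<le> t" for t
  proof (cases "t \<le> c")
    case True
    have "indicator {..<t} s *\<^sub>R \<psi> s = 0" for s
      using True K(4)[of s] subsetD[OF cd(4), of s] by (cases "s \<in> K") (auto simp: indicator_def)
    then show ?thesis unfolding prim_def by (simp only: Bochner_Integration.integral_zero)
  next
    case False
    have "indicator {..<t} s *\<^sub>R \<psi> s = \<psi> s" for s
      using False that K(4)[of s] subsetD[OF cd(4), of s] by (cases "s \<in> K") (auto simp: indicator_def)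
    then show ?thesis unfolding prim_def by (simp only: z)
  qed
  have cont: "continuous_on UNIV \<psi>" by (rule Ck_continuous[OF K(1)])
  have D: "(prim \<psi> has_real_derivative \<psi> t) (at t)" for t
  proof (cases "0 < t \<and> t < T")
    case True
    have "((\<lambda>u. integral {0..u} \<psi>) has_vector_derivative \<psi> t) (at t within {0..T})"
      by (rule integral_has_vector_derivative[OF continuous_on_subset[OF cont]]) (use True in auto)
    then have "((\<lambda>u. integral {0..u} \<psi>) has_real_derivative \<psi> t) (at t)"
      using True at_within_interior[of t "{0..T}"] by (simp add: has_real_derivative_iff_has_vector_derivative)
    then show ?thesis
    proof (rule has_field_derivative_transform_within_open[of _ _ _ "{0<..<T}"])
      fix u assume "u \<in> {0<..<T}"
      then show "integral {0..u} \<psi> = prim \<psi> u" using integral_indicator_J[OF cont, of u] by (simp add: prim_def)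
    qed (use True in auto)
  next
    case False
    then have "t < c \<or> d < t" using cd by auto
    moreover have "\<psi> t = 0" using K(3) False by (intro K(4)) auto
    ultimately have "((\<lambda>u. 0) has_real_derivative \<psi> t) (at t)" by simp
    then show ?thesis
      by (rule has_field_derivative_transform_within_open[of _ _ _ "{..<c} \<union> {d<..}"])
        (use \<open>t < c \<or> d < t\<close> out in auto)
  qed
  have D': "(prim \<psi> has_derivative (\<lambda>h. h * \<psi> t)) (at t)" for t
    using D[of t] unfolding has_field_derivative_def by (rule has_derivative_eq_rhs) (auto simp: mult.commute)
  show e: "partial_deriv 1 (prim \<psi>) = \<psi>"
    by (rule ext) (simp add: partial_derivI[OF D'])
  have "Ck (Suc k) (prim \<psi>)" for k
    using K(1)[of k] e differentiableI[OF D'] by simp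
  then have "Ck k (prim \<psi>)" for k by (rule Ck_pred)
  then show "prim \<psi> \<in> test_fun {0<..<T}"
    by (rule test_funI[of _ "{c..d}"]) (use cd out in auto)
qed

lemma continuous_L2_J:
  assumes "continuous_on {0..T} (r :: real \<Rightarrow> real)" shows "l2c J r"
proof -
  have "continuous_on {0<..<T} r" by (rule continuous_on_subset[OF assms]) auto
  then have "r \<in> borel_measurable J" by (rule continuous_imp_measurable_on_sets_lebesgue) auto
  moreover obtain B where "\<forall>x\<in>r ` {0..T}. norm x \<le> B"
    using compact_imp_bounded[OF compact_continuous_image[OF assms compact_Icc]] unfolding bounded_iff by blast
  ultimately show ?thesis by (intro l2c_bounded[OF borel_smeas, where C=B]) auto
qed

text \<open>Every test function differs by a multiple of one fixed test function from a function of
  mean zero, that is, from a derivative. So \<open>r\<close> is almost everywhere a constant, and by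
  continuity everywhere.\<close>

lemma du_bois_reymond:
  assumes r: "continuous_on {0..T} r"
    and z: "\<And>\<phi>. \<phi> \<in> test_fun {0<..<T} \<Longrightarrow> (LINT t|J. partial_deriv 1 \<phi> t * r t) = (0::real)"
    and t: "t \<in> {0..T}"
  shows "r t = r 0"
proof -
  have rl: "l2c J r" by (rule continuous_L2_J[OF r])
  have rL: "r \<in> L2 {0<..<T}" using rl JD.L2_iff by blast
  have oneL: "(\<lambda>t. c::real) \<in> L2 {0<..<T}" for c using l2c_const JD.L2_iff by blast
  \<comment> \<open>If all means vanished, the fundamental lemma would show 1 = 0 almost everywhere
    on an interval of positive length.\<close>
  have "\<exists>\<psi>\<in>test_fun {0<..<T}. (LINT t|J. \<psi> t) \<noteq> 0"
  proof (rule ccontr)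
    assume "\<not> ?thesis"
    then have "AE t in J. (1::real) = 0" by (intro JO.fundamental_lemma[OF oneL]) auto
    then have "AE t in J. False" by simp
    then have "{t \<in> space J. \<not> False} \<in> null_sets J" unfolding J.AE_iff_null_sets .
    moreover have "{t \<in> space J. \<not> False} = {0<..<T}" by auto
    ultimately have "{0<..<T} \<in> null_sets J" by (simp only:)
    then have "emeasure J {0<..<T} = 0" by (rule null_setsD1)
    then show False using measure_J T_pos by (simp add: measure_def)
  qed
  then obtain \<psi>0 where \<psi>0: "\<psi>0 \<in> test_fun {0<..<T}" "(LINT t|J. \<psi>0 t) \<noteq> 0" by blast
  have ti: "integrable J \<psi>" "integrable J (\<lambda>t. \<psi> t * r t)" if "\<psi> \<in> test_fun {0<..<T}" for \<psi>
    using JO.integrable_mult_L2[OF JO.test_L2[OF that] oneL[of 1]] JO.integrable_mult_L2[OF JO.test_L2[OF that] rL] by simp_all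
  \<comment> \<open>The only possible constant, as the test function \<open>\<psi>0\<close>
    shows.\<close>
  define c where "c = (LINT t|J. \<psi>0 t * r t) / (LINT t|J. \<psi>0 t)"
  have "AE t in J. r t - c = 0"
  proof (rule JO.fundamental_lemma[OF JD.L2_diff[OF rL oneL]])
    fix \<psi> assume \<psi>: "\<psi> \<in> test_fun {0<..<T}"
    define a where "a = (LINT t|J. \<psi> t) / (LINT t|J. \<psi>0 t)"
    define \<eta> where "\<eta> t = \<psi> t + (- a) * \<psi>0 t" for t
    have \<eta>: "\<eta> \<in> test_fun {0<..<T}" unfolding \<eta>_def by (intro test_fun_add test_fun_cmult \<psi> \<psi>0(1))
    have "(LINT t|J. \<eta> t) = (LINT t|J. \<psi> t) - a * (LINT t|J. \<psi>0 t)"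
      using ti(1)[OF \<psi>] ti(1)[OF \<psi>0(1)] by (simp add: \<eta>_def)
    then have "(LINT t|J. \<eta> t) = 0" using \<psi>0(2) by (simp add: a_def)
    from z[OF prim_test(1)[OF \<eta> this]] prim_test(2)[OF \<eta> this] have "(LINT t|J. \<eta> t * r t) = 0" by simp
    moreover have "(LINT t|J. \<eta> t * r t) = (LINT t|J. \<psi> t * r t) - a * (LINT t|J. \<psi>0 t * r t)"
      using ti(2)[OF \<psi>] ti(2)[OF \<psi>0(1)] by (simp add: \<eta>_def distrib_right mult.assoc left_diff_distrib)
    ultimately have "(LINT t|J. \<psi> t * r t) = c * (LINT t|J. \<psi> t)" using \<psi>0(2) by (simp add: a_def c_def)
    then show "(LINT t|J. (r t - c) * \<psi> t) = 0"
      using ti[OF \<psi>] by (simp add: left_diff_distrib mult.commute[of "r _"])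
  qed
  then have ae: "AE t in lebesgue. t \<in> {0<..<T} \<longrightarrow> r t = c" by (simp add: AE_restrict_space_iff)
  \<comment> \<open>The set is open and negligible, hence empty.\<close>
  have "{t \<in> {0<..<T}. r t \<noteq> c} = {}"
  proof (rule ccontr)
    assume ne: "{t \<in> {0<..<T}. r t \<noteq> c} \<noteq> {}"
    have c0: "continuous_on {0<..<T} r" by (rule continuous_on_subset[OF r]) auto
    have "open ({0<..<T} \<inter> r -` (- {c}))"
      by (rule continuous_open_preimage[OF c0]) auto
    moreover have "{0<..<T} \<inter> r -` (- {c}) = {t \<in> {0<..<T}. r t \<noteq> c}" by auto
    ultimately have "open {t \<in> {0<..<T}. r t \<noteq> c}" by simp
    then have "\<not> negligible {t \<in> {0<..<T}. r t \<noteq> c}" using ne open_not_negligible by blast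
    moreover have "{t \<in> {0<..<T}. r t \<noteq> c} \<in> null_sets lebesgue"
    proof -
      have "AE t in lebesgue. t \<notin> {t \<in> {0<..<T}. r t \<noteq> c}" using ae by eventually_elim auto
      then show ?thesis unfolding completion.null_sets_iff_AE by simp
    qed
    ultimately show False using negligible_iff_null_sets by blast
  qed
  then have "\<And>s. s \<in> {0<..<T} \<Longrightarrow> r s = c" by blast
  moreover have "closure {0<..<T} = {0..T}" using T_pos by (simp add: closure_greaterThanLessThan)
  ultimately have "r s = c" if "s \<in> {0..T}" for s
    using continuous_constant_on_closure[of "{0<..<T}" r c s] r that by simp
  then show ?thesis using t T_pos by simp
qed

text \<open>\<open>p\<close> and the primitive of \<open>q\<close> have the same weak derivative, so
  their difference is constant.\<close>

lemma weak_deriv_imp_integral: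
  fixes p q :: "real \<Rightarrow> real"
  assumes p: "continuous_on {0..T} p" and q: "l2c J q"
    and w: "\<And>\<phi>. \<phi> \<in> test_fun {0<..<T} \<Longrightarrow> (LINT t|J. partial_deriv 1 \<phi> t * p t) = - (LINT t|J. \<phi> t * q t)"
    and t: "t \<in> {0..T}"
  shows "p t - p 0 = (LINT s|J. indicator {..<t} s * q s)"
proof -
  note a = antideriv_prim[OF q]
  have cq: "continuous_on {0..T} (prim q)"
    unfolding continuous_on_def using antideriv_tendsto[OF a] by blast
  have "p t - prim q t = p 0 - prim q 0"
  proof (rule du_bois_reymond[OF continuous_on_diff[OF p cq] _ t])
    fix \<phi> assume \<phi>: "\<phi> \<in> test_fun {0<..<T}"
    have L: "partial_deriv 1 \<phi> \<in> L2 {0<..<T}" by (intro JO.test_L2 test_fun_partial \<phi>) simp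
    have "p \<in> L2 {0<..<T}" "prim q \<in> L2 {0<..<T}"
      using continuous_L2_J p cq JD.L2_iff by blast+
    then have "integrable J (\<lambda>t. partial_deriv 1 \<phi> t * p t)" "integrable J (\<lambda>t. partial_deriv 1 \<phi> t * prim q t)"
      using JO.integrable_mult_L2[OF L] by blast+
    then have "(LINT t|J. partial_deriv 1 \<phi> t * (p t - prim q t)) =
        (LINT t|J. partial_deriv 1 \<phi> t * p t) - (LINT t|J. partial_deriv 1 \<phi> t * prim q t)"
      by (simp add: right_diff_distrib)
    then show "(LINT t|J. partial_deriv 1 \<phi> t * (p t - prim q t)) = 0"
      using w[OF \<phi>] integration_by_parts_test[OF a \<phi>, of 1] by simp
  qed
  then have "p t - p 0 = prim q t" using antideriv_zero[OF a] by simp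
  then show ?thesis by (simp add: prim_def)
qed

end

locale spacetime = time_interval T + O: open_domain \<Omega>
  for T :: real and \<Omega> :: "'a::euclidean_space set"
begin

text \<open>\<open>has_time_deriv\<close> tests with functions on \<Omega>, \<open>antideriv\<close>
  with arbitrary classes. A representative links the two, as classes of functions on \<Omega> do not
  see its values elsewhere. For each test vector the claim is then a scalar one.\<close>

lemma time_deriv_antideriv:
  fixes u v :: "real \<Rightarrow> 'a \<Rightarrow> 'b::euclidean_space"
  assumes uL: "\<And>t. t \<in> {0..T} \<Longrightarrow> u t \<in> L2 \<Omega>"
    and cont: "\<And>t. t \<in> {0..T} \<Longrightarrow> ((\<lambda>s. cls \<Omega> (u s)) \<longlongrightarrow> cls \<Omega> (u t)) (at t within {0..T})"
    and u0: "cls \<Omega> (u 0) = 0" and v: "l2c J (\<lambda>t. cls \<Omega> (v t))" and vL: "AE t in J. v t \<in> L2 \<Omega>"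
    and d: "has_time_deriv {0<..<T} (L2 \<Omega>) (L2_inner \<Omega>) u v"
  shows "antideriv (\<lambda>t. cls \<Omega> (u t)) (\<lambda>t. cls \<Omega> (v t))"
  unfolding antideriv_def
proof (intro conjI ballI allI, rule v)
  fix t and y :: "('a, 'b) ltwo" assume t: "t \<in> {0..T}"
  define y' where "y' = rep_ltwo y"
  have y'L: "y' \<in> L2 \<Omega>" by (simp add: y'_def O.rep_L2)
  have yy: "cls \<Omega> a \<bullet> y = L2_inner \<Omega> a y'" if "a \<in> L2 \<Omega>" for a :: "'a \<Rightarrow> 'b"
    using O.inner_cls_rep[OF that, of y] O.inner_cls[OF that y'L] by (simp add: y'_def inner_commute)
  have "cls \<Omega> (u t) \<bullet> y - cls \<Omega> (u 0) \<bullet> y = (LINT s|J. indicator {..<t} s * (cls \<Omega> (v s) \<bullet> y))"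
  proof (rule weak_deriv_imp_integral[OF _ _ _ t])
    show "continuous_on {0..T} (\<lambda>t. cls \<Omega> (u t) \<bullet> y)"
      unfolding continuous_on_def by (intro ballI tendsto_inner cont tendsto_const)
    show "l2c J (\<lambda>s. cls \<Omega> (v s) \<bullet> y)" by (rule J.l2c_linear[OF bounded_linear_inner_left v])
    fix \<phi> assume \<phi>: "\<phi> \<in> test_fun {0<..<T}"
    have "(LINT t|J. partial_deriv 1 \<phi> t * (cls \<Omega> (u t) \<bullet> y)) = (LINT t|J. partial_deriv 1 \<phi> t * L2_inner \<Omega> (u t) y')"
      by (intro Bochner_Integration.integral_cong refl) (simp add: yy uL)
    also have "\<dots> = - (LINT t|J. \<phi> t * L2_inner \<Omega> (v t) y')"
      using d \<phi> y'L unfolding has_time_deriv_def by blast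
    also have "(LINT t|J. \<phi> t * L2_inner \<Omega> (v t) y') = (LINT t|J. \<phi> t * (cls \<Omega> (v t) \<bullet> y))"
      by (rule integral_cong_AE_complete[OF J.complete_measure_axioms]) (use vL in eventually_elim, simp add: yy)
    finally show "(LINT t|J. partial_deriv 1 \<phi> t * (cls \<Omega> (u t) \<bullet> y)) = - (LINT t|J. \<phi> t * (cls \<Omega> (v t) \<bullet> y))" .
  qed
  then show "cls \<Omega> (u t) \<bullet> y = (LINT s|J. indicator {..<t} s * (cls \<Omega> (v s) \<bullet> y))" by (simp add: u0)
qed

lemma antideriv_time_deriv:
  fixes u v :: "real \<Rightarrow> 'a \<Rightarrow> 'b::euclidean_space"
  assumes a: "antideriv (\<lambda>t. cls \<Omega> (u t)) (\<lambda>t. cls \<Omega> (v t))"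
    and L: "AE t in J. u t \<in> L2 \<Omega>" "AE t in J. v t \<in> L2 \<Omega>"
  shows "has_time_deriv {0<..<T} (L2 \<Omega>) (L2_inner \<Omega>) u v"
  unfolding has_time_deriv_def
proof (intro ballI)
  fix \<phi> and y :: "'a \<Rightarrow> 'b" assume \<phi>: "\<phi> \<in> test_fun {0<..<T}" and y: "y \<in> L2 \<Omega>"
  have "(LINT t|J. partial_deriv 1 \<phi> t * L2_inner \<Omega> (u t) y) = (LINT t|J. partial_deriv 1 \<phi> t * (cls \<Omega> (u t) \<bullet> cls \<Omega> y))"
    by (rule integral_cong_AE_complete[OF J.complete_measure_axioms]) (use L(1) in eventually_elim, simp add: O.inner_cls y)
  also have "\<dots> = - (LINT t|J. \<phi> t * (cls \<Omega> (v t) \<bullet> cls \<Omega> y))" by (rule integration_by_parts_test[OF a \<phi>])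
  also have "(LINT t|J. \<phi> t * (cls \<Omega> (v t) \<bullet> cls \<Omega> y)) = (LINT t|J. \<phi> t * L2_inner \<Omega> (v t) y)"
    by (rule integral_cong_AE_complete[OF J.complete_measure_axioms]) (use L(2) in eventually_elim, simp add: O.inner_cls y)
  finally show "(LINT t|J. partial_deriv 1 \<phi> t * L2_inner \<Omega> (u t) y) = - (LINT t|J. \<phi> t * L2_inner \<Omega> (v t) y)" .
qed

section \<open>Bochner spaces as spaces of curves of classes\<close>

lemma bochner_L2_cls:
  fixes u :: "real \<Rightarrow> 'a \<Rightarrow> 'b::euclidean_space"
  assumes "u \<in> bochner_L2 {0<..<T} (L2 \<Omega>) (L2_norm \<Omega>)"
  shows "AE t in J. u t \<in> L2 \<Omega>" "l2c J (\<lambda>t. cls \<Omega> (u t))"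
    "bochner_L2_norm {0<..<T} (L2_norm \<Omega>) u = l2n J (\<lambda>t. cls \<Omega> (u t))"
proof -
  have sm: "strongly_measurable {0<..<T} (L2 \<Omega>) (L2_norm \<Omega>) u"
    and int: "integrable J (\<lambda>t. (L2_norm \<Omega> (u t))\<^sup>2)" using assms by (auto simp: bochner_L2_def)
  show L: "AE t in J. u t \<in> L2 \<Omega>" using sm by (simp add: strongly_measurable_def)
  have s: "smeas J (\<lambda>t. cls \<Omega> (u t))"
    by (rule strongly_measurable_smeas[OF sm]) (simp add: O.norm_cls[OF O.L2_diff, symmetric] O.cls_diff)
  have e: "AE t in J. (L2_norm \<Omega> (u t))\<^sup>2 = (norm (cls \<Omega> (u t)))\<^sup>2"
    using L by eventually_elim (simp add: O.norm_cls)
  have "(\<lambda>t. (norm (cls \<Omega> (u t)))\<^sup>2) \<in> borel_measurable J" using smeas_borel[OF smeas_norm[OF s]] by measurable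
  then have "integrable J (\<lambda>t. (norm (cls \<Omega> (u t)))\<^sup>2)"
    by (rule integrable_cong_AE_imp[OF int]) (rule e)
  then show "l2c J (\<lambda>t. cls \<Omega> (u t))" using s by (simp add: l2c_def)
  show "bochner_L2_norm {0<..<T} (L2_norm \<Omega>) u = l2n J (\<lambda>t. cls \<Omega> (u t))"
    unfolding bochner_L2_norm_def l2n_def integral_cong_AE_complete[OF J.complete_measure_axioms e] ..
qed

lemma bochner_L2_H10:
  assumes "u \<in> bochner_L2 {0<..<T} (H10 \<Omega>) (H10_norm \<Omega>)"
  shows "AE t in J. u t \<in> H10 \<Omega>" "l2c J (\<lambda>t. O.Gr (u t))"
    "bochner_L2_norm {0<..<T} (H10_norm \<Omega>) u = l2n J (\<lambda>t. O.Gr (u t))"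
proof -
  have sm: "strongly_measurable {0<..<T} (H10 \<Omega>) (H10_norm \<Omega>) u"
    and int: "integrable J (\<lambda>t. (H10_norm \<Omega> (u t))\<^sup>2)" using assms by (auto simp: bochner_L2_def)
  show L: "AE t in J. u t \<in> H10 \<Omega>" using sm by (simp add: strongly_measurable_def)
  have s: "smeas J (\<lambda>t. O.Gr (u t))"
    by (rule strongly_measurable_smeas[OF sm]) (simp add: O.H10_norm_eq[OF O.H10_H1[OF O.H10_diff(1)]] O.H10_diff(2))
  have e: "AE t in J. (H10_norm \<Omega> (u t))\<^sup>2 = (norm (O.Gr (u t)))\<^sup>2"
    using L by eventually_elim (simp add: O.H10_norm_eq[OF O.H10_H1])
  have "(\<lambda>t. (norm (O.Gr (u t)))\<^sup>2) \<in> borel_measurable J" using smeas_borel[OF smeas_norm[OF s]] by measurable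
  then have "integrable J (\<lambda>t. (norm (O.Gr (u t)))\<^sup>2)"
    by (rule integrable_cong_AE_imp[OF int]) (rule e)
  then show "l2c J (\<lambda>t. O.Gr (u t))" using s by (simp add: l2c_def)
  show "bochner_L2_norm {0<..<T} (H10_norm \<Omega>) u = l2n J (\<lambda>t. O.Gr (u t))"
    unfolding bochner_L2_norm_def l2n_def integral_cong_AE_complete[OF J.complete_measure_axioms e] ..
qed

text \<open>The graph norm controls the Laplacian. Although \<open>laplacian\<close> chooses a
  representative, its class respects differences by uniqueness, so the map to this class does not
  increase distances.\<close>

lemma bochner_L2_X:
  assumes "u \<in> bochner_L2 {0<..<T} (Xspace \<Omega>) (X_norm \<Omega>)"
  shows "AE t in J. u t \<in> Xspace \<Omega>" "l2c J (\<lambda>t. cls \<Omega> (laplacian \<Omega> (u t)))"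
proof -
  have sm: "strongly_measurable {0<..<T} (Xspace \<Omega>) (X_norm \<Omega>) u"
    and int: "integrable J (\<lambda>t. (X_norm \<Omega> (u t))\<^sup>2)" using assms by (auto simp: bochner_L2_def)
  show L: "AE t in J. u t \<in> Xspace \<Omega>" using sm by (simp add: strongly_measurable_def)
  have le: "L2_norm \<Omega> (laplacian \<Omega> a) \<le> X_norm \<Omega> a" for a
    unfolding X_norm_def by (rule real_le_rsqrt) simp
  have diff: "cls \<Omega> (laplacian \<Omega> (\<lambda>x. a x - b x)) = cls \<Omega> (laplacian \<Omega> a) - cls \<Omega> (laplacian \<Omega> b)"
    "laplacian \<Omega> (\<lambda>x. a x - b x) \<in> L2 \<Omega>"
    if a: "a \<in> Xspace \<Omega>" and b: "b \<in> Xspace \<Omega>" for a b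
  proof -
    note A = O.X_laplacian[OF a] and B = O.X_laplacian[OF b]
    have ab: "a \<in> L2 \<Omega>" "b \<in> L2 \<Omega>" using a b by (auto simp: Xspace_def)
    have pair: "cls \<Omega> (\<lambda>x. laplacian \<Omega> a x - laplacian \<Omega> b x) \<bullet> cls \<Omega> \<phi>
        = (LINT x|lebesgue_on \<Omega>. (a x - b x) * (\<Sum>i\<in>Basis. partial_deriv i (partial_deriv i \<phi>) x))"
      if \<phi>: "\<phi> \<in> test_fun \<Omega>" for \<phi>
    proof -
      have S: "(\<lambda>x. \<Sum>i\<in>Basis. partial_deriv i (partial_deriv i \<phi>) x) \<in> L2 \<Omega>"
        by (intro O.L2_sum O.test_L2 test_fun_partial \<phi>)
      show ?thesis
        using O.weak_laplacian_pairing[OF A \<phi>] O.weak_laplacian_pairing[OF B \<phi>]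
          O.integrable_mult_L2[OF ab(1) S] O.integrable_mult_L2[OF ab(2) S]
        by (simp add: O.cls_diff A B inner_diff_left left_diff_distrib)
    qed
    have AB: "(\<lambda>x. laplacian \<Omega> a x - laplacian \<Omega> b x) \<in> L2 \<Omega>" by (rule O.L2_diff[OF A(1) B(1)])
    have "has_weak_laplacian \<Omega> (\<lambda>x. a x - b x) (\<lambda>x. laplacian \<Omega> a x - laplacian \<Omega> b x)"
      unfolding has_weak_laplacian_def using pair AB O.inner_cls[OF AB O.test_L2] by (simp add: L2_inner_def)
    then have "(\<lambda>x. a x - b x) \<in> Xspace \<Omega>" using O.L2_diff[OF ab] AB by (auto simp: Xspace_def)
    note C = O.X_laplacian[OF this]
    show "laplacian \<Omega> (\<lambda>x. a x - b x) \<in> L2 \<Omega>" by (rule C(1))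
    have "cls \<Omega> (laplacian \<Omega> (\<lambda>x. a x - b x)) = cls \<Omega> (\<lambda>x. laplacian \<Omega> a x - laplacian \<Omega> b x)"
      by (rule O.laplacian_unique[OF C(1) AB]) (simp add: pair O.weak_laplacian_pairing[OF C])
    then show "cls \<Omega> (laplacian \<Omega> (\<lambda>x. a x - b x)) = cls \<Omega> (laplacian \<Omega> a) - cls \<Omega> (laplacian \<Omega> b)"
      by (simp add: O.cls_diff A B)
  qed
  have s: "smeas J (\<lambda>t. cls \<Omega> (laplacian \<Omega> (u t)))"
  proof (rule strongly_measurable_smeas[OF sm, of "\<lambda>a. cls \<Omega> (laplacian \<Omega> a)"])
    fix a b assume ab: "a \<in> Xspace \<Omega>" "b \<in> Xspace \<Omega>"
    show "norm (cls \<Omega> (laplacian \<Omega> a) - cls \<Omega> (laplacian \<Omega> b)) \<le> X_norm \<Omega> (\<lambda>x. a x - b x)"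
      using le[of "\<lambda>x. a x - b x"] by (simp add: diff(1)[OF ab, symmetric] O.norm_cls[OF diff(2)[OF ab]])
  qed
  have "integrable J (\<lambda>t. (norm (cls \<Omega> (laplacian \<Omega> (u t))))\<^sup>2)"
  proof (rule Bochner_Integration.integrable_bound[OF int])
    show "(\<lambda>t. (norm (cls \<Omega> (laplacian \<Omega> (u t))))\<^sup>2) \<in> borel_measurable J"
      using smeas_borel[OF smeas_norm[OF s]] by measurable
    show "AE t in J. norm ((norm (cls \<Omega> (laplacian \<Omega> (u t))))\<^sup>2) \<le> norm ((X_norm \<Omega> (u t))\<^sup>2)"
      using L
    proof eventually_elim
      case (elim t)
      have "(norm (cls \<Omega> (laplacian \<Omega> (u t))))\<^sup>2 \<le> (X_norm \<Omega> (u t))\<^sup>2"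
        unfolding O.norm_cls[OF O.X_laplacian(1)[OF elim]]
        using le[of "u t"] norm_ge_zero[of "cls \<Omega> (laplacian \<Omega> (u t))"]
        by (intro power_mono) (simp_all only: O.norm_cls[OF O.X_laplacian(1)[OF elim]])
      then show ?case by simp
    qed
  qed
  then show "l2c J (\<lambda>t. cls \<Omega> (laplacian \<Omega> (u t)))" using s by (simp add: l2c_def)
qed

text \<open>Any explicitly known weak derivative may stand in for the one chosen by
  \<open>dt\<close>. Paired with a fixed vector, the difference vanishes by the fundamental lemma in
  time, and \<open>smeas_weakly_zero\<close> makes the null set independent of the vector.\<close>

lemma dt_unique:
  fixes u v :: "real \<Rightarrow> 'a \<Rightarrow> 'b::euclidean_space"
  assumes v: "v \<in> bochner_L2 {0<..<T} (L2 \<Omega>) (L2_norm \<Omega>)"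
    and d: "has_time_deriv {0<..<T} (L2 \<Omega>) (L2_inner \<Omega>) u v"
  shows "AE t in J. dt T \<Omega> u t \<in> L2 \<Omega> \<and> cls \<Omega> (dt T \<Omega> u t) = cls \<Omega> (v t)"
    and "dt T \<Omega> u \<in> bochner_L2 {0<..<T} (L2 \<Omega>) (L2_norm \<Omega>)"
    and "has_time_deriv {0<..<T} (L2 \<Omega>) (L2_inner \<Omega>) u (dt T \<Omega> u)"
proof -
  have "\<exists>v. v \<in> bochner_L2 {0<..<T} (L2 \<Omega>) (L2_norm \<Omega>) \<and> has_time_deriv {0<..<T} (L2 \<Omega>) (L2_inner \<Omega>) u v"
    using v d by blast
  from someI_ex[OF this] show w: "dt T \<Omega> u \<in> bochner_L2 {0<..<T} (L2 \<Omega>) (L2_norm \<Omega>)"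
    and dw: "has_time_deriv {0<..<T} (L2 \<Omega>) (L2_inner \<Omega>) u (dt T \<Omega> u)"
    unfolding dt_def by auto
  note V = bochner_L2_cls[OF v] and W = bochner_L2_cls[OF w]
  have "AE t in J. cls \<Omega> (dt T \<Omega> u t) - cls \<Omega> (v t) = 0"
  proof (rule smeas_weakly_zero)
    show "smeas J (\<lambda>t. cls \<Omega> (dt T \<Omega> u t) - cls \<Omega> (v t))" by (intro smeas_diff l2c_smeas V W)
    fix y :: "('a, 'b) ltwo"
    define y' where "y' = rep_ltwo y"
    have y'L: "y' \<in> L2 \<Omega>" by (simp add: y'_def O.rep_L2)
    have yy: "cls \<Omega> a \<bullet> y = L2_inner \<Omega> a y'" if "a \<in> L2 \<Omega>" for a :: "'a \<Rightarrow> 'b"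
      using O.inner_cls_rep[OF that, of y] O.inner_cls[OF that y'L] by (simp add: y'_def inner_commute)
    have l: "l2c J (\<lambda>t. cls \<Omega> (dt T \<Omega> u t) \<bullet> y)" "l2c J (\<lambda>t. cls \<Omega> (v t) \<bullet> y)"
      by (rule J.l2c_linear[OF bounded_linear_inner_left], rule W V)+
    show "AE t in J. (cls \<Omega> (dt T \<Omega> u t) - cls \<Omega> (v t)) \<bullet> y = 0"
    proof (rule JO.fundamental_lemma)
      show "(\<lambda>t. (cls \<Omega> (dt T \<Omega> u t) - cls \<Omega> (v t)) \<bullet> y) \<in> L2 {0<..<T}"
        unfolding JD.L2_iff inner_diff_left by (rule J.l2c_diff[OF l])
      fix \<phi> assume \<phi>: "\<phi> \<in> test_fun {0<..<T}"
      have i: "integrable J (\<lambda>t. \<phi> t * (cls \<Omega> (dt T \<Omega> u t) \<bullet> y))" "integrable J (\<lambda>t. \<phi> t * (cls \<Omega> (v t) \<bullet> y))"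
        using l by (auto intro!: JO.integrable_mult_L2 JO.test_L2[OF \<phi>] simp: JD.L2_iff)
      have e1: "(LINT t|J. \<phi> t * (cls \<Omega> (dt T \<Omega> u t) \<bullet> y)) = (LINT t|J. \<phi> t * L2_inner \<Omega> (dt T \<Omega> u t) y')"
        by (rule integral_cong_AE_complete[OF J.complete_measure_axioms]) (use W(1) in eventually_elim, simp add: yy)
      have e2: "(LINT t|J. \<phi> t * (cls \<Omega> (v t) \<bullet> y)) = (LINT t|J. \<phi> t * L2_inner \<Omega> (v t) y')"
        by (rule integral_cong_AE_complete[OF J.complete_measure_axioms]) (use V(1) in eventually_elim, simp add: yy)
      have "(LINT t|J. partial_deriv 1 \<phi> t * L2_inner \<Omega> (u t) y') = - (LINT t|J. \<phi> t * L2_inner \<Omega> (dt T \<Omega> u t) y')"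
        using dw \<phi> y'L unfolding has_time_deriv_def by blast
      moreover have "(LINT t|J. partial_deriv 1 \<phi> t * L2_inner \<Omega> (u t) y') = - (LINT t|J. \<phi> t * L2_inner \<Omega> (v t) y')"
        using d \<phi> y'L unfolding has_time_deriv_def by blast
      ultimately have "(LINT t|J. \<phi> t * L2_inner \<Omega> (dt T \<Omega> u t) y') = (LINT t|J. \<phi> t * L2_inner \<Omega> (v t) y')"
        by simp
      then show "(LINT t|J. (cls \<Omega> (dt T \<Omega> u t) - cls \<Omega> (v t)) \<bullet> y * \<phi> t) = 0"
        using e1 e2 i by (simp add: inner_diff_left right_diff_distrib mult.commute[of _ "\<phi> _"])
    qed
  qed
  then show "AE t in J. dt T \<Omega> u t \<in> L2 \<Omega> \<and> cls \<Omega> (dt T \<Omega> u t) = cls \<Omega> (v t)"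
    using W(1) by eventually_elim simp
qed

text \<open>Strong measurability asks for simple approximations with values in functions rather than
  in classes. They are obtained by approximating the real coefficients only.\<close>

lemma bochner_L2_finite_sum:
  fixes s :: "'i \<Rightarrow> 'a \<Rightarrow> 'b::euclidean_space" and a :: "'i \<Rightarrow> real \<Rightarrow> real"
  assumes I: "finite I" and s: "\<And>i. i \<in> I \<Longrightarrow> s i \<in> L2 \<Omega>" and a: "\<And>i. i \<in> I \<Longrightarrow> l2c J (a i)"
  shows "(\<lambda>t x. \<Sum>i\<in>I. a i t *\<^sub>R s i x) \<in> bochner_L2 {0<..<T} (L2 \<Omega>) (L2_norm \<Omega>)"
proof -
  have L: "(\<lambda>x. \<Sum>i\<in>I. c i *\<^sub>R s i x) \<in> L2 \<Omega>" for c by (intro O.L2_sum O.L2_scaleR s)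
  have C: "cls \<Omega> (\<lambda>x. \<Sum>i\<in>I. c i *\<^sub>R s i x) = (\<Sum>i\<in>I. c i *\<^sub>R cls \<Omega> (s i))" for c
    by (simp add: O.cls_sum O.L2_scaleR s O.cls_scaleR)
  have "\<forall>i\<in>I. \<exists>\<sigma>. (\<forall>k::nat. simple_function J (\<sigma> k)) \<and> (AE t in J. (\<lambda>k. \<sigma> k t) \<longlonglongrightarrow> a i t)"
    using l2c_smeas[OF a] unfolding smeas_def by blast
  from bchoice[OF this] obtain \<sigma> where \<sigma>': "\<forall>i\<in>I. (\<forall>k::nat. simple_function J (\<sigma> i k)) \<and> (AE t in J. (\<lambda>k. \<sigma> i k t) \<longlonglongrightarrow> a i t)"
    by blast
  then have \<sigma>: "\<And>i k. i \<in> I \<Longrightarrow> simple_function J (\<sigma> i k)" "\<And>i. i \<in> I \<Longrightarrow> AE t in J. (\<lambda>k. \<sigma> i k t) \<longlonglongrightarrow> a i t"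
    by blast+
  have "AE t in J. \<forall>i\<in>I. (\<lambda>k. \<sigma> i k t) \<longlonglongrightarrow> a i t" using \<sigma>(2) I by (intro AE_finite_allI) auto
  then have conv: "AE t in J. (\<lambda>k. L2_norm \<Omega> (\<lambda>x. (\<Sum>i\<in>I. \<sigma> i k t *\<^sub>R s i x) - (\<Sum>i\<in>I. a i t *\<^sub>R s i x))) \<longlonglongrightarrow> 0"
  proof eventually_elim
    case (elim t)
    have "(\<lambda>k. norm ((\<Sum>i\<in>I. \<sigma> i k t *\<^sub>R cls \<Omega> (s i)) - (\<Sum>i\<in>I. a i t *\<^sub>R cls \<Omega> (s i)))) \<longlonglongrightarrow>
        norm ((\<Sum>i\<in>I. a i t *\<^sub>R cls \<Omega> (s i)) - (\<Sum>i\<in>I. a i t *\<^sub>R cls \<Omega> (s i)))"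
      using elim by (intro tendsto_intros) auto
    moreover have "L2_norm \<Omega> (\<lambda>x. (\<Sum>i\<in>I. \<sigma> i k t *\<^sub>R s i x) - (\<Sum>i\<in>I. a i t *\<^sub>R s i x))
        = norm ((\<Sum>i\<in>I. \<sigma> i k t *\<^sub>R cls \<Omega> (s i)) - (\<Sum>i\<in>I. a i t *\<^sub>R cls \<Omega> (s i)))" for k
      unfolding O.norm_cls[OF O.L2_diff[OF L L], symmetric] O.cls_diff[OF L L] C ..
    ultimately show ?case by simp
  qed
  have simp: "simple_function J (\<lambda>t x. \<Sum>i\<in>I. \<sigma> i k t *\<^sub>R s i x)" for k
    unfolding simple_function_def
  proof
    \<comment> \<open>The sum depends on the tuple of coefficients alone; restricting the tuples to
      \<open>I\<close> makes them finite in number.\<close>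
    have fin: "finite ((\<lambda>t. \<lambda>i\<in>I. \<sigma> i k t) ` space J)"
    proof (rule finite_subset)
      show "(\<lambda>t. \<lambda>i\<in>I. \<sigma> i k t) ` space J \<subseteq> (\<Pi>\<^sub>E i\<in>I. \<sigma> i k ` space J)" by auto
      show "finite (\<Pi>\<^sub>E i\<in>I. \<sigma> i k ` space J)"
        using \<sigma>(1) by (intro finite_PiE I) (auto simp: simple_function_def)
    qed
    define G where "G c = (\<lambda>x. \<Sum>i\<in>I. c i *\<^sub>R s i x)" for c :: "'i \<Rightarrow> real"
    have Gc: "(\<lambda>x. \<Sum>i\<in>I. \<sigma> i k t *\<^sub>R s i x) = G (\<lambda>i\<in>I. \<sigma> i k t)" for t by (simp add: G_def cong: sum.cong)
    have sf: "simple_function J (\<lambda>t. \<lambda>i\<in>I. \<sigma> i k t)"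
      unfolding simple_function_def
    proof (intro conjI fin ballI)
      fix c assume c: "c \<in> (\<lambda>t. \<lambda>i\<in>I. \<sigma> i k t) ` space J"
      have "(\<lambda>t. \<lambda>i\<in>I. \<sigma> i k t) -` {c} \<inter> space J = {t \<in> space J. \<forall>i\<in>I. t \<in> \<sigma> i k -` {c i}}"
        using c by (auto simp: fun_eq_iff restrict_def split: if_splits)
      moreover have "{t \<in> space J. \<forall>i\<in>I. t \<in> \<sigma> i k -` {c i}} \<in> sets J"
      proof (rule sets.sets_Collect_finite_All[OF _ I])
        fix i assume i: "i \<in> I"
        have "{t \<in> space J. t \<in> \<sigma> i k -` {c i}} = \<sigma> i k -` {c i} \<inter> space J" by auto
        then show "{t \<in> space J. t \<in> \<sigma> i k -` {c i}} \<in> sets J"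
          using simple_functionD(2)[OF \<sigma>(1)[OF i, of k], of "{c i}"] by simp
      qed
      ultimately show "(\<lambda>t. \<lambda>i\<in>I. \<sigma> i k t) -` {c} \<inter> space J \<in> sets J" by simp
    qed
    from simple_function_compose1[OF this, of G] Gc
    have "simple_function J (\<lambda>t x. \<Sum>i\<in>I. \<sigma> i k t *\<^sub>R s i x)" by simp
    then show "finite ((\<lambda>t x. \<Sum>i\<in>I. \<sigma> i k t *\<^sub>R s i x) ` space J)"
      "\<forall>c\<in>(\<lambda>t x. \<Sum>i\<in>I. \<sigma> i k t *\<^sub>R s i x) ` space J. (\<lambda>t x. \<Sum>i\<in>I. \<sigma> i k t *\<^sub>R s i x) -` {c} \<inter> space J \<in> sets J"
      unfolding simple_function_def by blast+
  qed
  have sm: "strongly_measurable {0<..<T} (L2 \<Omega>) (L2_norm \<Omega>) (\<lambda>t x. \<Sum>i\<in>I. a i t *\<^sub>R s i x)"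
    unfolding strongly_measurable_def
    by (intro conjI AE_I2 L exI[of _ "\<lambda>k t x. \<Sum>i\<in>I. \<sigma> i k t *\<^sub>R s i x"] allI ballI simp conv)
  have "l2c J (\<lambda>t. \<Sum>i\<in>I. a i t *\<^sub>R cls \<Omega> (s i))"
    by (intro J.l2c_sum J.l2c_linear[OF bounded_linear_scaleR_left] a)
  then have "integrable J (\<lambda>t. (norm (\<Sum>i\<in>I. a i t *\<^sub>R cls \<Omega> (s i)))\<^sup>2)" by (rule l2c_integrable)
  moreover have "L2_norm \<Omega> (\<lambda>x. \<Sum>i\<in>I. a i t *\<^sub>R s i x) = norm (\<Sum>i\<in>I. a i t *\<^sub>R cls \<Omega> (s i))" for t
    unfolding C[symmetric] O.norm_cls[OF L] ..
  ultimately show ?thesis using sm by (simp add: bochner_L2_def)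
qed

lemma st_inner_cls:
  fixes u v :: "real \<Rightarrow> 'a \<Rightarrow> 'b::euclidean_space"
  assumes "AE t in J. u t \<in> L2 \<Omega> \<and> cls \<Omega> (u t) = a t" "AE t in J. v t \<in> L2 \<Omega> \<and> cls \<Omega> (v t) = b t"
  shows "st_inner T \<Omega> u v = (LINT t|J. a t \<bullet> b t)"
  unfolding st_inner_def
proof (rule integral_cong_AE_complete[OF J.complete_measure_axioms])
  show "AE t in J. L2_inner \<Omega> (u t) (v t) = a t \<bullet> b t"
    using assms by eventually_elim (auto simp: O.inner_cls[symmetric])
qed

end

section \<open>The semidiscrete Galerkin approximation\<close>

lemma matrix_inv_left: "invertible A \<Longrightarrow> matrix_inv A ** A = mat 1"
  and matrix_inv_right: "invertible A \<Longrightarrow> A ** matrix_inv A = mat 1"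
  for A :: "real^'n^'n"
  using someI_ex[of "\<lambda>A'. A ** A' = mat 1 \<and> A' ** A = mat 1"]
  unfolding invertible_def matrix_inv_def by blast+

lemma bounded_linear_inner_vec: "bounded_linear (\<lambda>v::'h::real_inner. (\<chi> l. v \<bullet> e l) :: real^'n)"
proof (rule bounded_linear_intro[of _ "\<Sum>l\<in>UNIV. norm (e l)"])
  show "norm (\<chi> l. x \<bullet> e l :: real^'n) \<le> norm x * (\<Sum>l\<in>UNIV. norm (e l))" for x :: 'h
  proof -
    have "norm (\<chi> l. x \<bullet> e l :: real^'n) \<le> (\<Sum>l\<in>UNIV. \<bar>(\<chi> l. x \<bullet> e l :: real^'n) $ l\<bar>)" by (rule norm_le_l1_cart)
    also have "\<dots> \<le> (\<Sum>l\<in>UNIV. norm x * norm (e l))" by (intro sum_mono) (simp add: Cauchy_Schwarz_ineq2)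
    finally show ?thesis by (simp add: sum_distrib_left)
  qed
qed (simp_all add: vec_eq_iff inner_add_left)

definition comb :: "('n::finite \<Rightarrow> 'v::real_vector) \<Rightarrow> real^'n \<Rightarrow> 'v" where
  "comb e a = (\<Sum>l\<in>UNIV. a $ l *\<^sub>R e l)"

lemma bounded_linear_comb: "bounded_linear (comb (e :: 'n::finite \<Rightarrow> 'v::real_normed_vector))"
  unfolding linear_conv_bounded_linear[symmetric] comb_def
  by (auto simp: linear_iff scaleR_add_left sum.distrib scaleR_sum_right)

lemma comb_diff: "comb (e :: 'n::finite \<Rightarrow> 'v::real_normed_vector) (a - b) = comb e a - comb e b"
  using bounded_linear_comb by (rule linear_diff[OF bounded_linear.linear])

lemma comb_inner: "comb e a \<bullet> v = (\<Sum>l\<in>UNIV. a $ l * (e l \<bullet> (v :: 'v::real_inner)))"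
  by (simp add: comb_def inner_sum_left)

lemma inner_comb: "(v :: 'v::real_inner) \<bullet> comb e a = (\<Sum>l\<in>UNIV. a $ l * (v \<bullet> e l))"
  by (simp add: comb_def inner_sum_right)

definition gram :: "('n::finite \<Rightarrow> 'v::real_inner) \<Rightarrow> real^'n^'n" where
  "gram e = (\<chi> i j. e i \<bullet> e j)"

lemma gram_mult: "(gram e *v y) $ i = e i \<bullet> comb e y"
  by (simp add: gram_def matrix_vector_mult_def inner_comb mult.commute)

lemma gram_inner: "x \<bullet> (gram e *v y) = comb e x \<bullet> comb e y"
  by (simp add: comb_inner inner_vec_def gram_mult)

lemma linear_comb: "linear (comb (e :: 'n::finite \<Rightarrow> 'v::real_normed_vector))"
  by (rule bounded_linear.linear[OF bounded_linear_comb])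

lemma comb_orthonormal:
  fixes e :: "'n::finite \<Rightarrow> 'h::real_inner"
  assumes orth: "\<And>l k. e l \<bullet> e k = (if l = k \<and> l \<in> I then 1 else 0)"
  shows "comb e a \<bullet> e l = (if l \<in> I then a $ l else 0)"
proof -
  have "comb e a \<bullet> e l = (\<Sum>k\<in>UNIV. if k = l then (if l \<in> I then a $ l else 0) else 0)"
    unfolding comb_inner by (intro sum.cong refl) (auto simp: orth)
  then show ?thesis by simp
qed

text \<open>
  The matrices of the problem have size \<open>mn\<close>, which exceeds the dimension \<open>n\<close> of the spatial space. One
  index type serves both: the spatial basis \<open>e\<close> is orthonormal on \<open>I\<close> and zero outside \<open>I\<close>, and \<open>\<epsilon>\<close>
  lists the gradients of \<open>e\<close>. The pair \<open>(w, gw)\<close> is a solution with its gradient, \<open>z\<close> its Laplacian.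
\<close>

locale galerkin = time_interval T + form_domain H
  for T :: real and H :: "('h::{real_inner,complete_space} \<times> 'g::{real_inner,complete_space}) set" +
  fixes \<nu> C CP :: real and e :: "'n::finite \<Rightarrow> 'h" and \<epsilon> :: "'n \<Rightarrow> 'g" and I :: "'n set"
    and w w' z :: "real \<Rightarrow> 'h" and gw :: "real \<Rightarrow> 'g"
  assumes \<nu>: "\<nu> > 0" and C: "C \<ge> 0"
    and basis: "\<And>l. (e l, \<epsilon> l) \<in> H"
    and orth: "\<And>l k. e l \<bullet> e k = (if l = k \<and> l \<in> I then 1 else 0)"
    and \<epsilon>0: "\<And>l. l \<notin> I \<Longrightarrow> \<epsilon> l = 0"
    and poincare: "\<And>h. h \<in> H \<Longrightarrow> norm (fst h) \<le> CP * norm (snd h)"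
    and approx: "\<And>p y. weak_lap p y \<Longrightarrow>
      \<exists>a::real^'n. (\<forall>l. (snd p - comb \<epsilon> a) \<bullet> \<epsilon> l = 0) \<and> norm (snd p - comb \<epsilon> a) \<le> C * norm y"
    and w: "antideriv w w'" and z: "l2c J z" and gw: "l2c J gw"
    and lap: "AE t in J. weak_lap (w t, gw t) (z t)"
begin

definition g :: "real \<Rightarrow> 'h" where "g t = w' t - \<nu> *\<^sub>R z t"

lemma l2c_g: "l2c J g"
  unfolding g_def[abs_def] by (intro J.l2c_diff J.l2c_scaleR antideriv_l2c[OF w] z)

lemma e0: "l \<notin> I \<Longrightarrow> e l = 0"
  using orth[of l l] by simp

lemma comb_in_H: "(comb e a, comb \<epsilon> a) \<in> H"
proof -
  have "(\<Sum>l\<in>UNIV. a $ l *\<^sub>R (e l, \<epsilon> l)) \<in> H" by (intro subspace_sum subspace_scale subspace_H basis)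
  moreover have "(\<Sum>l\<in>UNIV. a $ l *\<^sub>R (e l, \<epsilon> l)) = (comb e a, comb \<epsilon> a)"
    by (simp add: prod_eq_iff fst_sum snd_sum comb_def)
  ultimately show ?thesis by simp
qed

lemmas comb_e_inner = comb_orthonormal[OF orth]

lemma norm_comb_sq: "(norm (comb e a))\<^sup>2 = (\<Sum>l\<in>I. (a $ l)\<^sup>2)"
proof -
  have "(norm (comb e a))\<^sup>2 = (\<Sum>l\<in>UNIV. a $ l * (if l \<in> I then a $ l else 0))"
    by (simp add: power2_norm_eq_inner inner_comb comb_e_inner)
  also have "\<dots> = (\<Sum>l\<in>UNIV. if l \<in> I then (a $ l)\<^sup>2 else 0)" by (intro sum.cong) (auto simp: power2_eq_square)
  finally show ?thesis by (simp add: sum.If_cases)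
qed

lemma norm_vec_sq: "(norm (a :: real^'n))\<^sup>2 = (\<Sum>l\<in>UNIV. (a $ l)\<^sup>2)"
  unfolding power2_norm_eq_inner inner_vec_def by (simp add: power2_eq_square)

lemma norm_comb_le: "norm (comb e a) \<le> norm a"
proof (rule power2_le_imp_le)
  show "(norm (comb e a))\<^sup>2 \<le> (norm a)\<^sup>2" unfolding norm_comb_sq norm_vec_sq by (rule sum_mono2) auto
qed simp

text \<open>
  Since \<open>w\<close> need not be regular enough for \<open>\<integral> \<langle>w', -\<Delta>w\<rangle> \<ge> 0\<close> to follow from a product rule, \<open>-\<Delta>\<close> is
  replaced by its Yosida approximation, a bounded symmetric positive operator.
\<close>

lemma norm_lap_le: "\<nu> * l2n J z \<le> l2n J g"
proof -
  define R where "R n y = fst (resolvent H (1 / real (Suc n)) y)" for n y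
  have pos: "1 / real (Suc n) > 0" for n by simp
  have R: "bounded_linear (R n)" for n unfolding R_def by (rule bounded_linear_resolvent[OF pos])
  have Rs: "R n x \<bullet> y = x \<bullet> R n y" for n x y unfolding R_def by (rule resolvent_symmetric[OF pos])
  have Rn: "norm (R n y) \<le> norm y" for n y unfolding R_def by (rule norm_resolvent_le[OF pos])
  have Rz: "l2c J (\<lambda>t. R n (z t))" for n by (rule J.l2c_linear[OF R z])
  have Rzn: "l2n J (\<lambda>t. R n (z t)) \<le> l2n J z" for n
    using J.l2n_mono[OF Rz z, of 1 n] Rn by simp
  have le: "\<nu> * (LINT t|J. z t \<bullet> R n (z t)) \<le> l2n J g * l2n J z" for n
  proof -
    \<comment> \<open>On \<open>w t\<close> this operator is minus the resolvent of the Laplacian,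
      by \<open>resolvent_weak_lap\<close>; hence the energy identity for it produces the pairing of
      \<open>z t\<close> with \<open>R n (z t)\<close>.\<close>
    define A where "A x = real (Suc n) *\<^sub>R (x - R n x)" for x
    have A: "bounded_linear A" unfolding A_def
      by (intro bounded_linear_const_scaleR bounded_linear_sub bounded_linear_ident R)
    have As: "A x \<bullet> y = x \<bullet> A y" for x y by (simp add: A_def inner_diff Rs)
    have "2 * (LINT t|J. w' t \<bullet> A (w t)) = w T \<bullet> A (w T)" by (rule antideriv_energy[OF w A As])
    moreover have "w T \<bullet> A (w T) \<ge> 0"
    proof -
      have "w T \<bullet> R n (w T) \<le> norm (w T) * norm (R n (w T))" by (rule norm_cauchy_schwarz)
      also have "\<dots> \<le> norm (w T) * norm (w T)" by (intro mult_left_mono Rn) simp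
      finally have "w T \<bullet> (w T - R n (w T)) \<ge> 0"
        by (simp add: inner_diff_right power2_norm_eq_inner[symmetric] power2_eq_square)
      then show ?thesis by (simp add: A_def)
    qed
    moreover have "(LINT t|J. w' t \<bullet> A (w t)) = (LINT t|J. - (g t \<bullet> R n (z t)) - \<nu> * (z t \<bullet> R n (z t)))"
    proof (rule integral_cong_AE_complete[OF J.complete_measure_axioms])
      show "AE t in J. w' t \<bullet> A (w t) = - (g t \<bullet> R n (z t)) - \<nu> * (z t \<bullet> R n (z t))"
        using lap
      proof eventually_elim
        case (elim t)
        have "R n (w t) = w t + (1 / real (Suc n)) *\<^sub>R R n (z t)"
          using resolvent_weak_lap[OF pos[of n] elim] by (simp add: R_def)
        then have "A (w t) = - R n (z t)" by (simp add: A_def)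
        moreover have "w' t = g t + \<nu> *\<^sub>R z t" by (simp add: g_def)
        ultimately show ?case by (simp add: inner_add_left)
      qed
    qed
    moreover have "(LINT t|J. - (g t \<bullet> R n (z t)) - \<nu> * (z t \<bullet> R n (z t)))
        = - (LINT t|J. g t \<bullet> R n (z t)) - \<nu> * (LINT t|J. z t \<bullet> R n (z t))"
      using J.integrable_inner[OF l2c_g Rz] J.integrable_inner[OF z Rz] by simp
    ultimately have "\<nu> * (LINT t|J. z t \<bullet> R n (z t)) \<le> - (LINT t|J. g t \<bullet> R n (z t))" by linarith
    also have "\<dots> \<le> l2n J g * l2n J (\<lambda>t. R n (z t))" using J.l2n_CS[OF l2c_g Rz, of n] by linarith
    also have "\<dots> \<le> l2n J g * l2n J z" by (intro mult_left_mono Rzn) simp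
    finally show ?thesis .
  qed
  \<comment> \<open>The resolvents tend to the identity on \<open>z t\<close>, and their
    contractivity provides the dominating function.\<close>
  have "(\<lambda>n. LINT t|J. z t \<bullet> R n (z t)) \<longlonglongrightarrow> (LINT t|J. z t \<bullet> z t)"
  proof (rule integral_dominated_convergence[where w="\<lambda>t. (norm (z t))\<^sup>2"])
    show "(\<lambda>t. z t \<bullet> z t) \<in> borel_measurable J" using J.integrable_inner[OF z z] by simp
    show "(\<lambda>t. z t \<bullet> R n (z t)) \<in> borel_measurable J" for n using J.integrable_inner[OF z Rz] by simp
    show "integrable J (\<lambda>t. (norm (z t))\<^sup>2)" by (rule l2c_integrable[OF z])
    show "AE t in J. (\<lambda>n. z t \<bullet> R n (z t)) \<longlonglongrightarrow> z t \<bullet> z t"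
      using lap
    proof eventually_elim
      case (elim t)
      then have "z t \<in> closure (fst ` H)" by (simp add: weak_lap_def)
      from resolvent_tendsto[OF this] show ?case unfolding R_def[symmetric] by (intro tendsto_intros)
    qed
    show "AE t in J. norm (z t \<bullet> R n (z t)) \<le> (norm (z t))\<^sup>2" for n
    proof (rule AE_I2)
      fix t
      have "\<bar>z t \<bullet> R n (z t)\<bar> \<le> norm (z t) * norm (R n (z t))" by (rule Cauchy_Schwarz_ineq2)
      also have "\<dots> \<le> norm (z t) * norm (z t)" by (intro mult_left_mono Rn) simp
      finally show "norm (z t \<bullet> R n (z t)) \<le> (norm (z t))\<^sup>2" by (simp add: power2_eq_square)
    qed
  qed
  then have "(\<lambda>n. \<nu> * (LINT t|J. z t \<bullet> R n (z t))) \<longlonglongrightarrow> \<nu> * (LINT t|J. z t \<bullet> z t)"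
    by (intro tendsto_intros)
  then have "\<nu> * (LINT t|J. z t \<bullet> z t) \<le> l2n J g * l2n J z"
    by (rule LIMSEQ_le_const2) (use le in blast)
  then have "(\<nu> * l2n J z) * l2n J z \<le> l2n J g * l2n J z"
    using l2n_sq[of J z] unfolding power2_norm_eq_inner by (simp add: power2_eq_square mult.assoc)
  then show ?thesis
    using l2n_nonneg[of J z] l2n_nonneg[of J g] by (cases "l2n J z = 0") (auto simp: mult_le_cancel_right)
qed

lemma norm_lap_le': "C\<^sup>2 * l2n J z \<le> C\<^sup>2 / \<nu> * l2n J g"
proof -
  have "l2n J z \<le> l2n J g / \<nu>" using norm_lap_le \<nu> by (simp add: pos_le_divide_eq mult.commute)
  then have "C\<^sup>2 * l2n J z \<le> C\<^sup>2 * (l2n J g / \<nu>)" by (intro mult_left_mono) auto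
  then show ?thesis by simp
qed

text \<open>The Gram matrix has zero rows outside \<open>I\<close>. The identity placed there makes
  the matrix invertible; on \<open>I\<close> injectivity comes from the Poincare inequality and the
  orthonormality of \<open>e\<close>.\<close>

definition K1 :: "real^'n^'n" where
  "K1 = gram \<epsilon> + (\<chi> i j. if i = j \<and> i \<notin> I then 1 else 0)"

lemma K1_mult: "K1 *v y = gram \<epsilon> *v y + (\<chi> i. if i \<in> I then 0 else y $ i)"
proof -
  have "((\<chi> i j. if i = j \<and> i \<notin> I then 1 else 0) *v y) $ k = (if k \<in> I then 0 else y $ k)" for k
  proof -
    have "((\<chi> i j. if i = j \<and> i \<notin> I then 1 else 0) *v y) $ k = (\<Sum>j\<in>UNIV. if j = k then (if k \<in> I then 0 else y $ k) else 0)"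
      unfolding matrix_vector_mult_def vec_lambda_beta by (rule sum.cong) auto
    then show ?thesis by simp
  qed
  then show ?thesis by (simp add: K1_def matrix_vector_mult_add_rdistrib vec_eq_iff)
qed

lemma K1_inverse: "matrix_inv K1 ** K1 = mat 1"
proof -
  have "y = 0" if "K1 *v y = 0" for y
  proof -
    have "0 = y \<bullet> (K1 *v y)" using that by simp
    also have "\<dots> = (norm (comb \<epsilon> y))\<^sup>2 + (\<Sum>i\<in>UNIV. if i \<in> I then 0 else (y $ i)\<^sup>2)"
      unfolding K1_mult inner_add_right gram_inner power2_norm_eq_inner
      by (simp add: inner_vec_def power2_eq_square if_distrib cong: if_cong)
    finally have s: "(norm (comb \<epsilon> y))\<^sup>2 + (\<Sum>i\<in>UNIV. if i \<in> I then 0 else (y $ i)\<^sup>2) = 0" ..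
    have p: "(\<Sum>i\<in>UNIV. if i \<in> I then 0 else (y $ i)\<^sup>2) \<ge> 0" by (intro sum_nonneg) auto
    have "(norm (comb \<epsilon> y))\<^sup>2 = 0" "(\<Sum>i\<in>UNIV. if i \<in> I then 0 else (y $ i)\<^sup>2) = 0"
      using s p zero_le_power2[of "norm (comb \<epsilon> y)"] by linarith+
    moreover from this(1) have "comb e y = 0" using poincare[OF comb_in_H[of y]] by simp
    ultimately have "y $ i = 0" for i
      using comb_e_inner[of y i] by (cases "i \<in> I") (auto simp: sum_nonneg_eq_0_iff split: if_splits)
    then show "y = 0" by (simp add: vec_eq_iff)
  qed
  then have "invertible K1" using invertible_left_inverse matrix_left_invertible_ker by blast
  then show ?thesis by (rule matrix_inv_left)
qed

text \<open>Coordinates of the elliptic projection of \<open>w t\<close>. A formula linear in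
  \<open>gw t\<close> makes \<open>p\<close> a square integrable curve, which a separate choice of
  coefficients at each time would not guarantee.\<close>

definition p :: "real \<Rightarrow> real^'n" where
  "p t = matrix_inv K1 *v (\<chi> l. gw t \<bullet> \<epsilon> l)"

lemma l2c_p: "l2c J p"
  unfolding p_def[abs_def] by (intro J.l2c_linear[OF matrix_vector_mul_bounded_linear] J.l2c_linear[OF bounded_linear_inner_vec] gw)

definition \<rho> :: "real \<Rightarrow> 'h" where "\<rho> t = w t - comb e (p t)"
definition g\<rho> :: "real \<Rightarrow> 'g" where "g\<rho> t = gw t - comb \<epsilon> (p t)"

lemma l2c_\<rho>: "l2c J \<rho>"
  unfolding \<rho>_def[abs_def] by (intro J.l2c_diff antideriv_l2c_fun[OF w] J.l2c_linear[OF bounded_linear_comb l2c_p])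

text \<open>\<open>approx\<close> provides coefficients at each time without uniqueness. Setting
  those outside \<open>I\<close> to zero makes them the solution of the system that defines
  \<open>p\<close>. The second factor \<open>C\<close> in the L2 bound comes from duality.\<close>

lemma projection_error:
  assumes "weak_lap (w t, gw t) (z t)"
  shows "g\<rho> t \<bullet> \<epsilon> l = 0" "norm (g\<rho> t) \<le> C * norm (z t)" "(\<rho> t, g\<rho> t) \<in> H"
    "norm (\<rho> t) \<le> C\<^sup>2 * norm (z t)"
proof -
  obtain a where a: "\<And>l. (gw t - comb \<epsilon> a) \<bullet> \<epsilon> l = 0" "norm (gw t - comb \<epsilon> a) \<le> C * norm (z t)"
    using approx[OF assms] by auto
  define b where "b = (\<chi> l. if l \<in> I then a $ l else 0)"
  have ab: "comb \<epsilon> b = comb \<epsilon> a" unfolding comb_def b_def by (intro sum.cong) (auto simp: \<epsilon>0)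
  have b0: "(\<chi> i. if i \<in> I then 0 else b $ i) = 0" by (simp add: vec_eq_iff b_def)
  have "\<epsilon> l \<bullet> comb \<epsilon> a = gw t \<bullet> \<epsilon> l" for l
    using a(1)[of l] by (simp add: inner_diff_left inner_commute[of "\<epsilon> l"])
  then have "K1 *v b = (\<chi> l. gw t \<bullet> \<epsilon> l)"
    unfolding K1_mult b0 by (simp add: vec_eq_iff gram_mult ab)
  then have "p t = (matrix_inv K1 ** K1) *v b" unfolding p_def by (simp add: matrix_vector_mul_assoc[symmetric])
  then have pb: "p t = b" by (simp add: K1_inverse)
  show o: "g\<rho> t \<bullet> \<epsilon> l = 0" for l using a(1) by (simp add: g\<rho>_def pb ab)
  show n: "norm (g\<rho> t) \<le> C * norm (z t)" using a(2) by (simp add: g\<rho>_def pb ab)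
  have "(w t, gw t) - (comb e (p t), comb \<epsilon> (p t)) \<in> H"
    using assms comb_in_H by (intro subspace_diff subspace_H) (auto simp: weak_lap_def)
  then show h: "(\<rho> t, g\<rho> t) \<in> H" by (simp add: \<rho>_def g\<rho>_def)
  have "norm (fst (\<rho> t, g\<rho> t)) \<le> C * norm (snd (\<rho> t, g\<rho> t))"
  proof (rule aubin_nitsche[OF poincare _ h C])
    fix q y assume "weak_lap q y"
    then obtain a where a: "norm (snd q - comb \<epsilon> a) \<le> C * norm y" using approx by blast
    have "snd (\<rho> t, g\<rho> t) \<bullet> comb \<epsilon> a = 0" using o by (simp add: inner_comb)
    with a show "\<exists>s. snd (\<rho> t, g\<rho> t) \<bullet> s = 0 \<and> norm (snd q - s) \<le> C * norm y" by blast
  qed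
  also have "\<dots> \<le> C * (C * norm (z t))" using n C by (intro mult_left_mono) auto
  finally show "norm (\<rho> t) \<le> C\<^sup>2 * norm (z t)" by (simp add: power2_eq_square)
qed

lemma l2n_\<rho>: "l2n J \<rho> \<le> C\<^sup>2 / \<nu> * l2n J g"
proof -
  have "l2n J \<rho> \<le> C\<^sup>2 * l2n J z"
    by (rule J.l2n_mono[OF l2c_\<rho> z]) (use lap projection_error(4) in auto)
  then show ?thesis using norm_lap_le' by linarith
qed

text \<open>An energy identity for the error gives the gradient and final-time bounds; the L2 bound
  comes from the error equation integrated in time. The stated constants leave room: the argument
  yields \<open>C / \<nu>\<close>, \<open>2 * C\<^sup>2 / \<nu>\<close> and
  \<open>sqrt (2 / \<nu>) * C\<close>.\<close>

theorem semidiscrete_approximation: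
  obtains q q' where "antideriv q q'"
    "AE t in J. q' t + \<nu> *\<^sub>R (gram \<epsilon> *v q t) = (\<chi> l. g t \<bullet> e l)"
    "\<And>t l. t \<in> {0..T} \<Longrightarrow> l \<notin> I \<Longrightarrow> q t $ l = 0" "l2n J q' \<le> l2n J g"
    "l2n J (\<lambda>t. gw t - comb \<epsilon> (q t)) \<le> 2 / \<nu> * C * l2n J g"
    "l2n J (\<lambda>t. w t - comb e (q t)) \<le> 8 / \<nu> * C\<^sup>2 * l2n J g"
    "norm (w T - comb e (q T)) \<le> sqrt (8 / \<nu>) * C * l2n J g"
proof -
  define F where "F t = (\<chi> l. g t \<bullet> e l)" for t
  have F: "l2c J F" unfolding F_def[abs_def] by (rule J.l2c_linear[OF bounded_linear_inner_vec l2c_g])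
  have gp: "0 \<le> y \<bullet> ((\<nu> *\<^sub>R gram \<epsilon>) *v y)" for y
    using \<nu> by (simp add: scaleR_matrix_vector_assoc[symmetric] gram_inner)
  have gs: "transpose (\<nu> *\<^sub>R gram \<epsilon>) = \<nu> *\<^sub>R gram \<epsilon>" by (simp add: transpose_def gram_def inner_commute vec_eq_iff)
  \<comment> \<open>The system runs over all indices. Outside \<open>I\<close> its equations reduce
    to a vanishing derivative, so these coordinates remain zero.\<close>
  obtain q q' where q: "antideriv q q'" and ode0: "AE t in J. q' t + (\<nu> *\<^sub>R gram \<epsilon>) *v q t = F t"
    by (rule linear_ode[OF gs gp F])
  have ode: "AE t in J. q' t + \<nu> *\<^sub>R (gram \<epsilon> *v q t) = F t"
    using ode0 by eventually_elim (simp add: scaleR_matrix_vector_assoc)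
  note q' = antideriv_l2c[OF q] and ql = antideriv_l2c_fun[OF q]
  have lc: "l2c J (\<lambda>t. comb e (a t))" "l2c J (\<lambda>t. comb \<epsilon> (a t))" if "l2c J a" for a
    by (rule J.l2c_linear[OF bounded_linear_comb that])+
  have q0: "q t $ l = 0" if t: "t \<in> {0..T}" and l: "l \<notin> I" for t l
  proof -
    have "q t \<bullet> axis l 1 = (LINT s|J. indicator {..<t} s * (q' s \<bullet> axis l 1))" by (rule antideriv_inner[OF q t])
    also have "\<dots> = (LINT s|J. 0)"
    proof (rule integral_cong_AE_complete[OF J.complete_measure_axioms])
      show "AE s in J. indicator {..<t} s * (q' s \<bullet> axis l 1) = 0"
        using ode
      proof eventually_elim
        case (elim s)
        have "q' s $ l + \<nu> * (gram \<epsilon> *v q s) $ l = F s $ l" using arg_cong[OF elim, of "\<lambda>v. v $ l"] by simp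
        then show ?case using l by (simp add: inner_axis F_def e0 gram_mult \<epsilon>0)
      qed
    qed
    finally show ?thesis by (simp add: inner_axis)
  qed
  \<comment> \<open>The equation is tested with \<open>q'\<close>; the stiffness term is half the
    gradient energy at the final time, hence nonnegative.\<close>
  have test_q': "l2n J q' ^ 2 \<le> (LINT t|J. g t \<bullet> comb e (q' t))"
  proof -
    have E: "2 * (LINT t|J. q' t \<bullet> (gram \<epsilon> *v q t)) = q T \<bullet> (gram \<epsilon> *v q T)"
      by (rule antideriv_energy[OF q matrix_vector_mul_bounded_linear])
        (metis gram_inner inner_commute)
    have i: "integrable J (\<lambda>t. q' t \<bullet> (gram \<epsilon> *v q t))"
      by (rule J.integrable_inner[OF q' J.l2c_linear[OF matrix_vector_mul_bounded_linear ql]])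
    have "(LINT t|J. g t \<bullet> comb e (q' t)) = (LINT t|J. (norm (q' t))\<^sup>2 + \<nu> * (q' t \<bullet> (gram \<epsilon> *v q t)))"
    proof (rule integral_cong_AE_complete[OF J.complete_measure_axioms])
      show "AE t in J. g t \<bullet> comb e (q' t) = (norm (q' t))\<^sup>2 + \<nu> * (q' t \<bullet> (gram \<epsilon> *v q t))"
        using ode
      proof eventually_elim
        case (elim t)
        have "g t \<bullet> comb e (q' t) = q' t \<bullet> F t" by (simp add: inner_comb F_def inner_vec_def)
        also have "\<dots> = q' t \<bullet> q' t + \<nu> * (q' t \<bullet> (gram \<epsilon> *v q t))" by (simp add: elim[symmetric] inner_add_right)
        finally show ?case by (simp add: power2_norm_eq_inner)
      qed
    qed
    also have "\<dots> = (l2n J q')\<^sup>2 + \<nu> * (LINT t|J. q' t \<bullet> (gram \<epsilon> *v q t))"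
      using i l2c_integrable[OF q'] by (simp add: l2n_sq)
    moreover have "0 \<le> (LINT t|J. q' t \<bullet> (gram \<epsilon> *v q t))"
      using E inner_ge_zero[of "comb \<epsilon> (q T)"] unfolding gram_inner[of "q T"] by linarith
    ultimately show ?thesis using \<nu> by simp
  qed
  have ncq: "l2n J (\<lambda>t. comb e (q' t)) \<le> l2n J q'"
    using J.l2n_mono[OF lc(1)[OF q'] q', of 1] norm_comb_le by simp
  have nq': "l2n J q' \<le> l2n J g"
  proof -
    have "l2n J q' * l2n J q' \<le> l2n J g * l2n J (\<lambda>t. comb e (q' t))"
      using test_q' J.l2n_CS[OF l2c_g lc(1)[OF q']] by (simp add: power2_eq_square)
    also have "\<dots> \<le> l2n J g * l2n J q'" by (intro mult_left_mono ncq) simp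
    finally show ?thesis using l2n_nonneg[of J q'] by (cases "l2n J q' = 0") (auto simp: mult_le_cancel_right)
  qed
  define r where "r t = g t - comb e (q' t)" for t
  have r: "l2c J r" unfolding r_def[abs_def] by (intro J.l2c_diff l2c_g lc q')
  \<comment> \<open>The inequality just obtained makes the cross term outweigh the added
    square.\<close>
  have nr: "l2n J r \<le> l2n J g"
  proof (rule power2_le_imp_le)
    have "(l2n J r)\<^sup>2 = (LINT t|J. (norm (g t))\<^sup>2 - 2 * (g t \<bullet> comb e (q' t)) + (norm (comb e (q' t)))\<^sup>2)"
      unfolding l2n_sq by (intro Bochner_Integration.integral_cong)
        (auto simp: r_def power2_norm_eq_inner inner_diff inner_commute)
    also have "\<dots> = (l2n J g)\<^sup>2 - 2 * (LINT t|J. g t \<bullet> comb e (q' t)) + (l2n J (\<lambda>t. comb e (q' t)))\<^sup>2"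
      using J.integrable_inner[OF l2c_g lc(1)[OF q']] l2c_integrable[OF l2c_g] l2c_integrable[OF lc(1)[OF q']]
      by (simp add: l2n_sq)
    also have "\<dots> \<le> (l2n J g)\<^sup>2 - 2 * (l2n J q')\<^sup>2 + (l2n J q')\<^sup>2"
      using test_q' power_mono[OF ncq l2n_nonneg, of 2] by linarith
    also have "\<dots> \<le> (l2n J g)\<^sup>2" by simp
    finally show "(l2n J r)\<^sup>2 \<le> (l2n J g)\<^sup>2" .
  qed simp
  define E where "E t = w t - comb e (q t)" for t
  define E' where "E' t = w' t - comb e (q' t)" for t
  define GE where "GE t = gw t - comb \<epsilon> (q t)" for t
  have aq: "antideriv (\<lambda>t. comb e (q t)) (\<lambda>t. comb e (q' t))"
    by (rule antideriv_linear[OF q bounded_linear_comb, of e "\<lambda>y. \<chi> l. e l \<bullet> y"])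
      (simp add: comb_inner inner_vec_def)
  have aE: "antideriv E E'" unfolding E_def[abs_def] E'_def[abs_def] by (rule antideriv_diff[OF w aq])
  have GEl: "l2c J GE" unfolding GE_def[abs_def] by (intro J.l2c_diff gw lc ql)
  \<comment> \<open>The error \<open>E\<close> is split into projection error and discrete part,
    \<open>E'\<close> is kept whole. Galerkin orthogonality removes the discrete part, and the
    Laplacian hidden in \<open>E'\<close> cancels the gradient product, leaving \<open>r\<close>,
    which involves only the data and the discrete derivative.\<close>
  have energy: "(LINT t|J. E' t \<bullet> E t) + \<nu> * (l2n J GE)\<^sup>2 = (LINT t|J. r t \<bullet> \<rho> t)"
  proof -
    have "(LINT t|J. r t \<bullet> \<rho> t) = (LINT t|J. E' t \<bullet> E t + \<nu> * (norm (GE t))\<^sup>2)"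
    proof (rule integral_cong_AE_complete[OF J.complete_measure_axioms])
      show "AE t in J. r t \<bullet> \<rho> t = E' t \<bullet> E t + \<nu> * (norm (GE t))\<^sup>2"
        using lap ode
      proof eventually_elim
        case (elim t)
        note pe = projection_error[OF elim(1)]
        have zh: "z t \<bullet> fst h = - (gw t \<bullet> snd h)" if "h \<in> H" for h
          using elim(1) that by (auto simp: weak_lap_def)
        \<comment> \<open>Galerkin orthogonality of the error at almost every time.\<close>
        have br: "E' t \<bullet> e l + \<nu> * (GE t \<bullet> \<epsilon> l) = 0" for l
        proof (cases "l \<in> I")
          case True
          have "q' t $ l + \<nu> * (gram \<epsilon> *v q t) $ l = F t $ l" using arg_cong[OF elim(2), of "\<lambda>v. v $ l"] by simp
          then have "q' t $ l + \<nu> * (\<epsilon> l \<bullet> comb \<epsilon> (q t)) = g t \<bullet> e l" by (simp add: gram_mult F_def)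
          moreover have "g t \<bullet> e l = w' t \<bullet> e l + \<nu> * (gw t \<bullet> \<epsilon> l)"
            using zh[OF basis[of l]] by (simp add: g_def inner_diff_left)
          ultimately show ?thesis using True
            by (simp add: E'_def GE_def inner_diff_left comb_e_inner inner_commute[of "comb \<epsilon> _"] algebra_simps)
        qed (simp add: e0 \<epsilon>0)
        define \<theta> where "\<theta> = p t - q t"
        have dec: "E t = \<rho> t + comb e \<theta>" "GE t = g\<rho> t + comb \<epsilon> \<theta>"
          by (simp_all add: E_def GE_def \<rho>_def g\<rho>_def \<theta>_def comb_diff)
        have "E' t \<bullet> comb e \<theta> + \<nu> * (GE t \<bullet> comb \<epsilon> \<theta>) = (\<Sum>l\<in>UNIV. \<theta> $ l * (E' t \<bullet> e l + \<nu> * (GE t \<bullet> \<epsilon> l)))"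
          by (simp add: inner_comb sum_distrib_left sum.distrib distrib_left mult.left_commute)
        then have t0: "E' t \<bullet> comb e \<theta> + \<nu> * (GE t \<bullet> comb \<epsilon> \<theta>) = 0" by (simp add: br)
        have "comb \<epsilon> (q t) \<bullet> g\<rho> t = 0" using pe(1) by (simp add: comb_inner inner_commute)
        then have "GE t \<bullet> g\<rho> t = - (z t \<bullet> \<rho> t)" using zh[OF pe(3)] by (simp add: GE_def inner_diff_left)
        moreover have "r t = E' t - \<nu> *\<^sub>R z t" by (simp add: r_def E'_def g_def)
        ultimately have "r t \<bullet> \<rho> t = E' t \<bullet> \<rho> t + \<nu> * (GE t \<bullet> g\<rho> t)" by (simp add: inner_diff_left)
        moreover have "E' t \<bullet> E t + \<nu> * (norm (GE t))\<^sup>2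
            = (E' t \<bullet> \<rho> t + \<nu> * (GE t \<bullet> g\<rho> t)) + (E' t \<bullet> comb e \<theta> + \<nu> * (GE t \<bullet> comb \<epsilon> \<theta>))"
          unfolding power2_norm_eq_inner by (subst dec(1), subst (2) dec(2)) (simp add: inner_add_right algebra_simps)
        ultimately show ?case using t0 by simp
      qed
    qed
    also have "\<dots> = (LINT t|J. E' t \<bullet> E t) + \<nu> * (l2n J GE)\<^sup>2"
      using J.integrable_inner[OF antideriv_l2c[OF aE] antideriv_l2c_fun[OF aE]] l2c_integrable[OF GEl]
      by (simp add: l2n_sq)
    finally show ?thesis ..
  qed
  have EE: "2 * (LINT t|J. E' t \<bullet> E t) = (norm (E T))\<^sup>2"
    using antideriv_energy[OF aE bounded_linear_ident] by (simp add: power2_norm_eq_inner)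
  define B where "B = C\<^sup>2 / \<nu> * (l2n J g)\<^sup>2"
  have rB: "(LINT t|J. r t \<bullet> \<rho> t) \<le> B"
  proof -
    have "(LINT t|J. r t \<bullet> \<rho> t) \<le> l2n J r * l2n J \<rho>" using J.l2n_CS[OF r l2c_\<rho>] by linarith
    also have "\<dots> \<le> l2n J g * (C\<^sup>2 / \<nu> * l2n J g)" by (intro mult_mono nr l2n_\<rho>) simp_all
    finally show ?thesis by (simp add: B_def power2_eq_square mult_ac)
  qed
  have est1: "l2n J GE \<le> 2 / \<nu> * C * l2n J g"
  proof (rule power2_le_imp_le)
    have "\<nu> * (l2n J GE)\<^sup>2 \<le> B" using energy EE rB zero_le_power2[of "norm (E T)"] by linarith
    then have "(l2n J GE)\<^sup>2 \<le> B / \<nu>" using \<nu> by (simp add: pos_le_divide_eq mult.commute)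
    also have "\<dots> \<le> 4 * (B / \<nu>)"
    proof -
      have "0 \<le> B / \<nu>" using \<nu> by (simp add: B_def)
      then show ?thesis by linarith
    qed
    also have "\<dots> = (2 / \<nu> * C * l2n J g)\<^sup>2" by (simp add: B_def power2_eq_square)
    finally show "(l2n J GE)\<^sup>2 \<le> (2 / \<nu> * C * l2n J g)\<^sup>2" .
  qed (use \<nu> C in simp)
  have est3: "norm (E T) \<le> sqrt (8 / \<nu>) * C * l2n J g"
  proof (rule power2_le_imp_le)
    have "\<nu> * (l2n J GE)\<^sup>2 \<ge> 0" using \<nu> by simp
    then have "(norm (E T))\<^sup>2 \<le> 2 * B" using energy EE rB by linarith
    also have "\<dots> \<le> 8 * B"
    proof -
      have "0 \<le> B" using \<nu> by (simp add: B_def)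
      then show ?thesis by linarith
    qed
    also have "\<dots> = (sqrt (8 / \<nu>) * C * l2n J g)\<^sup>2" using \<nu> by (simp add: B_def power_mult_distrib)
    finally show "(norm (E T))\<^sup>2 \<le> (sqrt (8 / \<nu>) * C * l2n J g)\<^sup>2" .
  qed (use \<nu> C in simp)
  define \<theta> where "\<theta> t = p t - q t" for t
  have \<theta>: "l2c J \<theta>" unfolding \<theta>_def[abs_def] by (intro J.l2c_diff l2c_p ql)
  note a\<Theta> = antideriv_prim[OF \<theta>]
  \<comment> \<open>The error equation integrated from 0 to \<open>t\<close>. Only basis directions
    are tested, so the gradient of \<open>w\<close> may be replaced by that of its projection and
    the right side depends on \<theta> alone.\<close>
  have Ee: "E t \<bullet> e l = - \<nu> * (gram \<epsilon> *v prim \<theta> t) $ l" if t: "t \<in> {0..T}" for t l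
  proof (cases "l \<in> I")
    case True
    have "E t \<bullet> e l = (LINT s|J. indicator {..<t} s * (E' s \<bullet> e l))" by (rule antideriv_inner[OF aE t])
    also have "\<dots> = (LINT s|J. - \<nu> * (indicator {..<t} s * (\<theta> s \<bullet> (\<chi> k. \<epsilon> l \<bullet> \<epsilon> k))))"
    proof (rule integral_cong_AE_complete[OF J.complete_measure_axioms])
      show "AE s in J. indicator {..<t} s * (E' s \<bullet> e l) = - \<nu> * (indicator {..<t} s * (\<theta> s \<bullet> (\<chi> k. \<epsilon> l \<bullet> \<epsilon> k)))"
        using lap ode
      proof eventually_elim
        case (elim s)
        have "q' s $ l + \<nu> * (gram \<epsilon> *v q s) $ l = F s $ l" using arg_cong[OF elim(2), of "\<lambda>v. v $ l"] by simp
        then have 1: "q' s $ l + \<nu> * (\<epsilon> l \<bullet> comb \<epsilon> (q s)) = g s \<bullet> e l" by (simp add: gram_mult F_def)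
        have "z s \<bullet> fst (e l, \<epsilon> l) = - (gw s \<bullet> snd (e l, \<epsilon> l))"
          using elim(1) basis[of l] unfolding weak_lap_def by fastforce
        then have 2: "g s \<bullet> e l = w' s \<bullet> e l + \<nu> * (gw s \<bullet> \<epsilon> l)" by (simp add: g_def inner_diff_left)
        have 3: "gw s \<bullet> \<epsilon> l = comb \<epsilon> (p s) \<bullet> \<epsilon> l"
          using projection_error(1)[OF elim(1), of l] by (simp add: g\<rho>_def inner_diff_left)
        have 4: "\<theta> s \<bullet> (\<chi> k. \<epsilon> l \<bullet> \<epsilon> k) = comb \<epsilon> (p s) \<bullet> \<epsilon> l - comb \<epsilon> (q s) \<bullet> \<epsilon> l"
          unfolding inner_diff_left[symmetric] comb_diff[symmetric] \<theta>_def[symmetric]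
          unfolding comb_inner inner_vec_def by (rule sum.cong) (simp_all add: inner_commute)
        have "E' s \<bullet> e l = - \<nu> * (\<theta> s \<bullet> (\<chi> k. \<epsilon> l \<bullet> \<epsilon> k))"
          using 1 2 True unfolding 3 4 by (simp add: E'_def inner_diff_left comb_e_inner inner_commute[of "\<epsilon> l"] algebra_simps)
        then show ?case by simp
      qed
    qed
    also have "\<dots> = - \<nu> * (LINT s|J. indicator {..<t} s * (\<theta> s \<bullet> (\<chi> k. \<epsilon> l \<bullet> \<epsilon> k)))" by simp
    also have "(LINT s|J. indicator {..<t} s * (\<theta> s \<bullet> (\<chi> k. \<epsilon> l \<bullet> \<epsilon> k))) = prim \<theta> t \<bullet> (\<chi> k. \<epsilon> l \<bullet> \<epsilon> k)"
      by (rule antideriv_inner[OF a\<Theta> t, symmetric])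
    also have "\<dots> = (gram \<epsilon> *v prim \<theta> t) $ l" by (simp add: gram_mult inner_comb inner_vec_def)
    finally show ?thesis .
  qed (simp add: e0 gram_mult \<epsilon>0)
  \<comment> \<open>Testing the integrated equation with \<theta> makes the Gram term half a
    nonnegative quadratic form at \<open>T\<close>, so \<theta> is controlled by \<rho>.\<close>
  have est\<theta>: "l2n J (\<lambda>t. comb e (\<theta> t)) \<le> l2n J \<rho>"
  proof -
    have G: "2 * (LINT t|J. \<theta> t \<bullet> (gram \<epsilon> *v prim \<theta> t)) = prim \<theta> T \<bullet> (gram \<epsilon> *v prim \<theta> T)"
      by (rule antideriv_energy[OF a\<Theta> matrix_vector_mul_bounded_linear]) (metis gram_inner inner_commute)
    have "(LINT t|J. \<rho> t \<bullet> comb e (\<theta> t) + (norm (comb e (\<theta> t)))\<^sup>2) = (LINT t|J. - \<nu> * (\<theta> t \<bullet> (gram \<epsilon> *v prim \<theta> t)))"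
    proof (rule Bochner_Integration.integral_cong[OF refl])
      fix t assume "t \<in> space J"
      then have t: "t \<in> {0..T}" by auto
      have "E t = \<rho> t + comb e (\<theta> t)" by (simp add: E_def \<rho>_def \<theta>_def comb_diff)
      then have "\<rho> t \<bullet> comb e (\<theta> t) + (norm (comb e (\<theta> t)))\<^sup>2 = E t \<bullet> comb e (\<theta> t)"
        by (simp add: inner_add_left power2_norm_eq_inner)
      also have "\<dots> = (\<Sum>l\<in>UNIV. \<theta> t $ l * (- \<nu> * (gram \<epsilon> *v prim \<theta> t) $ l))" by (simp only: inner_comb Ee[OF t])
      also have "\<dots> = - \<nu> * (\<theta> t \<bullet> (gram \<epsilon> *v prim \<theta> t))"
        by (simp add: inner_vec_def sum_distrib_left mult.left_commute sum_negf)
      finally show "\<rho> t \<bullet> comb e (\<theta> t) + (norm (comb e (\<theta> t)))\<^sup>2 = - \<nu> * (\<theta> t \<bullet> (gram \<epsilon> *v prim \<theta> t))" .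
    qed
    moreover have "(LINT t|J. - \<nu> * (\<theta> t \<bullet> (gram \<epsilon> *v prim \<theta> t))) = - \<nu> * (LINT t|J. \<theta> t \<bullet> (gram \<epsilon> *v prim \<theta> t))" by simp
    moreover have "(LINT t|J. \<theta> t \<bullet> (gram \<epsilon> *v prim \<theta> t)) \<ge> 0" 
      using G inner_ge_zero[of "comb \<epsilon> (prim \<theta> T)"] unfolding gram_inner[of "prim \<theta> T"] by linarith
    moreover have "(LINT t|J. \<rho> t \<bullet> comb e (\<theta> t) + (norm (comb e (\<theta> t)))\<^sup>2)
        = (LINT t|J. \<rho> t \<bullet> comb e (\<theta> t)) + (l2n J (\<lambda>t. comb e (\<theta> t)))\<^sup>2"
      using J.integrable_inner[OF l2c_\<rho> lc(1)[OF \<theta>]] l2c_integrable[OF lc(1)[OF \<theta>]] by (simp add: l2n_sq)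
    ultimately have "(LINT t|J. \<rho> t \<bullet> comb e (\<theta> t)) + (l2n J (\<lambda>t. comb e (\<theta> t)))\<^sup>2 \<le> 0"
      using \<nu> by (simp add: mult_nonneg_nonneg)
    then have "(l2n J (\<lambda>t. comb e (\<theta> t)))\<^sup>2 \<le> l2n J \<rho> * l2n J (\<lambda>t. comb e (\<theta> t))"
      using J.l2n_CS[OF l2c_\<rho> lc(1)[OF \<theta>]] by linarith
    then show ?thesis using l2n_nonneg[of J "\<lambda>t. comb e (\<theta> t)"]
      by (cases "l2n J (\<lambda>t. comb e (\<theta> t)) = 0") (auto simp: power2_eq_square)
  qed
  have est2: "l2n J E \<le> 8 / \<nu> * C\<^sup>2 * l2n J g"
  proof -
    have "E = (\<lambda>t. \<rho> t + comb e (\<theta> t))" by (rule ext) (simp add: E_def \<rho>_def \<theta>_def comb_diff)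
    then have "l2n J E \<le> l2n J \<rho> + l2n J (\<lambda>t. comb e (\<theta> t))"
      using J.l2n_triangle[OF l2c_\<rho> lc(1)[OF \<theta>]] by simp
    also have "\<dots> \<le> 2 * (C\<^sup>2 / \<nu> * l2n J g)" using est\<theta> l2n_\<rho> by linarith
    also have "\<dots> \<le> 8 * (C\<^sup>2 / \<nu> * l2n J g)"
    proof -
      have "0 \<le> C\<^sup>2 / \<nu> * l2n J g" using \<nu> by simp
      then show ?thesis by linarith
    qed
    finally show ?thesis by simp
  qed
  show thesis
    by (rule that[OF q ode[unfolded F_def] q0 nq' est1[unfolded GE_def[abs_def]] est2[unfolded E_def[abs_def]]
          est3[unfolded E_def[abs_def]]])
qed

end

section \<open>Piecewise linear functions in time\<close>

locale time_grid = time_interval T for T :: real +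
  fixes m :: nat and tn :: "nat \<Rightarrow> real"
  assumes nodes: "nodes T m tn"
begin

lemma tn_mono: "i \<le> j \<Longrightarrow> j \<le> m \<Longrightarrow> tn i \<le> tn j"
proof (induction j rule: dec_induct)
  case (step j)
  then have "tn j < tn (Suc j)" using nodes by (simp add: nodes_def)
  with step show ?case by simp
qed simp

lemma tn_less: "i < m \<Longrightarrow> tn i < tn (Suc i)"
  using nodes by (simp add: nodes_def)

lemma tn_0: "tn 0 = 0" and tn_m: "tn m = T"
  using nodes by (simp_all add: nodes_def)

lemma tn_range: "i \<le> m \<Longrightarrow> tn i \<in> {0..T}"
  using tn_mono[of 0 i] tn_mono[of i m] tn_0 tn_m by simp

lemma cell_exists:
  assumes "t \<in> {0..T}" obtains k where "k < m" "t \<in> {tn k..tn (Suc k)}"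
proof -
  have m0: "m > 0" using tn_0 tn_m T_pos by (cases m) auto
  have "\<exists>k<m. t \<in> {tn k..tn (Suc k)}"
  proof (rule ccontr)
    assume n: "\<not> (\<exists>k<m. t \<in> {tn k..tn (Suc k)})"
    have "tn j \<le> t" if "j \<le> m" for j
      using that
    proof (induction j)
      case 0 then show ?case using assms tn_0 by simp
    next
      case (Suc j)
      then have "tn j \<le> t" by simp
      moreover have "t \<notin> {tn j..tn (Suc j)}" using n Suc by auto
      ultimately show ?case by simp
    qed
    then have "tn (m - 1) \<le> t" by simp
    moreover have "t \<le> tn (Suc (m - 1))" using assms tn_m m0 by simp
    moreover have "m - 1 < m" using m0 by simp
    ultimately show False using n by auto
  qed
  then show thesis using that by blast
qed

text \<open>Rises with slope 1 on one cell and is constant elsewhere. In contrast to hat functions,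
  the coefficients are simply the slopes and the derivatives have disjoint supports.\<close>

definition ramp :: "nat \<Rightarrow> real \<Rightarrow> real" where
  "ramp i t = min t (tn (Suc i)) - min t (tn i)"

definition step :: "nat \<Rightarrow> real \<Rightarrow> real" where
  "step i t = indicator {tn i<..<tn (Suc i)} t"

lemma ramp_after: "tn (Suc i) \<le> t \<Longrightarrow> tn i \<le> t \<Longrightarrow> ramp i t = tn (Suc i) - tn i"
  by (simp add: ramp_def)

lemma ramp_before: "t \<le> tn i \<Longrightarrow> t \<le> tn (Suc i) \<Longrightarrow> ramp i t = 0"
  by (simp add: ramp_def)

lemma sum_ramp:
  assumes k: "k < m" and t: "t \<in> {tn k..tn (Suc k)}"
  shows "(\<Sum>i<m. \<beta> i * ramp i t) = (\<Sum>i<k. \<beta> i * (tn (Suc i) - tn i)) + \<beta> k * (t - tn k)"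
proof -
  have "{..<m} = {..<k} \<union> {k} \<union> {k<..<m}" using k by auto
  then have "(\<Sum>i<m. \<beta> i * ramp i t) = (\<Sum>i\<in>{..<k} \<union> {k} \<union> {k<..<m}. \<beta> i * ramp i t)" by simp
  also have "\<dots> = (\<Sum>i<k. \<beta> i * ramp i t) + \<beta> k * ramp k t + (\<Sum>i\<in>{k<..<m}. \<beta> i * ramp i t)"
    by (subst sum.union_disjoint, simp, simp, force)+ simp
  also have "(\<Sum>i<k. \<beta> i * ramp i t) = (\<Sum>i<k. \<beta> i * (tn (Suc i) - tn i))"
  proof (rule sum.cong[OF refl])
    fix i assume "i \<in> {..<k}"
    then have "tn (Suc i) \<le> tn k" "tn i \<le> tn k" using k by (auto intro: tn_mono)
    then show "\<beta> i * ramp i t = \<beta> i * (tn (Suc i) - tn i)" using t by (simp add: ramp_after)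
  qed
  also have "ramp k t = t - tn k" using t by (auto simp: ramp_def)
  also have "(\<Sum>i\<in>{k<..<m}. \<beta> i * ramp i t) = 0"
  proof (rule sum.neutral, rule ballI)
    fix i assume "i \<in> {k<..<m}"
    then have "tn (Suc k) \<le> tn i" "tn i \<le> tn (Suc i)" using tn_mono[of "Suc k" i] tn_less[of i] by auto
    then show "\<beta> i * ramp i t = 0" using t by (simp add: ramp_before)
  qed
  finally show ?thesis by simp
qed

lemma P1_ramp: "(\<lambda>t. \<Sum>i<m. \<beta> i * ramp i t) \<in> P1_space T m tn"
  unfolding P1_space_def
proof (intro CollectI conjI allI impI)
  show "continuous_on {0..T} (\<lambda>t. \<Sum>i<m. \<beta> i * ramp i t)"
    unfolding ramp_def by (intro continuous_intros)
  have "ramp i 0 = 0" if "i < m" for i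
    using tn_range[of i] tn_range[of "Suc i"] that by (simp add: ramp_before)
  then show "(\<Sum>i<m. \<beta> i * ramp i 0) = 0" by simp
  fix k assume k: "k < m"
  show "\<exists>\<alpha> b. \<forall>t\<in>{tn k..tn (Suc k)}. (\<Sum>i<m. \<beta> i * ramp i t) = \<alpha> + b * t"
    by (intro exI[of _ "(\<Sum>i<k. \<beta> i * (tn (Suc i) - tn i)) - \<beta> k * tn k"] exI[of _ "\<beta> k"] ballI)
      (simp add: sum_ramp[OF k] algebra_simps)
qed

definition slope :: "(real \<Rightarrow> real) \<Rightarrow> nat \<Rightarrow> real" where
  "slope u i = (u (tn (Suc i)) - u (tn i)) / (tn (Suc i) - tn i)"

lemma sum_slope: "k \<le> m \<Longrightarrow> (\<Sum>i<k. slope u i * (tn (Suc i) - tn i)) = u (tn k) - u (tn 0)"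
proof (induction k)
  case (Suc k)
  then show ?case using tn_less[of k] by (simp add: slope_def)
qed simp

lemma P1_as_ramp:
  assumes v: "v \<in> P1_space T m tn" and t: "t \<in> {0..T}"
  shows "v t = (\<Sum>i<m. slope v i * ramp i t)"
proof -
  obtain k where k: "k < m" "t \<in> {tn k..tn (Suc k)}" using cell_exists[OF t] by blast
  obtain \<alpha> b where ab: "\<And>t. t \<in> {tn k..tn (Suc k)} \<Longrightarrow> v t = \<alpha> + b * t"
    using v k(1) unfolding P1_space_def by blast
  have lt: "tn k < tn (Suc k)" by (rule tn_less[OF k(1)])
  have "v (tn (Suc k)) - v (tn k) = b * (tn (Suc k) - tn k)"
    using ab[of "tn k"] ab[of "tn (Suc k)"] lt by (simp add: algebra_simps)
  then have "slope v k = b" using lt by (simp add: slope_def)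
  then have "v t = v (tn k) + slope v k * (t - tn k)" using ab[OF k(2)] ab[of "tn k"] lt by (simp add: algebra_simps)
  moreover have "v (tn 0) = 0" using v by (simp add: P1_space_def tn_0)
  ultimately show ?thesis using sum_ramp[OF k, of "slope v"] sum_slope[of k v] k(1) by simp
qed

lemma nodal_interp_props:
  assumes "u 0 = 0"
  shows "nodal_interp T m tn u \<in> P1_space T m tn" "\<And>i. i \<le> m \<Longrightarrow> nodal_interp T m tn u (tn i) = u (tn i)"
proof -
  define p where "p = (\<lambda>t. \<Sum>i<m. slope u i * ramp i t)"
  have "p \<in> P1_space T m tn" unfolding p_def by (rule P1_ramp)
  moreover have "p (tn k) = u (tn k)" if k: "k \<le> m" for k
  proof (cases "k < m")
    case True
    have "tn k \<in> {tn k..tn (Suc k)}" using tn_less[OF True] by simp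
    from sum_ramp[OF True this, of "slope u"] show ?thesis
      using sum_slope[of k u] k assms by (simp add: p_def tn_0)
  next
    case False
    then have km: "k = m" using k by simp
    have "ramp i (tn m) = tn (Suc i) - tn i" if "i < m" for i
      using that by (intro ramp_after tn_mono) auto
    then show ?thesis using sum_slope[of m u] assms by (simp add: p_def km tn_0)
  qed
  ultimately have "\<exists>p. p \<in> P1_space T m tn \<and> (\<forall>i\<le>m. p (tn i) = u (tn i))" by blast
  from someI_ex[OF this] show "nodal_interp T m tn u \<in> P1_space T m tn"
    "\<And>i. i \<le> m \<Longrightarrow> nodal_interp T m tn u (tn i) = u (tn i)" unfolding nodal_interp_def by auto
qed

lemma P1_lincomb:
  assumes "\<And>j. j \<in> N \<Longrightarrow> v j \<in> P1_space T m tn"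
  shows "(\<lambda>t. \<Sum>j\<in>N. c j * v j t) \<in> P1_space T m tn"
proof -
  define w where "w = (\<lambda>t. \<Sum>i<m. (\<Sum>j\<in>N. c j * slope (v j) i) * ramp i t)"
  have wP: "w \<in> P1_space T m tn" unfolding w_def by (rule P1_ramp)
  have e: "(\<Sum>j\<in>N. c j * v j t) = w t" if "t \<in> {0..T}" for t
  proof -
    have "(\<Sum>j\<in>N. c j * v j t) = (\<Sum>j\<in>N. \<Sum>i<m. c j * slope (v j) i * ramp i t)"
      by (intro sum.cong refl) (simp add: P1_as_ramp[OF assms that] sum_distrib_left mult.assoc)
    also have "\<dots> = w t" unfolding w_def sum_distrib_right by (rule sum.swap)
    finally show ?thesis .
  qed
  show ?thesis unfolding P1_space_def
  proof (intro CollectI conjI allI impI)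
    have "continuous_on {0..T} w" using wP by (simp add: P1_space_def)
    then show "continuous_on {0..T} (\<lambda>t. \<Sum>j\<in>N. c j * v j t)"
      by (rule continuous_on_eq) (simp add: e)
    show "(\<Sum>j\<in>N. c j * v j 0) = 0" using wP e[of 0] T_pos by (simp add: P1_space_def)
    fix k assume k: "k < m"
    then obtain \<alpha> b where "\<forall>t\<in>{tn k..tn (Suc k)}. w t = \<alpha> + b * t" using wP unfolding P1_space_def by blast
    moreover have "t \<in> {0..T}" if "t \<in> {tn k..tn (Suc k)}" for t
      using that tn_range[of k] tn_range[of "Suc k"] k by auto
    ultimately show "\<exists>\<alpha> b. \<forall>t\<in>{tn k..tn (Suc k)}. (\<Sum>j\<in>N. c j * v j t) = \<alpha> + b * t"
      using e by (intro exI[of _ \<alpha>] exI[of _ b]) auto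
  qed
qed

lemma step_measurable: "step i \<in> borel_measurable J"
  unfolding step_def by (intro measurable_restrict_space1 borel_measurable_indicator) auto

lemma l2c_step: "l2c J (step i)"
  by (rule l2c_bounded[OF borel_smeas[OF step_measurable], where C=1]) (simp add: step_def indicator_def)

lemma antideriv_ramp:
  assumes i: "i < m" shows "antideriv (ramp i) (step i)"
  unfolding antideriv_def
proof (intro conjI l2c_step ballI allI)
  fix t y assume t: "t \<in> {0..T}"
  note r = tn_range[of i] tn_range[of "Suc i"]
  have lt: "tn i < tn (Suc i)" by (rule tn_less[OF i])
  have "(LINT s|J. indicator {..<t} s * (step i s \<bullet> y)) = (LINT s|J. y * indicator {tn i<..<min t (tn (Suc i))} s)"
    by (intro Bochner_Integration.integral_cong) (auto simp: step_def indicator_def)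
  also have "\<dots> = y * measure J ({tn i<..<min t (tn (Suc i))} \<inter> {0<..<T})" by simp
  also have "{tn i<..<min t (tn (Suc i))} \<inter> {0<..<T} = {tn i<..<min t (tn (Suc i))}" using r i t by auto
  also have "measure J {tn i<..<min t (tn (Suc i))} = measure lebesgue {tn i<..<min t (tn (Suc i))}"
    by (rule measure_restrict_space) (use r i t in auto)
  also have "\<dots> = ramp i t"
  proof (cases "tn i \<le> min t (tn (Suc i))")
    case True
    then show ?thesis by (simp add: ramp_def)
  next
    case False
    then have "t \<le> tn i" "{tn i<..<min t (tn (Suc i))} = {}" using lt by auto
    then show ?thesis using lt by (simp add: ramp_def)
  qed
  finally show "ramp i t \<bullet> y = (LINT s|J. indicator {..<t} s * (step i s \<bullet> y))" by (simp add: mult.commute)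
qed

definition P1_deriv :: "(real \<Rightarrow> real) \<Rightarrow> real \<Rightarrow> real" where
  "P1_deriv v t = (\<Sum>i<m. slope v i * step i t)"

lemma antideriv_P1:
  assumes "v \<in> P1_space T m tn" shows "antideriv v (P1_deriv v)"
proof (rule antideriv_cong)
  show "antideriv (\<lambda>t. \<Sum>i<m. slope v i * ramp i t) (P1_deriv v)"
    unfolding P1_deriv_def
    by (intro antideriv_sum) (use antideriv_scaleR[OF antideriv_ramp] in auto)
qed (simp add: P1_as_ramp[OF assms])

text \<open>Nodal interpolation is the \<open>V\<^sup>1\<close>-orthogonal projection.\<close>

lemma P1_orthogonal:
  fixes r r' :: "real \<Rightarrow> real"
  assumes r: "antideriv r r'" and z: "\<And>i. i \<le> m \<Longrightarrow> r (tn i) = 0"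
  shows "(LINT t|J. r' t * P1_deriv v t) = 0"
proof -
  have rl: "l2c J r'" by (rule antideriv_l2c[OF r])
  have "(LINT t|J. r' t * step i t) = 0" if i: "i < m" for i
  proof -
    note ti = tn_range[of i] tn_range[of "Suc i"]
    have lt: "tn i < tn (Suc i)" by (rule tn_less[OF i])
    \<comment> \<open>Up to the single node \<open>tn i\<close>, the indicator of the cell is a
      difference of two initial intervals, so the integral is the increment of \<open>r\<close>
      between neighboring nodes.\<close>
    have "(LINT t|J. r' t * step i t) = (LINT s|J. indicator {..<tn (Suc i)} s * (r' s \<bullet> 1) - indicator {..<tn i} s * (r' s \<bullet> 1))"
    proof (rule integral_cong_AE_complete[OF J.complete_measure_axioms])
      have "{tn i} \<in> null_sets lebesgue" using negligible_iff_null_sets negligible_sing by blast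
      from AE_lebesgue_J[OF AE_not_in[OF this]]
      show "AE s in J. r' s * step i s = indicator {..<tn (Suc i)} s * (r' s \<bullet> 1) - indicator {..<tn i} s * (r' s \<bullet> 1)"
        by eventually_elim (use lt in \<open>auto simp: step_def indicator_def\<close>)
    qed
    also have "\<dots> = (LINT s|J. indicator {..<tn (Suc i)} s * (r' s \<bullet> 1)) - (LINT s|J. indicator {..<tn i} s * (r' s \<bullet> 1))"
      by (intro Bochner_Integration.integral_diff integrable_indicator_inner[OF rl])
    also have "\<dots> = r (tn (Suc i)) \<bullet> 1 - r (tn i) \<bullet> 1"
      using antideriv_inner[OF r ti(1), of 1] antideriv_inner[OF r ti(2), of 1] i by simp
    also have "\<dots> = 0" using z[of i] z[of "Suc i"] i by simp
    finally show ?thesis .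
  qed
  moreover have "(LINT t|J. r' t * P1_deriv v t) = (\<Sum>i<m. slope v i * (LINT t|J. r' t * step i t))"
  proof -
    have ii: "integrable J (\<lambda>t. r' t * step i t)" for i using J.integrable_inner[OF rl l2c_step[of i]] by simp
    have "(LINT t|J. r' t * P1_deriv v t) = (LINT t|J. (\<Sum>i<m. slope v i * (r' t * step i t)))"
      by (intro Bochner_Integration.integral_cong) (simp_all add: P1_deriv_def sum_distrib_left mult.left_commute)
    also have "\<dots> = (\<Sum>i<m. LINT t|J. slope v i * (r' t * step i t))"
      by (intro Bochner_Integration.integral_sum integrable_mult_right ii)
    finally show ?thesis by simp
  qed
  ultimately show ?thesis by simp
qed

end

section \<open>The fully discrete problem\<close>

lemma inner_matrix_transpose: "(R *v x) \<bullet> y = x \<bullet> (transpose R *v y)" for R :: "real^'n^'n"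
  by (metis dot_lmul_matrix inner_commute transpose_matrix_vector)

lemma norm_mat_norm: "norm (Z *v x) \<le> mat_norm Z * norm x" for Z :: "real^'n^'n"
  unfolding mat_norm_def by (rule onorm[OF matrix_vector_mul_bounded_linear])

lemma mat_norm_nonneg: "0 \<le> mat_norm Z" for Z :: "real^'n^'n"
  unfolding mat_norm_def by (rule onorm_pos_le[OF matrix_vector_mul_bounded_linear])

context time_interval
begin

lemma l2c_comb: "(\<And>i. l2c J (X i)) \<Longrightarrow> l2c J (\<lambda>t. comb (\<lambda>i. X i t) a)"
  unfolding comb_def by (intro J.l2c_sum J.l2c_scaleR)

lemma integral_comb:
  fixes X :: "'n::finite \<Rightarrow> real \<Rightarrow> 'v::real_inner"
  assumes "\<And>i. l2c J (X i)" "l2c J v"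
  shows "(LINT t|J. v t \<bullet> comb (\<lambda>i. X i t) y) = (\<Sum>i\<in>UNIV. y $ i * (LINT t|J. v t \<bullet> X i t))"
  unfolding inner_comb using J.integrable_inner[OF assms(2,1)] by simp

lemma integral_matrix:
  fixes X V :: "'n::finite \<Rightarrow> real \<Rightarrow> 'v::real_inner"
  assumes X: "\<And>i. l2c J (X i)" and V: "\<And>i. l2c J (V i)"
    and Z: "Z = (\<chi> i j. LINT t|J. X j t \<bullet> V i t)"
  shows "(Z *v x) $ i = (LINT t|J. comb (\<lambda>i. X i t) x \<bullet> V i t)"
    and "y \<bullet> (Z *v x) = (LINT t|J. comb (\<lambda>i. X i t) x \<bullet> comb (\<lambda>i. V i t) y)"
proof -
  show e: "(Z *v x) $ i = (LINT t|J. comb (\<lambda>i. X i t) x \<bullet> V i t)" for i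
    using integral_comb[OF X V[of i], where y=x]
    by (simp add: Z matrix_vector_mult_def inner_commute mult.commute)
  show "y \<bullet> (Z *v x) = (LINT t|J. comb (\<lambda>i. X i t) x \<bullet> comb (\<lambda>i. V i t) y)"
    using integral_comb[OF V l2c_comb[OF X, where a=x], where y=y] by (simp add: inner_vec_def e)
qed

text \<open>The product of the factors is the Gram matrix of \<open>X\<close>, and its quadratic
  form is the squared norm of the combination. The result is the same for every
  factorization.\<close>

lemma factor_norm:
  fixes X :: "'n::finite \<Rightarrow> real \<Rightarrow> 'v::real_inner" and R :: "real^'n^'n"
  assumes X: "\<And>i. l2c J (X i)" and Z: "R ** transpose R = (\<chi> i j. LINT t|J. X j t \<bullet> X i t)"
  shows "norm (transpose R *v y) = l2n J (\<lambda>t. comb (\<lambda>i. X i t) y)"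
proof -
  have "(norm (transpose R *v y))\<^sup>2 = y \<bullet> (R *v (transpose R *v y))"
    using inner_matrix_transpose[of R "transpose R *v y" y] by (simp add: power2_norm_eq_inner inner_commute)
  also have "\<dots> = (LINT t|J. comb (\<lambda>i. X i t) y \<bullet> comb (\<lambda>i. X i t) y)"
    unfolding matrix_vector_mul_assoc by (rule integral_matrix(2)[OF X X Z])
  also have "\<dots> = (l2n J (\<lambda>t. comb (\<lambda>i. X i t) y))\<^sup>2" by (simp add: l2n_sq power2_norm_eq_inner)
  finally show ?thesis by simp
qed

text \<open>All the constants \<open>\<gamma>\<close> and \<open>M\<close> arise from this bound.\<close>

lemma solution_bound:
  fixes V :: "'n::finite \<Rightarrow> real \<Rightarrow> 'v::real_inner" and R L Z :: "real^'n^'n"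
  assumes V: "\<And>i. l2c J (V i)" and R: "R ** transpose R = (\<chi> i j. LINT t|J. V j t \<bullet> V i t)"
    and h: "l2c J h" and Z: "invertible Z" "\<And>i. (Z *v d) $ i = c * (LINT t|J. h t \<bullet> V i t)"
  shows "norm (transpose L *v d) \<le> \<bar>c\<bar> * mat_norm (transpose L ** matrix_inv Z ** R) * l2n J h"
proof -
  define r where "r = (\<chi> i. LINT t|J. h t \<bullet> V i t)"
  have "\<bar>r \<bullet> y\<bar> \<le> l2n J h * norm (transpose R *v y)" for y
  proof -
    have "r \<bullet> y = (LINT t|J. h t \<bullet> comb (\<lambda>i. V i t) y)"
      by (simp add: integral_comb[OF V h] r_def inner_vec_def mult.commute)
    then show ?thesis using J.l2n_CS[OF h l2c_comb[of V y]] V unfolding factor_norm[OF V R] by simp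
  qed
  \<comment> \<open>The load vector becomes \<open>R *v s\<close> with \<open>norm s\<close> at most
    the norm of \<open>h\<close>; this is the origin of the right factor in the matrix products of
    the constants.\<close>
  from factor_bounded_functional[OF this] obtain s where s: "r = R *v s" "norm s \<le> l2n J h" by auto
  have "d = matrix_inv Z *v (Z *v d)" by (simp add: matrix_vector_mul_assoc matrix_inv_left[OF Z(1)])
  also have "Z *v d = c *\<^sub>R r" by (simp add: vec_eq_iff Z(2) r_def)
  finally have "transpose L *v d = c *\<^sub>R ((transpose L ** matrix_inv Z ** R) *v s)"
    by (simp only: s(1) matrix_vector_mult_scaleR matrix_vector_mul_assoc matrix_mul_assoc)
  then have "norm (transpose L *v d) = \<bar>c\<bar> * norm ((transpose L ** matrix_inv Z ** R) *v s)" by simp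
  also have "\<dots> \<le> \<bar>c\<bar> * (mat_norm (transpose L ** matrix_inv Z ** R) * norm s)"
    by (intro mult_left_mono norm_mat_norm) simp
  also have "\<dots> \<le> \<bar>c\<bar> * (mat_norm (transpose L ** matrix_inv Z ** R) * l2n J h)"
    by (intro mult_left_mono s(2) mat_norm_nonneg) simp
  finally show ?thesis by (simp only: mult.assoc)
qed

end

text \<open>
  A basis of the tensor product is represented by its coordinates \<open>P\<close> with respect to the spatial basis
  \<open>e\<close>, which are piecewise linear curves in \<open>real^'n\<close>.
\<close>

locale tensor_basis = time_grid T m tn
  for T :: real and m :: nat and tn :: "nat \<Rightarrow> real" +
  fixes \<nu> CJ Cinv :: real
    and e :: "'n::finite \<Rightarrow> 'h::real_inner" and \<epsilon> :: "'n \<Rightarrow> 'g::real_inner" and I :: "'n set"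
    and P P' :: "'n \<Rightarrow> real \<Rightarrow> real^'n"
    and A M B U W Y RA RM RU RW RY :: "real^'n^'n"
  assumes \<nu>: "\<nu> > 0" and CJ: "CJ > 0" and Cinv: "Cinv > 0"
    and orth: "\<And>l k. e l \<bullet> e k = (if l = k \<and> l \<in> I then 1 else 0)"
    and inverse_ineq: "\<And>a. norm (comb \<epsilon> a) \<le> Cinv * norm (comb e a)"
    and interp: "\<And>u u' :: real \<Rightarrow> real. antideriv u u' \<Longrightarrow>
      \<exists>v \<in> P1_space T m tn. (\<forall>i\<le>m. v (tn i) = u (tn i)) \<and> l2n J (\<lambda>t. u t - v t) \<le> CJ * l2n J u'"
    and P1: "\<And>i l. (\<lambda>t. P i t $ l) \<in> P1_space T m tn"
    and P0: "\<And>i t l. l \<notin> I \<Longrightarrow> P i t $ l = 0"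
    and P': "\<And>i t. P' i t = (\<chi> l. P1_deriv (\<lambda>t. P i t $ l) t)"
    and span: "\<And>r :: real \<Rightarrow> real^'n. (\<And>l. (\<lambda>t. r t $ l) \<in> P1_space T m tn) \<Longrightarrow> (\<And>t l. l \<notin> I \<Longrightarrow> r t $ l = 0) \<Longrightarrow>
      \<exists>a. \<forall>t\<in>{0..T}. r t = comb (\<lambda>i. P i t) a"
    and indep: "\<And>a. (\<And>t. t \<in> {0..T} \<Longrightarrow> comb (\<lambda>i. P i t) a = 0) \<Longrightarrow> a = 0"
    and A: "A = (\<chi> i j. LINT t|J. comb e (P' j t) \<bullet> comb e (P' i t))"
    and M: "M = (\<chi> i j. LINT t|J. comb \<epsilon> (P j t) \<bullet> comb \<epsilon> (P i t))"
    and B: "B = (\<chi> i j. LINT t|J. comb \<epsilon> (P j t) \<bullet> comb \<epsilon> (P' i t))"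
    and U: "U = (\<chi> i j. LINT t|J. comb e (P j t) \<bullet> comb e (P i t))"
    and W: "W = (\<chi> i j. LINT t|J. comb \<epsilon> (P' j t) \<bullet> comb \<epsilon> (P' i t))"
    and Y: "Y = (\<chi> i j. comb e (P j T) \<bullet> comb e (P i T))"
    and RA: "A = RA ** transpose RA" and RM: "M = RM ** transpose RM" and RU: "U = RU ** transpose RU"
    and RW: "W = RW ** transpose RW" and RY: "Y = RY ** transpose RY"
begin

lemmas comb_e_inner = comb_orthonormal[OF orth]

lemma comb_e_comb: "(\<And>l. l \<notin> I \<Longrightarrow> a $ l = 0) \<Longrightarrow> comb e a \<bullet> comb e b = a \<bullet> b"
  unfolding inner_comb inner_vec_def by (intro sum.cong) (auto simp: comb_e_inner)

lemma norm_comb_e: "(\<And>l. l \<notin> I \<Longrightarrow> a $ l = 0) \<Longrightarrow> norm (comb e a) = norm a"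
  by (simp add: norm_eq_sqrt_inner comb_e_comb)

lemma antideriv_vec:
  fixes u v :: "real \<Rightarrow> real^'n"
  assumes "\<And>l. antideriv (\<lambda>t. u t $ l) (\<lambda>t. v t $ l)" shows "antideriv u v"
proof -
  have "antideriv (\<lambda>t. \<Sum>l\<in>UNIV. u t $ l *\<^sub>R axis l 1) (\<lambda>t. \<Sum>l\<in>UNIV. v t $ l *\<^sub>R axis l (1::real))"
    by (intro antideriv_sum antideriv_scaleR_left assms)
  moreover have "(\<Sum>l\<in>UNIV. x $ l *\<^sub>R axis l (1::real)) = x" for x :: "real^'n"
    using basis_expansion[of x] by (simp add: vector_scalar_mult_def scalar_mult_eq_scaleR)
  ultimately show ?thesis by simp
qed

lemma antideriv_P: "antideriv (P i) (P' i)"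
  by (rule antideriv_vec) (simp add: P' antideriv_P1[OF P1])

lemma P'0: "l \<notin> I \<Longrightarrow> P' i t $ l = 0"
  by (simp add: P' P0 P1_deriv_def slope_def)

text \<open>The discrete space-time function with coefficient vector \<open>a\<close>, seen as a
  curve of spatial coordinates.\<close>

definition Pc :: "real^'n \<Rightarrow> real \<Rightarrow> real^'n" where "Pc a t = comb (\<lambda>i. P i t) a"
definition Pc' :: "real^'n \<Rightarrow> real \<Rightarrow> real^'n" where "Pc' a t = comb (\<lambda>i. P' i t) a"

lemma antideriv_Pc: "antideriv (Pc a) (Pc' a)"
  unfolding Pc_def[abs_def] Pc'_def[abs_def] comb_def by (intro antideriv_sum antideriv_scaleR antideriv_P)

lemma l2c_P: "l2c J (P i)" "l2c J (P' i)"
  using antideriv_l2c_fun[OF antideriv_P] antideriv_l2c[OF antideriv_P] by auto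

lemma l2c_combs:
  "l2c J (\<lambda>t. comb e (P i t))" "l2c J (\<lambda>t. comb e (P' i t))" "l2c J (\<lambda>t. comb \<epsilon> (P i t))" "l2c J (\<lambda>t. comb \<epsilon> (P' i t))"
  by (intro J.l2c_linear[OF bounded_linear_comb] l2c_P)+

lemma comb_comb:
  "comb (\<lambda>i. comb e (P i t)) a = comb e (Pc a t)" "comb (\<lambda>i. comb e (P' i t)) a = comb e (Pc' a t)"
  "comb (\<lambda>i. comb \<epsilon> (P i t)) a = comb \<epsilon> (Pc a t)" "comb (\<lambda>i. comb \<epsilon> (P' i t)) a = comb \<epsilon> (Pc' a t)"
  unfolding Pc_def Pc'_def comb_def[of _ a]
  by (simp_all add: linear_sum[OF linear_comb]
      linear_scale[OF linear_comb])

lemma Pc0: "l \<notin> I \<Longrightarrow> Pc a t $ l = 0" "l \<notin> I \<Longrightarrow> Pc' a t $ l = 0"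
  by (simp_all add: Pc_def Pc'_def comb_def P0 P'0)

text \<open>Testing with a kernel vector gives the squared norm of the time derivative plus half of
  \<nu> times the final gradient energy. Both vanish, so the function is zero by its initial value
  and its coefficients by independence.\<close>

lemma invertible_AB: "invertible (A + \<nu> *\<^sub>R B)"
proof -
  have "y = 0" if y: "(A + \<nu> *\<^sub>R B) *v y = 0" for y
  proof -
    note a = antideriv_Pc[of y]
    have "0 = y \<bullet> (A *v y) + \<nu> * (y \<bullet> (B *v y))"
      using arg_cong[OF y, of "\<lambda>x. y \<bullet> x"]
      by (simp add: matrix_vector_mult_add_rdistrib inner_add_right scaleR_matrix_vector_assoc[symmetric])
    moreover have "y \<bullet> (A *v y) = (LINT t|J. (norm (Pc' y t))\<^sup>2)"
      unfolding integral_matrix(2)[OF l2c_combs(2,2) A] comb_comb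
      by (intro Bochner_Integration.integral_cong) (auto simp: power2_norm_eq_inner comb_e_comb Pc0)
    moreover have "y \<bullet> (B *v y) \<ge> 0"
    proof -
      have s: "(gram \<epsilon> *v x) \<bullet> v = x \<bullet> (gram \<epsilon> *v v)" for x v by (metis gram_inner inner_commute)
      have "2 * (y \<bullet> (B *v y)) = 2 * (LINT t|J. Pc' y t \<bullet> (gram \<epsilon> *v Pc y t))"
        unfolding integral_matrix(2)[OF l2c_combs(3,4) B] comb_comb gram_inner
        by (simp add: inner_commute)
      also have "\<dots> = Pc y T \<bullet> (gram \<epsilon> *v Pc y T)"
        by (rule antideriv_energy[OF a matrix_vector_mul_bounded_linear s])
      also have "\<dots> \<ge> 0" unfolding gram_inner by simp
      finally show ?thesis by simp
    qed
    moreover have "\<nu> * (y \<bullet> (B *v y)) \<ge> 0" using calculation(3) \<nu> by simp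
    moreover have "(LINT t|J. (norm (Pc' y t))\<^sup>2) \<ge> 0" by simp
    ultimately have "(LINT t|J. (norm (Pc' y t))\<^sup>2) = 0" by linarith
    then have "AE t in J. (norm (Pc' y t))\<^sup>2 = 0"
      using integral_nonneg_eq_0_iff_AE[OF l2c_integrable[OF antideriv_l2c[OF a]]] by simp
    then have "l2n J (Pc' y) = 0" by (simp add: l2n_def \<open>(LINT t|J. (norm (Pc' y t))\<^sup>2) = 0\<close>)
    then have "Pc y t = 0" if "t \<in> {0..T}" for t using antideriv_norm_le[OF a that] by simp
    then show "y = 0" using indep[of y] by (simp add: Pc_def)
  qed
  then show ?thesis using invertible_left_inverse matrix_left_invertible_ker by blast
qed

lemma factor_norms:
  "norm (transpose RM *v a) = l2n J (\<lambda>t. comb \<epsilon> (Pc a t))"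
  "norm (transpose RU *v a) = l2n J (\<lambda>t. comb e (Pc a t))"
  "norm (transpose RY *v a) = norm (comb e (Pc a T))"
proof -
  show "norm (transpose RM *v a) = l2n J (\<lambda>t. comb \<epsilon> (Pc a t))"
    unfolding comb_comb[symmetric] by (rule factor_norm[OF l2c_combs(3)]) (simp add: RM[symmetric] M)
  show "norm (transpose RU *v a) = l2n J (\<lambda>t. comb e (Pc a t))"
    unfolding comb_comb[symmetric] by (rule factor_norm[OF l2c_combs(1)]) (simp add: RU[symmetric] U)
  have "(norm (transpose RY *v a))\<^sup>2 = a \<bullet> (Y *v a)"
    using inner_matrix_transpose[of RY "transpose RY *v a" a]
    unfolding RY power2_norm_eq_inner matrix_vector_mul_assoc[symmetric] by (metis inner_commute)
  also have "Y = gram (\<lambda>i. comb e (P i T))" by (simp add: Y gram_def inner_commute)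
  also have "a \<bullet> (gram (\<lambda>i. comb e (P i T)) *v a) = (norm (comb e (Pc a T)))\<^sup>2"
    by (simp add: gram_inner comb_comb power2_norm_eq_inner)
  finally show "norm (transpose RY *v a) = norm (comb e (Pc a T))" by simp
qed

text \<open>\<open>Pc d\<close> is compared with the interpolant of \<open>q\<close>, whose
  coefficients are \<open>a\<close>. The vector \<open>a - d\<close> solves a system whose load is
  the gradient of the interpolation error paired with gradients of time derivatives;
  \<open>solution_bound\<close> with the factor \<open>RW\<close> then applies.\<close>

lemma fully_discrete_error:
  assumes q: "antideriv q q'" and g: "l2c J g"
    and ode: "AE t in J. q' t + \<nu> *\<^sub>R (gram \<epsilon> *v q t) = (\<chi> l. g t \<bullet> e l)"
    and q0: "\<And>t l. t \<in> {0..T} \<Longrightarrow> l \<notin> I \<Longrightarrow> q t $ l = 0" and nq: "l2n J q' \<le> l2n J g"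
    and d: "\<And>i. ((A + \<nu> *\<^sub>R B) *v d) $ i = (LINT t|J. g t \<bullet> comb e (P' i t))"
  shows "l2n J (\<lambda>t. comb \<epsilon> (q t) - comb \<epsilon> (Pc d t))
      \<le> (Cinv * CJ + CJ * Cinv * (\<nu> * mat_norm (transpose RM ** matrix_inv (A + \<nu> *\<^sub>R B) ** RW))) * l2n J g"
    and "l2n J (\<lambda>t. comb e (q t) - comb e (Pc d t))
      \<le> (CJ + CJ * Cinv * (\<nu> * mat_norm (transpose RU ** matrix_inv (A + \<nu> *\<^sub>R B) ** RW))) * l2n J g"
    and "norm (comb e (q T) - comb e (Pc d T))
      \<le> CJ * Cinv * (\<nu> * mat_norm (transpose RY ** matrix_inv (A + \<nu> *\<^sub>R B) ** RW)) * l2n J g"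
proof -
  \<comment> \<open>Interpolation acts on each coordinate. Outside \<open>I\<close> the zero
    function is taken, because \<open>span\<close> demands zero at all real times while
    \<open>q\<close> is known to vanish there only on the closed interval.\<close>
  have ex: "\<forall>l. \<exists>v. (v \<in> P1_space T m tn \<and> (\<forall>i\<le>m. v (tn i) = q (tn i) $ l) \<and> l2n J (\<lambda>t. q t $ l - v t) \<le> CJ * l2n J (\<lambda>t. q' t $ l)) \<and>
      (l \<notin> I \<longrightarrow> (\<forall>t. v t = 0))"
  proof
    fix l
    show "\<exists>v. (v \<in> P1_space T m tn \<and> (\<forall>i\<le>m. v (tn i) = q (tn i) $ l) \<and> l2n J (\<lambda>t. q t $ l - v t) \<le> CJ * l2n J (\<lambda>t. q' t $ l)) \<and>
      (l \<notin> I \<longrightarrow> (\<forall>t. v t = 0))"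
  proof (cases "l \<in> I")
    case True
    have "antideriv (\<lambda>t. q t $ l) (\<lambda>t. q' t $ l)"
      using antideriv_comp_inner[OF q, of "axis l 1"] by (simp add: inner_axis)
    from interp[OF this] True show ?thesis by blast
  next
    case False
    have "(LINT t|J. (norm (q t $ l - 0))\<^sup>2) = (LINT t|J. 0)"
      by (intro Bochner_Integration.integral_cong) (use q0[OF _ False] in auto)
    then have "l2n J (\<lambda>t. q t $ l - 0) = 0" by (simp add: l2n_def)
    moreover have "(\<lambda>t. 0) \<in> P1_space T m tn" using P1_lincomb[of "{}"] by simp
    moreover have "q (tn i) $ l = 0" if "i \<le> m" for i using q0[OF tn_range[OF that] False] .
    ultimately show ?thesis using CJ by (intro exI[of _ "\<lambda>t. 0"]) auto
  qed
  qed
  from choice[OF ex] obtain v where v0: "\<forall>l. (v l \<in> P1_space T m tn \<and> (\<forall>i\<le>m. v l (tn i) = q (tn i) $ l) \<and>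
      l2n J (\<lambda>t. q t $ l - v l t) \<le> CJ * l2n J (\<lambda>t. q' t $ l)) \<and> (l \<notin> I \<longrightarrow> (\<forall>t. v l t = 0))" by blast
  have v: "\<And>l. v l \<in> P1_space T m tn" "\<And>l i. i \<le> m \<Longrightarrow> v l (tn i) = q (tn i) $ l"
    "\<And>l. l2n J (\<lambda>t. q t $ l - v l t) \<le> CJ * l2n J (\<lambda>t. q' t $ l)" "\<And>l t. l \<notin> I \<Longrightarrow> v l t = 0"
    using v0 by blast+
  define \<pi> where "\<pi> t = (\<chi> l. v l t)" for t
  obtain a where a: "\<And>t. t \<in> {0..T} \<Longrightarrow> \<pi> t = Pc a t"
    using span[of \<pi>] v(1,4) by (auto simp: \<pi>_def Pc_def)
  have a\<pi>: "antideriv \<pi> (Pc' a)" by (rule antideriv_cong[OF antideriv_Pc[of a]]) (simp add: a)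
  define \<eta> where "\<eta> t = \<pi> t - q t" for t
  have a\<eta>: "antideriv \<eta> (\<lambda>t. Pc' a t - q' t)" unfolding \<eta>_def[abs_def] by (rule antideriv_diff[OF a\<pi> q])
  note \<eta>l = antideriv_l2c_fun[OF a\<eta>]
  have \<eta>0: "\<eta> t $ l = 0" if "t \<in> {0..T}" "l \<notin> I" for t l using that v(4) q0 by (simp add: \<eta>_def \<pi>_def)
  have \<eta>node: "\<eta> (tn i) = 0" if "i \<le> m" for i using v(2)[OF that] by (simp add: \<eta>_def \<pi>_def vec_eq_iff)
  have comp: "l2c J (\<lambda>t. u t $ l)" if "l2c J u" for u :: "real \<Rightarrow> real^'n" and l
    by (rule J.l2c_linear[OF bounded_linear_vec_nth that])
  have sq: "(l2n J u)\<^sup>2 = (\<Sum>l\<in>UNIV. (l2n J (\<lambda>t. u t $ l))\<^sup>2)" if "l2c J u" for u :: "real \<Rightarrow> real^'n"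
  proof -
    have "(l2n J u)\<^sup>2 = (LINT t|J. (\<Sum>l\<in>UNIV. (norm (u t $ l))\<^sup>2))"
      unfolding l2n_sq power2_norm_eq_inner inner_vec_def ..
    also have "\<dots> = (\<Sum>l\<in>UNIV. (l2n J (\<lambda>t. u t $ l))\<^sup>2)"
      unfolding l2n_sq by (rule Bochner_Integration.integral_sum[OF l2c_integrable[OF comp[OF that]]])
    finally show ?thesis .
  qed
  have n\<eta>: "l2n J \<eta> \<le> CJ * l2n J g"
  proof -
    have "l2n J \<eta> \<le> CJ * l2n J q'"
    proof (rule power2_le_imp_le)
      have "(l2n J \<eta>)\<^sup>2 = (\<Sum>l\<in>UNIV. (l2n J (\<lambda>t. \<eta> t $ l))\<^sup>2)" by (rule sq[OF \<eta>l])
      also have "\<dots> \<le> (\<Sum>l\<in>UNIV. (CJ * l2n J (\<lambda>t. q' t $ l))\<^sup>2)"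
      proof (rule sum_mono, rule power_mono)
        fix l
        have "l2n J (\<lambda>t. \<eta> t $ l) = l2n J (\<lambda>t. q t $ l - v l t)"
          unfolding l2n_def by (simp add: \<eta>_def \<pi>_def abs_minus_commute norm_minus_commute power2_commute)
        then show "l2n J (\<lambda>t. \<eta> t $ l) \<le> CJ * l2n J (\<lambda>t. q' t $ l)" using v(3) by simp
      qed simp
      also have "\<dots> = CJ\<^sup>2 * (l2n J q')\<^sup>2"
        by (simp add: sq[OF antideriv_l2c[OF q]] power_mult_distrib sum_distrib_left)
      finally show "(l2n J \<eta>)\<^sup>2 \<le> (CJ * l2n J q')\<^sup>2" by (simp add: power_mult_distrib)
    qed (use CJ in simp)
    also have "\<dots> \<le> CJ * l2n J g" using CJ nq by (intro mult_left_mono) auto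
    finally show ?thesis .
  qed
  have ce: "l2c J (\<lambda>t. comb e (u t))" "l2c J (\<lambda>t. comb \<epsilon> (u t))" if "l2c J u" for u
    by (rule J.l2c_linear[OF bounded_linear_comb that])+
  have n\<eta>e: "l2n J (\<lambda>t. comb e (\<eta> t)) \<le> CJ * l2n J g"
  proof -
    have "l2n J (\<lambda>t. comb e (\<eta> t)) \<le> 1 * l2n J \<eta>"
      by (rule J.l2n_mono[OF ce(1)[OF \<eta>l] \<eta>l]) (auto intro!: AE_I2 simp: norm_comb_e \<eta>0)
    then show ?thesis using n\<eta> by simp
  qed
  have n\<eta>\<epsilon>: "l2n J (\<lambda>t. comb \<epsilon> (\<eta> t)) \<le> Cinv * CJ * l2n J g"
  proof -
    have "l2n J (\<lambda>t. comb \<epsilon> (\<eta> t)) \<le> Cinv * l2n J (\<lambda>t. comb e (\<eta> t))"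
      by (rule J.l2n_mono[OF ce(2)[OF \<eta>l] ce(1)[OF \<eta>l]]) (use Cinv inverse_ineq in auto)
    also have "\<dots> \<le> Cinv * (CJ * l2n J g)" using Cinv n\<eta>e by (intro mult_left_mono) auto
    finally show ?thesis by simp
  qed
  define \<delta> where "\<delta> = a - d"
  \<comment> \<open>The difference of two equations: the one for \<open>a\<close> contains the
    interpolant, the one for \<open>d\<close> is rewritten by the semidiscrete equation in terms of
    \<open>q\<close>.\<close>
  have \<delta>: "((A + \<nu> *\<^sub>R B) *v \<delta>) $ i = \<nu> * (LINT t|J. comb \<epsilon> (\<eta> t) \<bullet> comb \<epsilon> (P' i t))" for i
  proof -
    note l = l2c_P(2)[of i]
    have iA: "integrable J (\<lambda>t. Pc' a t \<bullet> P' i t)" by (rule J.integrable_inner[OF antideriv_l2c[OF antideriv_Pc] l])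
    have iq: "integrable J (\<lambda>t. q' t \<bullet> P' i t)" by (rule J.integrable_inner[OF antideriv_l2c[OF q] l])
    have iE: "integrable J (\<lambda>t. comb \<epsilon> (u t) \<bullet> comb \<epsilon> (P' i t))" if "l2c J u" for u
      by (rule J.integrable_inner[OF ce(2)[OF that] l2c_combs(4)])
    have "((A + \<nu> *\<^sub>R B) *v a) $ i = (A *v a) $ i + \<nu> * (B *v a) $ i"
      by (simp add: matrix_vector_mult_add_rdistrib scaleR_matrix_vector_assoc[symmetric])
    also have "(A *v a) $ i = (LINT t|J. Pc' a t \<bullet> P' i t)"
      unfolding integral_matrix(1)[OF l2c_combs(2,2) A] comb_comb
      by (intro Bochner_Integration.integral_cong) (auto simp: comb_e_comb Pc0)
    also have "(B *v a) $ i = (LINT t|J. comb \<epsilon> (\<pi> t) \<bullet> comb \<epsilon> (P' i t))"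
      unfolding integral_matrix(1)[OF l2c_combs(3,4) B] comb_comb
      by (intro Bochner_Integration.integral_cong) (auto simp: a)
    finally have 1: "((A + \<nu> *\<^sub>R B) *v a) $ i = (LINT t|J. Pc' a t \<bullet> P' i t) + \<nu> * (LINT t|J. comb \<epsilon> (\<pi> t) \<bullet> comb \<epsilon> (P' i t))" .
    have "((A + \<nu> *\<^sub>R B) *v d) $ i = (LINT t|J. q' t \<bullet> P' i t + \<nu> * (comb \<epsilon> (q t) \<bullet> comb \<epsilon> (P' i t)))"
      unfolding d
    proof (rule integral_cong_AE_complete[OF J.complete_measure_axioms])
      show "AE t in J. g t \<bullet> comb e (P' i t) = q' t \<bullet> P' i t + \<nu> * (comb \<epsilon> (q t) \<bullet> comb \<epsilon> (P' i t))"
        using ode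
      proof eventually_elim
        case (elim t)
        have "g t \<bullet> comb e (P' i t) = P' i t \<bullet> (\<chi> l. g t \<bullet> e l)" by (simp add: inner_comb inner_vec_def)
        also have "\<dots> = P' i t \<bullet> q' t + \<nu> * (comb \<epsilon> (P' i t) \<bullet> comb \<epsilon> (q t))"
          unfolding elim[symmetric] gram_inner[symmetric] by (simp add: inner_add_right)
        finally show ?case by (simp add: inner_commute)
      qed
    qed
    also have "\<dots> = (LINT t|J. q' t \<bullet> P' i t) + \<nu> * (LINT t|J. comb \<epsilon> (q t) \<bullet> comb \<epsilon> (P' i t))"
      using iq iE[OF antideriv_l2c_fun[OF q]] by simp
    finally have 2: "((A + \<nu> *\<^sub>R B) *v d) $ i = (LINT t|J. q' t \<bullet> P' i t) + \<nu> * (LINT t|J. comb \<epsilon> (q t) \<bullet> comb \<epsilon> (P' i t))" .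
    \<comment> \<open>Orthogonality of nodal interpolation, applied to each coordinate of the error
      against the piecewise constant derivative of the basis function.\<close>
    have 3: "(LINT t|J. (Pc' a t - q' t) \<bullet> P' i t) = 0"
    proof -
      have z: "(LINT t|J. (Pc' a t - q' t) $ l * P1_deriv (\<lambda>t. P i t $ l) t) = 0" for l
        using P1_orthogonal[of "\<lambda>t. \<eta> t $ l" "\<lambda>t. (Pc' a t - q' t) $ l"] antideriv_comp_inner[OF a\<eta>, of "axis l 1"] \<eta>node
        by (simp add: inner_axis)
      have il: "integrable J (\<lambda>t. (Pc' a t - q' t) $ l * P' i t $ l)" for l
        using J.integrable_inner[OF comp[OF antideriv_l2c[OF a\<eta>], of l] comp[OF l, of l]] by simp
      have "(LINT t|J. (Pc' a t - q' t) \<bullet> P' i t) = (\<Sum>l\<in>UNIV. LINT t|J. (Pc' a t - q' t) $ l * P' i t $ l)"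
        unfolding inner_vec_def inner_real_def by (rule Bochner_Integration.integral_sum[OF il])
      also have "\<dots> = 0" using z by (simp add: P')
      finally show ?thesis .
    qed
    have 4: "(LINT t|J. (Pc' a t - q' t) \<bullet> P' i t) = (LINT t|J. Pc' a t \<bullet> P' i t) - (LINT t|J. q' t \<bullet> P' i t)"
      using iA iq by (simp add: inner_diff_left)
    have 5: "(LINT t|J. comb \<epsilon> (\<eta> t) \<bullet> comb \<epsilon> (P' i t)) = (LINT t|J. comb \<epsilon> (\<pi> t) \<bullet> comb \<epsilon> (P' i t)) - (LINT t|J. comb \<epsilon> (q t) \<bullet> comb \<epsilon> (P' i t))"
      using iE[OF antideriv_l2c_fun[OF a\<pi>]] iE[OF antideriv_l2c_fun[OF q]] by (simp add: \<eta>_def comb_diff inner_diff_left)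
    have "((A + \<nu> *\<^sub>R B) *v \<delta>) $ i = ((A + \<nu> *\<^sub>R B) *v a) $ i - ((A + \<nu> *\<^sub>R B) *v d) $ i"
      by (simp add: \<delta>_def matrix_vector_mult_diff_distrib)
    also have "\<dots> = \<nu> * ((LINT t|J. comb \<epsilon> (\<pi> t) \<bullet> comb \<epsilon> (P' i t)) - (LINT t|J. comb \<epsilon> (q t) \<bullet> comb \<epsilon> (P' i t)))"
      unfolding 1 2 right_diff_distrib using 3 4 by linarith
    finally show ?thesis unfolding 5 .
  qed
  have RW': "RW ** transpose RW = (\<chi> i j. LINT t|J. comb \<epsilon> (P' j t) \<bullet> comb \<epsilon> (P' i t))" by (simp add: RW[symmetric] W)
  have bd: "norm (transpose L *v \<delta>) \<le> CJ * Cinv * (\<nu> * mat_norm (transpose L ** matrix_inv (A + \<nu> *\<^sub>R B) ** RW)) * l2n J g" for L :: "real^'n^'n"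
  proof -
    have "norm (transpose L *v \<delta>) \<le> \<bar>\<nu>\<bar> * mat_norm (transpose L ** matrix_inv (A + \<nu> *\<^sub>R B) ** RW) * l2n J (\<lambda>t. comb \<epsilon> (\<eta> t))"
      by (rule solution_bound[OF l2c_combs(4) RW' ce(2)[OF \<eta>l] invertible_AB \<delta>])
    also have "\<dots> \<le> \<bar>\<nu>\<bar> * mat_norm (transpose L ** matrix_inv (A + \<nu> *\<^sub>R B) ** RW) * (Cinv * CJ * l2n J g)"
      by (intro mult_left_mono n\<eta>\<epsilon> mult_nonneg_nonneg mat_norm_nonneg) simp
    finally show ?thesis using \<nu> by (simp add: mult_ac)
  qed
  have Pd: "comb \<epsilon> (Pc \<delta> t) = comb \<epsilon> (Pc a t) - comb \<epsilon> (Pc d t)" "comb e (Pc \<delta> t) = comb e (Pc a t) - comb e (Pc d t)" for t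
    unfolding \<delta>_def Pc_def comb_diff by simp_all
  have dl: "l2c J (Pc \<delta>)" by (rule antideriv_l2c_fun[OF antideriv_Pc])
  have dec: "comb x (q t) - comb x (Pc d t) = comb x (Pc \<delta> t) - comb x (\<eta> t)" if "t \<in> {0..T}" for t and x :: "'n \<Rightarrow> 'v::real_normed_vector"
  proof -
    have "Pc \<delta> t = Pc a t - Pc d t" unfolding \<delta>_def Pc_def comb_diff ..
    then show ?thesis using a[OF that] by (simp add: comb_diff \<eta>_def)
  qed
  have l2d: "l2n J (\<lambda>t. comb x (q t) - comb x (Pc d t)) \<le> l2n J (\<lambda>t. comb x (\<eta> t)) + l2n J (\<lambda>t. comb x (Pc \<delta> t))"
    for x :: "'n \<Rightarrow> 'v::real_inner"
  proof -
    have cx: "l2c J (\<lambda>t. comb x (Pc \<delta> t))" "l2c J (\<lambda>t. comb x (\<eta> t))" by (rule J.l2c_linear[OF bounded_linear_comb], rule dl \<eta>l)+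
    have "(LINT t|J. (norm (comb x (q t) - comb x (Pc d t)))\<^sup>2) = (LINT t|J. (norm (comb x (Pc \<delta> t) - comb x (\<eta> t)))\<^sup>2)"
      by (intro Bochner_Integration.integral_cong refl) (simp add: dec)
    then have "l2n J (\<lambda>t. comb x (q t) - comb x (Pc d t)) = l2n J (\<lambda>t. comb x (Pc \<delta> t) - comb x (\<eta> t))"
      by (simp add: l2n_def)
    then show ?thesis using J.l2n_triangle_diff[OF cx] by simp
  qed
  show "l2n J (\<lambda>t. comb \<epsilon> (q t) - comb \<epsilon> (Pc d t))
      \<le> (Cinv * CJ + CJ * Cinv * (\<nu> * mat_norm (transpose RM ** matrix_inv (A + \<nu> *\<^sub>R B) ** RW))) * l2n J g"
    using l2d[of \<epsilon>] n\<eta>\<epsilon> bd[of RM] unfolding factor_norms by (simp add: distrib_right)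
  show "l2n J (\<lambda>t. comb e (q t) - comb e (Pc d t))
      \<le> (CJ + CJ * Cinv * (\<nu> * mat_norm (transpose RU ** matrix_inv (A + \<nu> *\<^sub>R B) ** RW))) * l2n J g"
    using l2d[of e] n\<eta>e bd[of RU] unfolding factor_norms by (simp add: distrib_right)
  \<comment> \<open>\<open>T\<close> is a node, so the interpolation error vanishes there; this is
    why the final-time estimate has no separate interpolation term.\<close>
  have "\<eta> T = 0" using \<eta>node[of m] tn_m by simp
  then have "comb e (q T) - comb e (Pc d T) = comb e (Pc \<delta> T)" using dec[of T e] T_pos by (simp add: comb_def)
  then show "norm (comb e (q T) - comb e (Pc d T))
      \<le> CJ * Cinv * (\<nu> * mat_norm (transpose RY ** matrix_inv (A + \<nu> *\<^sub>R B) ** RW)) * l2n J g"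
    using bd[of RY] unfolding factor_norms by simp
qed

text \<open>Adding the lower-order terms of the discrete function to both sides turns the system for
  \<open>A + \<nu> *\<^sub>R B\<close> into one for \<open>G\<close>. The new load is paired with
  time derivatives, whose norms \<open>RA\<close> measures.\<close>

lemma discrete_solution_bounds:
  fixes b\<phi> :: "'n \<Rightarrow> real \<Rightarrow> 'h"
  assumes b: "\<And>j. l2c J (b\<phi> j)" and g: "l2c J g" and G: "invertible G"
    and Gd: "G = A + \<nu> *\<^sub>R B + (\<chi> i j. LINT t|J. b\<phi> j t \<bullet> comb e (P' i t))"
    and d: "\<And>i. ((A + \<nu> *\<^sub>R B) *v d) $ i = (LINT t|J. g t \<bullet> comb e (P' i t))"
  shows "l2n J (\<lambda>t. comb \<epsilon> (Pc d t)) \<le> mat_norm (transpose RM ** matrix_inv G ** RA) * l2n J (\<lambda>t. g t + comb (\<lambda>j. b\<phi> j t) d)"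
    and "l2n J (\<lambda>t. comb e (Pc d t)) \<le> mat_norm (transpose RU ** matrix_inv G ** RA) * l2n J (\<lambda>t. g t + comb (\<lambda>j. b\<phi> j t) d)"
    and "norm (comb e (Pc d T)) \<le> mat_norm (transpose RY ** matrix_inv G ** RA) * l2n J (\<lambda>t. g t + comb (\<lambda>j. b\<phi> j t) d)"
proof -
  have bl: "l2c J (\<lambda>t. comb (\<lambda>j. b\<phi> j t) d)" by (rule l2c_comb[OF b])
  have h: "l2c J (\<lambda>t. g t + comb (\<lambda>j. b\<phi> j t) d)" by (rule J.l2c_add[OF g bl])
  have Gi: "(G *v d) $ i = 1 * (LINT t|J. (g t + comb (\<lambda>j. b\<phi> j t) d) \<bullet> comb e (P' i t))" for i
  proof -
    have "(G *v d) $ i = ((A + \<nu> *\<^sub>R B) *v d) $ i + ((\<chi> i j. LINT t|J. b\<phi> j t \<bullet> comb e (P' i t)) *v d) $ i"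
      by (simp add: Gd matrix_vector_mult_add_rdistrib)
    also have "\<dots> = (LINT t|J. g t \<bullet> comb e (P' i t)) + (LINT t|J. comb (\<lambda>j. b\<phi> j t) d \<bullet> comb e (P' i t))"
      by (simp only: d integral_matrix(1)[OF b l2c_combs(2) refl])
    also have "\<dots> = (LINT t|J. (g t + comb (\<lambda>j. b\<phi> j t) d) \<bullet> comb e (P' i t))"
      using J.integrable_inner[OF g l2c_combs(2)] J.integrable_inner[OF bl l2c_combs(2)] by (simp add: inner_add_left)
    finally show ?thesis by simp
  qed
  have RA': "RA ** transpose RA = (\<chi> i j. LINT t|J. comb e (P' j t) \<bullet> comb e (P' i t))" by (simp add: RA[symmetric] A)
  have bd: "norm (transpose L *v d) \<le> mat_norm (transpose L ** matrix_inv G ** RA) * l2n J (\<lambda>t. g t + comb (\<lambda>j. b\<phi> j t) d)" for L :: "real^'n^'n"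
    using solution_bound[OF l2c_combs(2) RA' h G Gi, of L] by simp
  show "l2n J (\<lambda>t. comb \<epsilon> (Pc d t)) \<le> mat_norm (transpose RM ** matrix_inv G ** RA) * l2n J (\<lambda>t. g t + comb (\<lambda>j. b\<phi> j t) d)"
    "l2n J (\<lambda>t. comb e (Pc d t)) \<le> mat_norm (transpose RU ** matrix_inv G ** RA) * l2n J (\<lambda>t. g t + comb (\<lambda>j. b\<phi> j t) d)"
    "norm (comb e (Pc d T)) \<le> mat_norm (transpose RY ** matrix_inv G ** RA) * l2n J (\<lambda>t. g t + comb (\<lambda>j. b\<phi> j t) d)"
    using bd[of RM] bd[of RU] bd[of RY] unfolding factor_norms by simp_all
qed

lemma Galerkin_solution: "\<exists>d. \<forall>i. ((A + \<nu> *\<^sub>R B) *v d) $ i = F i"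
proof -
  have "(A + \<nu> *\<^sub>R B) *v (matrix_inv (A + \<nu> *\<^sub>R B) *v (\<chi> i. F i)) = (\<chi> i. F i)"
    by (simp add: matrix_vector_mul_assoc matrix_inv_right[OF invertible_AB])
  then show ?thesis by (intro exI[of _ "matrix_inv (A + \<nu> *\<^sub>R B) *v (\<chi> i. F i)"]) simp
qed

end

section \<open>An orthonormal basis of the spatial discrete space\<close>

lemma comb_axis: "comb e (axis l c) = c *\<^sub>R (e l :: 'v::real_vector)"
proof -
  have "comb e (axis l c) = (\<Sum>k\<in>UNIV. if k = l then c *\<^sub>R e l else 0)"
    unfolding comb_def by (intro sum.cong) (auto simp: axis_def)
  then show ?thesis by simp
qed

lemma subspace_range_comb: "subspace (range (comb (e :: 'n::finite \<Rightarrow> 'v::real_normed_vector)))"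
  by (intro linear_subspace_image linear_comb subspace_UNIV)

lemma comb_in_span: "comb e a \<in> span (range (e :: 'n::finite \<Rightarrow> 'v::real_vector))"
  unfolding comb_def by (intro span_sum span_scale span_base) auto

text \<open>Gram--Schmidt leaves at most \<open>CARD('n)\<close> nonzero vectors. An injection
  places them on the indices in \<open>I\<close>; the other indices carry the zero vector.\<close>

lemma orthonormal_family:
  fixes B :: "'h::real_inner set"
  assumes "finite B" "card B \<le> CARD('n::finite)"
  obtains e :: "'n::finite \<Rightarrow> 'h" and I where "\<And>l k. e l \<bullet> e k = (if l = k \<and> l \<in> I then 1 else 0)"
    "range (comb e) = span B"
proof -
  obtain C0 where C0: "finite C0" "card C0 \<le> card B" "span C0 = span B" "pairwise orthogonal C0"
    using basis_orthogonal[OF assms(1)] by blast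
  define C where "C = C0 - {0}"
  have "card C \<le> card C0" unfolding C_def using C0(1) by (intro card_mono) auto
  then have C: "finite C" "card C \<le> CARD('n)" "span C = span B" "pairwise orthogonal C" "0 \<notin> C"
    using C0 assms(2) unfolding C_def by (auto simp: span_delete_0 pairwise_def)
  obtain h :: "'h \<Rightarrow> 'n" where h: "inj_on h C" using card_le_inj[OF C(1) finite[of "UNIV :: 'n set"] C(2)] by blast
  define I where "I = h ` C"
  define c where "c = inv_into C h"
  have ch: "c (h v) = v" if "v \<in> C" for v unfolding c_def by (rule inv_into_f_f[OF h that])
  have cI: "c l \<in> C" if "l \<in> I" for l using that unfolding c_def I_def by (rule inv_into_into)
  have cinj: "c l \<noteq> c k" if "l \<in> I" "k \<in> I" "l \<noteq> k" for l k
    using that inv_into_injective unfolding c_def I_def by metis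
  define e where "e l = (if l \<in> I then c l /\<^sub>R norm (c l) else 0)" for l
  have c0: "c l \<noteq> 0" if "l \<in> I" for l using cI[OF that] C(5) by auto
  have orth: "e l \<bullet> e k = (if l = k \<and> l \<in> I then 1 else 0)" for l k
  proof (cases "l \<in> I \<and> k \<in> I")
    case True
    show ?thesis
    proof (cases "l = k")
      case True
      then show ?thesis using c0[of l] by (simp add: e_def power2_norm_eq_inner[symmetric] power2_eq_square)
    next
      case False
      then have "c l \<bullet> c k = 0" using C(4) cI cinj[of l k] \<open>l \<in> I \<and> k \<in> I\<close> unfolding pairwise_def orthogonal_def by blast
      then show ?thesis using False by (simp add: e_def)
    qed
  qed (auto simp: e_def)
  have "range (comb e) = span C"
  proof
    have "e l \<in> span C" for l
      using span_scale[OF span_base[OF cI[of l]]] by (cases "l \<in> I") (simp_all add: e_def span_zero)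
    then have "range e \<subseteq> span C" by blast
    then have "span (range e) \<subseteq> span C" by (intro span_minimal) auto
    then show "range (comb e) \<subseteq> span C" using comb_in_span by blast
    have "v \<in> range (comb e)" if "v \<in> C" for v
    proof -
      have "h v \<in> I" using that by (simp add: I_def)
      moreover have "norm v \<noteq> 0" using that C(5) by auto
      ultimately have "v = comb e (axis (h v) (norm v))" using that by (simp add: comb_axis e_def ch)
      then show ?thesis by blast
    qed
    then show "span C \<subseteq> range (comb e)" by (intro span_minimal subspace_range_comb) auto
  qed
  then show thesis using that[OF orth] C(3) by blast
qed

text \<open>The family may be linearly dependent, so the projection is computed in an orthonormal
  family with the same span and then rewritten, with coefficients that need not be unique.\<close>

lemma finite_dim_projection:
  fixes \<epsilon> :: "'n::finite \<Rightarrow> 'g::real_inner"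
  shows "\<exists>a. \<forall>l. (x - comb \<epsilon> a) \<bullet> \<epsilon> l = 0"
proof -
  have fin: "finite (range \<epsilon>)" and card: "card (range \<epsilon>) \<le> CARD('n)" by (simp_all add: card_image_le)
  obtain e :: "'n \<Rightarrow> 'g" and I where e: "\<And>l k. e l \<bullet> e k = (if l = k \<and> l \<in> I then 1 else 0)"
    and r: "range (comb e) = span (range \<epsilon>)" by (rule orthonormal_family[OF fin card]) (rule that)
  have sub: "range (comb e) \<subseteq> range (comb \<epsilon>)"
    unfolding r by (rule span_minimal[OF _ subspace_range_comb]) (metis comb_axis image_subset_iff rangeI scaleR_one)
  then obtain a where a: "comb e (\<chi> l. x \<bullet> e l) = comb \<epsilon> a" by blast
  have "(x - comb e (\<chi> l. x \<bullet> e l)) \<bullet> e k = 0" for k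
  proof (cases "k \<in> I")
    case True
    then show ?thesis by (simp add: inner_diff_left comb_orthonormal[OF e])
  next
    case False
    then have "e k = 0" using e[of k k] by simp
    then show ?thesis by simp
  qed
  then have "(x - comb \<epsilon> a) \<bullet> comb e b = 0" for b unfolding a inner_comb by simp
  moreover have "\<epsilon> l \<in> range (comb e)" for l unfolding r by (auto intro: span_base)
  ultimately have "(x - comb \<epsilon> a) \<bullet> \<epsilon> l = 0" for l by (metis imageE)
  then show ?thesis by blast
qed

section \<open>Functions behind abstract pairs, and the basis of the discrete space\<close>

context open_domain
begin

text \<open>The defect lies in the closure of the first components and is orthogonal to all of
  them.\<close>

lemma cls_rep_closure:
  assumes "y \<in> closure (fst ` HD)" shows "cls \<Omega> (rep_ltwo y) = y"
proof -
  define d where "d = cls \<Omega> (rep_ltwo y) - y"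
  have sub: "subspace (fst ` HD)" using HD.subspace_H by (intro linear_subspace_image linear_fst)
  have "d \<in> closure (fst ` HD)"
    unfolding d_def by (intro subspace_diff[OF subspace_closure[OF sub]] cls_in_closure rep_L2 assms)
  moreover have "closure (fst ` HD) \<subseteq> {v. d \<bullet> v = 0}"
  proof (rule closure_minimal)
    show "fst ` HD \<subseteq> {v. d \<bullet> v = 0}"
    proof
      fix v assume "v \<in> fst ` HD"
      then obtain u where u: "u \<in> H10 \<Omega>" "v = cls \<Omega> u" by (auto elim!: HD_H10)
      then show "v \<in> {v. d \<bullet> v = 0}" using inner_cls_rep[OF H10_L2[OF u(1)], of y] by (simp add: d_def inner_diff_left)
    qed
  qed (intro closed_Collect_eq continuous_intros)
  ultimately have "d \<bullet> d = 0" by blast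
  then show ?thesis by (simp add: d_def)
qed

text \<open>The approximation constant is assumed for functions, while the duality argument produces
  abstract pairs; this is the way back from pairs to functions.\<close>

lemma weak_lap_function:
  assumes "HD.weak_lap p y"
  obtains u where "u \<in> H10 \<Omega>" "u \<in> Xspace \<Omega>" "p = (cls \<Omega> u, Gr u)" "cls \<Omega> (laplacian \<Omega> u) = y"
proof -
  have p: "p \<in> HD" "y \<in> closure (fst ` HD)" using assms by (auto simp: HD.weak_lap_def)
  obtain u where u: "u \<in> H10 \<Omega>" "p = (cls \<Omega> u, Gr u)" by (rule HD_H10[OF p(1)])
  note y = cls_rep_closure[OF p(2)]
  have l: "has_weak_laplacian \<Omega> u (rep_ltwo y)"
    using assms unfolding weak_laplacian_iff[OF u(1) rep_L2] y u(2) .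
  then have X: "u \<in> Xspace \<Omega>" unfolding Xspace_def using H10_L2[OF u(1)] rep_L2 by blast
  note L = X_laplacian[OF X]
  have "cls \<Omega> (laplacian \<Omega> u) = cls \<Omega> (rep_ltwo y)"
    by (rule laplacian_unique[OF L(1) rep_L2]) (simp add: weak_laplacian_pairing[OF L] weak_laplacian_pairing[OF rep_L2 l])
  then show thesis using that u X y by simp
qed

text \<open>Surplus indices carry the zero function, so that the index type of the space-time basis
  also serves in space. With an orthonormal basis, membership in \<open>S\<close> becomes a
  condition on classes.\<close>

lemma discrete_basis:
  assumes S: "findim_subspace_H10 \<Omega> n S" and n: "n \<le> CARD('n::finite)"
  obtains s :: "'n::finite \<Rightarrow> 'a \<Rightarrow> real" and I where "\<And>l. s l \<in> S"
    "\<And>l k. cls \<Omega> (s l) \<bullet> cls \<Omega> (s k) = (if l = k \<and> l \<in> I then 1 else 0)" "\<And>l. l \<notin> I \<Longrightarrow> Gr (s l) = 0"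
    "S = {v \<in> H10 \<Omega>. \<exists>a. cls \<Omega> v = comb (\<lambda>l. cls \<Omega> (s l)) a}"
proof -
  obtain b :: "nat \<Rightarrow> 'a \<Rightarrow> real" where b: "\<And>i. i < n \<Longrightarrow> b i \<in> H10 \<Omega>"
    and Seq: "S = {v \<in> H10 \<Omega>. \<exists>a. AE x in lebesgue_on \<Omega>. v x = (\<Sum>i<n. a i * b i x)}"
    using S unfolding findim_subspace_H10_def by blast
  have sumH: "(\<lambda>x. \<Sum>i<n. a i * b i x) \<in> H10 \<Omega>" for a by (rule H10_sum(1)) (simp add: b)
  have clsum: "cls \<Omega> (\<lambda>x. \<Sum>i<n. a i * b i x) = (\<Sum>i<n. a i *\<^sub>R cls \<Omega> (b i))" for a
  proof -
    have "cls \<Omega> (\<lambda>x. \<Sum>i<n. a i * b i x) = (\<Sum>i<n. cls \<Omega> (\<lambda>x. a i * b i x))"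
      by (rule cls_sum) (use L2_scaleR[OF H10_L2[OF b]] in simp)
    also have "\<dots> = (\<Sum>i<n. a i *\<^sub>R cls \<Omega> (b i))" by (intro sum.cong refl cls_mult H10_L2 b) simp
    finally show ?thesis .
  qed
  define V where "V = range (\<lambda>a::nat \<Rightarrow> real. \<Sum>i<n. a i *\<^sub>R cls \<Omega> (b i))"
  have SV: "v \<in> S \<longleftrightarrow> v \<in> H10 \<Omega> \<and> cls \<Omega> v \<in> V" for v
  proof (cases "v \<in> H10 \<Omega>")
    case True
    have "(AE x in lebesgue_on \<Omega>. v x = (\<Sum>i<n. a i * b i x)) \<longleftrightarrow> cls \<Omega> v = (\<Sum>i<n. a i *\<^sub>R cls \<Omega> (b i))" for a
      unfolding clsum[symmetric] by (rule cls_eq_iff[symmetric, OF H10_L2[OF True] H10_L2[OF sumH]])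
    then show ?thesis using True by (auto simp: Seq V_def)
  qed (simp add: Seq)
  have V: "V = span (cls \<Omega> ` b ` {..<n})"
  proof
    show "V \<subseteq> span (cls \<Omega> ` b ` {..<n})" unfolding V_def
      by (auto intro!: span_sum span_scale) (auto intro!: span_base)
    have "subspace V" unfolding subspace_def
    proof (intro conjI allI ballI)
      show "0 \<in> V" unfolding V_def by (rule range_eqI[of _ _ "\<lambda>i. 0"]) simp
      fix x assume "x \<in> V"
      then obtain a where a: "x = (\<Sum>i<n. a i *\<^sub>R cls \<Omega> (b i))" by (auto simp: V_def)
      show "c *\<^sub>R x \<in> V" for c unfolding V_def a
        by (rule range_eqI[of _ _ "\<lambda>i. c * a i"]) (simp add: scaleR_sum_right)
      fix y assume "y \<in> V"
      then obtain a' where a': "y = (\<Sum>i<n. a' i *\<^sub>R cls \<Omega> (b i))" by (auto simp: V_def)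
      show "x + y \<in> V" unfolding V_def a a'
        by (rule range_eqI[of _ _ "\<lambda>i. a i + a' i"]) (simp add: scaleR_add_left sum.distrib)
    qed
    moreover have "cls \<Omega> (b i) \<in> V" if "i < n" for i
    proof -
      have "(\<Sum>k<n. (if k = i then 1 else 0) *\<^sub>R cls \<Omega> (b k)) = (\<Sum>k<n. if k = i then cls \<Omega> (b i) else 0)"
        by (intro sum.cong) auto
      then have "cls \<Omega> (b i) = (\<Sum>k<n. (if k = i then 1 else 0) *\<^sub>R cls \<Omega> (b k))" using that by simp
      then show ?thesis unfolding V_def by (rule range_eqI[where x="\<lambda>k. if k = i then 1 else 0"])
    qed
    ultimately show "span (cls \<Omega> ` b ` {..<n}) \<subseteq> V" by (intro span_minimal) auto
  qed
  have "card (cls \<Omega> ` b ` {..<n}) \<le> card {..<n}"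
    unfolding image_image by (rule card_image_le) simp
  then have "card (cls \<Omega> ` b ` {..<n}) \<le> CARD('n)" using n by simp
  then obtain e :: "'n \<Rightarrow> ('a, real) ltwo" and I where e: "\<And>l k. e l \<bullet> e k = (if l = k \<and> l \<in> I then 1 else 0)"
    and re: "range (comb e) = V"
    using orthonormal_family[where ?'n='n and B="cls \<Omega> ` b ` {..<n}"] finite_imageI[OF finite_imageI[OF finite_lessThan]]
    unfolding V by blast
  have ex: "\<exists>u. u \<in> H10 \<Omega> \<and> cls \<Omega> u = e l \<and> (l \<notin> I \<longrightarrow> u = (\<lambda>x. 0))" for l
  proof (cases "l \<in> I")
    case True
    have "comb e (axis l 1) \<in> V" using re by blast
    then have "e l \<in> V" by (simp add: comb_axis)
    then obtain a where "e l = (\<Sum>i<n. a i *\<^sub>R cls \<Omega> (b i))" by (auto simp: V_def)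
    then show ?thesis using sumH[of a] clsum[of a] True by metis
  next
    case False
    then have "e l = 0" using e[of l l] by simp
    then show ?thesis using H10_zero cls_zero by auto
  qed
  define s where "s l = (SOME u. u \<in> H10 \<Omega> \<and> cls \<Omega> u = e l \<and> (l \<notin> I \<longrightarrow> u = (\<lambda>x. 0)))" for l
  have s: "s l \<in> H10 \<Omega>" "cls \<Omega> (s l) = e l" "l \<notin> I \<Longrightarrow> s l = (\<lambda>x. 0)" for l
    using someI_ex[OF ex[of l]] unfolding s_def by blast+
  have el: "e l \<in> V" for l
  proof -
    have "comb e (axis l 1) \<in> V" using re by blast
    then show ?thesis by (simp add: comb_axis)
  qed
  show thesis
  proof (rule that[of s I])
    show "s l \<in> S" for l using s el by (simp add: SV)
    show "cls \<Omega> (s l) \<bullet> cls \<Omega> (s k) = (if l = k \<and> l \<in> I then 1 else 0)" for l k by (simp only: s(2) e)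
    show "Gr (s l) = 0" if "l \<notin> I" for l using s(3)[OF that] Gr_zero by simp
    have "S = {v \<in> H10 \<Omega>. cls \<Omega> v \<in> range (comb e)}" using SV re by blast
    then show "S = {v \<in> H10 \<Omega>. \<exists>a. cls \<Omega> v = comb (\<lambda>l. cls \<Omega> (s l)) a}" unfolding s(2) by auto
  qed
qed

end

locale discrete_space = open_domain \<Omega> for \<Omega> :: "'a::euclidean_space set" +
  fixes S :: "('a \<Rightarrow> real) set" and s :: "'n::finite \<Rightarrow> 'a \<Rightarrow> real" and I :: "'n set"
  assumes s: "\<And>l. s l \<in> S"
    and orth: "\<And>l k. cls \<Omega> (s l) \<bullet> cls \<Omega> (s k) = (if l = k \<and> l \<in> I then 1 else 0)"
    and Gr_s0: "\<And>l. l \<notin> I \<Longrightarrow> Gr (s l) = 0"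
    and S_eq: "S = {v \<in> H10 \<Omega>. \<exists>a. cls \<Omega> v = comb (\<lambda>l. cls \<Omega> (s l)) a}"
begin

abbreviation e :: "'n \<Rightarrow> ('a, real) ltwo" where "e l \<equiv> cls \<Omega> (s l)"
abbreviation \<epsilon> :: "'n \<Rightarrow> ('a, 'a) ltwo" where "\<epsilon> l \<equiv> Gr (s l)"

lemma s_H10: "s l \<in> H10 \<Omega>" using s[of l] by (simp add: S_eq)

definition fn :: "real^'n \<Rightarrow> 'a \<Rightarrow> real" where "fn a x = (\<Sum>l\<in>UNIV. a $ l * s l x)"

lemma fn_H10: "fn a \<in> H10 \<Omega>" and Gr_fn: "Gr (fn a) = comb \<epsilon> a"
  using H10_sum[of UNIV s "\<lambda>l. a $ l"] s_H10 unfolding fn_def[abs_def] comb_def by auto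

lemma cls_fn: "cls \<Omega> (fn a) = comb e a"
proof -
  have "cls \<Omega> (\<lambda>x. \<Sum>l\<in>UNIV. a $ l * s l x) = (\<Sum>l\<in>UNIV. cls \<Omega> (\<lambda>x. a $ l * s l x))"
    by (rule cls_sum) (use L2_scaleR[OF H10_L2[OF s_H10]] in simp)
  also have "\<dots> = comb e a" unfolding comb_def by (intro sum.cong refl cls_mult H10_L2 s_H10)
  finally show ?thesis unfolding fn_def[abs_def] .
qed

lemma fn_S: "fn a \<in> S"
  unfolding S_eq using fn_H10 cls_fn by blast

lemma Gr_cls: "u \<in> L2 \<Omega> \<Longrightarrow> cls \<Omega> u = comb e a \<Longrightarrow> u \<in> H10 \<Omega> \<and> Gr u = comb \<epsilon> a"
  using H10_cong_AE[OF fn_H10, of u a] by (simp add: cls_fn Gr_fn)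

lemmas e_inner = comb_orthonormal[OF orth]

definition coord :: "('a \<Rightarrow> real) \<Rightarrow> real^'n" where "coord v = (\<chi> l. cls \<Omega> v \<bullet> e l)"

lemma coord_0: "l \<notin> I \<Longrightarrow> coord v $ l = 0"
  using orth[of l l] by (simp add: coord_def)

lemma e0: "l \<notin> I \<Longrightarrow> e l = 0" using orth[of l l] by simp

lemma S_coord:
  assumes "v \<in> S" shows "cls \<Omega> v = comb e (coord v)"
proof -
  obtain a where a: "cls \<Omega> v = comb e a" using assms by (auto simp: S_eq)
  have "comb e (coord v) = comb e a" unfolding comb_def
    by (intro sum.cong refl) (use e0 in \<open>auto simp: coord_def a e_inner\<close>)
  then show ?thesis using a by simp
qed

lemma coord_fn: "(\<And>l. l \<notin> I \<Longrightarrow> a $ l = 0) \<Longrightarrow> coord (fn a) = a"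
  by (auto simp: vec_eq_iff coord_def cls_fn e_inner)

lemma inverse_ineq:
  assumes "\<And>u. u \<in> S \<Longrightarrow> H10_norm \<Omega> u \<le> C * L2_norm \<Omega> u"
  shows "norm (comb \<epsilon> a) \<le> C * norm (comb e a)"
  using assms[OF fn_S[of a]] H10_norm_eq[OF H10_H1[OF fn_H10[of a]]] norm_cls[OF H10_L2[OF fn_H10[of a]]]
  by (simp add: Gr_fn cls_fn)

text \<open>\<open>H10_proj\<close> is a choice, so its defining property becomes available only
  after the existence of a projection, here from finite dimension. The assumed estimate then turns
  into the hypothesis \<open>approx\<close> of the Galerkin locale.\<close>

lemma projection_approx:
  assumes C: "\<And>u. u \<in> H10 \<Omega> \<inter> Xspace \<Omega> \<Longrightarrow> H10_norm \<Omega> (\<lambda>x. u x - H10_proj \<Omega> S u x) \<le> C * L2_norm \<Omega> (laplacian \<Omega> u)"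
    and p: "HD.weak_lap p y"
  shows "\<exists>a. (\<forall>l. (snd p - comb \<epsilon> a) \<bullet> \<epsilon> l = 0) \<and> norm (snd p - comb \<epsilon> a) \<le> C * norm y"
proof -
  obtain u where u: "u \<in> H10 \<Omega>" "u \<in> Xspace \<Omega>" "p = (cls \<Omega> u, Gr u)" "cls \<Omega> (laplacian \<Omega> u) = y"
    by (rule weak_lap_function[OF p])
  obtain a0 where a0: "\<And>l. (Gr u - comb \<epsilon> a0) \<bullet> \<epsilon> l = 0" using finite_dim_projection by blast
  have SD: "v \<in> S \<Longrightarrow> v \<in> H10 \<Omega> \<and> Gr v = comb \<epsilon> (coord v)" for v
    using Gr_cls[OF _ S_coord, of v] by (auto simp: S_eq H10_L2)
  have ip: "H10_inner \<Omega> (\<lambda>x. u x - q x) v = (Gr u - Gr q) \<bullet> Gr v" if "q \<in> S" "v \<in> S" for q v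
    using H10_diff[OF u(1), of q] SD[OF that(1)] SD[OF that(2)] H10_inner_eq[OF H10_H1 H10_H1] by simp
  have "\<exists>q. q \<in> S \<and> (\<forall>v\<in>S. H10_inner \<Omega> (\<lambda>x. u x - q x) v = 0)"
  proof (intro exI[of _ "fn a0"] conjI ballI fn_S)
    fix v assume v: "v \<in> S"
    show "H10_inner \<Omega> (\<lambda>x. u x - fn a0 x) v = 0"
      unfolding ip[OF fn_S v] Gr_fn conjunct2[OF SD[OF v]] inner_comb by (simp add: a0)
  qed
  from someI_ex[OF this] have q: "H10_proj \<Omega> S u \<in> S" "\<And>v. v \<in> S \<Longrightarrow> H10_inner \<Omega> (\<lambda>x. u x - H10_proj \<Omega> S u x) v = 0"
    unfolding H10_proj_def by blast+
  define q where "q = H10_proj \<Omega> S u"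
  note q = q[folded q_def]
  note qD = SD[OF q(1)]
  have "(snd p - comb \<epsilon> (coord q)) \<bullet> \<epsilon> l = 0" for l using q(2)[OF s[of l]] ip[OF q(1) s[of l]] qD u(3) by simp
  moreover have "norm (snd p - comb \<epsilon> (coord q)) \<le> C * norm y"
    using C[of u] u H10_norm_eq[OF H10_H1[OF H10_diff(1)[OF u(1) conjunct1[OF qD]]]] H10_diff(2)[OF u(1) conjunct1[OF qD]]
      norm_cls[OF X_laplacian(1)[OF u(2)]] qD by (simp add: q_def[symmetric])
  ultimately show ?thesis by blast
qed

end

section \<open>Bounded coefficients\<close>

lemma AE_le_real_esssup:
  assumes "esssup M (\<lambda>x. ereal (f x)) < \<infinity>" and f: "\<And>x. f x \<ge> 0"
  shows "AE x in M. f x \<le> real_of_ereal (esssup M (\<lambda>x. ereal (f x)))"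
  using esssup_AE[of "\<lambda>x. ereal (f x)" M]
proof eventually_elim
  case (elim x)
  have "esssup M (\<lambda>x. ereal (f x)) \<noteq> -\<infinity>" using elim by auto
  then show ?case using assms(1) elim by (cases "esssup M (\<lambda>x. ereal (f x))") auto
qed

lemma real_esssup_nonneg:
  assumes "esssup M (\<lambda>x. ereal (f x)) < \<infinity>" and f: "\<And>x. f x \<ge> 0"
  shows "0 \<le> real_of_ereal (esssup M (\<lambda>x. ereal (f x)))"
proof (cases "emeasure M (space M) = 0")
  \<comment> \<open>On a null space the essential supremum is -\<infinity>, which
    \<open>real_of_ereal\<close> maps to 0.\<close>
  case True
  \<comment> \<open>The essential supremum of a nonmeasurable function is infinite by convention, so
    finiteness includes measurability.\<close>
  have "(\<lambda>x. ereal (f x)) \<in> borel_measurable M"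
    using assms(1) esssup_non_measurable[of "\<lambda>x. ereal (f x)" M] by (auto simp: top_ereal_def)
  then show ?thesis using esssup_zero_space[OF True] by simp
next
  case False
  have "\<exists>x. f x \<le> real_of_ereal (esssup M (\<lambda>x. ereal (f x)))"
  proof (rule ccontr)
    assume "\<not> ?thesis"
    then have "AE x in M. False" using AE_le_real_esssup[OF assms] by auto
    then show False using False by (simp add: ae_filter_eq_bot_iff[symmetric] trivial_limit_def)
  qed
  then show ?thesis using f order_trans by blast
qed

context domain
begin

lemma Linf_measurable: "a \<in> Linf \<Omega> \<Longrightarrow> a \<in> borel_measurable (lebesgue_on \<Omega>)"
  by (simp add: Linf_def)

lemma Linf_AE: "a \<in> Linf \<Omega> \<Longrightarrow> AE x in lebesgue_on \<Omega>. \<bar>a x\<bar> \<le> Linf_norm \<Omega> a"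
  unfolding Linf_norm_def Linf_def by (intro AE_le_real_esssup) auto

lemma Linf_norm_nonneg: "a \<in> Linf \<Omega> \<Longrightarrow> 0 \<le> Linf_norm \<Omega> a"
  unfolding Linf_norm_def Linf_def by (intro real_esssup_nonneg) auto

lemma Linf_diff:
  assumes "a \<in> Linf \<Omega>" "b \<in> Linf \<Omega>" shows "(\<lambda>x. a x - b x) \<in> Linf \<Omega>"
proof -
  have "(\<lambda>x. a x - b x) \<in> borel_measurable (lebesgue_on \<Omega>)" using assms[THEN Linf_measurable] by simp
  moreover have "esssup (lebesgue_on \<Omega>) (\<lambda>x. ereal \<bar>a x - b x\<bar>) < \<infinity>"
  proof (rule le_less_trans[OF esssup_I])
    show "AE x in lebesgue_on \<Omega>. ereal \<bar>a x - b x\<bar> \<le> ereal (Linf_norm \<Omega> a + Linf_norm \<Omega> b)"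
      using assms[THEN Linf_AE] by eventually_elim auto
  qed (use assms[THEN Linf_measurable] in simp_all)
  ultimately show ?thesis unfolding Linf_def by simp
qed

text \<open>The product \<open>h x \<bullet> i\<close> with \<open>norm i \<le> 1\<close> covers the
  components of a gradient and, with \<open>i = 1\<close>, scalar functions.\<close>

lemma multiplier:
  fixes h :: "'a \<Rightarrow> 'b::euclidean_space"
  assumes a: "a \<in> borel_measurable (lebesgue_on \<Omega>)" and h: "h \<in> L2 \<Omega>"
    and b: "AE x in lebesgue_on \<Omega>. \<bar>a x\<bar> \<le> C" and C: "C \<ge> 0" and i: "norm i \<le> 1"
  shows "(\<lambda>x. a x * (h x \<bullet> i)) \<in> L2 \<Omega>" "norm (cls \<Omega> (\<lambda>x. a x * (h x \<bullet> i))) \<le> C * norm (cls \<Omega> h)"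
proof -
  have h': "l2c (lebesgue_on \<Omega>) h" "h \<in> borel_measurable (lebesgue_on \<Omega>)" using h by (auto simp: L2_iff[symmetric] L2_def)
  have m: "smeas (lebesgue_on \<Omega>) (\<lambda>x. a x * (h x \<bullet> i))"
    using a h'(2) by (intro borel_smeas) simp
  have le: "AE x in lebesgue_on \<Omega>. norm (a x * (h x \<bullet> i)) \<le> C * norm (h x)"
    using b
  proof eventually_elim
    case (elim x)
    have "\<bar>h x \<bullet> i\<bar> \<le> norm (h x) * norm i" by (rule Cauchy_Schwarz_ineq2)
    also have "\<dots> \<le> norm (h x)" using i by (simp add: mult_left_le)
    finally show ?case using elim C by (simp add: abs_mult mult_mono)
  qed
  have l: "l2c (lebesgue_on \<Omega>) (\<lambda>x. a x * (h x \<bullet> i))" by (rule D.l2c_bound[OF m h'(1) le])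
  then show L: "(\<lambda>x. a x * (h x \<bullet> i)) \<in> L2 \<Omega>" by (simp add: L2_iff)
  show "norm (cls \<Omega> (\<lambda>x. a x * (h x \<bullet> i))) \<le> C * norm (cls \<Omega> h)"
    unfolding norm_cls[OF L] norm_cls[OF h] L2_norm_eq by (rule D.l2n_mono[OF l h'(1) C le])
qed

end

context spacetime
begin

lemma bochner_Linf_bounds:
  assumes k: "k \<in> bochner_Linf {0<..<T} (Linf \<Omega>) (Linf_norm \<Omega>)"
  defines "N \<equiv> bochner_Linf_norm {0<..<T} (Linf_norm \<Omega>) k"
  shows "AE t in J. k t \<in> Linf \<Omega>" "AE t in J. AE x in lebesgue_on \<Omega>. \<bar>k t x\<bar> \<le> N" "0 \<le> N"
proof -
  show L: "AE t in J. k t \<in> Linf \<Omega>" using k by (simp add: bochner_Linf_def strongly_measurable_def)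
  have fin: "esssup J (\<lambda>t. ereal (Linf_norm \<Omega> (k t))) < \<infinity>" using k by (simp add: bochner_Linf_def)
  \<comment> \<open>\<open>Linf_norm\<close> is known to be nonnegative on \<open>Linf\<close> only,
    hence for almost every time; truncation at 0 makes it so at every time, as the facts about
    essential suprema require.\<close>
  define r where "r t = max 0 (Linf_norm \<Omega> (k t))" for t
  have m: "(\<lambda>t. ereal (Linf_norm \<Omega> (k t))) \<in> borel_measurable J"
    using fin esssup_non_measurable[of "\<lambda>t. ereal (Linf_norm \<Omega> (k t))" J] by (auto simp: top_ereal_def)
  have rm: "(\<lambda>t. ereal (r t)) \<in> borel_measurable J"
  proof -
    have "(\<lambda>t. max 0 (ereal (Linf_norm \<Omega> (k t)))) \<in> borel_measurable J" using m by simp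
    moreover have "max 0 (ereal (Linf_norm \<Omega> (k t))) = ereal (r t)" for t
      by (auto simp: r_def max_def zero_ereal_def)
    ultimately show ?thesis by simp
  qed
  have re: "AE t in J. r t = Linf_norm \<Omega> (k t)"
    using L by eventually_elim (simp add: r_def O.Linf_norm_nonneg)
  have e: "esssup J (\<lambda>t. ereal (Linf_norm \<Omega> (k t))) = esssup J (\<lambda>t. ereal (r t))"
    by (rule esssup_AE_cong[OF m rm]) (use re in eventually_elim, simp)
  have N: "N = real_of_ereal (esssup J (\<lambda>t. ereal (r t)))" unfolding N_def bochner_Linf_norm_def e ..
  have r0: "r t \<ge> 0" for t by (simp add: r_def)
  show "0 \<le> N" unfolding N by (rule real_esssup_nonneg[OF fin[unfolded e] r0])
  have "AE t in J. r t \<le> N" unfolding N by (rule AE_le_real_esssup[OF fin[unfolded e] r0])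
  then show "AE t in J. AE x in lebesgue_on \<Omega>. \<bar>k t x\<bar> \<le> N"
    using L re
  proof eventually_elim
    case (elim t)
    show ?case using O.Linf_AE[OF elim(2)] by eventually_elim (use elim in simp)
  qed
qed

text \<open>Products of simple approximations are simple, and they converge because the coefficient
  converges in the essential supremum norm while the other factor converges in L2.\<close>

lemma bochner_multiplier:
  fixes u :: "real \<Rightarrow> 'a \<Rightarrow> 'b::euclidean_space"
  assumes k: "k \<in> bochner_Linf {0<..<T} (Linf \<Omega>) (Linf_norm \<Omega>)"
    and u: "l2c J (\<lambda>t. cls \<Omega> (u t))" "AE t in J. u t \<in> L2 \<Omega>" and i: "norm (i :: 'b) \<le> 1"
  shows "AE t in J. (\<lambda>x. k t x * (u t x \<bullet> i)) \<in> L2 \<Omega>" "l2c J (\<lambda>t. cls \<Omega> (\<lambda>x. k t x * (u t x \<bullet> i)))"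
proof -
  define N where "N = bochner_Linf_norm {0<..<T} (Linf_norm \<Omega>) k"
  note b = bochner_Linf_bounds[OF k, folded N_def]
  have bd: "AE t in J. (\<lambda>x. k t x * (u t x \<bullet> i)) \<in> L2 \<Omega> \<and>
      norm (cls \<Omega> (\<lambda>x. k t x * (u t x \<bullet> i))) \<le> N * norm (cls \<Omega> (u t))"
    using b(1,2) u(2) by eventually_elim (use O.multiplier[OF O.Linf_measurable _ _ b(3) i] in blast)
  then show "AE t in J. (\<lambda>x. k t x * (u t x \<bullet> i)) \<in> L2 \<Omega>" by eventually_elim simp
  obtain s where s: "\<And>n. simple_function J (s n)" "\<And>n t. t \<in> {0<..<T} \<Longrightarrow> s n t \<in> Linf \<Omega>"
    "AE t in J. (\<lambda>n. Linf_norm \<Omega> (\<lambda>x. s n t x - k t x)) \<longlonglongrightarrow> 0"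
    using k unfolding bochner_Linf_def strongly_measurable_def by blast
  obtain \<sigma> where \<sigma>: "\<And>n. simple_function J (\<sigma> n)" "AE t in J. (\<lambda>n. \<sigma> n t) \<longlonglongrightarrow> cls \<Omega> (u t)"
    using l2c_smeas[OF u(1)] unfolding smeas_def by auto
  \<comment> \<open>The approximations of \<open>u\<close> are classes, so a representative has to
    be multiplied. Depending on the two values alone, the product of simple functions is again
    simple.\<close>
  define mul where "mul a h = cls \<Omega> (\<lambda>x. a x * (rep_ltwo h x \<bullet> i))" for a :: "'a \<Rightarrow> real" and h :: "('a, 'b) ltwo"
  have simple: "simple_function J (\<lambda>t. mul (s n t) (\<sigma> n t))" for n
    by (rule simple_function_compose2[OF s(1) \<sigma>(1)])
  have lim: "AE t in J. (\<lambda>n. mul (s n t) (\<sigma> n t)) \<longlonglongrightarrow> cls \<Omega> (\<lambda>x. k t x * (u t x \<bullet> i))"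
    using s(3) \<sigma>(2) b(1) u(2) AE_J_interval
  proof eventually_elim
    case (elim t)
    define K where "K = Linf_norm \<Omega> (k t)"
    have K: "K \<ge> 0" unfolding K_def by (rule O.Linf_norm_nonneg[OF elim(3)])
    define \<delta> where "\<delta> n = Linf_norm \<Omega> (\<lambda>x. s n t x - k t x)" for n
    have le: "norm (mul (s n t) (\<sigma> n t) - cls \<Omega> (\<lambda>x. k t x * (u t x \<bullet> i))) \<le> \<delta> n * norm (\<sigma> n t) + K * norm (\<sigma> n t - cls \<Omega> (u t))" for n
    proof -
      let ?r = "rep_ltwo (\<sigma> n t)"
      have sk: "(\<lambda>x. s n t x - k t x) \<in> Linf \<Omega>" by (rule O.Linf_diff[OF s(2)[OF elim(5)] elim(3)])
      note m1 = O.multiplier[OF O.Linf_measurable[OF sk] O.rep_L2[of "\<sigma> n t"] O.Linf_AE[OF sk] O.Linf_norm_nonneg[OF sk] i]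
      note m2 = O.multiplier[OF O.Linf_measurable[OF elim(3)] O.L2_diff[OF O.rep_L2[of "\<sigma> n t"] elim(4)] O.Linf_AE[OF elim(3)] O.Linf_norm_nonneg[OF elim(3)] i]
      note s1 = O.multiplier(1)[OF O.Linf_measurable[OF s(2)[OF elim(5)]] O.rep_L2[of "\<sigma> n t"] O.Linf_AE[OF s(2)[OF elim(5)]] O.Linf_norm_nonneg[OF s(2)[OF elim(5)]] i]
      note s2 = O.multiplier(1)[OF O.Linf_measurable[OF elim(3)] elim(4) O.Linf_AE[OF elim(3)] O.Linf_norm_nonneg[OF elim(3)] i]
      have "mul (s n t) (\<sigma> n t) - cls \<Omega> (\<lambda>x. k t x * (u t x \<bullet> i)) = cls \<Omega> (\<lambda>x. s n t x * (?r x \<bullet> i) - k t x * (u t x \<bullet> i))"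
        unfolding mul_def by (rule O.cls_diff[OF s1 s2, symmetric])
      also have "(\<lambda>x. s n t x * (?r x \<bullet> i) - k t x * (u t x \<bullet> i)) =
          (\<lambda>x. (s n t x - k t x) * (?r x \<bullet> i) + k t x * ((?r x - u t x) \<bullet> i))"
        by (auto simp: algebra_simps inner_diff_left)
      also have "cls \<Omega> \<dots> = cls \<Omega> (\<lambda>x. (s n t x - k t x) * (?r x \<bullet> i)) + cls \<Omega> (\<lambda>x. k t x * ((?r x - u t x) \<bullet> i))"
        by (rule O.cls_add[OF m1(1) m2(1)])
      finally have "norm (mul (s n t) (\<sigma> n t) - cls \<Omega> (\<lambda>x. k t x * (u t x \<bullet> i))) \<le> 
          norm (cls \<Omega> (\<lambda>x. (s n t x - k t x) * (?r x \<bullet> i))) + norm (cls \<Omega> (\<lambda>x. k t x * ((?r x - u t x) \<bullet> i)))"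
        by (simp only: norm_triangle_ineq)
      also have "\<dots> \<le> \<delta> n * norm (cls \<Omega> ?r) + K * norm (cls \<Omega> ?r - cls \<Omega> (u t))"
        using m1(2) m2(2) unfolding \<delta>_def K_def O.cls_diff[OF O.rep_L2 elim(4)] by (rule add_mono)
      also have "\<dots> \<le> \<delta> n * norm (\<sigma> n t) + K * norm (\<sigma> n t - cls \<Omega> (u t))"
        using O.cls_rep_diff_le[OF O.L2_zero, of "\<sigma> n t"] O.cls_rep_diff_le[OF elim(4), of "\<sigma> n t"] K O.Linf_norm_nonneg[OF sk]
        by (intro add_mono mult_left_mono) (auto simp: O.cls_zero \<delta>_def)
      finally show ?thesis .
    qed
    have "(\<lambda>n. \<sigma> n t - cls \<Omega> (u t)) \<longlonglongrightarrow> cls \<Omega> (u t) - cls \<Omega> (u t)" by (intro tendsto_diff elim(2) tendsto_const)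
    then have d: "(\<lambda>n. norm (\<sigma> n t - cls \<Omega> (u t))) \<longlonglongrightarrow> 0" by (intro tendsto_norm_zero) simp
    have "(\<lambda>n. \<delta> n * norm (\<sigma> n t) + K * norm (\<sigma> n t - cls \<Omega> (u t))) \<longlonglongrightarrow> 0 * norm (cls \<Omega> (u t)) + K * 0"
      using elim(1) unfolding \<delta>_def[symmetric] by (intro tendsto_add tendsto_mult tendsto_norm elim(2) d tendsto_const)
    then have lim: "(\<lambda>n. \<delta> n * norm (\<sigma> n t) + K * norm (\<sigma> n t - cls \<Omega> (u t))) \<longlonglongrightarrow> 0" by simp
    have "(\<lambda>n. mul (s n t) (\<sigma> n t) - cls \<Omega> (\<lambda>x. k t x * (u t x \<bullet> i))) \<longlonglongrightarrow> 0"
      by (rule tendsto_0_le[OF lim, of _ 1]) (use le in \<open>auto intro!: always_eventually intro: order_trans[OF _ abs_ge_self]\<close>)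
    then show ?case by (rule LIM_zero_cancel)
  qed
  have "smeas J (\<lambda>t. cls \<Omega> (\<lambda>x. k t x * (u t x \<bullet> i)))"
    unfolding smeas_def by (rule exI[of _ "\<lambda>n t. mul (s n t) (\<sigma> n t)"]) (simp only: simple lim simp_thms)
  then show "l2c J (\<lambda>t. cls \<Omega> (\<lambda>x. k t x * (u t x \<bullet> i)))"
    by (rule J.l2c_bound[OF _ u(1)]) (use bd in eventually_elim, blast)
qed

text \<open>Measurability is obtained component by component. The bound is not: adding the bounds of
  \<open>multiplier\<close> would give the sum of the component norms, while Cauchy--Schwarz at
  almost every point gives the root of the sum of squares in \<open>Cb\<close>.\<close>

lemma lower_order_terms:
  fixes b :: "real \<Rightarrow> 'a \<Rightarrow> 'a" and c u :: "real \<Rightarrow> 'a \<Rightarrow> real" and g :: "real \<Rightarrow> 'a \<Rightarrow> 'a"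
  assumes b: "\<forall>i\<in>Basis. (\<lambda>t x. b t x \<bullet> i) \<in> bochner_Linf {0<..<T} (Linf \<Omega>) (Linf_norm \<Omega>)"
    and c: "c \<in> bochner_Linf {0<..<T} (Linf \<Omega>) (Linf_norm \<Omega>)"
    and u: "l2c J (\<lambda>t. cls \<Omega> (u t))" "AE t in J. u t \<in> L2 \<Omega>"
    and g: "l2c J (\<lambda>t. cls \<Omega> (g t))" "AE t in J. g t \<in> L2 \<Omega>"
  defines "Cb \<equiv> sqrt (\<Sum>i\<in>Basis. (bochner_Linf_norm {0<..<T} (Linf_norm \<Omega>) (\<lambda>t x. b t x \<bullet> i))\<^sup>2)"
    and "Cc \<equiv> bochner_Linf_norm {0<..<T} (Linf_norm \<Omega>) c"
    and "r \<equiv> \<lambda>t x. b t x \<bullet> g t x + c t x * u t x"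
  shows "AE t in J. r t \<in> L2 \<Omega>" "l2c J (\<lambda>t. cls \<Omega> (r t))"
    "l2n J (\<lambda>t. cls \<Omega> (r t)) \<le> Cb * l2n J (\<lambda>t. cls \<Omega> (g t)) + Cc * l2n J (\<lambda>t. cls \<Omega> (u t))"
proof -
  have m1: "AE t in J. (\<lambda>x. (b t x \<bullet> i) * (g t x \<bullet> i)) \<in> L2 \<Omega>" "l2c J (\<lambda>t. cls \<Omega> (\<lambda>x. (b t x \<bullet> i) * (g t x \<bullet> i)))"
    if "i \<in> Basis" for i using bochner_multiplier[OF bspec[OF b that] g, of i] that by auto
  have m2: "AE t in J. (\<lambda>x. c t x * u t x) \<in> L2 \<Omega>" "l2c J (\<lambda>t. cls \<Omega> (\<lambda>x. c t x * u t x))"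
    using bochner_multiplier[OF c u, of 1] by auto
  have m1': "AE t in J. \<forall>i\<in>Basis. (\<lambda>x. (b t x \<bullet> i) * (g t x \<bullet> i)) \<in> L2 \<Omega>"
    using m1(1) by (intro AE_finite_allI) auto
  have bg: "AE t in J. (\<lambda>x. b t x \<bullet> g t x) \<in> L2 \<Omega> \<and> (\<Sum>i\<in>Basis. cls \<Omega> (\<lambda>x. (b t x \<bullet> i) * (g t x \<bullet> i))) = cls \<Omega> (\<lambda>x. b t x \<bullet> g t x)"
    using m1'
  proof eventually_elim
    case (elim t)
    show ?case using O.L2_sum[of Basis "\<lambda>i x. (b t x \<bullet> i) * (g t x \<bullet> i)"] O.cls_sum[of Basis "\<lambda>i x. (b t x \<bullet> i) * (g t x \<bullet> i)"] elim
      by (simp add: euclidean_inner[symmetric])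
  qed
  have bg': "AE t in J. (\<Sum>i\<in>Basis. cls \<Omega> (\<lambda>x. (b t x \<bullet> i) * (g t x \<bullet> i))) = cls \<Omega> (\<lambda>x. b t x \<bullet> g t x)"
    using bg by eventually_elim blast
  have lbg: "l2c J (\<lambda>t. cls \<Omega> (\<lambda>x. b t x \<bullet> g t x))"
    by (rule l2c_cong_AE[OF bg' J.l2c_sum J.complete_measure_axioms]) (rule m1(2))
  have rc: "AE t in J. r t \<in> L2 \<Omega> \<and> cls \<Omega> (\<lambda>x. b t x \<bullet> g t x) + cls \<Omega> (\<lambda>x. c t x * u t x) = cls \<Omega> (r t)"
    using bg m2(1) unfolding r_def by eventually_elim (simp add: O.L2_add O.cls_add)
  show "AE t in J. r t \<in> L2 \<Omega>" using rc by eventually_elim simp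
  have rc': "AE t in J. cls \<Omega> (\<lambda>x. b t x \<bullet> g t x) + cls \<Omega> (\<lambda>x. c t x * u t x) = cls \<Omega> (r t)" using rc by eventually_elim simp
  have s: "l2c J (\<lambda>t. cls \<Omega> (\<lambda>x. b t x \<bullet> g t x) + cls \<Omega> (\<lambda>x. c t x * u t x))" by (rule J.l2c_add[OF lbg m2(2)])
  show "l2c J (\<lambda>t. cls \<Omega> (r t))" by (rule l2c_cong_AE[OF rc' s J.complete_measure_axioms])
  note bc = bochner_Linf_bounds[OF c, folded Cc_def]
  have nc: "l2n J (\<lambda>t. cls \<Omega> (\<lambda>x. c t x * u t x)) \<le> Cc * l2n J (\<lambda>t. cls \<Omega> (u t))"
    by (rule J.l2n_mono[OF m2(2) u(1) bc(3)])
      (use bc(1,2) u(2) in eventually_elim, use O.multiplier(2)[OF O.Linf_measurable _ _ bc(3), of _ _ "1::real"] in auto)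
  have Cb0: "Cb \<ge> 0" unfolding Cb_def by (intro real_sqrt_ge_zero sum_nonneg) simp
  have bb: "AE t in J. \<forall>i\<in>Basis. AE x in lebesgue_on \<Omega>. \<bar>b t x \<bullet> i\<bar> \<le> bochner_Linf_norm {0<..<T} (Linf_norm \<Omega>) (\<lambda>t x. b t x \<bullet> i)"
    using bochner_Linf_bounds(2)[OF bspec[OF b]] by (intro AE_finite_allI) auto
  have nb: "l2n J (\<lambda>t. cls \<Omega> (\<lambda>x. b t x \<bullet> g t x)) \<le> Cb * l2n J (\<lambda>t. cls \<Omega> (g t))"
  proof (rule J.l2n_mono[OF lbg g(1) Cb0])
    show "AE t in J. norm (cls \<Omega> (\<lambda>x. b t x \<bullet> g t x)) \<le> Cb * norm (cls \<Omega> (g t))"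
      using bb bg g(2)
    proof eventually_elim
      case (elim t)
      have "AE x in lebesgue_on \<Omega>. \<forall>i\<in>Basis. \<bar>b t x \<bullet> i\<bar> \<le> bochner_Linf_norm {0<..<T} (Linf_norm \<Omega>) (\<lambda>t x. b t x \<bullet> i)"
        using elim(1) by (intro AE_finite_allI) auto
      then have le: "AE x in lebesgue_on \<Omega>. norm (b t x \<bullet> g t x) \<le> Cb * norm (g t x)"
      proof eventually_elim
        case (elim x)
        have "(norm (b t x))\<^sup>2 = (\<Sum>i\<in>Basis. (b t x \<bullet> i)\<^sup>2)"
          unfolding power2_norm_eq_inner by (subst euclidean_inner) (simp add: power2_eq_square)
        also have "\<dots> \<le> (\<Sum>i\<in>Basis. (bochner_Linf_norm {0<..<T} (Linf_norm \<Omega>) (\<lambda>t x. b t x \<bullet> i))\<^sup>2)"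
          by (intro sum_mono) (use elim in \<open>simp add: abs_le_square_iff[symmetric] order_trans[OF _ abs_ge_self]\<close>)
        finally have "norm (b t x) \<le> Cb" unfolding Cb_def by (rule real_le_rsqrt)
        then show ?case using Cauchy_Schwarz_ineq2[of "b t x" "g t x"] mult_right_mono[of "norm (b t x)" Cb "norm (g t x)"] by simp
      qed
      have l: "l2c (lebesgue_on \<Omega>) (\<lambda>x. b t x \<bullet> g t x)" "l2c (lebesgue_on \<Omega>) (g t)" using elim by (auto simp: O.L2_iff)
      show ?case using O.D.l2n_mono[OF l Cb0 le] elim(2,3) by (simp add: O.norm_cls O.L2_norm_eq)
    qed
  qed
  have "l2n J (\<lambda>t. cls \<Omega> (r t)) = l2n J (\<lambda>t. cls \<Omega> (\<lambda>x. b t x \<bullet> g t x) + cls \<Omega> (\<lambda>x. c t x * u t x))"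
    by (rule l2n_cong_AE[OF rc' l2c_smeas[OF s] J.complete_measure_axioms, symmetric])
  also have "\<dots> \<le> l2n J (\<lambda>t. cls \<Omega> (\<lambda>x. b t x \<bullet> g t x)) + l2n J (\<lambda>t. cls \<Omega> (\<lambda>x. c t x * u t x))"
    by (rule J.l2n_triangle[OF lbg m2(2)])
  finally show "l2n J (\<lambda>t. cls \<Omega> (r t)) \<le> Cb * l2n J (\<lambda>t. cls \<Omega> (g t)) + Cc * l2n J (\<lambda>t. cls \<Omega> (u t))" using nb nc by simp
qed

end

section \<open>The space-time discrete space\<close>

context time_grid
begin

lemma antideriv_V1:
  fixes u u' :: "real \<Rightarrow> real"
  assumes a: "antideriv u u'"
  shows "u \<in> V1 T" "V1_norm T u = l2n J u'"
proof -
  have uL: "u \<in> L2 {0<..<T}" "u' \<in> L2 {0<..<T}"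
    using antideriv_l2c_fun[OF a] antideriv_l2c[OF a] by (simp_all add: JD.L2_iff)
  have w: "has_weak_grad {0<..<T} u u'" unfolding has_weak_grad_def
    using integration_by_parts_test[OF a, where y=1] by (simp add: mult.commute)
  note H = JO.H1I[OF uL w]
  have "continuous_on {0..T} u" unfolding continuous_on_def using antideriv_tendsto[OF a] by blast
  then show "u \<in> V1 T" unfolding V1_def using H(1) antideriv_zero[OF a] by simp
  have "V1_norm T u = norm (JO.Gr u)"
    unfolding V1_norm_def JO.Gr_def by (rule JD.norm_cls[OF JO.H1_weak_grad(1)[OF H(1)], symmetric])
  also have "\<dots> = l2n J u'" unfolding H(2) JD.norm_cls[OF uL(2)] JD.L2_norm_eq ..
  finally show "V1_norm T u = l2n J u'" .
qed

lemma P1_interpolation: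
  fixes u u' :: "real \<Rightarrow> real"
  assumes C: "\<And>u. u \<in> V1 T \<Longrightarrow> L2_norm {0<..<T} (\<lambda>t. u t - nodal_interp T m tn u t) \<le> C * V1_norm T u"
    and a: "antideriv u u'"
  shows "\<exists>v \<in> P1_space T m tn. (\<forall>i\<le>m. v (tn i) = u (tn i)) \<and> l2n J (\<lambda>t. u t - v t) \<le> C * l2n J u'"
  using nodal_interp_props[of u] antideriv_zero[OF a] C[OF antideriv_V1(1)[OF a]] antideriv_V1(2)[OF a]
  unfolding JD.L2_norm_eq by (intro bexI[of _ "nodal_interp T m tn u"]) auto

lemma P1_cong:
  assumes "v \<in> P1_space T m tn" "\<And>t. t \<in> {0..T} \<Longrightarrow> u t = v t" shows "u \<in> P1_space T m tn"
proof -
  have "t \<in> {0..T}" if "i < m" "t \<in> {tn i..tn (Suc i)}" for i t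
    using that tn_range[of i] tn_range[of "Suc i"] by auto
  then have "\<forall>i<m. \<exists>\<alpha> \<beta>. \<forall>t\<in>{tn i..tn (Suc i)}. u t = \<alpha> + \<beta> * t"
    using assms unfolding P1_space_def mem_Collect_eq by metis
  moreover have "continuous_on {0..T} u"
    using assms(1) continuous_on_eq[of "{0..T}" v u] assms(2) by (simp add: P1_space_def)
  moreover have "u 0 = 0" using assms T_pos by (simp add: P1_space_def)
  ultimately show ?thesis by (simp add: P1_space_def)
qed

end

locale space_time_discretization = spacetime T \<Omega> + time_grid T m tn + O: discrete_space \<Omega> S s I
  for T :: real and m :: nat and tn :: "nat \<Rightarrow> real" and \<Omega> :: "'a::euclidean_space set"
    and S :: "('a \<Rightarrow> real) set" and s :: "'n::finite \<Rightarrow> 'a \<Rightarrow> real" and I :: "'n set"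
begin

abbreviation tensor :: "(real \<Rightarrow> 'a \<Rightarrow> real) set" where
  "tensor \<equiv> tensor_space T \<Omega> (P1_space T m tn) S"

definition P :: "(real \<Rightarrow> 'a \<Rightarrow> real) \<Rightarrow> real \<Rightarrow> real^'n" where "P u t = O.coord (u t)"

definition P' :: "(real \<Rightarrow> 'a \<Rightarrow> real) \<Rightarrow> real \<Rightarrow> real^'n" where
  "P' u t = (\<chi> l. P1_deriv (\<lambda>t. P u t $ l) t)"

lemma L2_cong_AE:
  assumes "v \<in> L2 \<Omega>" "AE x in lebesgue_on \<Omega>. u x = v x" shows "u \<in> L2 \<Omega>" "cls \<Omega> u = cls \<Omega> (v :: 'a \<Rightarrow> real)"
proof -
  have e: "AE x in lebesgue_on \<Omega>. v x = u x" using assms(2) by eventually_elim simp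
  show u: "u \<in> L2 \<Omega>" using l2c_cong_AE[OF e _ O.D.complete_measure_axioms] assms(1) by (simp add: O.L2_iff)
  show "cls \<Omega> u = cls \<Omega> v" using O.cls_eq_iff[OF u assms(1)] assms(2) by simp
qed

lemma tensor_expansion:
  assumes "u \<in> tensor"
  obtains N :: nat and v r where "\<And>j. j < N \<Longrightarrow> v j \<in> P1_space T m tn" "\<And>j. j < N \<Longrightarrow> r j \<in> S"
    "\<And>t. t \<in> {0..T} \<Longrightarrow> u t \<in> L2 \<Omega>" "\<And>t. t \<in> {0..T} \<Longrightarrow> cls \<Omega> (u t) = (\<Sum>j<N. v j t *\<^sub>R cls \<Omega> (r j))"
proof -
  obtain N :: nat and v r where v: "\<And>j. j < N \<Longrightarrow> v j \<in> P1_space T m tn \<and> r j \<in> S"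
    and u: "\<And>t. t \<in> {0..T} \<Longrightarrow> AE x in lebesgue_on \<Omega>. u t x = (\<Sum>j<N. v j t * r j x)"
    using assms unfolding tensor_space_def by blast
  have rL: "r j \<in> L2 \<Omega>" if "j < N" for j using v[OF that] O.H10_L2 by (simp add: O.S_eq)
  have L: "(\<lambda>x. v j t * r j x) \<in> L2 \<Omega>" if "j < N" for j t using O.L2_scaleR[OF rL[OF that]] by simp
  have sL: "(\<lambda>x. \<Sum>j<N. v j t * r j x) \<in> L2 \<Omega>" for t by (rule O.L2_sum) (use L in simp)
  have sc: "cls \<Omega> (\<lambda>x. \<Sum>j<N. v j t * r j x) = (\<Sum>j<N. v j t *\<^sub>R cls \<Omega> (r j))" for t
  proof -
    have "cls \<Omega> (\<lambda>x. \<Sum>j<N. v j t * r j x) = (\<Sum>j<N. cls \<Omega> (\<lambda>x. v j t * r j x))" by (rule O.cls_sum) (use L in simp)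
    also have "\<dots> = (\<Sum>j<N. v j t *\<^sub>R cls \<Omega> (r j))" by (intro sum.cong refl O.cls_mult rL) simp
    finally show ?thesis .
  qed
  show thesis
  proof (rule that[of N v r])
    show "u t \<in> L2 \<Omega>" if "t \<in> {0..T}" for t by (rule L2_cong_AE(1)[OF sL u[OF that]])
    show "cls \<Omega> (u t) = (\<Sum>j<N. v j t *\<^sub>R cls \<Omega> (r j))" if "t \<in> {0..T}" for t
      using L2_cong_AE(2)[OF sL u[OF that]] sc by simp
  qed (use v in auto)
qed

lemma tensor_values:
  assumes u: "u \<in> tensor" and t: "t \<in> {0..T}"
  shows "u t \<in> L2 \<Omega>" "u t \<in> H10 \<Omega>" "cls \<Omega> (u t) = comb O.e (P u t)" "O.Gr (u t) = comb O.\<epsilon> (P u t)"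
proof -
  obtain N :: nat and v r where e: "\<And>j. j < N \<Longrightarrow> v j \<in> P1_space T m tn" "\<And>j. j < N \<Longrightarrow> r j \<in> S"
    "\<And>t. t \<in> {0..T} \<Longrightarrow> u t \<in> L2 \<Omega>" "\<And>t. t \<in> {0..T} \<Longrightarrow> cls \<Omega> (u t) = (\<Sum>j<N. v j t *\<^sub>R cls \<Omega> (r j))"
    using tensor_expansion[OF u] by blast
  show L: "u t \<in> L2 \<Omega>" by (rule e(3)[OF t])
  have "cls \<Omega> (u t) = (\<Sum>j<N. v j t *\<^sub>R comb O.e (O.coord (r j)))"
    unfolding e(4)[OF t] by (intro sum.cong refl) (simp add: O.S_coord[OF e(2)])
  also have "\<dots> = comb O.e (\<Sum>j<N. v j t *\<^sub>R O.coord (r j))"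
    by (simp add: linear_sum[OF linear_comb]
        linear_scale[OF linear_comb])
  finally have c: "cls \<Omega> (u t) = comb O.e (\<Sum>j<N. v j t *\<^sub>R O.coord (r j))" .
  note g = O.Gr_cls[OF L c]
  have "u t \<in> S" unfolding O.S_eq using g c by blast
  then show c': "cls \<Omega> (u t) = comb O.e (P u t)" unfolding P_def by (rule O.S_coord)
  show "u t \<in> H10 \<Omega>" "O.Gr (u t) = comb O.\<epsilon> (P u t)" using O.Gr_cls[OF L c'] by auto
qed

lemma tensor_P1:
  assumes u: "u \<in> tensor" shows "(\<lambda>t. P u t $ l) \<in> P1_space T m tn"
proof -
  obtain N :: nat and v r where e: "\<And>j. j < N \<Longrightarrow> v j \<in> P1_space T m tn" "\<And>j. j < N \<Longrightarrow> r j \<in> S"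
    "\<And>t. t \<in> {0..T} \<Longrightarrow> u t \<in> L2 \<Omega>" "\<And>t. t \<in> {0..T} \<Longrightarrow> cls \<Omega> (u t) = (\<Sum>j<N. v j t *\<^sub>R cls \<Omega> (r j))"
    using tensor_expansion[OF u] by blast
  show ?thesis
  proof (rule P1_cong)
    show "(\<lambda>t. \<Sum>j<N. (cls \<Omega> (r j) \<bullet> O.e l) * v j t) \<in> P1_space T m tn" by (rule P1_lincomb) (simp add: e(1))
    show "P u t $ l = (\<Sum>j<N. (cls \<Omega> (r j) \<bullet> O.e l) * v j t)" if "t \<in> {0..T}" for t
      by (simp add: P_def O.coord_def e(4)[OF that] inner_sum_left mult.commute)
  qed
qed

lemma P_0: "l \<notin> I \<Longrightarrow> P u t $ l = 0" by (simp add: P_def O.coord_0)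

lemma fn_tensor:
  fixes r :: "real \<Rightarrow> real^'n"
  assumes "\<And>l. (\<lambda>t. r t $ l) \<in> P1_space T m tn" shows "(\<lambda>t. O.fn (r t)) \<in> tensor"
proof -
  obtain h :: "nat \<Rightarrow> 'n" where h: "bij_betw h {0..<CARD('n)} UNIV"
    using ex_bij_betw_nat_finite[OF finite[of "UNIV :: 'n set"]] by blast
  have "O.fn (r t) x = (\<Sum>j<CARD('n). r t $ h j * s (h j) x)" for t x
    unfolding O.fn_def using sum.reindex_bij_betw[OF h, of "\<lambda>l. r t $ l * s l x"] by (simp add: atLeast0LessThan)
  then show ?thesis unfolding tensor_space_def mem_Collect_eq
    by (intro exI[of _ "CARD('n)"] exI[of _ "\<lambda>j t. r t $ h j"] exI[of _ "\<lambda>j. s (h j)"]) (simp add: assms O.s)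
qed

lemma antideriv_P:
  assumes "u \<in> tensor" shows "antideriv (\<lambda>t. P u t $ l) (\<lambda>t. P' u t $ l)"
  using antideriv_P1[OF tensor_P1[OF assms]] by (simp add: P'_def)

text \<open>The combination with piecewise constant coefficients is a weak time derivative of
  \<open>\<psi>\<close>, so by uniqueness it represents the one chosen by \<open>dt\<close>. The
  value type is general in order to serve the functions and their gradients.\<close>

lemma dt_combination:
  fixes \<psi> :: "real \<Rightarrow> 'a \<Rightarrow> 'b::euclidean_space" and \<sigma> :: "'n \<Rightarrow> 'a \<Rightarrow> 'b"
  assumes u: "u \<in> tensor" and \<sigma>: "\<And>l. \<sigma> l \<in> L2 \<Omega>"
    and \<psi>: "\<And>t. t \<in> {0..T} \<Longrightarrow> \<psi> t \<in> L2 \<Omega> \<and> cls \<Omega> (\<psi> t) = comb (\<lambda>l. cls \<Omega> (\<sigma> l)) (P u t)"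
  shows "AE t in J. dt T \<Omega> \<psi> t \<in> L2 \<Omega> \<and> cls \<Omega> (dt T \<Omega> \<psi> t) = comb (\<lambda>l. cls \<Omega> (\<sigma> l)) (P' u t)"
proof -
  define v where "v t x = (\<Sum>l\<in>UNIV. P' u t $ l *\<^sub>R \<sigma> l x)" for t x
  have vb: "v \<in> bochner_L2 {0<..<T} (L2 \<Omega>) (L2_norm \<Omega>)" unfolding v_def[abs_def]
    by (rule bochner_L2_finite_sum) (use \<sigma> antideriv_l2c[OF antideriv_P[OF u]] in auto)
  have vL: "v t \<in> L2 \<Omega>" for t unfolding v_def[abs_def] by (intro O.L2_sum O.L2_scaleR \<sigma>)
  have cv: "cls \<Omega> (v t) = comb (\<lambda>l. cls \<Omega> (\<sigma> l)) (P' u t)" for t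
    unfolding v_def[abs_def] comb_def by (simp add: O.cls_sum O.L2_scaleR O.cls_scaleR \<sigma>)
  have "antideriv (\<lambda>t. \<Sum>l\<in>UNIV. P u t $ l *\<^sub>R cls \<Omega> (\<sigma> l)) (\<lambda>t. \<Sum>l\<in>UNIV. P' u t $ l *\<^sub>R cls \<Omega> (\<sigma> l))"
    by (intro antideriv_sum antideriv_scaleR_left antideriv_P u)
  then have "antideriv (\<lambda>t. cls \<Omega> (\<psi> t)) (\<lambda>t. \<Sum>l\<in>UNIV. P' u t $ l *\<^sub>R cls \<Omega> (\<sigma> l))"
    by (rule antideriv_cong) (simp add: \<psi> comb_def)
  then have a: "antideriv (\<lambda>t. cls \<Omega> (\<psi> t)) (\<lambda>t. cls \<Omega> (v t))" by (simp add: cv comb_def)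
  have "AE t in J. \<psi> t \<in> L2 \<Omega>" using AE_J_interval by eventually_elim (use \<psi> in auto)
  from dt_unique(1)[OF vb antideriv_time_deriv[OF a this]] vL show ?thesis by (simp add: cv)
qed

lemma tensor_derivatives:
  assumes u: "u \<in> tensor"
  shows "AE t in J. u t \<in> L2 \<Omega> \<and> cls \<Omega> (u t) = comb O.e (P u t)"
    and "AE t in J. nabla \<Omega> u t \<in> L2 \<Omega> \<and> cls \<Omega> (nabla \<Omega> u t) = comb O.\<epsilon> (P u t)"
    and "AE t in J. dt T \<Omega> u t \<in> L2 \<Omega> \<and> cls \<Omega> (dt T \<Omega> u t) = comb O.e (P' u t)"
    and "AE t in J. dt T \<Omega> (nabla \<Omega> u) t \<in> L2 \<Omega> \<and> cls \<Omega> (dt T \<Omega> (nabla \<Omega> u) t) = comb O.\<epsilon> (P' u t)"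
proof -
  note v = tensor_values[OF u]
  have n: "nabla \<Omega> u t \<in> L2 \<Omega> \<and> cls \<Omega> (nabla \<Omega> u t) = comb O.\<epsilon> (P u t)" if "t \<in> {0..T}" for t
    using O.H1_weak_grad(1)[OF O.H10_H1[OF v(2)[OF that]]] v(4)[OF that] by (simp add: nabla_def O.Gr_def)
  show "AE t in J. u t \<in> L2 \<Omega> \<and> cls \<Omega> (u t) = comb O.e (P u t)"
    using AE_J_interval by eventually_elim (use v in auto)
  show "AE t in J. nabla \<Omega> u t \<in> L2 \<Omega> \<and> cls \<Omega> (nabla \<Omega> u t) = comb O.\<epsilon> (P u t)"
    using AE_J_interval by eventually_elim (use n in auto)
  show "AE t in J. dt T \<Omega> u t \<in> L2 \<Omega> \<and> cls \<Omega> (dt T \<Omega> u t) = comb O.e (P' u t)"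
    by (rule dt_combination[OF u O.H10_L2[OF O.s_H10]]) (use v in blast)
  show "AE t in J. dt T \<Omega> (nabla \<Omega> u) t \<in> L2 \<Omega> \<and> cls \<Omega> (dt T \<Omega> (nabla \<Omega> u) t) = comb O.\<epsilon> (P' u t)"
    unfolding O.Gr_def
    by (rule dt_combination[OF u O.H1_weak_grad(1)[OF O.H10_H1[OF O.s_H10]]]) (use n in \<open>simp add: O.Gr_def\<close>)
qed

text \<open>Translation into coordinates. Spanning is applied to the function with prescribed
  coordinates, independence to the class of a combination; both are stated almost everywhere in
  space for every time and become identities between coordinate vectors.\<close>

lemma is_basis_tensor_basis:
  fixes \<phi> :: "'n \<Rightarrow> real \<Rightarrow> 'a \<Rightarrow> real"
  assumes \<nu>: "\<nu> > 0" and CJ: "CJ > 0" and Cinv: "Cinv > 0"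
    and basis: "is_basis T \<Omega> tensor \<phi>"
    and interp: "\<And>u. u \<in> V1 T \<Longrightarrow> L2_norm {0<..<T} (\<lambda>t. u t - nodal_interp T m tn u t) \<le> CJ * V1_norm T u"
    and inv: "\<And>u. u \<in> S \<Longrightarrow> H10_norm \<Omega> u \<le> Cinv * L2_norm \<Omega> u"
    and A: "A = (\<chi> i j. st_inner T \<Omega> (dt T \<Omega> (\<phi> j)) (dt T \<Omega> (\<phi> i)))"
    and M: "M = (\<chi> i j. st_inner T \<Omega> (nabla \<Omega> (\<phi> j)) (nabla \<Omega> (\<phi> i)))"
    and B: "B = (\<chi> i j. st_inner T \<Omega> (nabla \<Omega> (\<phi> j)) (dt T \<Omega> (nabla \<Omega> (\<phi> i))))"
    and U: "U = (\<chi> i j. st_inner T \<Omega> (\<phi> j) (\<phi> i))"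
    and W: "W = (\<chi> i j. st_inner T \<Omega> (dt T \<Omega> (nabla \<Omega> (\<phi> j))) (dt T \<Omega> (nabla \<Omega> (\<phi> i))))"
    and Y: "Y = (\<chi> i j. L2_inner \<Omega> (\<phi> j T) (\<phi> i T))"
    and R: "A = RA ** transpose RA" "M = RM ** transpose RM" "U = RU ** transpose RU"
      "W = RW ** transpose RW" "Y = RY ** transpose RY"
  shows "tensor_basis T m tn \<nu> CJ Cinv O.e O.\<epsilon> I (\<lambda>i. P (\<phi> i)) (\<lambda>i. P' (\<phi> i)) A M B U W Y RA RM RU RW RY"
proof -
  have \<phi>: "\<phi> i \<in> tensor" for i using basis by (simp add: is_basis_def)
  have cs: "(\<lambda>x. \<Sum>i\<in>UNIV. a i * \<phi> i t x) \<in> L2 \<Omega> \<and>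
      cls \<Omega> (\<lambda>x. \<Sum>i\<in>UNIV. a i * \<phi> i t x) = (\<Sum>i\<in>UNIV. a i *\<^sub>R cls \<Omega> (\<phi> i t))" if "t \<in> {0..T}" for a t
  proof -
    have L: "(\<lambda>x. a i * \<phi> i t x) \<in> L2 \<Omega>" for i using O.L2_scaleR[OF tensor_values(1)[OF \<phi> that]] by simp
    have "cls \<Omega> (\<lambda>x. \<Sum>i\<in>UNIV. a i * \<phi> i t x) = (\<Sum>i\<in>UNIV. cls \<Omega> (\<lambda>x. a i * \<phi> i t x))" by (rule O.cls_sum[OF L])
    also have "\<dots> = (\<Sum>i\<in>UNIV. a i *\<^sub>R cls \<Omega> (\<phi> i t))" by (intro sum.cong refl O.cls_mult tensor_values(1)[OF \<phi> that])
    finally show ?thesis using O.L2_sum[of UNIV "\<lambda>i x. a i * \<phi> i t x", OF L] by blast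
  qed
  show ?thesis
  proof (intro tensor_basis.intro tensor_basis_axioms.intro time_grid_axioms \<nu> CJ Cinv R)
    show "O.e l \<bullet> O.e k = (if l = k \<and> l \<in> I then 1 else 0)" for l k by (rule O.orth)
    show "norm (comb O.\<epsilon> a) \<le> Cinv * norm (comb O.e a)" for a by (rule O.inverse_ineq[OF inv])
    show "\<exists>v \<in> P1_space T m tn. (\<forall>i\<le>m. v (tn i) = u (tn i)) \<and> l2n J (\<lambda>t. u t - v t) \<le> CJ * l2n J u'"
      if "antideriv u u'" for u u' :: "real \<Rightarrow> real" by (rule P1_interpolation[OF interp that])
    show "(\<lambda>t. P (\<phi> i) t $ l) \<in> P1_space T m tn" for i l by (rule tensor_P1[OF \<phi>])
    show "l \<notin> I \<Longrightarrow> P (\<phi> i) t $ l = 0" for i t l by (rule P_0)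
    show "P' (\<phi> i) t = (\<chi> l. P1_deriv (\<lambda>t. P (\<phi> i) t $ l) t)" for i t by (rule P'_def)
    show "\<exists>a. \<forall>t\<in>{0..T}. r t = comb (\<lambda>i. P (\<phi> i) t) a"
      if r: "\<And>l. (\<lambda>t. r t $ l) \<in> P1_space T m tn" "\<And>t l. l \<notin> I \<Longrightarrow> r t $ l = 0" for r :: "real \<Rightarrow> real^'n"
    proof -
      have "\<forall>u\<in>tensor. \<exists>a. \<forall>t\<in>{0..T}. AE x in lebesgue_on \<Omega>. u t x = (\<Sum>i\<in>UNIV. a i * \<phi> i t x)"
        using basis by (simp add: is_basis_def)
      from bspec[OF this fn_tensor[OF r(1)]]
      obtain a where a: "\<And>t. t \<in> {0..T} \<Longrightarrow> AE x in lebesgue_on \<Omega>. O.fn (r t) x = (\<Sum>i\<in>UNIV. a i * \<phi> i t x)" by blast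
      have "r t = comb (\<lambda>i. P (\<phi> i) t) (\<chi> i. a i)" if t: "t \<in> {0..T}" for t
      proof -
        have "cls \<Omega> (O.fn (r t)) = (\<Sum>i\<in>UNIV. a i *\<^sub>R cls \<Omega> (\<phi> i t))"
          using cs[OF t, of a] L2_cong_AE(2)[OF _ a[OF t]] by simp
        then have "O.coord (O.fn (r t)) = comb (\<lambda>i. P (\<phi> i) t) (\<chi> i. a i)"
          by (simp add: vec_eq_iff O.coord_def P_def comb_def inner_sum_left)
        then show ?thesis using O.coord_fn[of "r t"] r(2) by simp
      qed
      then show ?thesis by blast
    qed
    show "a = 0" if a: "\<And>t. t \<in> {0..T} \<Longrightarrow> comb (\<lambda>i. P (\<phi> i) t) a = 0" for a :: "real^'n"
    proof -
      have "AE x in lebesgue_on \<Omega>. (\<Sum>i\<in>UNIV. a $ i * \<phi> i t x) = 0" if t: "t \<in> {0..T}" for t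
      proof -
        have "(\<Sum>i\<in>UNIV. a $ i *\<^sub>R cls \<Omega> (\<phi> i t)) = comb O.e (comb (\<lambda>i. P (\<phi> i) t) a)"
          unfolding comb_def[of _ a]
          by (simp add: tensor_values(3)[OF \<phi> t] linear_sum[OF linear_comb]
              linear_scale[OF linear_comb])
        also have "\<dots> = 0" by (simp add: a[OF t] linear_0[OF linear_comb])
        finally have "cls \<Omega> (\<lambda>x. \<Sum>i\<in>UNIV. a $ i * \<phi> i t x) = cls \<Omega> (\<lambda>x. 0)"
          using cs[OF t, of "\<lambda>i. a $ i"] by (simp add: O.cls_zero)
        then show ?thesis using O.cls_eq_iff[OF _ O.L2_zero] cs[OF t, of "\<lambda>i. a $ i"] by blast
      qed
      then have "\<forall>t\<in>{0..T}. AE x in lebesgue_on \<Omega>. (\<Sum>i\<in>UNIV. a $ i * \<phi> i t x) = 0" by blast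
      moreover have "(\<forall>t\<in>{0..T}. AE x in lebesgue_on \<Omega>. (\<Sum>i\<in>UNIV. a $ i * \<phi> i t x) = 0) \<longrightarrow> (\<forall>i. a $ i = 0)"
        using basis unfolding is_basis_def by simp
      ultimately have "\<forall>i. a $ i = 0" by simp
      then show ?thesis by (simp add: vec_eq_iff)
    qed
    note d = tensor_derivatives[OF \<phi>]
    show "A = (\<chi> i j. LINT t|J. comb O.e (P' (\<phi> j) t) \<bullet> comb O.e (P' (\<phi> i) t))"
      unfolding A st_inner_cls[OF d(3) d(3)] ..
    show "M = (\<chi> i j. LINT t|J. comb O.\<epsilon> (P (\<phi> j) t) \<bullet> comb O.\<epsilon> (P (\<phi> i) t))"
      unfolding M st_inner_cls[OF d(2) d(2)] ..
    show "B = (\<chi> i j. LINT t|J. comb O.\<epsilon> (P (\<phi> j) t) \<bullet> comb O.\<epsilon> (P' (\<phi> i) t))"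
      unfolding B st_inner_cls[OF d(2) d(4)] ..
    show "U = (\<chi> i j. LINT t|J. comb O.e (P (\<phi> j) t) \<bullet> comb O.e (P (\<phi> i) t))"
      unfolding U st_inner_cls[OF d(1) d(1)] ..
    show "W = (\<chi> i j. LINT t|J. comb O.\<epsilon> (P' (\<phi> j) t) \<bullet> comb O.\<epsilon> (P' (\<phi> i) t))"
      unfolding W st_inner_cls[OF d(4) d(4)] ..
    have "L2_inner \<Omega> (\<phi> j T) (\<phi> i T) = comb O.e (P (\<phi> j) T) \<bullet> comb O.e (P (\<phi> i) T)" for i j
      using O.inner_cls[OF tensor_values(1)[OF \<phi>] tensor_values(1)[OF \<phi>], of T T j i] tensor_values(3)[OF \<phi>, of T] T_pos by simp
    then show "Y = (\<chi> i j. comb O.e (P (\<phi> j) T) \<bullet> comb O.e (P (\<phi> i) T))" unfolding Y by simp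
  qed
qed

end

section \<open>The a priori estimates\<close>

context spacetime
begin

text \<open>Continuity up to the end points and the zero initial value, both part of
  \<open>bochner_V1\<close>, turn the weak derivative into an integral from 0.\<close>

lemma V1_antideriv:
  fixes u :: "real \<Rightarrow> 'a \<Rightarrow> real"
  assumes u: "u \<in> bochner_V1 T (L2 \<Omega>) (L2_inner \<Omega>)"
  shows "antideriv (\<lambda>t. cls \<Omega> (u t)) (\<lambda>t. cls \<Omega> (dt T \<Omega> u t))" "AE t in J. dt T \<Omega> u t \<in> L2 \<Omega>"
    "\<And>t. t \<in> {0..T} \<Longrightarrow> u t \<in> L2 \<Omega>"
proof -
  have N: "(\<lambda>u. sqrt (L2_inner \<Omega> u u)) = L2_norm \<Omega>" by (simp add: fun_eq_iff L2_norm_def)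
  obtain v where v: "v \<in> bochner_L2 {0<..<T} (L2 \<Omega>) (L2_norm \<Omega>)" "has_time_deriv {0<..<T} (L2 \<Omega>) (L2_inner \<Omega>) u v"
    using u unfolding bochner_V1_def Let_def N by blast
  have uL: "\<And>t. t \<in> {0..T} \<Longrightarrow> u t \<in> L2 \<Omega>"
    and c: "\<And>t. t \<in> {0..T} \<Longrightarrow> ((\<lambda>s. L2_norm \<Omega> (\<lambda>x. u s x - u t x)) \<longlongrightarrow> 0) (at t within {0..T})"
    and u0: "L2_norm \<Omega> (u 0) = 0"
    using u unfolding bochner_V1_def Let_def N by blast+
  note dt = dt_unique[OF v]
  have c': "((\<lambda>s. cls \<Omega> (u s)) \<longlongrightarrow> cls \<Omega> (u t)) (at t within {0..T})" if t: "t \<in> {0..T}" for t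
  proof -
    have "eventually (\<lambda>s. s \<in> {0..T}) (at t within {0..T})" by (simp add: eventually_at_filter)
    then have "eventually (\<lambda>s. L2_norm \<Omega> (\<lambda>x. u s x - u t x) = norm (cls \<Omega> (u s) - cls \<Omega> (u t))) (at t within {0..T})"
      by eventually_elim (simp only: O.cls_diff[OF uL uL[OF t], symmetric] O.norm_cls[OF O.L2_diff[OF uL uL[OF t]]])
    then have "((\<lambda>s. norm (cls \<Omega> (u s) - cls \<Omega> (u t))) \<longlongrightarrow> 0) (at t within {0..T})"
      by (rule Lim_transform_eventually[OF c[OF t]])
    then have "((\<lambda>s. cls \<Omega> (u s) - cls \<Omega> (u t)) \<longlongrightarrow> 0) (at t within {0..T})" by (rule tendsto_norm_zero_cancel)
    then show ?thesis by (rule LIM_zero_cancel)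
  qed
  have "norm (cls \<Omega> (u 0)) = 0" using O.norm_cls[OF uL[of 0]] u0 T_pos by simp
  then have z: "cls \<Omega> (u 0) = 0" by simp
  show dL: "AE t in J. dt T \<Omega> u t \<in> L2 \<Omega>" using dt(1) by eventually_elim blast
  show "antideriv (\<lambda>t. cls \<Omega> (u t)) (\<lambda>t. cls \<Omega> (dt T \<Omega> u t))"
    by (rule time_deriv_antideriv[OF uL c' z bochner_L2_cls(2)[OF dt(2)] dL dt(3)])
  show "\<And>t. t \<in> {0..T} \<Longrightarrow> u t \<in> L2 \<Omega>" by (rule uL)
qed

end

text \<open>Inserting the bounds for \<open>w1\<close>, \<open>w0\<close> and \<open>H\<close> gives
  \<open>X \<le> F + (E - 1) * (F + \<tau> * X) + \<tau> * X\<close>, that is,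
  \<open>X \<le> E * F + \<tau> * E * X\<close>. The summand 1 in \<open>E\<close> thus accounts for
  the direct contribution of the data, and the last term is absorbed since its factor is below
  1.\<close>

lemma absorb:
  fixes F X :: real
  assumes nonneg: "0 \<le> Cb" "0 \<le> Cc" "0 \<le> M1" "0 \<le> M0" "0 \<le> C1" "0 \<le> C0"
    and \<tau>: "\<tau> = C1 * Cb + C0 * Cc" and E: "E = M1 * Cb + M0 * Cc + 1" and \<kappa>: "\<tau> * E < 1"
    and w1: "w1 \<le> M1 * H + C1 * X" and w0: "w0 \<le> M0 * H + C0 * X"
    and X: "X \<le> F + (Cb * w1 + Cc * w0)" and H: "H \<le> F + \<tau> * X"
  shows "X \<le> E / (1 - \<tau> * E) * F" "H \<le> (\<tau> * (E / (1 - \<tau> * E)) + 1) * F"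
proof -
  have \<tau>0: "\<tau> \<ge> 0" unfolding \<tau> using nonneg by simp
  have "Cb * w1 + Cc * w0 \<le> Cb * (M1 * H + C1 * X) + Cc * (M0 * H + C0 * X)"
    by (intro add_mono mult_left_mono w1 w0 nonneg)
  also have "\<dots> = (E - 1) * H + \<tau> * X" by (simp add: E \<tau> algebra_simps)
  also have "(E - 1) * H \<le> (E - 1) * (F + \<tau> * X)"
    using nonneg by (intro mult_left_mono H) (simp add: E)
  finally have "X * (1 - \<tau> * E) \<le> E * F" using X by (simp add: algebra_simps)
  then show X': "X \<le> E / (1 - \<tau> * E) * F" using \<kappa> by (simp add: pos_le_divide_eq)
  show "H \<le> (\<tau> * (E / (1 - \<tau> * E)) + 1) * F"
    using H mult_left_mono[OF X' \<tau>0] by (simp add: algebra_simps)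
qed

context space_time_discretization
begin

text \<open>The witnesses are the norms of the heat equation data \<open>gal.g\<close> and of the
  load \<open>h\<close> of the full discrete problem. All analysis is contained in the five
  inequalities; what remains is the algebra of \<open>absorb\<close>.\<close>

lemma error_estimates:
  fixes \<phi> :: "'n \<Rightarrow> real \<Rightarrow> 'a \<Rightarrow> real" and b :: "real \<Rightarrow> 'a \<Rightarrow> 'a" and c f w :: "real \<Rightarrow> 'a \<Rightarrow> real"
  assumes tb: "tensor_basis T m tn \<nu> CJ Cinv O.e O.\<epsilon> I (\<lambda>i. P (\<phi> i)) (\<lambda>i. P' (\<phi> i)) A M B U W Y RA RM RU RW RY"
    and \<phi>: "\<And>i. \<phi> i \<in> tensor" and bounded: "bounded \<Omega>" and C: "C > 0"
    and C_approx: "\<And>u. u \<in> H10 \<Omega> \<inter> Xspace \<Omega> \<Longrightarrow>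
      H10_norm \<Omega> (\<lambda>x. u x - H10_proj \<Omega> S u x) \<le> C * L2_norm \<Omega> (laplacian \<Omega> u)"
    and f: "f \<in> bochner_L2 {0<..<T} (L2 \<Omega>) (L2_norm \<Omega>)"
    and b: "\<forall>i\<in>Basis. (\<lambda>t x. b t x \<bullet> i) \<in> bochner_Linf {0<..<T} (Linf \<Omega>) (Linf_norm \<Omega>)"
    and c: "c \<in> bochner_Linf {0<..<T} (Linf \<Omega>) (Linf_norm \<Omega>)"
    and G: "G = (\<chi> i j. form_a T \<Omega> \<nu> b c (\<phi> j) (\<phi> i))" "invertible G"
    and w: "w \<in> Vspace T \<Omega>" "w \<in> bochner_L2 {0<..<T} (Xspace \<Omega>) (X_norm \<Omega>)"
    and pde: "AE t in lebesgue_on {0<..<T}. AE x in lebesgue_on \<Omega>.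
      dt T \<Omega> w t x - \<nu> * laplacian \<Omega> (w t) x + b t x \<bullet> nabla \<Omega> w t x + c t x * w t x = f t x"
    and Cb_def: "Cb = sqrt (\<Sum>i\<in>Basis. (bochner_Linf_norm {0<..<T} (Linf_norm \<Omega>) (\<lambda>t x. b t x \<bullet> i))\<^sup>2)"
    and Cc_def: "Cc = bochner_Linf_norm {0<..<T} (Linf_norm \<Omega>) c"
    and M1_def: "M1 = mat_norm (transpose RM ** matrix_inv G ** RA)"
    and M0_def: "M0 = mat_norm (transpose RU ** matrix_inv G ** RA)"
    and MT_def: "MT = mat_norm (transpose RY ** matrix_inv G ** RA)"
    and C1_def: "C1 = 2 / \<nu> * C + Cinv * CJ + CJ * Cinv * (\<nu> * mat_norm (transpose RM ** matrix_inv (A + \<nu> *\<^sub>R B) ** RW))"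
    and C0_def: "C0 = 8 / \<nu> * C\<^sup>2 + CJ + CJ * Cinv * (\<nu> * mat_norm (transpose RU ** matrix_inv (A + \<nu> *\<^sub>R B) ** RW))"
    and CT_def: "CT = sqrt (8 / \<nu>) * C + CJ * Cinv * (\<nu> * mat_norm (transpose RY ** matrix_inv (A + \<nu> *\<^sub>R B) ** RW))"
    and F_def: "F = bochner_L2_norm {0<..<T} (L2_norm \<Omega>) f"
  obtains X H where "X \<le> F + (Cb * bochner_L2_norm {0<..<T} (H10_norm \<Omega>) w + Cc * bochner_L2_norm {0<..<T} (L2_norm \<Omega>) w)"
    "H \<le> F + (C1 * Cb + C0 * Cc) * X"
    "bochner_L2_norm {0<..<T} (H10_norm \<Omega>) w \<le> M1 * H + C1 * X"
    "bochner_L2_norm {0<..<T} (L2_norm \<Omega>) w \<le> M0 * H + C0 * X"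
    "L2_norm \<Omega> (w T) \<le> MT * H + CT * X"
proof -
  interpret tb: tensor_basis T m tn \<nu> CJ Cinv O.e O.\<epsilon> I "\<lambda>i. P (\<phi> i)" "\<lambda>i. P' (\<phi> i)" A M B U W Y RA RM RU RW RY by (rule tb)
  note cmp = J.complete_measure_axioms
  have wV: "w \<in> bochner_V1 T (L2 \<Omega>) (L2_inner \<Omega>)" "w \<in> bochner_L2 {0<..<T} (H10 \<Omega>) (H10_norm \<Omega>)"
    using w(1) by (auto simp: Vspace_def)
  have wL2: "w \<in> bochner_L2 {0<..<T} (L2 \<Omega>) (L2_norm \<Omega>)"
    using wV(1) unfolding bochner_V1_def Let_def L2_norm_def[abs_def] by blast
  note V = V1_antideriv[OF wV(1)]
  note wH = bochner_L2_H10[OF wV(2)] and wL = bochner_L2_cls[OF wL2] and wX = bochner_L2_X[OF w(2)] and fL = bochner_L2_cls[OF f]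
  obtain CP where CP: "\<And>h. h \<in> O.HD \<Longrightarrow> norm (fst h) \<le> CP * norm (snd h)" using O.poincare[OF bounded] by blast
  have lap: "AE t in J. O.HD.weak_lap (cls \<Omega> (w t), O.Gr (w t)) (cls \<Omega> (laplacian \<Omega> (w t)))"
    using wH(1) wX(1) by eventually_elim (simp add: O.weak_laplacian_iff[symmetric] O.X_laplacian)
  interpret gal: galerkin T O.HD \<nu> C CP O.e O.\<epsilon> I "\<lambda>t. cls \<Omega> (w t)" "\<lambda>t. cls \<Omega> (dt T \<Omega> w t)"
    "\<lambda>t. cls \<Omega> (laplacian \<Omega> (w t))" "\<lambda>t. O.Gr (w t)"
  proof (intro galerkin.intro galerkin_axioms.intro time_interval_axioms O.HD.form_domain_axioms tb.\<nu> V(1) wX(2) wH(2) lap)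
    show "C \<ge> 0" using C by simp
    show "(O.e l, O.\<epsilon> l) \<in> O.HD" for l by (rule O.H10_HD[OF O.s_H10])
    show "O.e l \<bullet> O.e k = (if l = k \<and> l \<in> I then 1 else 0)" for l k by (rule O.orth)
    show "l \<notin> I \<Longrightarrow> O.\<epsilon> l = 0" for l by (rule O.Gr_s0)
    show "h \<in> O.HD \<Longrightarrow> norm (fst h) \<le> CP * norm (snd h)" for h by (rule CP)
    show "\<exists>a. (\<forall>l. (snd p - comb O.\<epsilon> a) \<bullet> O.\<epsilon> l = 0) \<and> norm (snd p - comb O.\<epsilon> a) \<le> C * norm y"
      if "O.HD.weak_lap p y" for p y by (rule O.projection_approx[OF C_approx that])
  qed
  obtain q q' where q: "antideriv q q'" "AE t in J. q' t + \<nu> *\<^sub>R (gram O.\<epsilon> *v q t) = (\<chi> l. gal.g t \<bullet> O.e l)"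
    "\<And>t l. t \<in> {0..T} \<Longrightarrow> l \<notin> I \<Longrightarrow> q t $ l = 0" "l2n J q' \<le> l2n J gal.g"
    "l2n J (\<lambda>t. O.Gr (w t) - comb O.\<epsilon> (q t)) \<le> 2 / \<nu> * C * l2n J gal.g"
    "l2n J (\<lambda>t. cls \<Omega> (w t) - comb O.e (q t)) \<le> 8 / \<nu> * C\<^sup>2 * l2n J gal.g"
    "norm (cls \<Omega> (w T) - comb O.e (q T)) \<le> sqrt (8 / \<nu>) * C * l2n J gal.g"
    by (rule gal.semidiscrete_approximation) (rule that)
  obtain d where d: "\<And>i. ((A + \<nu> *\<^sub>R B) *v d) $ i = (LINT t|J. gal.g t \<bullet> comb O.e (P' (\<phi> i) t))"
    using tb.Galerkin_solution[of "\<lambda>i. LINT t|J. gal.g t \<bullet> comb O.e (P' (\<phi> i) t)"] by blast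
  note fd = tb.fully_discrete_error[OF q(1) gal.l2c_g q(2,3,4) d]
  have ld: "l2c J (tb.Pc d)" by (rule antideriv_l2c_fun[OF tb.antideriv_Pc])
  have lc: "l2c J (\<lambda>t. comb x (u t))" if "l2c J u" for u :: "real \<Rightarrow> real^'n" and x :: "'n \<Rightarrow> 'v::real_inner"
    by (rule J.l2c_linear[OF bounded_linear_comb that])
  note lq = antideriv_l2c_fun[OF q(1)]

  \<comment> \<open>Each constant is a semidiscrete part plus a part from the time discretization,
    added by the triangle inequality through \<open>q\<close>.\<close>
  have e1: "l2n J (\<lambda>t. O.Gr (w t) - comb O.\<epsilon> (tb.Pc d t)) \<le> C1 * l2n J gal.g"
    using J.l2n_triangle[OF J.l2c_diff[OF wH(2) lc[OF lq]] J.l2c_diff[OF lc[OF lq] lc[OF ld]], of O.\<epsilon> O.\<epsilon> O.\<epsilon>] q(5) fd(1)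
    by (simp add: C1_def distrib_right)
  have e0: "l2n J (\<lambda>t. cls \<Omega> (w t) - comb O.e (tb.Pc d t)) \<le> C0 * l2n J gal.g"
    using J.l2n_triangle[OF J.l2c_diff[OF wL(2) lc[OF lq]] J.l2c_diff[OF lc[OF lq] lc[OF ld]], of O.e O.e O.e] q(6) fd(2)
    by (simp add: C0_def distrib_right)
  have eT: "norm (cls \<Omega> (w T) - comb O.e (tb.Pc d T)) \<le> CT * l2n J gal.g"
    using norm_triangle_ineq[of "cls \<Omega> (w T) - comb O.e (q T)" "comb O.e (q T) - comb O.e (tb.Pc d T)"] q(7) fd(3)
    by (simp add: CT_def distrib_right)

  \<comment> \<open>The lower-order operator applied to the basis functions; it accounts for the
    difference between \<open>G\<close> and \<open>A + \<nu> *\<^sub>R B\<close>.\<close>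
  define b\<phi> where "b\<phi> j t = cls \<Omega> (\<lambda>x. b t x \<bullet> nabla \<Omega> (\<phi> j) t x + c t x * \<phi> j t x)" for j t
  note td = tensor_derivatives[OF \<phi>]
  have \<phi>l: "l2c J (\<lambda>t. cls \<Omega> (\<phi> j t))" "l2c J (\<lambda>t. cls \<Omega> (nabla \<Omega> (\<phi> j) t))" for j
    by (rule l2c_cong_AE[OF _ tb.l2c_combs(1)[of j] cmp], use td(1)[of j] in eventually_elim, simp)
      (rule l2c_cong_AE[OF _ tb.l2c_combs(3)[of j] cmp], use td(2)[of j] in eventually_elim, simp)
  have \<phi>L: "AE t in J. \<phi> j t \<in> L2 \<Omega>" "AE t in J. nabla \<Omega> (\<phi> j) t \<in> L2 \<Omega>" for j
    using td(1)[of j] td(2)[of j] by (eventually_elim, simp)+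
  note r\<phi> = lower_order_terms[OF b c \<phi>l(1) \<phi>L(1) \<phi>l(2) \<phi>L(2)]
  have bl: "l2c J (b\<phi> j)" for j unfolding b\<phi>_def[abs_def] by (rule r\<phi>(2))
  have Gd: "G = A + \<nu> *\<^sub>R B + (\<chi> i j. LINT t|J. b\<phi> j t \<bullet> comb O.e (P' (\<phi> i) t))"
  proof -
    have "st_inner T \<Omega> (\<lambda>t x. b t x \<bullet> nabla \<Omega> (\<phi> j) t x + c t x * \<phi> j t x) (dt T \<Omega> (\<phi> i)) =
        (LINT t|J. b\<phi> j t \<bullet> comb O.e (P' (\<phi> i) t))" for i j
      by (rule st_inner_cls[OF _ td(3)]) (use r\<phi>(1)[of j j] in eventually_elim, simp add: b\<phi>_def)
    moreover have "st_inner T \<Omega> (dt T \<Omega> (\<phi> j)) (dt T \<Omega> (\<phi> i)) = A $ i $ j" for i j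
      unfolding tb.A st_inner_cls[OF td(3) td(3)] by simp
    moreover have "st_inner T \<Omega> (nabla \<Omega> (\<phi> j)) (dt T \<Omega> (nabla \<Omega> (\<phi> i))) = B $ i $ j" for i j
      unfolding tb.B st_inner_cls[OF td(2) td(4)] by simp
    ultimately show ?thesis by (simp add: G(1) vec_eq_iff form_a_def form_a0_def)
  qed
  note db = tb.discrete_solution_bounds[OF bl gal.l2c_g G(2) Gd d]
  define h where "h t = gal.g t + comb (\<lambda>j. b\<phi> j t) d" for t
  have hl: "l2c J h" unfolding h_def[abs_def] comb_def by (intro J.l2c_add gal.l2c_g J.l2c_sum J.l2c_scaleR bl)

  have wn: "AE t in J. nabla \<Omega> w t \<in> L2 \<Omega>" "l2c J (\<lambda>t. cls \<Omega> (nabla \<Omega> w t))"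
  proof -
    show "AE t in J. nabla \<Omega> w t \<in> L2 \<Omega>" using wH(1) by eventually_elim (simp add: nabla_def O.H1_weak_grad O.H10_H1)
    show "l2c J (\<lambda>t. cls \<Omega> (nabla \<Omega> w t))" using wH(2) by (simp add: nabla_def O.Gr_def)
  qed
  note rw = lower_order_terms[OF b c wL(2,1) wn(2,1)]
  have g_eq: "AE t in J. gal.g t = cls \<Omega> (f t) - cls \<Omega> (\<lambda>x. b t x \<bullet> nabla \<Omega> w t x + c t x * w t x)"
    using pde V(2) wX(1) rw(1) fL(1)
  proof eventually_elim
    case (elim t)
    have L: "(\<lambda>x. \<nu> * laplacian \<Omega> (w t) x) \<in> L2 \<Omega>" using O.L2_scaleR[OF O.X_laplacian(1)[OF elim(3)]] by simp
    let ?r = "\<lambda>x. b t x \<bullet> nabla \<Omega> w t x + c t x * w t x"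
    have "cls \<Omega> (\<lambda>x. dt T \<Omega> w t x - \<nu> * laplacian \<Omega> (w t) x) = cls \<Omega> (\<lambda>x. f t x - ?r x)"
      using O.cls_eq_iff[OF O.L2_diff[OF elim(2) L] O.L2_diff[OF elim(5,4)]] elim(1) by (simp add: algebra_simps)
    then show ?case
      by (simp add: gal.g_def O.cls_diff[OF elim(2) L] O.cls_diff[OF elim(5,4)] O.cls_mult O.X_laplacian(1)[OF elim(3)])
  qed
  have X: "l2n J gal.g \<le> F + (Cb * l2n J (\<lambda>t. O.Gr (w t)) + Cc * l2n J (\<lambda>t. cls \<Omega> (w t)))"
  proof -
    have "l2n J gal.g \<le> l2n J (\<lambda>t. cls \<Omega> (f t)) + l2n J (\<lambda>t. cls \<Omega> (\<lambda>x. b t x \<bullet> nabla \<Omega> w t x + c t x * w t x))"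
      unfolding l2n_cong_AE[OF g_eq l2c_smeas[OF gal.l2c_g] cmp] by (rule J.l2n_triangle_diff[OF fL(2) rw(2)])
    then show ?thesis using rw(3) by (simp add: F_def fL(3) Cb_def Cc_def nabla_def O.Gr_def)
  qed

  \<comment> \<open>The error and its gradient as functions of time and space: the coefficients
    multiply functions rather than classes, so \<open>lower_order_terms\<close> needs them in this
    form.\<close>
  define u where "u t x = w t x - (\<Sum>j\<in>UNIV. d $ j * \<phi> j t x)" for t x
  define gu where "gu t x = nabla \<Omega> w t x - (\<Sum>j\<in>UNIV. d $ j *\<^sub>R nabla \<Omega> (\<phi> j) t x)" for t x
  have all: "AE t in J. \<forall>j\<in>UNIV. \<phi> j t \<in> L2 \<Omega> \<and> cls \<Omega> (\<phi> j t) = comb O.e (P (\<phi> j) t) \<and>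
      nabla \<Omega> (\<phi> j) t \<in> L2 \<Omega> \<and> cls \<Omega> (nabla \<Omega> (\<phi> j) t) = comb O.\<epsilon> (P (\<phi> j) t) \<and>
      (\<lambda>x. b t x \<bullet> nabla \<Omega> (\<phi> j) t x + c t x * \<phi> j t x) \<in> L2 \<Omega>"
  proof (rule AE_finite_allI)
    show "AE t in J. \<phi> j t \<in> L2 \<Omega> \<and> cls \<Omega> (\<phi> j t) = comb O.e (P (\<phi> j) t) \<and>
      nabla \<Omega> (\<phi> j) t \<in> L2 \<Omega> \<and> cls \<Omega> (nabla \<Omega> (\<phi> j) t) = comb O.\<epsilon> (P (\<phi> j) t) \<and>
      (\<lambda>x. b t x \<bullet> nabla \<Omega> (\<phi> j) t x + c t x * \<phi> j t x) \<in> L2 \<Omega>" for j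
      using td(1)[of j] td(2)[of j] r\<phi>(1)[of j j] by eventually_elim simp
  qed simp
  have Gw: "cls \<Omega> (nabla \<Omega> w t) = O.Gr (w t)" for t by (simp add: nabla_def O.Gr_def)
  have uc: "AE t in J. u t \<in> L2 \<Omega> \<and> cls \<Omega> (w t) - comb O.e (tb.Pc d t) = cls \<Omega> (u t)"
    using all wL(1)
  proof eventually_elim
    case (elim t)
    have L: "(\<lambda>x. d $ j * \<phi> j t x) \<in> L2 \<Omega>" for j using O.L2_scaleR[of "\<phi> j t" "d $ j"] elim by simp
    have s: "(\<lambda>x. \<Sum>j\<in>UNIV. d $ j * \<phi> j t x) \<in> L2 \<Omega>" by (rule O.L2_sum) (rule L)
    have "cls \<Omega> (\<lambda>x. \<Sum>j\<in>UNIV. d $ j * \<phi> j t x) = (\<Sum>j\<in>UNIV. cls \<Omega> (\<lambda>x. d $ j * \<phi> j t x))" by (rule O.cls_sum) (rule L)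
    also have "\<dots> = comb (\<lambda>j. comb O.e (P (\<phi> j) t)) d"
      unfolding comb_def[of _ d] by (intro sum.cong refl) (use elim in \<open>simp add: O.cls_mult\<close>)
    finally show ?case unfolding u_def[abs_def]
      using O.L2_diff[OF elim(2) s] O.cls_diff[OF elim(2) s] by (simp add: tb.comb_comb)
  qed
  have gc: "AE t in J. gu t \<in> L2 \<Omega> \<and> O.Gr (w t) - comb O.\<epsilon> (tb.Pc d t) = cls \<Omega> (gu t)"
    using all wn(1)
  proof eventually_elim
    case (elim t)
    have L: "(\<lambda>x. d $ j *\<^sub>R nabla \<Omega> (\<phi> j) t x) \<in> L2 \<Omega>" for j using O.L2_scaleR elim by blast
    have s: "(\<lambda>x. \<Sum>j\<in>UNIV. d $ j *\<^sub>R nabla \<Omega> (\<phi> j) t x) \<in> L2 \<Omega>" by (rule O.L2_sum) (rule L)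
    have "cls \<Omega> (\<lambda>x. \<Sum>j\<in>UNIV. d $ j *\<^sub>R nabla \<Omega> (\<phi> j) t x) = (\<Sum>j\<in>UNIV. cls \<Omega> (\<lambda>x. d $ j *\<^sub>R nabla \<Omega> (\<phi> j) t x))"
      by (rule O.cls_sum) (rule L)
    also have "\<dots> = comb (\<lambda>j. comb O.\<epsilon> (P (\<phi> j) t)) d"
      unfolding comb_def[of _ d] by (intro sum.cong refl) (use elim in \<open>simp add: O.cls_scaleR\<close>)
    finally show ?case unfolding gu_def[abs_def]
      using O.L2_diff[OF elim(2) s] O.cls_diff[OF elim(2) s] by (simp add: tb.comb_comb Gw)
  qed
  have uc': "AE t in J. cls \<Omega> (w t) - comb O.e (tb.Pc d t) = cls \<Omega> (u t)" "AE t in J. u t \<in> L2 \<Omega>"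
    using uc by (eventually_elim, blast)+
  have gc': "AE t in J. O.Gr (w t) - comb O.\<epsilon> (tb.Pc d t) = cls \<Omega> (gu t)" "AE t in J. gu t \<in> L2 \<Omega>"
    using gc by (eventually_elim, blast)+
  have lu: "l2c J (\<lambda>t. cls \<Omega> (w t) - comb O.e (tb.Pc d t))" "l2c J (\<lambda>t. O.Gr (w t) - comb O.\<epsilon> (tb.Pc d t))"
    by (intro J.l2c_diff wL(2) wH(2) lc ld)+
  have lu': "l2c J (\<lambda>t. cls \<Omega> (u t))" by (rule l2c_cong_AE[OF uc'(1) lu(1) cmp])
  have lg': "l2c J (\<lambda>t. cls \<Omega> (gu t))" by (rule l2c_cong_AE[OF gc'(1) lu(2) cmp])
  note ru = lower_order_terms[OF b c lu' uc'(2) lg' gc'(2)]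
  have h_eq: "AE t in J. h t = cls \<Omega> (f t) - cls \<Omega> (\<lambda>x. b t x \<bullet> gu t x + c t x * u t x)"
    using g_eq all rw(1)
  proof eventually_elim
    case (elim t)
    let ?r = "\<lambda>j x. b t x \<bullet> nabla \<Omega> (\<phi> j) t x + c t x * \<phi> j t x"
    have L: "(\<lambda>x. d $ j * ?r j x) \<in> L2 \<Omega>" for j using O.L2_scaleR[of "?r j" "d $ j"] elim(2) by simp
    have s: "(\<lambda>x. \<Sum>j\<in>UNIV. d $ j * ?r j x) \<in> L2 \<Omega>" by (rule O.L2_sum) (rule L)
    have "cls \<Omega> (\<lambda>x. \<Sum>j\<in>UNIV. d $ j * ?r j x) = (\<Sum>j\<in>UNIV. cls \<Omega> (\<lambda>x. d $ j * ?r j x))" by (rule O.cls_sum) (rule L)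
    also have "\<dots> = comb (\<lambda>j. b\<phi> j t) d"
      unfolding comb_def b\<phi>_def by (intro sum.cong refl O.cls_mult) (use elim(2) in blast)
    finally have c': "cls \<Omega> (\<lambda>x. \<Sum>j\<in>UNIV. d $ j * ?r j x) = comb (\<lambda>j. b\<phi> j t) d" .
    have "(\<lambda>x. b t x \<bullet> gu t x + c t x * u t x) =
        (\<lambda>x. (b t x \<bullet> nabla \<Omega> w t x + c t x * w t x) - (\<Sum>j\<in>UNIV. d $ j * ?r j x))"
      by (simp add: fun_eq_iff gu_def u_def inner_diff_right inner_sum_right right_diff_distrib sum_distrib_left
          distrib_left sum.distrib mult_ac)
    then show ?case using O.cls_diff[OF elim(3) s] c' elim(1) by (simp add: h_def)
  qed
  have H: "l2n J h \<le> F + (C1 * Cb + C0 * Cc) * l2n J gal.g"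
  proof -
    have "l2n J h \<le> l2n J (\<lambda>t. cls \<Omega> (f t)) + l2n J (\<lambda>t. cls \<Omega> (\<lambda>x. b t x \<bullet> gu t x + c t x * u t x))"
      unfolding l2n_cong_AE[OF h_eq l2c_smeas[OF hl] cmp] by (rule J.l2n_triangle_diff[OF fL(2) ru(2)])
    also have "\<dots> \<le> F + (Cb * l2n J (\<lambda>t. cls \<Omega> (gu t)) + Cc * l2n J (\<lambda>t. cls \<Omega> (u t)))"
      using ru(3) by (simp add: F_def fL(3) Cb_def Cc_def)
    also have "\<dots> \<le> F + (Cb * (C1 * l2n J gal.g) + Cc * (C0 * l2n J gal.g))"
    proof (intro add_left_mono add_mono mult_left_mono)
      show "l2n J (\<lambda>t. cls \<Omega> (gu t)) \<le> C1 * l2n J gal.g"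
        using e1 l2n_cong_AE[OF gc'(1) l2c_smeas[OF lu(2)] cmp] by simp
      show "l2n J (\<lambda>t. cls \<Omega> (u t)) \<le> C0 * l2n J gal.g"
        using e0 l2n_cong_AE[OF uc'(1) l2c_smeas[OF lu(1)] cmp] by simp
      show "0 \<le> Cb" unfolding Cb_def by (intro real_sqrt_ge_zero sum_nonneg) simp
      show "0 \<le> Cc" unfolding Cc_def by (rule bochner_Linf_bounds(3)[OF c])
    qed
    finally show ?thesis by (simp add: algebra_simps)
  qed
  show thesis
  proof (rule that[OF _ H])
    show "l2n J gal.g \<le> F + (Cb * bochner_L2_norm {0<..<T} (H10_norm \<Omega>) w + Cc * bochner_L2_norm {0<..<T} (L2_norm \<Omega>) w)"
      using X by (simp add: wH(3) wL(3))
    have "l2n J (\<lambda>t. O.Gr (w t)) \<le> l2n J (\<lambda>t. comb O.\<epsilon> (tb.Pc d t)) + l2n J (\<lambda>t. O.Gr (w t) - comb O.\<epsilon> (tb.Pc d t))"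
      using J.l2n_triangle[OF lc[OF ld] lu(2), of O.\<epsilon>] by simp
    then show "bochner_L2_norm {0<..<T} (H10_norm \<Omega>) w \<le> M1 * l2n J h + C1 * l2n J gal.g"
      using db(1) e1 unfolding wH(3) h_def M1_def by linarith
    have "l2n J (\<lambda>t. cls \<Omega> (w t)) \<le> l2n J (\<lambda>t. comb O.e (tb.Pc d t)) + l2n J (\<lambda>t. cls \<Omega> (w t) - comb O.e (tb.Pc d t))"
      using J.l2n_triangle[OF lc[OF ld] lu(1), of O.e] by simp
    then show "bochner_L2_norm {0<..<T} (L2_norm \<Omega>) w \<le> M0 * l2n J h + C0 * l2n J gal.g"
      using db(2) e0 unfolding wL(3) h_def M0_def by linarith
    have "norm (cls \<Omega> (w T)) = L2_norm \<Omega> (w T)" using O.norm_cls[OF V(3)[of T]] T_pos by simp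
    then show "L2_norm \<Omega> (w T) \<le> MT * l2n J h + CT * l2n J gal.g"
      using db(3) eT norm_triangle_sub[of "cls \<Omega> (w T)" "comb O.e (tb.Pc d T)"] unfolding h_def MT_def by linarith
  qed
qed

end

theorem theorem5:
  fixes \<nu> T :: real
    and \<Omega> :: "'a::euclidean_space set"
    and S\<^sub>h :: "('a \<Rightarrow> real) set" and n m :: nat and tn :: "nat \<Rightarrow> real"
    and \<phi> :: "'n::finite \<Rightarrow> real \<Rightarrow> 'a \<Rightarrow> real"
    and C\<^sub>\<Omega> C\<^sub>J C\<^sub>i\<^sub>n\<^sub>v :: real
    and f c w :: "real \<Rightarrow> 'a \<Rightarrow> real" and b :: "real \<Rightarrow> 'a \<Rightarrow> 'a"
    and A M B U W Y G :: "real^'n^'n"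
    and RA RM RU RW RY :: "real^'n^'n"
    and \<gamma>\<^sub>1 \<gamma>\<^sub>0 \<gamma>\<^sub>T Ct\<^sub>1 Ct\<^sub>0 ct\<^sub>0 C\<^sub>b C\<^sub>c M\<^sub>1 M\<^sub>0 M\<^sub>T \<tau> E \<kappa> C\<^sub>\<Delta> C\<^sub>Q :: real
  assumes "\<nu> > 0" and "T > 0"
    and "DIM('a) \<in> {1, 2, 3}" and "polyhedral_domain \<Omega>"
    and "findim_subspace_H10 \<Omega> n S\<^sub>h"
    and "nodes T m tn"
    and "CARD('n) = m * n"
    and "is_basis T \<Omega> (tensor_space T \<Omega> (P1_space T m tn) S\<^sub>h) \<phi>"
    and "C\<^sub>\<Omega> > 0" and "\<And>u. u \<in> H10 \<Omega> \<inter> Xspace \<Omega> \<Longrightarrow>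
           H10_norm \<Omega> (\<lambda>x. u x - H10_proj \<Omega> S\<^sub>h u x) \<le> C\<^sub>\<Omega> * L2_norm \<Omega> (laplacian \<Omega> u)"
    and "C\<^sub>J > 0" and "\<And>u. u \<in> V1 T \<Longrightarrow>
           L2_norm {0<..<T} (\<lambda>t. u t - nodal_interp T m tn u t) \<le> C\<^sub>J * V1_norm T u"
    and "C\<^sub>i\<^sub>n\<^sub>v > 0" and "\<And>u. u \<in> S\<^sub>h \<Longrightarrow> H10_norm \<Omega> u \<le> C\<^sub>i\<^sub>n\<^sub>v * L2_norm \<Omega> u"
    and "f \<in> bochner_L2 {0<..<T} (L2 \<Omega>) (L2_norm \<Omega>)"
    and "\<And>i. i \<in> Basis \<Longrightarrow> (\<lambda>t x. b t x \<bullet> i) \<in> bochner_Linf {0<..<T} (Linf \<Omega>) (Linf_norm \<Omega>)"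
    and "c \<in> bochner_Linf {0<..<T} (Linf \<Omega>) (Linf_norm \<Omega>)"
    and "A = (\<chi> i j. st_inner T \<Omega> (dt T \<Omega> (\<phi> j)) (dt T \<Omega> (\<phi> i)))"
    and "M = (\<chi> i j. st_inner T \<Omega> (nabla \<Omega> (\<phi> j)) (nabla \<Omega> (\<phi> i)))"
    and "B = (\<chi> i j. st_inner T \<Omega> (nabla \<Omega> (\<phi> j)) (dt T \<Omega> (nabla \<Omega> (\<phi> i))))"
    and "U = (\<chi> i j. st_inner T \<Omega> (\<phi> j) (\<phi> i))"
    and "W = (\<chi> i j. st_inner T \<Omega> (dt T \<Omega> (nabla \<Omega> (\<phi> j))) (dt T \<Omega> (nabla \<Omega> (\<phi> i))))"
    and "Y = (\<chi> i j. L2_inner \<Omega> (\<phi> j T) (\<phi> i T))"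
    and "G = (\<chi> i j. form_a T \<Omega> \<nu> b c (\<phi> j) (\<phi> i))"
    and "invertible G"
    and "A = RA ** transpose RA" and "M = RM ** transpose RM" and "U = RU ** transpose RU"
    and "W = RW ** transpose RW" and "Y = RY ** transpose RY"
    and "\<gamma>\<^sub>1 = \<nu> * mat_norm (transpose RM ** matrix_inv (A + \<nu> *\<^sub>R B) ** RW)"
    and "\<gamma>\<^sub>0 = \<nu> * mat_norm (transpose RU ** matrix_inv (A + \<nu> *\<^sub>R B) ** RW)"
    and "\<gamma>\<^sub>T = \<nu> * mat_norm (transpose RY ** matrix_inv (A + \<nu> *\<^sub>R B) ** RW)"
    and "Ct\<^sub>1 = 2 / \<nu> * C\<^sub>\<Omega> + C\<^sub>i\<^sub>n\<^sub>v * C\<^sub>J + C\<^sub>J * C\<^sub>i\<^sub>n\<^sub>v * \<gamma>\<^sub>1"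
    and "Ct\<^sub>0 = 8 / \<nu> * C\<^sub>\<Omega>\<^sup>2 + C\<^sub>J + C\<^sub>J * C\<^sub>i\<^sub>n\<^sub>v * \<gamma>\<^sub>0"
    and "ct\<^sub>0 = sqrt (8 / \<nu>) * C\<^sub>\<Omega> + C\<^sub>J * C\<^sub>i\<^sub>n\<^sub>v * \<gamma>\<^sub>T"
    and "C\<^sub>b = sqrt (\<Sum>i\<in>Basis. (bochner_Linf_norm {0<..<T} (Linf_norm \<Omega>) (\<lambda>t x. b t x \<bullet> i))\<^sup>2)"
    and "C\<^sub>c = bochner_Linf_norm {0<..<T} (Linf_norm \<Omega>) c"
    and "M\<^sub>1 = mat_norm (transpose RM ** matrix_inv G ** RA)"
    and "M\<^sub>0 = mat_norm (transpose RU ** matrix_inv G ** RA)"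
    and "M\<^sub>T = mat_norm (transpose RY ** matrix_inv G ** RA)"
    and "\<tau> = Ct\<^sub>1 * C\<^sub>b + Ct\<^sub>0 * C\<^sub>c"
    and "E = M\<^sub>1 * C\<^sub>b + M\<^sub>0 * C\<^sub>c + 1"
    and "\<kappa> = \<tau> * E"
    and "C\<^sub>\<Delta> = E / (1 - \<kappa>)"
    and "C\<^sub>Q = \<tau> * C\<^sub>\<Delta> + 1"
    \<comment> \<open>the solution; its initial and boundary values are part of the space\<close>
    and "w \<in> Vspace T \<Omega> \<inter> bochner_L2 {0<..<T} (Xspace \<Omega>) (X_norm \<Omega>)"
    and "AE t in lebesgue_on {0<..<T}. AE x in lebesgue_on \<Omega>.
           dt T \<Omega> w t x - \<nu> * laplacian \<Omega> (w t) x + b t x \<bullet> nabla \<Omega> w t x + c t x * w t x = f t x"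
    and "\<kappa> < 1"
  shows "bochner_L2_norm {0<..<T} (H10_norm \<Omega>) w
           \<le> (M\<^sub>1 * C\<^sub>Q + Ct\<^sub>1 * C\<^sub>\<Delta>) * bochner_L2_norm {0<..<T} (L2_norm \<Omega>) f
       \<and> bochner_L2_norm {0<..<T} (L2_norm \<Omega>) w
           \<le> (M\<^sub>0 * C\<^sub>Q + Ct\<^sub>0 * C\<^sub>\<Delta>) * bochner_L2_norm {0<..<T} (L2_norm \<Omega>) f
       \<and> L2_norm \<Omega> (w T)
           \<le> (M\<^sub>T * C\<^sub>Q + ct\<^sub>0 * C\<^sub>\<Delta>) * bochner_L2_norm {0<..<T} (L2_norm \<Omega>) f"
proof -
  note a = assms
  have dom: "open \<Omega>" "bounded \<Omega>" using a(4) by (simp_all add: polyhedral_domain_def)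
  have "spacetime T \<Omega>"
    using a(2) dom(1) by (intro spacetime.intro time_interval.intro open_domain.intro domain.intro open_domain_axioms.intro) auto
  then interpret st: spacetime T \<Omega> .
  \<comment> \<open>A positive \<open>T\<close> forces at least one time cell, so \<open>n\<close>
    is at most the size of the index type.\<close>
  have "m \<noteq> 0" using a(2,6) by (intro notI) (simp add: nodes_def)
  then have n: "n \<le> CARD('n)" by (simp add: a(7))
  obtain s :: "'n \<Rightarrow> 'a \<Rightarrow> real" and I where s: "\<And>l. s l \<in> S\<^sub>h"
    "\<And>l k. cls \<Omega> (s l) \<bullet> cls \<Omega> (s k) = (if l = k \<and> l \<in> I then 1 else 0)" "\<And>l. l \<notin> I \<Longrightarrow> st.O.Gr (s l) = 0"
    "S\<^sub>h = {v \<in> H10 \<Omega>. \<exists>a. cls \<Omega> v = comb (\<lambda>l. cls \<Omega> (s l)) a}"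
    by (rule st.O.discrete_basis[OF a(5) n]) (rule that)
  interpret D: space_time_discretization T m tn \<Omega> S\<^sub>h s I
    by (intro space_time_discretization.intro time_grid.intro time_grid_axioms.intro discrete_space.intro
        discrete_space_axioms.intro st.spacetime_axioms st.time_interval_axioms st.O.open_domain_axioms a(6) s)
  have tb: "tensor_basis T m tn \<nu> C\<^sub>J C\<^sub>i\<^sub>n\<^sub>v D.O.e D.O.\<epsilon> I (\<lambda>i. D.P (\<phi> i)) (\<lambda>i. D.P' (\<phi> i)) A M B U W Y RA RM RU RW RY"
    by (rule D.is_basis_tensor_basis[OF a(1,11,13,8) _ _ a(18-23,26-30)]) (rule a(12), assumption, rule a(14), assumption)
  have \<phi>: "\<phi> i \<in> D.tensor" for i using a(8) by (simp add: is_basis_def)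
  have b: "\<forall>i\<in>Basis. (\<lambda>t x. b t x \<bullet> i) \<in> bochner_Linf {0<..<T} (Linf \<Omega>) (Linf_norm \<Omega>)" using a(16) by blast
  have w: "w \<in> Vspace T \<Omega>" "w \<in> bochner_L2 {0<..<T} (Xspace \<Omega>) (X_norm \<Omega>)" using a(47) by auto
  let ?F = "bochner_L2_norm {0<..<T} (L2_norm \<Omega>) f"
  let ?w1 = "bochner_L2_norm {0<..<T} (H10_norm \<Omega>) w"
  let ?w0 = "bochner_L2_norm {0<..<T} (L2_norm \<Omega>) w"
  have C1: "Ct\<^sub>1 = 2 / \<nu> * C\<^sub>\<Omega> + C\<^sub>i\<^sub>n\<^sub>v * C\<^sub>J + C\<^sub>J * C\<^sub>i\<^sub>n\<^sub>v * (\<nu> * mat_norm (transpose RM ** matrix_inv (A + \<nu> *\<^sub>R B) ** RW))"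
    and C0: "Ct\<^sub>0 = 8 / \<nu> * C\<^sub>\<Omega>\<^sup>2 + C\<^sub>J + C\<^sub>J * C\<^sub>i\<^sub>n\<^sub>v * (\<nu> * mat_norm (transpose RU ** matrix_inv (A + \<nu> *\<^sub>R B) ** RW))"
    and CT: "ct\<^sub>0 = sqrt (8 / \<nu>) * C\<^sub>\<Omega> + C\<^sub>J * C\<^sub>i\<^sub>n\<^sub>v * (\<nu> * mat_norm (transpose RY ** matrix_inv (A + \<nu> *\<^sub>R B) ** RW))"
    by (simp_all only: a(31-36))
  obtain X H where X: "X \<le> ?F + (C\<^sub>b * ?w1 + C\<^sub>c * ?w0)" and H: "H \<le> ?F + (Ct\<^sub>1 * C\<^sub>b + Ct\<^sub>0 * C\<^sub>c) * X"
    and W1: "?w1 \<le> M\<^sub>1 * H + Ct\<^sub>1 * X" and W0: "?w0 \<le> M\<^sub>0 * H + Ct\<^sub>0 * X"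
    and WT: "L2_norm \<Omega> (w T) \<le> M\<^sub>T * H + ct\<^sub>0 * X"
    by (rule D.error_estimates[OF tb \<phi> dom(2) a(9) _ a(15) b a(17,24,25) w a(48,37-41) C1 C0 CT refl])
      (rule a(10), assumption, rule that)
  have nonneg: "0 \<le> C\<^sub>b" "0 \<le> C\<^sub>c" "0 \<le> M\<^sub>1" "0 \<le> M\<^sub>0" "0 \<le> M\<^sub>T" "0 \<le> Ct\<^sub>1" "0 \<le> Ct\<^sub>0" "0 \<le> ct\<^sub>0"
    unfolding C1 C0 CT a(37-41) using a(1,9,11,13) st.bochner_Linf_bounds(3)[OF a(17)]
    by (auto intro!: add_nonneg_nonneg mult_nonneg_nonneg mat_norm_nonneg sum_nonneg)
  have \<kappa>: "\<tau> * E < 1" using a(44,49) by simp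
  note ab = absorb[OF nonneg(1-4,6,7) a(42,43) \<kappa> W1 W0 X H[folded a(42)]]
  \<comment> \<open>The three estimates have the same form, a multiple of \<open>H\<close> plus a
    multiple of \<open>X\<close>, and are finished by the same bounds.\<close>
  have est: "x \<le> (p * C\<^sub>Q + r * C\<^sub>\<Delta>) * ?F" if "x \<le> p * H + r * X" "0 \<le> p" "0 \<le> r" for x p r
  proof -
    have "p * H + r * X \<le> p * (C\<^sub>Q * ?F) + r * (C\<^sub>\<Delta> * ?F)"
      using ab that(2,3) unfolding a(46,45) a(44) by (intro add_mono mult_left_mono) auto
    then show ?thesis using that(1) by (simp add: algebra_simps)
  qed
  show ?thesis
    using est[OF W1 nonneg(3,6)] est[OF W0 nonneg(4,7)] est[OF WT nonneg(5,8)] by blast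
qed

end
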